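(* Let $G_1,G_2$ be second countable locally compact groups and let $\Gamma$ be an irreducible lattice in $G=G_1\times G_2$. Assume that $G_1$ has Kazhdan's Property $(T)$ and that $G_2$ is connected and minimally almost periodic. Then $\Gamma$ has Property $(T_{\ell_p})$ for every $1<p<\infty$, $p\neq 2$.
   Context: A lattice $\Gamma$ in $G_1\times G_2$ is irreducible if its projections to $G_1$ and to $G_2$ are dense. A locally compact group is minimally almost periodic if it has no non-trivial finite-dimensional unitary representation. All Banach spaces are complex; $\ell_p=\ell_p(\mathbf N)$, $q$ the conjugate exponent, $\mathbf O(\ell_p)$ the group of linear bijective isometries. An orthogonal representation of $\Gamma$ on $\ell_p$ is a homomorphism $\pi:\Gamma\to\mathbf O(\ell_p)$; a sequence of almost invariant vectors is a sequence of unit vectors $f_n$ with $\|\pi(g)f_n-f_n\|\to0$ for all $g$. With $\pi^*$ the dual representation on $\ell_q$, $\ell'_p(\pi)$ is the annihilator in $\ell_p$ of the $\pi^*(\Gamma)$-invariant vectors of $\ell_q$. $\Gamma$ has Property $(T_{\ell_p})$ if for no orthogonal representation $\pi$ on $\ell_p$ does $\ell'_p(\pi)$ contain a sequence of almost invariant vectors. *)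

theory Defs
  imports "HOL-Analysis.Analysis" "HOL-Algebra.Group"
begin

definition topological_group :: "('a, 'm) monoid_scheme \<Rightarrow> 'a topology \<Rightarrow> bool" where
  "topological_group G T \<longleftrightarrow> group G \<and> topspace T = carrier G
     \<and> continuous_map (prod_topology T T) T (\<lambda>(x, y). x \<otimes>\<^bsub>G\<^esub> y)
     \<and> continuous_map T T (\<lambda>x. inv\<^bsub>G\<^esub> x)"

definition lc_group :: "('a, 'm) monoid_scheme \<Rightarrow> 'a topology \<Rightarrow> bool" where
  "lc_group G T \<longleftrightarrow> topological_group G T \<and> Hausdorff_space T \<and> locally_compact_space T"

definition second_countable_lc_group :: "('a, 'm) monoid_scheme \<Rightarrow> 'a topology \<Rightarrow> bool" where
  "second_countable_lc_group G T \<longleftrightarrow> lc_group G T \<and> second_countable T"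

definition borel_sets_of :: "'a topology \<Rightarrow> 'a set set" where
  "borel_sets_of T = sigma_sets (topspace T) {U. openin T U}"

text \<open>Left Haar measure: nonzero left-invariant Borel measure, finite on compact sets,
positive on nonempty open sets (on second countable locally compact Hausdorff spaces such
a measure is automatically Radon, hence a left Haar measure).\<close>

definition left_haar_measure :: "('a, 'm) monoid_scheme \<Rightarrow> 'a topology \<Rightarrow> 'a measure \<Rightarrow> bool" where
  "left_haar_measure G T M \<longleftrightarrow>
     space M = topspace T \<and> sets M = borel_sets_of T
     \<and> (\<forall>g\<in>carrier G. \<forall>A\<in>sets M. emeasure M ((\<lambda>x. g \<otimes>\<^bsub>G\<^esub> x) ` A) = emeasure M A)
     \<and> (\<forall>K. compactin T K \<longrightarrow> emeasure M K < \<infinity>)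
     \<and> (\<forall>U. openin T U \<and> U \<noteq> {} \<longrightarrow> emeasure M U > 0)"

definition fundamental_domain :: "('a, 'm) monoid_scheme \<Rightarrow> 'a topology \<Rightarrow> 'a set \<Rightarrow> 'a set \<Rightarrow> bool" where
  "fundamental_domain G T \<Gamma> F \<longleftrightarrow> F \<in> borel_sets_of T \<and> F \<subseteq> carrier G
     \<and> (\<forall>x\<in>carrier G. \<exists>!p. fst p \<in> F \<and> snd p \<in> \<Gamma> \<and> x = fst p \<otimes>\<^bsub>G\<^esub> snd p)"

text \<open>A lattice: a discrete subgroup such that G/\<Gamma> has finite invariant measure,
i.e. some (equivalently every) Borel fundamental domain has finite Haar measure.\<close>

definition lattice :: "('a, 'm) monoid_scheme \<Rightarrow> 'a topology \<Rightarrow> 'a set \<Rightarrow> bool" where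
  "lattice G T \<Gamma> \<longleftrightarrow> subgroup \<Gamma> G \<and> subtopology T \<Gamma> = discrete_topology \<Gamma>
     \<and> (\<exists>M F. left_haar_measure G T M \<and> fundamental_domain G T \<Gamma> F \<and> emeasure M F < \<infinity>)"

definition irreducible_lattice ::
  "('a, 'm) monoid_scheme \<Rightarrow> 'a topology \<Rightarrow> ('b, 'n) monoid_scheme \<Rightarrow> 'b topology \<Rightarrow> ('a \<times> 'b) set \<Rightarrow> bool" where
  "irreducible_lattice G1 T1 G2 T2 \<Gamma> \<longleftrightarrow> lattice (G1 \<times>\<times> G2) (prod_topology T1 T2) \<Gamma>
     \<and> T1 closure_of (fst ` \<Gamma>) = topspace T1 \<and> T2 closure_of (snd ` \<Gamma>) = topspace T2"

definition l2_space :: "nat set \<Rightarrow> (nat \<Rightarrow> complex) set" where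
  "l2_space I = {f. (\<forall>n. n \<notin> I \<longrightarrow> f n = 0) \<and> summable (\<lambda>n. (cmod (f n))\<^sup>2)}"

definition l2_norm :: "(nat \<Rightarrow> complex) \<Rightarrow> real" where
  "l2_norm f = sqrt (\<Sum>n. (cmod (f n))\<^sup>2)"

definition unitary_on :: "nat set \<Rightarrow> ((nat \<Rightarrow> complex) \<Rightarrow> (nat \<Rightarrow> complex)) \<Rightarrow> bool" where
  "unitary_on I U \<longleftrightarrow> bij_betw U (l2_space I) (l2_space I)
     \<and> (\<forall>f\<in>l2_space I. \<forall>h\<in>l2_space I. \<forall>a b. U (\<lambda>n. a * f n + b * h n) = (\<lambda>n. a * U f n + b * U h n))
     \<and> (\<forall>f\<in>l2_space I. l2_norm (U f) = l2_norm f)"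

definition unitary_rep ::
  "('a, 'm) monoid_scheme \<Rightarrow> 'a topology \<Rightarrow> nat set \<Rightarrow> ('a \<Rightarrow> (nat \<Rightarrow> complex) \<Rightarrow> (nat \<Rightarrow> complex)) \<Rightarrow> bool" where
  "unitary_rep G T I \<pi> \<longleftrightarrow>
     (\<forall>g\<in>carrier G. unitary_on I (\<pi> g))
     \<and> (\<forall>g\<in>carrier G. \<forall>h\<in>carrier G. \<forall>f\<in>l2_space I. \<pi> (g \<otimes>\<^bsub>G\<^esub> h) f = \<pi> g (\<pi> h f))
     \<and> (\<forall>f\<in>l2_space I. \<pi> \<one>\<^bsub>G\<^esub> f = f)
     \<and> (\<forall>f\<in>l2_space I. \<forall>g0\<in>carrier G. \<forall>\<epsilon>>0. \<exists>V. openin T V \<and> g0 \<in> V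
          \<and> (\<forall>g\<in>V. l2_norm (\<lambda>n. \<pi> g f n - \<pi> g0 f n) < \<epsilon>))"

definition has_almost_invariant_vectors ::
  "('a, 'm) monoid_scheme \<Rightarrow> 'a topology \<Rightarrow> nat set \<Rightarrow> ('a \<Rightarrow> (nat \<Rightarrow> complex) \<Rightarrow> (nat \<Rightarrow> complex)) \<Rightarrow> bool" where
  "has_almost_invariant_vectors G T I \<pi> \<longleftrightarrow>
     (\<forall>K \<epsilon>. compactin T K \<and> \<epsilon> > 0 \<longrightarrow>
        (\<exists>f\<in>l2_space I. l2_norm f = 1 \<and> (\<forall>g\<in>K. l2_norm (\<lambda>n. \<pi> g f n - f n) < \<epsilon>)))"

definition has_nonzero_invariant_vector ::
  "('a, 'm) monoid_scheme \<Rightarrow> nat set \<Rightarrow> ('a \<Rightarrow> (nat \<Rightarrow> complex) \<Rightarrow> (nat \<Rightarrow> complex)) \<Rightarrow> bool" where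
  "has_nonzero_invariant_vector G I \<pi> \<longleftrightarrow>
     (\<exists>f\<in>l2_space I. f \<noteq> (\<lambda>n. 0) \<and> (\<forall>g\<in>carrier G. \<pi> g f = f))"

text \<open>Kazhdan's Property (T) (tested on separable Hilbert spaces \<open>\<ell>\<^sub>2(I)\<close>, \<open>I \<subseteq> \<nat>\<close>).\<close>

definition kazhdan_T :: "('a, 'm) monoid_scheme \<Rightarrow> 'a topology \<Rightarrow> bool" where
  "kazhdan_T G T \<longleftrightarrow> (\<forall>I \<pi>. unitary_rep G T I \<pi> \<and> has_almost_invariant_vectors G T I \<pi>
       \<longrightarrow> has_nonzero_invariant_vector G I \<pi>)"

definition minimally_almost_periodic :: "('a, 'm) monoid_scheme \<Rightarrow> 'a topology \<Rightarrow> bool" where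
  "minimally_almost_periodic G T \<longleftrightarrow> (\<forall>I \<pi>. finite I \<and> unitary_rep G T I \<pi>
       \<longrightarrow> (\<forall>g\<in>carrier G. \<forall>f\<in>l2_space I. \<pi> g f = f))"

definition lp_space :: "real \<Rightarrow> (nat \<Rightarrow> complex) set" where
  "lp_space p = {f. summable (\<lambda>n. cmod (f n) powr p)}"

definition lp_norm :: "real \<Rightarrow> (nat \<Rightarrow> complex) \<Rightarrow> real" where
  "lp_norm p f = (\<Sum>n. cmod (f n) powr p) powr (1 / p)"

definition conj_exp :: "real \<Rightarrow> real" where
  "conj_exp p = p / (p - 1)"

definition lp_isometry :: "real \<Rightarrow> ((nat \<Rightarrow> complex) \<Rightarrow> (nat \<Rightarrow> complex)) \<Rightarrow> bool" where
  "lp_isometry p U \<longleftrightarrow> bij_betw U (lp_space p) (lp_space p)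
     \<and> (\<forall>f\<in>lp_space p. \<forall>h\<in>lp_space p. \<forall>a b. U (\<lambda>n. a * f n + b * h n) = (\<lambda>n. a * U f n + b * U h n))
     \<and> (\<forall>f\<in>lp_space p. lp_norm p (U f) = lp_norm p f)"

definition orth_rep :: "('a, 'm) monoid_scheme \<Rightarrow> real \<Rightarrow> ('a \<Rightarrow> (nat \<Rightarrow> complex) \<Rightarrow> (nat \<Rightarrow> complex)) \<Rightarrow> bool" where
  "orth_rep G p \<pi> \<longleftrightarrow>
     (\<forall>g\<in>carrier G. lp_isometry p (\<pi> g))
     \<and> (\<forall>g\<in>carrier G. \<forall>h\<in>carrier G. \<forall>f\<in>lp_space p. \<pi> (g \<otimes>\<^bsub>G\<^esub> h) f = \<pi> g (\<pi> h f))
     \<and> (\<forall>f\<in>lp_space p. \<pi> \<one>\<^bsub>G\<^esub> f = f)"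

definition pairing :: "(nat \<Rightarrow> complex) \<Rightarrow> (nat \<Rightarrow> complex) \<Rightarrow> complex" where
  "pairing f h = (\<Sum>n. f n * h n)"

text \<open>\<open>\<pi>\<^sup>*(g) = \<pi>(g\<^sup>-\<^sup>1)\<^sup>*\<close>; \<open>h \<in> \<ell>\<^sub>q\<close> is \<open>\<pi>\<^sup>*\<close>-invariant iff
\<open>\<langle>\<pi>(g\<^sup>-\<^sup>1) f, h\<rangle> = \<langle>f, h\<rangle>\<close> for all g and f.\<close>

definition dual_invariant_vectors ::
  "('a, 'm) monoid_scheme \<Rightarrow> real \<Rightarrow> ('a \<Rightarrow> (nat \<Rightarrow> complex) \<Rightarrow> (nat \<Rightarrow> complex)) \<Rightarrow> (nat \<Rightarrow> complex) set" where
  "dual_invariant_vectors G p \<pi> = {h \<in> lp_space (conj_exp p).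
      \<forall>g\<in>carrier G. \<forall>f\<in>lp_space p. pairing (\<pi> (inv\<^bsub>G\<^esub> g) f) h = pairing f h}"

definition lp_prime :: "('a, 'm) monoid_scheme \<Rightarrow> real \<Rightarrow> ('a \<Rightarrow> (nat \<Rightarrow> complex) \<Rightarrow> (nat \<Rightarrow> complex)) \<Rightarrow> (nat \<Rightarrow> complex) set" where
  "lp_prime G p \<pi> = {f \<in> lp_space p. \<forall>h\<in>dual_invariant_vectors G p \<pi>. pairing f h = 0}"

definition property_T_lp :: "('a, 'm) monoid_scheme \<Rightarrow> real \<Rightarrow> bool" where
  "property_T_lp G p \<longleftrightarrow> \<not> (\<exists>\<pi> F. orth_rep G p \<pi>
      \<and> (\<forall>k. F k \<in> lp_prime G p \<pi> \<and> lp_norm p (F k) = 1)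
      \<and> (\<forall>g\<in>carrier G. (\<lambda>k. lp_norm p (\<lambda>n. \<pi> g (F k) n - F k n)) \<longlonglongrightarrow> 0))"

end

theory Submission
  imports Defs
begin

text \<open>Lamperti's theorem makes an orthogonal representation on \<open>\<ell>\<^sub>p\<close>, \<open>p \<noteq> 2\<close>, monomial: every group
element permutes the coordinates and multiplies them by unimodular scalars. The same monomial action
is unitary on \<open>\<ell>\<^sub>2\<close>, and the Mazur map turns almost invariant vectors of \<open>\<ell>'\<^sub>p(\<pi>)\<close> into almost
invariant vectors of \<open>\<ell>\<^sub>2\<close> orthogonal to the invariant vectors. Induction from \<open>\<Gamma>\<close> to \<open>G1 \<times> G2\<close>
and property (T) of \<open>G1\<close> then give a nonzero \<open>\<Gamma>\<close>-equivariant function \<open>f\<close> on \<open>G1 \<times> G2\<close> that is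
left \<open>G1\<close>-invariant, so that its averages \<open>\<phi> n y\<close> over slabs \<open>U1 \<times> U2 y\<close> define equivariant
continuous functions on \<open>G2\<close>; here \<open>G1 \<times> G2\<close> has to be unimodular, which holds because neither
factor has a nontrivial homomorphism to the reals. By local summability only finitely many of the
\<open>\<phi> n\<close> are large near the identity. Density of the projection of \<open>\<Gamma>\<close> and connectedness of \<open>G2\<close>
then make \<open>\<phi> n\<close> a multiple of a unitary character, which is trivial as \<open>G2\<close> is minimally almost
periodic. Hence the orbit of \<open>n\<close> is finite and carries an invariant vector not orthogonal to the
values \<open>\<phi> n 1\<close>, a contradiction.\<close>

section \<open>Isometries of sequence spaces\<close>

text \<open>\<open>kazhdan_T\<close> is tested on coordinate spaces \<open>l2_space I\<close> only,
  whereas the induced representation lives on equivariant functions with a seminorm. Null functions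
  are not divided out: Gram-Schmidt on a countable family of functions supplies the coordinates, so
  equivariance can be kept at every point and only equality is relaxed to seminorm zero. The
  quotient by \<Gamma> need not be compact, so control over the finite-measure domain
  \<open>F\<close> has to be carried to compact sets, by neighbourhoods that inject into the
  quotient. A function that is only almost everywhere \<open>G1\<close>-invariant is not yet a
  function on \<open>G2\<close>; integrating it over rectangles avoids disintegrating the Haar
  measure and gives continuous coordinates. Square-summable invariant vectors of a monomial action
  have constant modulus on orbits, hence live on finite orbits, so one finitely supported vector per
  orbit describes orthogonality to all of them. The exponent 2 is special because the Clarkson
  defect, from which disjointness is read off in Lamperti's theorem, vanishes identically
  there.\<close>

lemma powr_add_strict:
  fixes a b s :: real
  assumes "a > 0" "b > 0"
  shows "s > 1 \<Longrightarrow> a powr s + b powr s < (a + b) powr s"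
    and "s < 1 \<Longrightarrow> (a + b) powr s < a powr s + b powr s"
proof -
  \<comment> \<open>Peeling off one factor leaves \<open>x powr (s - 1)\<close>, which increases for
    \<open>s > 1\<close> and decreases for \<open>s < 1\<close>; comparing it at \<open>a\<close>,
    \<open>b\<close> and \<open>a + b\<close> gives both claims.\<close>
  have split: "x powr s = x * x powr (s - 1)" if "x > 0" for x :: real
    using that by (metis add.commute diff_add_cancel powr_add powr_one less_imp_le)
  show "a powr s + b powr s < (a + b) powr s" if "s > 1"
  proof -
    have "a powr (s - 1) < (a + b) powr (s - 1)" "b powr (s - 1) < (a + b) powr (s - 1)"
      using assms that by (auto intro!: powr_less_mono2)
    then have "a * a powr (s - 1) + b * b powr (s - 1)
        < a * (a + b) powr (s - 1) + b * (a + b) powr (s - 1)"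
      using assms by (intro add_strict_mono mult_strict_left_mono) auto
    then show ?thesis
      using assms split[of a] split[of b] split[of "a + b"] by (simp add: distrib_right)
  qed
  show "(a + b) powr s < a powr s + b powr s" if "s < 1"
  proof -
    have "(a + b) powr (s - 1) < a powr (s - 1)" "(a + b) powr (s - 1) < b powr (s - 1)"
      using assms that by (auto intro!: powr_less_mono2_neg)
    then have "a * (a + b) powr (s - 1) + b * (a + b) powr (s - 1)
        < a * a powr (s - 1) + b * b powr (s - 1)"
      using assms by (intro add_strict_mono mult_strict_left_mono) auto
    then show ?thesis
      using assms split[of a] split[of b] split[of "a + b"] by (simp add: distrib_right)
  qed
qed

lemma powr_midpoint_convex:
  fixes x y s :: real
  assumes "x \<ge> 0" "y \<ge> 0" "s \<ge> 1"
  shows "2 * ((x + y) / 2) powr s \<le> x powr s + y powr s"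
proof -
  \<comment> \<open>Convexity is used on the open half line; this estimate covers the cases in which
    \<open>x\<close> or \<open>y\<close> is zero.\<close>
  have half: "2 * (u / 2) powr s \<le> u powr s" if "u \<ge> 0" for u :: real
  proof -
    have "2 * (u / 2) powr s = 2 * (u powr s / 2 powr s)"
      using that by (simp add: powr_divide)
    moreover have "(2::real) powr 1 \<le> 2 powr s"
      using assms by (intro powr_mono) auto
    moreover have "(2 - 2 powr s) * (u / 2) powr s \<le> 0"
      using calculation(2) by (intro mult_nonpos_nonneg) auto
    ultimately show ?thesis
      by (simp add: field_simps)
  qed
  consider "x = 0" | "y = 0" | "x > 0" "y > 0"
    using assms by linarith
  then show ?thesis
  proof cases
    case 3
    have "convex_on {0<..} (\<lambda>x. x powr s)"
      using assms powr_convex by blast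
    from convex_onD[OF this, of "1/2" x y] 3 show ?thesis
      by (simp add: add_divide_distrib)
  qed (use half assms in auto)
qed

text \<open>Midpoint convexity for the exponent \<open>1/s\<close>, applied to the numbers
  \<open>x powr s\<close> and \<open>y powr s\<close>, and then raised to the power
  \<open>s\<close>.\<close>

lemma powr_midpoint_concave:
  fixes x y s :: real
  assumes "x \<ge> 0" "y \<ge> 0" "0 < s" "s \<le> 1"
  shows "x powr s + y powr s \<le> 2 * ((x + y) / 2) powr s"
proof -
  have "2 * ((x powr s + y powr s) / 2) powr (1/s) \<le> (x powr s) powr (1/s) + (y powr s) powr (1/s)"
    using assms by (intro powr_midpoint_convex) auto
  also have "\<dots> = x + y"
    using assms by (simp add: powr_powr)
  finally have "((x powr s + y powr s) / 2) powr (1/s) \<le> (x + y) / 2"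
    by simp
  then have "(((x powr s + y powr s) / 2) powr (1/s)) powr s \<le> ((x + y) / 2) powr s"
    using assms by (intro powr_mono2) auto
  then show ?thesis
    using assms by (simp add: powr_powr)
qed

lemma cmod_powr_eq: "cmod z powr p = ((cmod z)\<^sup>2) powr (p / 2)"
proof -
  have "cmod z powr p = (cmod z powr 2) powr (p / 2)"
    unfolding powr_powr by simp
  then show ?thesis by simp
qed

text \<open>The gap in Clarkson's inequality. Summed over coordinates it is an expression in norms
  alone, yet for positive \<open>p \<noteq> 2\<close> each summand detects whether
  \<open>z * w\<close> vanishes.\<close>

definition clarkson_defect :: "real \<Rightarrow> complex \<Rightarrow> complex \<Rightarrow> real" where
  "clarkson_defect p z w =
     cmod (z + w) powr p + cmod (z - w) powr p - 2 * cmod z powr p - 2 * cmod w powr p"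

lemma clarkson_defect_zero: "p > 0 \<Longrightarrow> z * w = 0 \<Longrightarrow> clarkson_defect p z w = 0"
  by (auto simp: clarkson_defect_def)

text \<open>By the parallelogram identity, \<open>(cmod z)\<^sup>2 + (cmod w)\<^sup>2\<close> is the
  mean of \<open>(cmod (z + w))\<^sup>2\<close> and \<open>(cmod (z - w))\<^sup>2\<close>. For
  \<open>p > 2\<close>, midpoint convexity of the power \<open>p/2\<close> and its strict
  superadditivity push in the same direction; both reverse for \<open>p < 2\<close>.\<close>

lemma clarkson_defect_sign:
  assumes "z * w \<noteq> 0"
  shows "p > 2 \<Longrightarrow> clarkson_defect p z w > 0"
    and "0 < p \<Longrightarrow> p < 2 \<Longrightarrow> clarkson_defect p z w < 0"
proof -
  let ?X = "(cmod (z + w))\<^sup>2" and ?Y = "(cmod (z - w))\<^sup>2"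
  have XY: "(?X + ?Y) / 2 = (cmod z)\<^sup>2 + (cmod w)\<^sup>2"
    unfolding cmod_power2 by (simp add: power2_eq_square field_simps)
  have pos: "(cmod z)\<^sup>2 > 0" "(cmod w)\<^sup>2 > 0"
    using assms by auto
  show "clarkson_defect p z w > 0" if "p > 2"
    using powr_midpoint_convex[of ?X ?Y "p/2"] powr_add_strict(1)[OF pos, of "p/2"] that
    unfolding clarkson_defect_def cmod_powr_eq[of _ p] XY by simp
  show "clarkson_defect p z w < 0" if "0 < p" "p < 2"
    using powr_midpoint_concave[of ?X ?Y "p/2"] powr_add_strict(2)[OF pos, of "p/2"] that
    unfolding clarkson_defect_def cmod_powr_eq[of _ p] XY by simp
qed

lemma cmod_add_powr_le:
  assumes "p > 0"
  shows "cmod (z + w) powr p \<le> 2 powr p * (cmod z powr p + cmod w powr p)"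
proof -
  have "cmod (z + w) powr p \<le> (2 * max (cmod z) (cmod w)) powr p"
    using assms norm_triangle_ineq[of z w] by (intro powr_mono2) auto
  also have "\<dots> = 2 powr p * max (cmod z) (cmod w) powr p"
    by (simp add: powr_mult)
  also have "\<dots> \<le> 2 powr p * (cmod z powr p + cmod w powr p)"
    by (intro mult_left_mono) (auto simp: max_def)
  finally show ?thesis .
qed

lemma lp_space_lincomb:
  assumes "p > 0" "f \<in> lp_space p" "h \<in> lp_space p"
  shows "(\<lambda>n. a * f n + b * h n) \<in> lp_space p"
proof -
  have "summable (\<lambda>n. 2 powr p * (cmod a powr p * cmod (f n) powr p + cmod b powr p * cmod (h n) powr p))"
    using assms by (intro summable_mult summable_add) (auto simp: lp_space_def)
  then show ?thesis
    unfolding lp_space_def mem_Collect_eq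
    by (rule summable_comparison_test'[where N=0])
       (use cmod_add_powr_le[OF assms(1), of "a * f _" "b * h _"] in \<open>auto simp: norm_mult powr_mult\<close>)
qed

lemma lp_space_diff:
  assumes "p > 0" "f \<in> lp_space p" "h \<in> lp_space p"
  shows "(\<lambda>n. f n - h n) \<in> lp_space p"
  using lp_space_lincomb[OF assms, of 1 "-1"] by simp

lemma lp_norm_powr:
  assumes "p > 0" "f \<in> lp_space p"
  shows "lp_norm p f powr p = (\<Sum>n. cmod (f n) powr p)"
  using assms by (simp add: lp_norm_def powr_powr lp_space_def suminf_nonneg)

definition unit_vec :: "nat \<Rightarrow> nat \<Rightarrow> complex" where
  "unit_vec n = (\<lambda>m. if m = n then 1 else 0)"

lemma unit_vec_lp: "unit_vec n \<in> lp_space p"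
  unfolding lp_space_def mem_Collect_eq
  by (rule summable_finite[of "{n}"]) (auto simp: unit_vec_def)

lemma suminf_single_powr: "(\<Sum>m. cmod ((a * unit_vec n m)) powr p) = cmod a powr p"
  by (subst suminf_finite[of "{n}"]) (auto simp: unit_vec_def)

text \<open>Disjointness of supports is visible in norms: the defects of \<open>f\<close> and
  \<open>h\<close> sum to a combination of the norms of \<open>f + h\<close>, \<open>f - h\<close>,
  \<open>f\<close> and \<open>h\<close>, which \<open>U\<close> preserves. So the defects of the
  images also sum to zero, and having a common sign they vanish one by one.\<close>

lemma lp_isometry_disjoint:
  assumes p: "1 < p" "p \<noteq> 2" and U: "lp_isometry p U"
    and f: "f \<in> lp_space p" and h: "h \<in> lp_space p" and disj: "\<And>n. f n * h n = 0"
  shows "U f n * U h n = 0"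
proof -
  have p0: "p > 0" using p by simp
  have bij: "bij_betw U (lp_space p) (lp_space p)"
    and lin: "\<And>f h a b. f \<in> lp_space p \<Longrightarrow> h \<in> lp_space p \<Longrightarrow>
          U (\<lambda>n. a * f n + b * h n) = (\<lambda>n. a * U f n + b * U h n)"
    and nrm: "\<And>f. f \<in> lp_space p \<Longrightarrow> lp_norm p (U f) = lp_norm p f"
    using U by (auto simp: lp_isometry_def)
  have Uin: "U k \<in> lp_space p" if "k \<in> lp_space p" for k
    using bij that by (auto simp: bij_betw_def)
  have S: "(\<Sum>n. cmod (U k n) powr p) = (\<Sum>n. cmod (k n) powr p)" if "k \<in> lp_space p" for k
    using lp_norm_powr[OF p0 that] lp_norm_powr[OF p0 Uin[OF that]] nrm[OF that] by simp
  have sm: "summable (\<lambda>n. cmod (k n) powr p)" if "k \<in> lp_space p" for k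
    using that by (simp add: lp_space_def)
  have D: "(\<lambda>n. clarkson_defect p (k n) (l n)) sums
      ((\<Sum>n. cmod (k n + l n) powr p) + (\<Sum>n. cmod (k n - l n) powr p)
        - 2 * (\<Sum>n. cmod (k n) powr p) - 2 * (\<Sum>n. cmod (l n) powr p))"
    if "k \<in> lp_space p" "l \<in> lp_space p" for k l
  proof -
    have a: "(\<lambda>n. k n + l n) \<in> lp_space p" "(\<lambda>n. k n - l n) \<in> lp_space p"
      using lp_space_lincomb[OF p0 that, of 1 1] lp_space_lincomb[OF p0 that, of 1 "-1"] by auto
    show ?thesis
      unfolding clarkson_defect_def
      by (intro sums_diff sums_add sums_mult summable_sums sm[OF a(1)] sm[OF a(2)] sm[OF that(1)] sm[OF that(2)])
  qed
  have e1: "U (\<lambda>n. f n + h n) = (\<lambda>n. U f n + U h n)" "U (\<lambda>n. f n - h n) = (\<lambda>n. U f n - U h n)"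
    using lin[OF f h, of 1 1] lin[OF f h, of 1 "-1"] by simp_all
  have a: "(\<lambda>n. f n + h n) \<in> lp_space p" "(\<lambda>n. f n - h n) \<in> lp_space p"
    using lp_space_lincomb[OF p0 f h, of 1 1] lp_space_lincomb[OF p0 f h, of 1 "-1"] by auto
  have "(\<lambda>n. clarkson_defect p (f n) (h n)) = (\<lambda>n. 0)"
    using disj p0 by (auto simp: clarkson_defect_zero)
  then have "(\<Sum>n. cmod (f n + h n) powr p) + (\<Sum>n. cmod (f n - h n) powr p)
        - 2 * (\<Sum>n. cmod (f n) powr p) - 2 * (\<Sum>n. cmod (h n) powr p) = 0"
    using sums_unique[OF D[OF f h]] by simp
  then have z: "(\<lambda>n. clarkson_defect p (U f n) (U h n)) sums 0"
    using D[OF Uin[OF f] Uin[OF h]] S[OF a(1)] S[OF a(2)] S[OF f] S[OF h]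
    by (simp add: e1)
  show ?thesis
  proof (rule ccontr)
    assume ne: "U f n * U h n \<noteq> 0"
    \<comment> \<open>The factor \<open>p - 2\<close> makes the nonzero defects positive in both
      ranges of \<open>p\<close>.\<close>
    have sgn: "z * w \<noteq> 0 \<Longrightarrow> clarkson_defect p z w * (p - 2) > 0" for z w
      using clarkson_defect_sign[of z w p] p p0
      by (cases "p > 2") (auto simp: mult_neg_neg)
    have nn: "clarkson_defect p z w * (p - 2) \<ge> 0" for z w
      using sgn[of z w] clarkson_defect_zero[OF p0, of z w] by fastforce
    have "(\<lambda>n. clarkson_defect p (U f n) (U h n) * (p - 2)) sums (0 * (p - 2))"
      by (intro sums_mult2 z)
    then have s0: "(\<lambda>n. clarkson_defect p (U f n) (U h n) * (p - 2)) sums 0" by simp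
    have "clarkson_defect p (U f n) (U h n) * (p - 2) = 0"
      using iffD1[OF suminf_eq_zero_iff[OF sums_summable[OF s0] nn] sums_unique[OF s0, symmetric]] by blast
    with sgn[OF ne] show False by simp
  qed
qed

lemma lp_isometry_inverse:
  assumes p: "1 < p" and U: "lp_isometry p U"
  shows "lp_isometry p (inv_into (lp_space p) U)"
proof -
  have p0: "p > 0" using p by simp
  let ?V = "inv_into (lp_space p) U"
  have bij: "bij_betw U (lp_space p) (lp_space p)"
    and lin: "\<And>f h a b. f \<in> lp_space p \<Longrightarrow> h \<in> lp_space p \<Longrightarrow>
          U (\<lambda>n. a * f n + b * h n) = (\<lambda>n. a * U f n + b * U h n)"
    and nrm: "\<And>f. f \<in> lp_space p \<Longrightarrow> lp_norm p (U f) = lp_norm p f"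
    using U by (auto simp: lp_isometry_def)
  have Vb: "bij_betw ?V (lp_space p) (lp_space p)"
    by (rule bij_betw_inv_into[OF bij])
  have Vin: "?V k \<in> lp_space p" if "k \<in> lp_space p" for k
    using Vb that by (auto simp: bij_betw_def)
  have UV: "U (?V k) = k" if "k \<in> lp_space p" for k
    using bij that by (simp add: bij_betw_inv_into_right)
  have VU: "?V (U k) = k" if "k \<in> lp_space p" for k
    using bij that by (simp add: bij_betw_inv_into_left)
  have 1: "?V (\<lambda>n. a * f n + b * h n) = (\<lambda>n. a * ?V f n + b * ?V h n)"
    if "f \<in> lp_space p" "h \<in> lp_space p" for f h a b
  proof -
    have "U (\<lambda>n. a * ?V f n + b * ?V h n) = (\<lambda>n. a * f n + b * h n)"
      using lin[OF Vin[OF that(1)] Vin[OF that(2)]] UV that by simp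
    then show ?thesis
      using VU[OF lp_space_lincomb[OF p0 Vin[OF that(1)] Vin[OF that(2)]]] by metis
  qed
  have 2: "lp_norm p (?V f) = lp_norm p f" if "f \<in> lp_space p" for f
    using nrm[OF Vin[OF that]] UV[OF that] by simp
  show ?thesis
    unfolding lp_isometry_def using Vb 1 2 by blast
qed

text \<open>If the image of a unit vector had several nonzero coordinates, it would split into two
  disjoint nonzero pieces, and the inverse isometry would split the unit vector itself in the same
  way.\<close>

lemma lp_isometry_unit_vec:
  assumes p: "1 < p" "p \<noteq> 2" and U: "lp_isometry p U"
  shows "\<exists>m a. cmod a = 1 \<and> U (unit_vec n) = (\<lambda>k. a * unit_vec m k)"
proof -
  have p0: "p > 0" using p by simp
  let ?V = "inv_into (lp_space p) U"
  have V: "lp_isometry p ?V"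
    by (rule lp_isometry_inverse[OF p(1) U])
  have bij: "bij_betw U (lp_space p) (lp_space p)"
    and nrm: "\<And>f. f \<in> lp_space p \<Longrightarrow> lp_norm p (U f) = lp_norm p f"
    using U by (auto simp: lp_isometry_def)
  have linV: "\<And>f h a b. f \<in> lp_space p \<Longrightarrow> h \<in> lp_space p \<Longrightarrow>
          ?V (\<lambda>n. a * f n + b * h n) = (\<lambda>n. a * ?V f n + b * ?V h n)"
    using V by (auto simp: lp_isometry_def)
  let ?u = "U (unit_vec n)"
  have u_in: "?u \<in> lp_space p"
    using bij unit_vec_lp by (auto simp: bij_betw_def)
  have S1: "(\<Sum>k. cmod (?u k) powr p) = 1"
    using lp_norm_powr[OF p0 u_in] nrm[OF unit_vec_lp] lp_norm_powr[OF p0 unit_vec_lp, of n]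
      suminf_single_powr[of 1 n p] by simp
  obtain m where m: "?u m \<noteq> 0"
    using S1 p0 by fastforce
  define a where "a = ?u m"
  \<comment> \<open>\<open>r\<close> is the image with its coordinate \<open>m\<close> removed,
    hence disjoint from \<open>unit_vec m\<close>.\<close>
  define r where "r = (\<lambda>k. 1 * ?u k + (- a) * unit_vec m k)"
  have r_in: "r \<in> lp_space p"
    unfolding r_def by (rule lp_space_lincomb[OF p0 u_in unit_vec_lp])
  have rm: "unit_vec m k * r k = 0" for k
    by (auto simp: r_def unit_vec_def a_def)
  have disj: "?V (unit_vec m) k * ?V r k = 0" for k
    by (rule lp_isometry_disjoint[OF p V unit_vec_lp r_in rm])
  have Vu: "?V ?u = unit_vec n"
    using bij by (simp add: bij_betw_inv_into_left unit_vec_lp)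
  have "?V (\<lambda>k. a * unit_vec m k + 1 * r k) = (\<lambda>k. a * ?V (unit_vec m) k + 1 * ?V r k)"
    by (rule linV[OF unit_vec_lp r_in])
  moreover have "(\<lambda>k. a * unit_vec m k + 1 * r k) = ?u"
    by (auto simp: r_def)
  ultimately have dec: "unit_vec n k = a * ?V (unit_vec m) k + ?V r k" for k
    using Vu by (metis mult_1)
  have zero_im: "k = (\<lambda>n. 0)" if "k \<in> lp_space p" "?V k = (\<lambda>n. 0)" for k
  proof -
    have "U (?V k) = k" by (rule bij_betw_inv_into_right[OF bij that(1)])
    moreover have "U (\<lambda>n. 0) = (\<lambda>n. 0)"
    proof -
      have "U (\<lambda>j. 0 * unit_vec m j + 0 * unit_vec m j) = (\<lambda>j. 0 * U (unit_vec m) j + 0 * U (unit_vec m) j)"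
        using U unit_vec_lp unfolding lp_isometry_def by blast
      then show ?thesis by simp
    qed
    ultimately show ?thesis using that by simp
  qed
  have "?V (unit_vec m) \<noteq> (\<lambda>n. 0)"
  proof
    assume "?V (unit_vec m) = (\<lambda>n. 0)"
    from zero_im[OF unit_vec_lp this] have "unit_vec m m = 0" by metis
    then show False by (simp add: unit_vec_def)
  qed
  then obtain j where j: "?V (unit_vec m) j \<noteq> 0" by auto
  with disj have rj: "?V r j = 0" by (metis mult_eq_0_iff)
  with dec[of j] j m have jn: "j = n" by (auto simp: unit_vec_def a_def split: if_splits)
  have "?V r k = 0" for k
  proof (cases "k = n")
    case True then show ?thesis using rj jn by simp
  next
    case False
    with dec[of k] disj[of k] m show ?thesis
      by (auto simp: unit_vec_def a_def)
  qed
  then have "r = (\<lambda>n. 0)" using zero_im[OF r_in] by auto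
  then have ueq: "?u = (\<lambda>k. a * unit_vec m k)"
    by (auto simp: r_def fun_eq_iff)
  then have "cmod a powr p = 1"
    using S1 suminf_single_powr[of a m p] by simp
  then have "(cmod a powr p) powr (1/p) = 1"
    by simp
  then have "cmod a = 1"
    using p0 by (simp add: powr_powr)
  then show ?thesis using ueq by blast
qed

text \<open>Unit vectors fix the permutation and the scalars; \<open>s\<close> is the inverse of the
  map \<open>t\<close> they define, since the value of \<open>U f\<close> at \<open>m\<close> is
  read off from the index sent to \<open>m\<close>. For general \<open>f\<close> the formula is
  pointwise: \<open>f\<close> without its coordinate at \<open>s m\<close> is disjoint from that
  unit vector, so its image vanishes at \<open>m\<close>.\<close>

theorem lamperti:
  assumes p: "1 < p" "p \<noteq> 2" and U: "lp_isometry p U"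
  obtains c s where "bij s" "\<And>m. cmod (c m) = 1"
    "\<And>f m. f \<in> lp_space p \<Longrightarrow> U f m = c m * f (s m)"
proof -
  have p0: "p > 0" using p by simp
  let ?V = "inv_into (lp_space p) U"
  have V: "lp_isometry p ?V"
    by (rule lp_isometry_inverse[OF p(1) U])
  have bij: "bij_betw U (lp_space p) (lp_space p)"
    and lin: "\<And>f h a b. f \<in> lp_space p \<Longrightarrow> h \<in> lp_space p \<Longrightarrow>
          U (\<lambda>n. a * f n + b * h n) = (\<lambda>n. a * U f n + b * U h n)"
    using U by (auto simp: lp_isometry_def)
  obtain t a where t: "\<And>n. cmod (a n) = 1" "\<And>n. U (unit_vec n) = (\<lambda>k. a n * unit_vec (t n) k)"
    using lp_isometry_unit_vec[OF p U] by metis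
  have a0: "a n \<noteq> 0" for n using t(1)[of n] by auto
  have "inj t"
  proof (rule injI)
    fix n n' assume eq: "t n = t n'"
    show "n = n'"
    proof (rule ccontr)
      assume "n \<noteq> n'"
      then have "U (unit_vec n) (t n) * U (unit_vec n') (t n) = 0"
        by (intro lp_isometry_disjoint[OF p U unit_vec_lp unit_vec_lp]) (auto simp: unit_vec_def)
      then show False using a0 eq by (simp add: t) (simp add: unit_vec_def)
    qed
  qed
  moreover have "surj t"
    unfolding surj_def
  proof
    fix m
    obtain n b where b: "cmod b = 1" "?V (unit_vec m) = (\<lambda>k. b * unit_vec n k)"
      using lp_isometry_unit_vec[OF p V, of m] by metis
    have "unit_vec m = U (\<lambda>k. b * unit_vec n k + 0 * unit_vec n k)"
      using bij_betw_inv_into_right[OF bij unit_vec_lp, of m] b by simp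
    also have "\<dots> = (\<lambda>k. b * a n * unit_vec (t n) k)"
      by (subst lin[OF unit_vec_lp unit_vec_lp]) (simp add: t mult.assoc)
    finally have "unit_vec m m = b * a n * unit_vec (t n) m"
      by (rule fun_cong)
    then show "\<exists>n. m = t n" by (auto simp: unit_vec_def split: if_splits)
  qed
  ultimately have bt: "bij t" by (simp add: bij_def)
  define s where "s = inv_into UNIV t"
  define c where "c m = a (s m)" for m
  have ts: "t (s m) = m" for m using bt by (simp add: s_def surj_f_inv_f bij_is_surj)
  have "U f m = c m * f (s m)" if f: "f \<in> lp_space p" for f m
  proof -
    define r where "r = (\<lambda>k. 1 * f k + (- f (s m)) * unit_vec (s m) k)"
    have r_in: "r \<in> lp_space p"
      unfolding r_def by (rule lp_space_lincomb[OF p0 f unit_vec_lp])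
    have "U (unit_vec (s m)) m * U r m = 0"
      by (rule lp_isometry_disjoint[OF p U unit_vec_lp r_in]) (auto simp: r_def unit_vec_def)
    then have Ur: "U r m = 0" using a0 by (simp add: t ts) (simp add: unit_vec_def)
    have "U (\<lambda>k. f (s m) * unit_vec (s m) k + 1 * r k) = (\<lambda>k. f (s m) * U (unit_vec (s m)) k + 1 * U r k)"
      by (rule lin[OF unit_vec_lp r_in])
    moreover have "(\<lambda>k. f (s m) * unit_vec (s m) k + 1 * r k) = f"
      by (auto simp: r_def)
    ultimately have "U f m = f (s m) * U (unit_vec (s m)) m + 1 * U r m" by metis
    then show ?thesis using Ur by (simp add: t ts c_def) (simp add: unit_vec_def)
  qed
  moreover have "bij s" using bt by (simp add: s_def bij_imp_bij_inv)
  moreover have "cmod (c m) = 1" for m by (simp add: c_def t)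
  ultimately show thesis using that by blast
qed

section \<open>Semi-inner-product spaces of functions and property (T)\<close>

text \<open>\<open>B\<close> is only positive semidefinite, so that spaces of genuine functions
  serve as Hilbert spaces without dividing out null functions. Limits exist, but are unique only up
  to norm zero.\<close>

locale semi_hilbert =
  fixes V :: "('x \<Rightarrow> complex) set"
    and B :: "('x \<Rightarrow> complex) \<Rightarrow> ('x \<Rightarrow> complex) \<Rightarrow> complex"
  assumes V_zero: "(\<lambda>x. 0) \<in> V"
    and V_lin: "f \<in> V \<Longrightarrow> h \<in> V \<Longrightarrow> (\<lambda>x. a * f x + b * h x) \<in> V"
    and B_lin: "f \<in> V \<Longrightarrow> h \<in> V \<Longrightarrow> k \<in> V \<Longrightarrow>
          B (\<lambda>x. a * f x + b * h x) k = a * B f k + b * B h k"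
    and B_herm: "f \<in> V \<Longrightarrow> h \<in> V \<Longrightarrow> B h f = cnj (B f h)"
    and B_nonneg: "f \<in> V \<Longrightarrow> 0 \<le> Re (B f f)"
    and complete: "(\<And>k. F k \<in> V) \<Longrightarrow>
          (\<And>\<epsilon>. \<epsilon> > 0 \<Longrightarrow> \<exists>N::nat. \<forall>k\<ge>N. \<forall>l\<ge>N.
             Re (B (\<lambda>x. F k x - F l x) (\<lambda>x. F k x - F l x)) < \<epsilon>) \<Longrightarrow>
          \<exists>f\<in>V. (\<lambda>k. Re (B (\<lambda>x. F k x - f x) (\<lambda>x. F k x - f x))) \<longlonglongrightarrow> 0"
begin

definition nrm :: "('x \<Rightarrow> complex) \<Rightarrow> real" where
  "nrm f = sqrt (Re (B f f))"

lemma V_add: "f \<in> V \<Longrightarrow> h \<in> V \<Longrightarrow> (\<lambda>x. f x + h x) \<in> V"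
  using V_lin[of f h 1 1] by simp

lemma V_diff: "f \<in> V \<Longrightarrow> h \<in> V \<Longrightarrow> (\<lambda>x. f x - h x) \<in> V"
  using V_lin[of f h 1 "-1"] by simp

lemma V_scale: "f \<in> V \<Longrightarrow> (\<lambda>x. a * f x) \<in> V"
  using V_lin[of f f a 0] by simp

lemma V_sum: "(\<And>j. j \<in> A \<Longrightarrow> f j \<in> V) \<Longrightarrow> (\<lambda>x. \<Sum>j\<in>A. c j * f j x) \<in> V"
  by (induction A rule: infinite_finite_induct) (simp_all add: V_zero V_add V_scale)

lemma B_add: "f \<in> V \<Longrightarrow> h \<in> V \<Longrightarrow> k \<in> V \<Longrightarrow> B (\<lambda>x. f x + h x) k = B f k + B h k"
  using B_lin[of f h k 1 1] by simp

lemma B_diff: "f \<in> V \<Longrightarrow> h \<in> V \<Longrightarrow> k \<in> V \<Longrightarrow> B (\<lambda>x. f x - h x) k = B f k - B h k"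
  using B_lin[of f h k 1 "-1"] by simp

lemma B_scale: "f \<in> V \<Longrightarrow> k \<in> V \<Longrightarrow> B (\<lambda>x. a * f x) k = a * B f k"
  using B_lin[of f f k a 0] by simp

lemma B_zero: "k \<in> V \<Longrightarrow> B (\<lambda>x. 0) k = 0"
  using B_scale[of k k 0] by simp

lemma B_sum: "(\<And>j. j \<in> A \<Longrightarrow> f j \<in> V) \<Longrightarrow> k \<in> V \<Longrightarrow>
    B (\<lambda>x. \<Sum>j\<in>A. c j * f j x) k = (\<Sum>j\<in>A. c j * B (f j) k)"
  by (induction A rule: infinite_finite_induct)
     (auto simp: B_zero B_scale B_add V_sum V_scale)

lemma B_right:
  assumes "f \<in> V" "h \<in> V" "k \<in> V"
  shows "B k (\<lambda>x. f x + h x) = B k f + B k h"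
    and "B k (\<lambda>x. f x - h x) = B k f - B k h"
    and "B k (\<lambda>x. a * f x) = cnj a * B k f"
  using assms by (simp_all add: B_herm[of _ k] B_add B_diff B_scale V_add V_diff V_scale)

lemma B_self: "f \<in> V \<Longrightarrow> B f f = of_real ((nrm f)\<^sup>2)"
  using B_herm[of f f] B_nonneg[of f]
  by (auto simp: nrm_def complex_eq_iff)

lemma nrm_nonneg [simp]: "f \<in> V \<Longrightarrow> 0 \<le> nrm f"
  by (simp add: nrm_def B_nonneg)

lemma nrm_sq_Re: "f \<in> V \<Longrightarrow> (nrm f)\<^sup>2 = Re (B f f)"
  by (simp add: B_self)

lemma nrm_zero [simp]: "nrm (\<lambda>x. 0) = 0"
  by (simp add: nrm_def B_zero V_zero)

lemma nrm_scale: "f \<in> V \<Longrightarrow> nrm (\<lambda>x. a * f x) = cmod a * nrm f"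
proof -
  assume f: "f \<in> V"
  have "B (\<lambda>x. a * f x) (\<lambda>x. a * f x) = (a * cnj a) * B f f"
    using f by (simp add: B_scale B_right V_scale)
  also have "\<dots> = of_real ((cmod a * nrm f)\<^sup>2)"
    using f by (simp add: complex_norm_square power_mult_distrib B_self del: of_real_power)
  finally have "(nrm (\<lambda>x. a * f x))\<^sup>2 = (cmod a * nrm f)\<^sup>2"
    using f by (simp add: nrm_sq_Re V_scale del: of_real_power of_real_mult)
  then show ?thesis
    using f by (simp add: V_scale)
qed

lemma nrm_add_sq: "f \<in> V \<Longrightarrow> h \<in> V \<Longrightarrow>
    (nrm (\<lambda>x. f x + h x))\<^sup>2 = (nrm f)\<^sup>2 + (nrm h)\<^sup>2 + 2 * Re (B f h)"
  by (simp add: nrm_sq_Re V_add B_add B_right B_herm[of f h])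

lemma nrm_diff_sq: "f \<in> V \<Longrightarrow> h \<in> V \<Longrightarrow>
    (nrm (\<lambda>x. f x - h x))\<^sup>2 = (nrm f)\<^sup>2 + (nrm h)\<^sup>2 - 2 * Re (B f h)"
  by (simp add: nrm_sq_Re V_diff B_diff B_right B_herm[of f h])

lemma cauchy_schwarz:
  assumes f: "f \<in> V" and h: "h \<in> V"
  shows "cmod (B f h) \<le> nrm f * nrm h"
proof -
  let ?b = "B f h"
  \<comment> \<open>The squared norm of \<open>f - t * B f h * h\<close> for real \<open>t\<close>.
    The best choice is \<open>t = 1 / (nrm h)\<^sup>2\<close>; if \<open>nrm h = 0\<close> the right
    side is affine in \<open>t\<close>, and a large \<open>t\<close> makes it negative unless
    \<open>B f h\<close> is zero.\<close>
  have key: "0 \<le> (nrm f)\<^sup>2 + t\<^sup>2 * (cmod ?b)\<^sup>2 * (nrm h)\<^sup>2 - 2 * t * (cmod ?b)\<^sup>2" for t :: real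
  proof -
    let ?a = "of_real t * ?b"
    have "0 \<le> (nrm (\<lambda>x. f x - ?a * h x))\<^sup>2" by simp
    also have "\<dots> = (nrm f)\<^sup>2 + (nrm (\<lambda>x. ?a * h x))\<^sup>2 - 2 * Re (B f (\<lambda>x. ?a * h x))"
      using f h by (intro nrm_diff_sq V_scale)
    also have "B f (\<lambda>x. ?a * h x) = of_real (t * (cmod ?b)\<^sup>2)"
      using B_right(3)[OF h h f, of ?a] by (simp add: complex_norm_square mult_ac del: of_real_power)
    also have "nrm (\<lambda>x. ?a * h x) = \<bar>t\<bar> * cmod ?b * nrm h"
      using h by (simp add: nrm_scale norm_mult)
    finally show ?thesis
      by (simp add: power_mult_distrib algebra_simps)
  qed
  show ?thesis
  proof (cases "nrm h = 0")
    case True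
    have "cmod ?b = 0"
    proof (rule ccontr)
      assume "cmod ?b \<noteq> 0"
      then have "(cmod ?b)\<^sup>2 > 0" by simp
      with key[of "((nrm f)\<^sup>2 + 1) / (2 * (cmod ?b)\<^sup>2)"] True show False
        by (simp add: field_simps)
    qed
    then show ?thesis using f h by simp
  next
    case False
    then have pos: "(nrm h)\<^sup>2 > 0" by simp
    have "0 \<le> ((nrm f)\<^sup>2 + (1/(nrm h)\<^sup>2)\<^sup>2 * (cmod ?b)\<^sup>2 * (nrm h)\<^sup>2 - 2 * (1/(nrm h)\<^sup>2) * (cmod ?b)\<^sup>2) * (nrm h)\<^sup>2"
      using key[of "1 / (nrm h)\<^sup>2"] pos by (intro mult_nonneg_nonneg) auto
    also have "\<dots> = (nrm f)\<^sup>2 * (nrm h)\<^sup>2 - (cmod ?b)\<^sup>2"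
      using pos False by (simp add: field_simps power2_eq_square)
    finally have "(cmod ?b)\<^sup>2 \<le> (nrm f * nrm h)\<^sup>2"
      by (simp add: power_mult_distrib)
    then show ?thesis
      by (rule power2_le_imp_le) (use f h in simp)
  qed
qed

lemma nrm_triangle:
  assumes "f \<in> V" "h \<in> V"
  shows "nrm (\<lambda>x. f x + h x) \<le> nrm f + nrm h"
proof (rule power2_le_imp_le)
  have "Re (B f h) \<le> nrm f * nrm h"
    using cauchy_schwarz[OF assms] complex_Re_le_cmod[of "B f h"] by linarith
  then show "(nrm (\<lambda>x. f x + h x))\<^sup>2 \<le> (nrm f + nrm h)\<^sup>2"
    using assms by (simp add: nrm_add_sq power2_sum)
qed (use assms in simp)

lemma nrm_minus_commute: "f \<in> V \<Longrightarrow> h \<in> V \<Longrightarrow> nrm (\<lambda>x. f x - h x) = nrm (\<lambda>x. h x - f x)"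
  using nrm_scale[OF V_diff[of h f], of "-1"] by simp

lemma nrm_triangle_diff:
  assumes "f \<in> V" "h \<in> V" "k \<in> V"
  shows "nrm (\<lambda>x. f x - k x) \<le> nrm (\<lambda>x. f x - h x) + nrm (\<lambda>x. h x - k x)"
  using nrm_triangle[OF V_diff[OF assms(1,2)] V_diff[OF assms(2,3)]] by simp

lemma nrm_diff_le:
  assumes "f \<in> V" "h \<in> V"
  shows "\<bar>nrm f - nrm h\<bar> \<le> nrm (\<lambda>x. f x - h x)"
  using nrm_triangle[OF V_diff[OF assms] assms(2)] nrm_triangle[OF V_diff[OF assms(2,1)] assms(1)]
    nrm_minus_commute[OF assms] by simp

lemma complete_nrm:
  assumes F: "\<And>k. F k \<in> V"
    and cauchy: "\<And>\<epsilon>. \<epsilon> > 0 \<Longrightarrow> \<exists>N::nat. \<forall>k\<ge>N. \<forall>l\<ge>N. nrm (\<lambda>x. F k x - F l x) < \<epsilon>"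
  shows "\<exists>f\<in>V. (\<lambda>k. nrm (\<lambda>x. F k x - f x)) \<longlonglongrightarrow> 0"
proof -
  have "\<exists>f\<in>V. (\<lambda>k. Re (B (\<lambda>x. F k x - f x) (\<lambda>x. F k x - f x))) \<longlonglongrightarrow> 0"
  proof (rule complete[OF F])
    fix \<epsilon> :: real assume "\<epsilon> > 0"
    then obtain N where N: "\<forall>k\<ge>N. \<forall>l\<ge>N. nrm (\<lambda>x. F k x - F l x) < sqrt \<epsilon>"
      using cauchy[of "sqrt \<epsilon>"] by auto
    then show "\<exists>N. \<forall>k\<ge>N. \<forall>l\<ge>N. Re (B (\<lambda>x. F k x - F l x) (\<lambda>x. F k x - F l x)) < \<epsilon>"
      by (intro exI[of _ N]) (simp add: nrm_def)
  qed
  then obtain f where f: "f \<in> V" "(\<lambda>k. Re (B (\<lambda>x. F k x - f x) (\<lambda>x. F k x - f x))) \<longlonglongrightarrow> 0"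
    by blast
  have "(\<lambda>k. nrm (\<lambda>x. F k x - f x)) \<longlonglongrightarrow> 0"
    unfolding nrm_def using tendsto_real_sqrt[OF f(2)] by simp
  with f(1) show ?thesis by blast
qed

section \<open>Gram-Schmidt orthonormalisation and Fourier coefficients\<close>

context
  fixes u :: "nat \<Rightarrow> 'x \<Rightarrow> complex"
begin

text \<open>Gram-Schmidt without discarding dependent vectors: if the residual has norm zero,
  \<open>inverse 0 = 0\<close> makes \<open>gs m\<close> the zero function. All positions are kept,
  and \<open>gs_index\<close> records those that carry a unit vector.\<close>

fun gs :: "nat \<Rightarrow> 'x \<Rightarrow> complex" where
  "gs m = (\<lambda>x. of_real (inverse (nrm (\<lambda>x. u m x - (\<Sum>j<m. B (u m) (gs j) * gs j x))))
             * (u m x - (\<Sum>j<m. B (u m) (gs j) * gs j x)))"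

declare gs.simps [simp del]

definition gs_res :: "nat \<Rightarrow> 'x \<Rightarrow> complex" where
  "gs_res m = (\<lambda>x. u m x - (\<Sum>j<m. B (u m) (gs j) * gs j x))"

lemma gs_eq: "gs m = (\<lambda>x. of_real (inverse (nrm (gs_res m))) * gs_res m x)"
  by (subst gs.simps) (simp add: gs_res_def)

definition gs_index :: "nat set" where
  "gs_index = {m. nrm (gs_res m) \<noteq> 0}"

definition psum :: "nat \<Rightarrow> (nat \<Rightarrow> complex) \<Rightarrow> 'x \<Rightarrow> complex" where
  "psum N c = (\<lambda>x. \<Sum>j<N. c j * gs j x)"

definition coef :: "('x \<Rightarrow> complex) \<Rightarrow> nat \<Rightarrow> complex" where
  "coef f = (\<lambda>j. B f (gs j))"

text \<open>The limit of the partial sums is determined only up to norm zero, so one is chosen.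
  \<open>synth\<close> is therefore linear only modulo null vectors.\<close>

definition synth :: "(nat \<Rightarrow> complex) \<Rightarrow> 'x \<Rightarrow> complex" where
  "synth c = (SOME f. f \<in> V \<and> (\<lambda>N. nrm (\<lambda>x. psum N c x - f x)) \<longlonglongrightarrow> 0)"

text \<open>The closed linear span of the family \<open>u\<close>, described by convergence of
  Fourier series; it also contains every vector at norm distance zero from its members.\<close>

definition cspan :: "('x \<Rightarrow> complex) set" where
  "cspan = {f \<in> V. (\<lambda>N. nrm (\<lambda>x. psum N (coef f) x - f x)) \<longlonglongrightarrow> 0}"

context
  assumes u_in: "\<And>m. u m \<in> V"
begin

lemma gs_in: "gs m \<in> V"
  by (induction m rule: less_induct) (subst gs.simps, intro V_scale V_diff V_sum u_in, simp)

lemma gs_res_in: "gs_res m \<in> V"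
  unfolding gs_res_def by (intro V_diff V_sum u_in gs_in)

lemma gs_outside: "m \<notin> gs_index \<Longrightarrow> gs m = (\<lambda>x. 0)"
  by (simp add: gs_eq gs_index_def)

lemma B_gs_self: "B (gs m) (gs m) = (if m \<in> gs_index then 1 else 0)"
proof (cases "m \<in> gs_index")
  case True
  then have "nrm (gs m) = 1"
    using gs_res_in[of m] nrm_nonneg[OF gs_res_in, of m]
    by (subst gs_eq, subst nrm_scale) (auto simp: gs_index_def norm_inverse)
  then show ?thesis using True gs_in by (simp add: B_self)
qed (simp add: gs_outside B_zero V_zero)

lemma B_gs_less: "i < m \<Longrightarrow> B (gs m) (gs i) = 0"
proof (induction m arbitrary: i rule: less_induct)
  case (less m)
  have orth: "B (gs j) (gs i) = 0" if "j < m" "j \<noteq> i" for j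
  proof (cases "i < j")
    case True then show ?thesis using less.IH that by simp
  next
    case False
    then have "B (gs i) (gs j) = 0" using less that by (intro less.IH) auto
    then show ?thesis using B_herm[OF gs_in gs_in, of i j] by simp
  qed
  have "B (gs_res m) (gs i) = B (u m) (gs i) - (\<Sum>j<m. B (u m) (gs j) * B (gs j) (gs i))"
    unfolding gs_res_def by (simp add: B_diff B_sum u_in gs_in V_sum)
  also have "(\<Sum>j<m. B (u m) (gs j) * B (gs j) (gs i)) = B (u m) (gs i) * B (gs i) (gs i)"
    using less.prems orth by (subst sum.remove[of _ i]) auto
  \<comment> \<open>For \<open>i\<close> outside \<open>gs_index\<close> the vector
    \<open>gs i\<close> is zero, and both sides vanish.\<close>
  also have "\<dots> = B (u m) (gs i)"
    using B_right(3)[OF V_zero V_zero u_in, of m 0]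
    by (cases "i \<in> gs_index") (auto simp: B_gs_self gs_outside)
  finally have "B (gs_res m) (gs i) = 0" by simp
  then show ?case
    using gs_res_in gs_in by (subst gs_eq) (simp add: B_scale)
qed

lemma B_gs: "B (gs i) (gs j) = (if i = j \<and> i \<in> gs_index then 1 else 0)"
proof -
  consider "i = j" | "j < i" | "i < j" by linarith
  then show ?thesis
  proof cases
    case 3
    then show ?thesis using B_gs_less[of i j] B_herm[OF gs_in gs_in, of j i] by auto
  qed (auto simp: B_gs_self B_gs_less)
qed

lemma psum_in: "psum N c \<in> V"
  unfolding psum_def by (intro V_sum gs_in)

lemma B_psum_gs: "B (psum N c) (gs i) = (if i < N \<and> i \<in> gs_index then c i else 0)"
proof -
  have "B (psum N c) (gs i) = (\<Sum>j<N. if j = i then (if i \<in> gs_index then c i else 0) else 0)"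
    unfolding psum_def by (subst B_sum[OF gs_in gs_in], intro sum.cong) (auto simp: B_gs)
  then show ?thesis by (simp add: sum.delta)
qed

lemma B_psum_right: "f \<in> V \<Longrightarrow> B f (psum N c) = (\<Sum>j<N. cnj (c j) * coef f j)"
  using B_herm[OF psum_in, of f N c] B_sum[of "{..<N}" gs f c] B_herm[OF _ gs_in, of f]
  by (simp add: psum_def coef_def gs_in)

lemma coef_outside: "f \<in> V \<Longrightarrow> j \<notin> gs_index \<Longrightarrow> coef f j = 0"
  using B_right(3)[OF V_zero V_zero, of f 0] by (simp add: coef_def gs_outside)

lemma coef_psum: "coef (psum N c) = (\<lambda>i. if i < N \<and> i \<in> gs_index then c i else 0)"
  by (auto simp: coef_def B_psum_gs)

lemma nrm_psum: "(nrm (psum N c))\<^sup>2 = (\<Sum>j<N. if j \<in> gs_index then (cmod (c j))\<^sup>2 else 0)"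
proof -
  have "of_real ((nrm (psum N c))\<^sup>2) = (\<Sum>j<N. if j \<in> gs_index then c j * cnj (c j) else 0)"
    using psum_in by (subst B_self[symmetric]) (auto simp: B_psum_right coef_psum intro!: sum.cong)
  also have "\<dots> = of_real (\<Sum>j<N. if j \<in> gs_index then (cmod (c j))\<^sup>2 else 0)"
    unfolding of_real_sum by (intro sum.cong) (auto simp: complex_norm_square simp del: of_real_power)
  finally show ?thesis
    using of_real_eq_iff by blast
qed

lemma nrm_sub_psum:
  assumes f: "f \<in> V"
  shows "(nrm (\<lambda>x. psum N (coef f) x - f x))\<^sup>2 = (nrm f)\<^sup>2 - (\<Sum>j<N. (cmod (coef f j))\<^sup>2)"
proof -
  have "(nrm (psum N (coef f)))\<^sup>2 = (\<Sum>j<N. (cmod (coef f j))\<^sup>2)"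
    unfolding nrm_psum using coef_outside[OF f] by (intro sum.cong) auto
  moreover have "Re (B (psum N (coef f)) f) = (\<Sum>j<N. (cmod (coef f j))\<^sup>2)"
    using f by (simp add: B_herm[of f "psum N (coef f)"] psum_in B_psum_right
        cmod_power2 flip: power2_eq_square)
  ultimately show ?thesis
    by (simp add: nrm_diff_sq psum_in f)
qed

lemma bessel:
  assumes f: "f \<in> V"
  shows "summable (\<lambda>j. (cmod (coef f j))\<^sup>2)" and "(\<Sum>j. (cmod (coef f j))\<^sup>2) \<le> (nrm f)\<^sup>2"
proof -
  have le: "(\<Sum>j<N. (cmod (coef f j))\<^sup>2) \<le> (nrm f)\<^sup>2" for N
    using nrm_sub_psum[OF f, of N] zero_le_power2[of "nrm (\<lambda>x. psum N (coef f) x - f x)"] by linarith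
  show s: "summable (\<lambda>j. (cmod (coef f j))\<^sup>2)"
    by (rule summableI_nonneg_bounded[OF _ le]) simp
  show "(\<Sum>j. (cmod (coef f j))\<^sup>2) \<le> (nrm f)\<^sup>2"
    by (rule suminf_le_const[OF s le])
qed

lemma coef_l2: "f \<in> V \<Longrightarrow> coef f \<in> l2_space gs_index"
  using bessel(1) coef_outside by (auto simp: l2_space_def)

lemma coef_norm_le: "f \<in> V \<Longrightarrow> l2_norm (coef f) \<le> nrm f"
  using bessel(2)[of f] real_le_lsqrt[of "nrm f"] by (simp add: l2_norm_def)

lemma coef_lin: "f \<in> V \<Longrightarrow> h \<in> V \<Longrightarrow> coef (\<lambda>x. a * f x + b * h x) = (\<lambda>j. a * coef f j + b * coef h j)"
  by (simp add: coef_def B_lin gs_in)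

lemma coef_diff: "f \<in> V \<Longrightarrow> h \<in> V \<Longrightarrow> coef (\<lambda>x. f x - h x) = (\<lambda>j. coef f j - coef h j)"
  by (simp add: coef_def B_diff gs_in)

lemma psum_lin: "psum N (\<lambda>j. a * c j + b * d j) = (\<lambda>x. a * psum N c x + b * psum N d x)"
  by (auto simp: psum_def algebra_simps sum.distrib sum_distrib_left)

lemma nrm_sub_psum_le:
  assumes f: "f \<in> V"
  shows "nrm (\<lambda>x. psum N (coef f) x - f x) \<le> nrm f"
proof (rule power2_le_imp_le)
  have "(\<Sum>j<N. (cmod (coef f j))\<^sup>2) \<ge> 0"
    by (rule sum_nonneg) simp
  then show "(nrm (\<lambda>x. psum N (coef f) x - f x))\<^sup>2 \<le> (nrm f)\<^sup>2"
    unfolding nrm_sub_psum[OF f] by linarith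
qed (use f in simp)

lemma synth_exists:
  assumes c: "c \<in> l2_space gs_index"
  shows "\<exists>f. f \<in> V \<and> (\<lambda>N. nrm (\<lambda>x. psum N c x - f x)) \<longlonglongrightarrow> 0"
proof -
  have sc: "summable (\<lambda>n. (cmod (c n))\<^sup>2)" and c0: "n \<notin> gs_index \<Longrightarrow> c n = 0" for n
    using c by (auto simp: l2_space_def)
  have diff: "(nrm (\<lambda>x. psum l c x - psum k c x))\<^sup>2 = (\<Sum>j\<in>{k..<l}. (cmod (c j))\<^sup>2)" if "k \<le> l" for k l
  proof -
    have "(\<lambda>x. psum l c x - psum k c x) = psum l (\<lambda>j. if j < k then 0 else c j)"
    proof
      fix x
      have "psum l (\<lambda>j. if j < k then 0 else c j) x = (\<Sum>j\<in>{..<l} - {..<k}. c j * gs j x)"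
        unfolding psum_def by (rule sum.mono_neutral_cong_right) auto
      also have "\<dots> = psum l c x - psum k c x"
        unfolding psum_def using that by (subst sum_diff) auto
      finally show "psum l c x - psum k c x = psum l (\<lambda>j. if j < k then 0 else c j) x" by simp
    qed
    then have "(nrm (\<lambda>x. psum l c x - psum k c x))\<^sup>2
      = (\<Sum>j<l. if j \<in> gs_index then (cmod (if j < k then 0 else c j))\<^sup>2 else 0)"
      by (simp add: nrm_psum)
    also have "\<dots> = (\<Sum>j\<in>{k..<l}. (cmod (c j))\<^sup>2)"
      using c0 by (intro sum.mono_neutral_cong_right) (auto split: if_splits)
    finally show ?thesis .
  qed
  have "\<exists>f\<in>V. (\<lambda>N. nrm (\<lambda>x. psum N c x - f x)) \<longlonglongrightarrow> 0"
  proof (rule complete_nrm[OF psum_in])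
    fix \<epsilon> :: real assume e: "\<epsilon> > 0"
    obtain N where N: "\<And>m n. m \<ge> N \<Longrightarrow> norm (\<Sum>j\<in>{m..<n}. (cmod (c j))\<^sup>2) < \<epsilon>\<^sup>2"
      using sc e unfolding summable_Cauchy by (meson zero_less_power)
    have lt: "nrm (\<lambda>x. psum l c x - psum k c x) < \<epsilon>" if "k \<le> l" "N \<le> k" for k l
      using N[OF that(2), of l] diff[OF that(1)] e
      by (intro power2_less_imp_less[of _ \<epsilon>]) auto
    show "\<exists>N. \<forall>k\<ge>N. \<forall>l\<ge>N. nrm (\<lambda>x. psum k c x - psum l c x) < \<epsilon>"
    proof (intro exI[of _ N] allI impI)
      fix k l assume "N \<le> k" "N \<le> l"
      then show "nrm (\<lambda>x. psum k c x - psum l c x) < \<epsilon>"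
        using lt[of k l] lt[of l k] nrm_minus_commute[OF psum_in psum_in, of k c l c]
        by (cases "k \<le> l") auto
    qed
  qed
  then show ?thesis by blast
qed

lemma synth:
  assumes "c \<in> l2_space gs_index"
  shows "synth c \<in> V" and "(\<lambda>N. nrm (\<lambda>x. psum N c x - synth c x)) \<longlonglongrightarrow> 0"
  using someI_ex[OF synth_exists[OF assms]] by (auto simp: synth_def)

lemma B_limit:
  assumes "\<And>N. F N \<in> V" "f \<in> V" "h \<in> V" "(\<lambda>N. nrm (\<lambda>x. F N x - f x)) \<longlonglongrightarrow> 0"
  shows "(\<lambda>N. B (F N) h) \<longlonglongrightarrow> B f h"
proof -
  have t0: "(\<lambda>N. nrm (\<lambda>x. F N x - f x) * nrm h) \<longlonglongrightarrow> 0"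
    by (rule tendsto_mult_left_zero[OF assms(4)])
  have "cmod (B (F N) h - B f h) \<le> nrm (\<lambda>x. F N x - f x) * nrm h" for N
    using cauchy_schwarz[OF V_diff[OF assms(1,2)] assms(3), of N] assms by (simp add: B_diff)
  then have "(\<lambda>N. B (F N) h - B f h) \<longlonglongrightarrow> 0"
    by (intro Lim_null_comparison[OF _ t0] always_eventually allI)
  then show ?thesis by (simp add: LIM_zero_iff)
qed

lemma coef_synth:
  assumes c: "c \<in> l2_space gs_index"
  shows "coef (synth c) = c"
proof
  fix i
  have "(\<lambda>N. B (psum N c) (gs i)) \<longlonglongrightarrow> B (synth c) (gs i)"
    by (intro B_limit psum_in synth[OF c] gs_in)
  moreover have "(\<lambda>N. B (psum N c) (gs i)) \<longlonglongrightarrow> c i"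
  proof (rule tendsto_eventually)
    show "\<forall>\<^sub>F N in sequentially. B (psum N c) (gs i) = c i"
      using c by (intro eventually_sequentiallyI[of "Suc i"]) (auto simp: B_psum_gs l2_space_def)
  qed
  ultimately show "coef (synth c) i = c i"
    unfolding coef_def by (rule LIMSEQ_unique)
qed

lemma synth_cspan: "c \<in> l2_space gs_index \<Longrightarrow> synth c \<in> cspan"
  using synth[of c] by (simp add: cspan_def coef_synth)

lemma cspanD: "f \<in> cspan \<Longrightarrow> f \<in> V"
  by (simp add: cspan_def)

lemma cspan_lin:
  assumes "f \<in> cspan" "h \<in> cspan"
  shows "(\<lambda>x. a * f x + b * h x) \<in> cspan"
proof -
  have fh: "f \<in> V" "h \<in> V" using assms cspanD by auto
  have "(\<lambda>N. nrm (\<lambda>x. psum N (coef (\<lambda>x. a * f x + b * h x)) x - (a * f x + b * h x))) \<longlonglongrightarrow> 0"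
  proof (rule Lim_null_comparison)
    show "(\<lambda>N. cmod a * nrm (\<lambda>x. psum N (coef f) x - f x) + cmod b * nrm (\<lambda>x. psum N (coef h) x - h x)) \<longlonglongrightarrow> 0"
      using assms by (auto simp: cspan_def intro!: tendsto_add_zero tendsto_mult_right_zero)
    have "nrm (\<lambda>x. psum N (coef (\<lambda>x. a * f x + b * h x)) x - (a * f x + b * h x))
        \<le> cmod a * nrm (\<lambda>x. psum N (coef f) x - f x) + cmod b * nrm (\<lambda>x. psum N (coef h) x - h x)" for N
    proof -
      have "(\<lambda>x. psum N (coef (\<lambda>x. a * f x + b * h x)) x - (a * f x + b * h x))
        = (\<lambda>x. a * (psum N (coef f) x - f x) + b * (psum N (coef h) x - h x))"
        using fh by (auto simp: coef_lin psum_lin algebra_simps)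
      then show ?thesis
        using nrm_triangle[OF V_scale[OF V_diff[OF psum_in fh(1)]] V_scale[OF V_diff[OF psum_in fh(2)]], of a N "coef f" b N "coef h"]
          fh by (simp add: nrm_scale V_diff psum_in)
    qed
    then show "\<forall>\<^sub>F N in sequentially. norm (nrm (\<lambda>x. psum N (coef (\<lambda>x. a * f x + b * h x)) x - (a * f x + b * h x)))
        \<le> cmod a * nrm (\<lambda>x. psum N (coef f) x - f x) + cmod b * nrm (\<lambda>x. psum N (coef h) x - h x)"
      using fh V_lin[OF fh] by (auto simp: V_diff psum_in)
  qed
  then show ?thesis using fh by (simp add: cspan_def V_lin)
qed

text \<open>The Fourier remainder of \<open>f\<close> is that of \<open>h\<close> plus that of
  \<open>f - h\<close>. The first tends to zero, and the second never exceeds the norm of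
  \<open>f - h\<close>.\<close>

lemma cspan_closed:
  assumes f: "f \<in> V" and ap: "\<And>\<epsilon>. \<epsilon> > 0 \<Longrightarrow> \<exists>h\<in>cspan. nrm (\<lambda>x. f x - h x) < \<epsilon>"
  shows "f \<in> cspan"
proof -
  have "(\<lambda>N. nrm (\<lambda>x. psum N (coef f) x - f x)) \<longlonglongrightarrow> 0"
  proof (rule LIMSEQ_I)
    fix \<epsilon> :: real assume e: "\<epsilon> > 0"
    then obtain h where h: "h \<in> cspan" "nrm (\<lambda>x. f x - h x) < \<epsilon> / 2"
      using ap[of "\<epsilon>/2"] by auto
    have hV: "h \<in> V" using h cspanD by auto
    have "(\<lambda>N. nrm (\<lambda>x. psum N (coef h) x - h x)) \<longlonglongrightarrow> 0"
      using h by (simp add: cspan_def)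
    then obtain N0 where N0: "\<And>N. N \<ge> N0 \<Longrightarrow> nrm (\<lambda>x. psum N (coef h) x - h x) < \<epsilon> / 2"
      using LIMSEQ_D[of _ 0 "\<epsilon>/2"] e by fastforce
    show "\<exists>N0. \<forall>N\<ge>N0. norm (nrm (\<lambda>x. psum N (coef f) x - f x) - 0) < \<epsilon>"
    proof (intro exI[of _ N0] allI impI)
      fix N assume N: "N \<ge> N0"
      have d: "(\<lambda>x. f x - h x) \<in> V" using f hV V_diff by simp
      have "psum N (coef (\<lambda>x. f x - h x)) = (\<lambda>x. psum N (coef f) x - psum N (coef h) x)"
        using psum_lin[of N 1 "coef f" "-1" "coef h"] f hV by (simp add: coef_diff)
      then have "(\<lambda>x. psum N (coef f) x - f x)
         = (\<lambda>x. (psum N (coef h) x - h x) + (psum N (coef (\<lambda>x. f x - h x)) x - (f x - h x)))"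
        by auto
      then have "nrm (\<lambda>x. psum N (coef f) x - f x)
         \<le> nrm (\<lambda>x. psum N (coef h) x - h x) + nrm (\<lambda>x. psum N (coef (\<lambda>x. f x - h x)) x - (f x - h x))"
        using nrm_triangle[OF V_diff[OF psum_in hV] V_diff[OF psum_in d]] by simp
      also have "\<dots> < \<epsilon> / 2 + \<epsilon> / 2"
        using N0[OF N] nrm_sub_psum_le[OF d, of N] h(2) by linarith
      finally show "norm (nrm (\<lambda>x. psum N (coef f) x - f x) - 0) < \<epsilon>"
        using f by (simp add: V_diff psum_in)
    qed
  qed
  then show ?thesis using f by (simp add: cspan_def)
qed

lemma psum_cspan: "psum M c \<in> cspan"
proof -
  have "psum N (coef (psum M c)) = psum M c" if "N \<ge> M" for N
  proof
    fix x
    show "psum N (coef (psum M c)) x = psum M c x"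
      unfolding psum_def[of N] psum_def[of M c] coef_psum[unfolded psum_def]
      using that by (intro sum.mono_neutral_cong_right) (auto simp: gs_outside)
  qed
  then have "(\<lambda>N. nrm (\<lambda>x. psum N (coef (psum M c)) x - psum M c x)) \<longlonglongrightarrow> 0"
    by (intro tendsto_eventually eventually_sequentiallyI[of M]) simp
  then show ?thesis by (simp add: cspan_def psum_in)
qed

lemma nrm_zero_cspan: "f \<in> V \<Longrightarrow> h \<in> cspan \<Longrightarrow> nrm (\<lambda>x. f x - h x) = 0 \<Longrightarrow> f \<in> cspan"
  by (rule cspan_closed) (auto intro!: bexI[of _ h])

text \<open>The difference is the residual times \<open>1 - r * inverse r\<close>, where
  \<open>r\<close> is the norm of the residual: either the factor or \<open>r\<close> is
  zero.\<close>

lemma u_decomp: "nrm (\<lambda>x. u m x - psum (Suc m) (coef (u m)) x) = 0"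
proof -
  have Bm: "B (u m) (gs m) = of_real (nrm (gs_res m))"
  proof -
    have "u m = (\<lambda>x. gs_res m x + (\<Sum>j<m. B (u m) (gs j) * gs j x))"
      by (auto simp: gs_res_def)
    then have "B (u m) (gs m) = B (gs_res m) (gs m) + (\<Sum>j<m. B (u m) (gs j) * B (gs j) (gs m))"
      using B_add[OF gs_res_in V_sum gs_in, of "{..<m}" gs m "\<lambda>j. B (u m) (gs j)" m]
        B_sum[of "{..<m}" gs "gs m" "\<lambda>j. B (u m) (gs j)"] gs_in by simp
    also have "(\<Sum>j<m. B (u m) (gs j) * B (gs j) (gs m)) = 0"
      by (intro sum.neutral) (auto simp: B_gs)
    also have "B (gs_res m) (gs m) = of_real (nrm (gs_res m))"
      using gs_res_in[of m] B_right(3)[OF gs_res_in[of m] gs_res_in[of m] gs_res_in[of m], of "of_real (inverse (nrm (gs_res m)))"]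
      by (subst gs_eq, cases "nrm (gs_res m) = 0") (simp_all add: B_self power2_eq_square)
    finally show ?thesis by simp
  qed
  have "(\<lambda>x. u m x - psum (Suc m) (coef (u m)) x) = (\<lambda>x. gs_res m x - B (u m) (gs m) * gs m x)"
    by (auto simp: psum_def gs_res_def coef_def)
  also have "\<dots> = (\<lambda>x. (1 - of_real (nrm (gs_res m) * inverse (nrm (gs_res m)))) * gs_res m x)"
    unfolding Bm by (subst gs_eq) (auto simp: algebra_simps)
  finally have "nrm (\<lambda>x. u m x - psum (Suc m) (coef (u m)) x)
      = cmod (1 - of_real (nrm (gs_res m) * inverse (nrm (gs_res m)))) * nrm (gs_res m)"
    using gs_res_in by (simp add: nrm_scale del: of_real_mult)
  then show ?thesis by (cases "nrm (gs_res m) = 0") auto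
qed

lemma u_cspan: "u m \<in> cspan"
  by (rule nrm_zero_cspan[OF u_in psum_cspan u_decomp])

lemma parseval:
  assumes f: "f \<in> cspan"
  shows "l2_norm (coef f) = nrm f"
proof -
  have fV: "f \<in> V" using f cspanD by auto
  have "(\<lambda>N. (nrm f)\<^sup>2 - (nrm (\<lambda>x. psum N (coef f) x - f x))\<^sup>2) \<longlonglongrightarrow> (nrm f)\<^sup>2 - 0\<^sup>2"
    using f by (intro tendsto_diff tendsto_power tendsto_const) (auto simp: cspan_def)
  then have "(\<lambda>j. (cmod (coef f j))\<^sup>2) sums (nrm f)\<^sup>2"
    unfolding sums_def nrm_sub_psum[OF fV] by simp
  then show ?thesis using fV by (simp add: l2_norm_def sums_iff)
qed

lemma nrm_synth: "c \<in> l2_space gs_index \<Longrightarrow> nrm (synth c) = l2_norm c"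
  using parseval[OF synth_cspan] by (simp add: coef_synth)

lemma synth_coef:
  assumes f: "f \<in> cspan"
  shows "nrm (\<lambda>x. synth (coef f) x - f x) = 0"
proof -
  have fV: "f \<in> V" and c: "coef f \<in> l2_space gs_index" using f cspanD coef_l2 by auto
  have "(\<lambda>x. 1 * synth (coef f) x + (-1) * f x) \<in> cspan"
    by (rule cspan_lin[OF synth_cspan[OF c] f])
  then have "(\<lambda>x. synth (coef f) x - f x) \<in> cspan" by simp
  then have "nrm (\<lambda>x. synth (coef f) x - f x) = l2_norm (coef (\<lambda>x. synth (coef f) x - f x))"
    by (simp add: parseval)
  also have "\<dots> = 0"
    using fV synth[OF c] by (simp add: coef_diff coef_synth[OF c] l2_norm_def)
  finally show ?thesis .
qed

lemma B_cspan_zero: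
  assumes f: "f \<in> V" and h: "h \<in> cspan" and z: "\<And>j. coef f j = 0"
  shows "B f h = 0"
proof -
  have hV: "h \<in> V" using h cspanD by auto
  have "(\<lambda>N. B (psum N (coef h)) f) \<longlonglongrightarrow> B h f"
    using h f by (intro B_limit psum_in hV) (auto simp: cspan_def)
  moreover have "B (psum N (coef h)) f = 0" for N
    using B_herm[OF f psum_in, of N "coef h"] B_psum_right[OF f, of N "coef h"] z by simp
  ultimately have "B h f = 0" by (simp add: LIMSEQ_unique[OF _ tendsto_const])
  then show ?thesis using B_herm[OF hV f] by simp
qed

lemma projection:
  assumes f: "f \<in> V"
  shows "\<exists>h\<in>cspan. \<forall>m. B (\<lambda>x. f x - h x) (u m) = 0"
proof (intro bexI allI)
  have c: "coef f \<in> l2_space gs_index" by (rule coef_l2[OF f])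
  show "synth (coef f) \<in> cspan" by (rule synth_cspan[OF c])
  show "B (\<lambda>x. f x - synth (coef f) x) (u m) = 0" for m
    using f synth[OF c] by (intro B_cspan_zero u_cspan V_diff) (simp_all add: coef_diff coef_synth[OF c])
qed

end
end

text \<open>An induction rule for the closed span: a property that is linear and stable under norm
  limits only has to be checked on generators. It carries invariance and continuity of orbit maps
  from the generators to the whole span.\<close>

lemma cspan_induct:
  assumes u: "\<And>m. u m \<in> V"
    and base: "\<And>m. u m \<in> S"
    and lin: "\<And>f h a b. f \<in> S \<Longrightarrow> h \<in> S \<Longrightarrow> (\<lambda>x. a * f x + b * h x) \<in> S"
    and closed: "\<And>f. f \<in> V \<Longrightarrow> (\<And>\<epsilon>. \<epsilon> > 0 \<Longrightarrow> \<exists>h\<in>S. nrm (\<lambda>x. f x - h x) < \<epsilon>) \<Longrightarrow> f \<in> S"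
    and f: "f \<in> cspan u"
  shows "f \<in> S"
proof -
  have zero: "(\<lambda>x. 0) \<in> S" using lin[OF base base, of 0 0 0 0] by simp
  have sum: "(\<lambda>x. \<Sum>j\<in>A. c j * k j x) \<in> S" if "\<And>j. j \<in> A \<Longrightarrow> k j \<in> S" "finite A" for A :: "nat set" and c k
    using that(2,1)
  proof (induction A)
    case (insert j A)
    then show ?case using lin[of "k j" "\<lambda>x. \<Sum>j\<in>A. c j * k j x" "c j" 1] by simp
  qed (use zero in simp)
  have gsS: "gs u m \<in> S" for m
  proof (induction m rule: less_induct)
    case (less m)
    have 1: "(\<lambda>x. \<Sum>j<m. B (u m) (gs u j) * gs u j x) \<in> S"
      using less by (intro sum) auto
    have 2: "gs_res u m \<in> S"
      using lin[OF base[of m] 1, of 1 "-1"] by (simp add: gs_res_def)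
    show ?case
      unfolding gs_eq[of u m] using lin[OF 2 2, of "of_real (inverse (nrm (gs_res u m)))" 0] by simp
  qed
  have fV: "f \<in> V" using f by (simp add: cspan_def)
  have lim: "(\<lambda>N. nrm (\<lambda>x. psum u N (coef u f) x - f x)) \<longlonglongrightarrow> 0"
    using f by (simp add: cspan_def)
  show ?thesis
  proof (rule closed[OF fV])
    fix \<epsilon> :: real assume "\<epsilon> > 0"
    then obtain N where "norm (nrm (\<lambda>x. psum u N (coef u f) x - f x) - 0) < \<epsilon>"
      using LIMSEQ_D[OF lim] by blast
    moreover have "psum u N (coef u f) \<in> V" by (rule psum_in[of u, OF u])
    ultimately have "nrm (\<lambda>x. f x - psum u N (coef u f) x) < \<epsilon>"
      using fV nrm_minus_commute[of f "psum u N (coef u f)"] by (auto simp: V_diff)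
    moreover have "psum u N (coef u f) \<in> S"
      unfolding psum_def using gsS by (intro sum) auto
    ultimately show "\<exists>h\<in>S. nrm (\<lambda>x. f x - h x) < \<epsilon>" by blast
  qed
qed

lemma coef_cong:
  assumes u: "\<And>m. u m \<in> V" and "f \<in> V" "h \<in> V" "nrm (\<lambda>x. f x - h x) = 0"
  shows "coef u f = coef u h"
proof
  fix j
  have "cmod (B (\<lambda>x. f x - h x) (gs u j)) \<le> 0"
    using cauchy_schwarz[OF V_diff[OF assms(2,3)] gs_in[of u, OF u], of j] assms(4) by simp
  then show "coef u f j = coef u h j"
    using assms gs_in[of u, OF u] by (simp add: coef_def B_diff)
qed

lemma cspan_eq:
  assumes u: "\<And>m. u m \<in> V" and "f \<in> cspan u" "h \<in> cspan u" "coef u f = coef u h"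
  shows "nrm (\<lambda>x. f x - h x) = 0"
proof -
  have V: "f \<in> V" "h \<in> V" using assms by (auto simp: cspan_def)
  have "(\<lambda>x. f x - h x) \<in> cspan u"
    using cspan_lin[of u, OF u assms(2,3), of 1 "-1"] by simp
  from parseval[of u, OF u this] show ?thesis
    using V assms(4) by (simp add: coef_diff[of u, OF u] l2_norm_def)
qed

text \<open>Transfers property (T) to semi-Hilbert spaces of functions. The translates of the
  vectors \<open>w k\<close> by a countable dense set span a separable invariant subspace, on which
  \<open>coef\<close> and \<open>synth\<close> turn \<open>\<rho>\<close> into a unitary
  representation on some \<open>l2_space I\<close>. Continuity is assumed only along the orbits of
  the \<open>w k\<close>, and invariance is obtained up to norm zero.\<close>

lemma kazhdan_invariant_vector:
  fixes G :: "('g, 'm) monoid_scheme" and \<rho> :: "'g \<Rightarrow> ('x \<Rightarrow> complex) \<Rightarrow> 'x \<Rightarrow> complex"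
    and w :: "nat \<Rightarrow> 'x \<Rightarrow> complex"
  assumes T: "kazhdan_T G T" and tg: "topological_group G T" and sc: "second_countable T"
    and \<rho>_in: "\<And>g f. g \<in> carrier G \<Longrightarrow> f \<in> V \<Longrightarrow> \<rho> g f \<in> V"
    and \<rho>_lin: "\<And>g f h a b. g \<in> carrier G \<Longrightarrow> f \<in> V \<Longrightarrow> h \<in> V \<Longrightarrow>
          \<rho> g (\<lambda>x. a * f x + b * h x) = (\<lambda>x. a * \<rho> g f x + b * \<rho> g h x)"
    and \<rho>_nrm: "\<And>g f. g \<in> carrier G \<Longrightarrow> f \<in> V \<Longrightarrow> nrm (\<rho> g f) = nrm f"
    and \<rho>_mult: "\<And>g h f. g \<in> carrier G \<Longrightarrow> h \<in> carrier G \<Longrightarrow> f \<in> V \<Longrightarrow> \<rho> (g \<otimes>\<^bsub>G\<^esub> h) f = \<rho> g (\<rho> h f)"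
    and \<rho>_one: "\<And>f. f \<in> V \<Longrightarrow> \<rho> \<one>\<^bsub>G\<^esub> f = f"
    and w_in: "\<And>k. w k \<in> V" and w_nrm: "\<And>k. nrm (w k) = 1"
    and w_cont: "\<And>k g0 \<epsilon>. g0 \<in> carrier G \<Longrightarrow> \<epsilon> > 0 \<Longrightarrow>
          \<exists>U. openin T U \<and> g0 \<in> U \<and> (\<forall>g\<in>U. nrm (\<lambda>x. \<rho> g (w k) x - \<rho> g0 (w k) x) < \<epsilon>)"
    and w_ai: "\<And>K \<epsilon>. compactin T K \<Longrightarrow> \<epsilon> > 0 \<Longrightarrow> \<exists>k. \<forall>g\<in>K. nrm (\<lambda>x. \<rho> g (w k) x - w k x) < \<epsilon>"
  shows "\<exists>f\<in>V. nrm f \<noteq> 0 \<and> (\<forall>g\<in>carrier G. nrm (\<lambda>x. \<rho> g f x - f x) = 0)"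
proof -
  interpret group G using tg by (simp add: topological_group_def)
  have tsp: "topspace T = carrier G" using tg by (simp add: topological_group_def)
  have \<rho>_diff: "\<rho> g (\<lambda>x. f x - h x) = (\<lambda>x. \<rho> g f x - \<rho> g h x)" if "g \<in> carrier G" "f \<in> V" "h \<in> V" for g f h
    using \<rho>_lin[OF that, of 1 "-1"] by simp
  have \<rho>_dist: "nrm (\<lambda>x. \<rho> g f x - \<rho> g h x) = nrm (\<lambda>x. f x - h x)" if "g \<in> carrier G" "f \<in> V" "h \<in> V" for g f h
    using \<rho>_nrm[OF that(1) V_diff[OF that(2,3)]] that by (simp add: \<rho>_diff)
  obtain D0 where D0: "countable D0" "D0 \<subseteq> topspace T" "T closure_of D0 = topspace T"
    using second_countable_imp_separable_space[OF sc] unfolding separable_space_def by blast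
  define D where "D = insert \<one>\<^bsub>G\<^esub> D0"
  have D: "countable D" "D \<noteq> {}" "D \<subseteq> carrier G" using D0 by (auto simp: D_def tsp)
  define d where "d = from_nat_into D"
  have range_d: "range d = D" unfolding d_def using D by (simp add: range_from_nat_into)
  have d_in: "d i \<in> carrier G" for i using range_d D(3) by auto
  \<comment> \<open>The generators are indexed by pairs of a dense group element and a vector
    \<open>w k\<close>, enumerated through \<open>prod_decode\<close>.\<close>
  define u where "u m = \<rho> (d (fst (prod_decode m))) (w (snd (prod_decode m)))" for m
  have u: "u m \<in> V" for m by (simp add: u_def \<rho>_in d_in w_in)
  have dw: "\<rho> g (w k) \<in> cspan u" if g: "g \<in> D" for g k
  proof -
    obtain i where "g = d i" using g range_d by auto
    then have "\<rho> g (w k) = u (prod_encode (i, k))" by (simp add: u_def)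
    then show ?thesis using u_cspan[of u, OF u] by simp
  qed
  \<comment> \<open>Dense group elements approximate arbitrary ones along the continuous orbit map
    of \<open>w k\<close>; this makes the span invariant under the whole group.\<close>
  have gw: "\<rho> g (w k) \<in> cspan u" if g: "g \<in> carrier G" for g k
  proof (rule cspan_closed[of u, OF u \<rho>_in[OF g w_in]])
    fix \<epsilon> :: real assume "\<epsilon> > 0"
    then obtain U where U: "openin T U" "g \<in> U" "\<And>h. h \<in> U \<Longrightarrow> nrm (\<lambda>x. \<rho> h (w k) x - \<rho> g (w k) x) < \<epsilon>"
      using w_cont[OF g, of \<epsilon> k] by auto
    have "g \<in> T closure_of D0" using D0 g tsp by simp
    then obtain h where h: "h \<in> D0" "h \<in> U" using U by (auto simp: in_closure_of)
    have hc: "h \<in> carrier G" using h D0 tsp by auto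
    have "nrm (\<lambda>x. \<rho> g (w k) x - \<rho> h (w k) x) < \<epsilon>"
      using U(3)[OF h(2)] nrm_minus_commute[OF \<rho>_in[OF g w_in] \<rho>_in[OF hc w_in]] by simp
    moreover have "\<rho> h (w k) \<in> cspan u" using h by (intro dw) (simp add: D_def)
    ultimately show "\<exists>h\<in>cspan u. nrm (\<lambda>x. \<rho> g (w k) x - h x) < \<epsilon>" by blast
  qed
  have inv: "\<rho> g f \<in> cspan u" if g: "g \<in> carrier G" and f: "f \<in> cspan u" for g f
  proof -
    have "f \<in> {f \<in> V. \<rho> g f \<in> cspan u}"
    proof (rule cspan_induct[of u, OF u _ _ _ f])
      show "u m \<in> {f \<in> V. \<rho> g f \<in> cspan u}" for m
        using u[of m] gw[of "g \<otimes>\<^bsub>G\<^esub> d (fst (prod_decode m))"] g d_in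
        by (simp add: u_def \<rho>_mult w_in)
    next
      fix f h a b assume "f \<in> {f \<in> V. \<rho> g f \<in> cspan u}" "h \<in> {f \<in> V. \<rho> g f \<in> cspan u}"
      then show "(\<lambda>x. a * f x + b * h x) \<in> {f \<in> V. \<rho> g f \<in> cspan u}"
        using g by (auto simp: \<rho>_lin V_lin intro!: cspan_lin[of u, OF u])
    next
      fix f assume fV: "f \<in> V" and ap: "\<And>\<epsilon>. \<epsilon> > 0 \<Longrightarrow> \<exists>h\<in>{f \<in> V. \<rho> g f \<in> cspan u}. nrm (\<lambda>x. f x - h x) < \<epsilon>"
      have "\<rho> g f \<in> cspan u"
      proof (rule cspan_closed[of u, OF u \<rho>_in[OF g fV]])
        fix \<epsilon> :: real assume "\<epsilon> > 0"
        from ap[OF this] obtain h where "h \<in> V" "\<rho> g h \<in> cspan u" "nrm (\<lambda>x. f x - h x) < \<epsilon>" by auto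
        then show "\<exists>h\<in>cspan u. nrm (\<lambda>x. \<rho> g f x - h x) < \<epsilon>"
          using \<rho>_dist[OF g fV] by (intro bexI[of _ "\<rho> g h"]) auto
      qed
      then show "f \<in> {f \<in> V. \<rho> g f \<in> cspan u}" using fV by simp
    qed
    then show ?thesis by simp
  qed
  \<comment> \<open>The vectors with continuous orbit map. They form a linear set, closed under norm
    limits because \<open>\<rho>\<close> is isometric, so it is enough that the generators belong to
    it.\<close>
  define S where "S = {f \<in> V. \<forall>g0\<in>carrier G. \<forall>\<epsilon>>0. \<exists>U. openin T U \<and> g0 \<in> U \<and> (\<forall>g\<in>U. nrm (\<lambda>x. \<rho> g f x - \<rho> g0 f x) < \<epsilon>)}"
  have SD: "\<exists>U. openin T U \<and> g0 \<in> U \<and> (\<forall>g\<in>U. nrm (\<lambda>x. \<rho> g f x - \<rho> g0 f x) < \<epsilon>)"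
    if "f \<in> S" "g0 \<in> carrier G" "\<epsilon> > 0" for f g0 \<epsilon>
    using that by (simp add: S_def)
  have cont: "f \<in> S" if f: "f \<in> cspan u" for f
  proof (rule cspan_induct[of u, OF u _ _ _ f])
    fix m
    show "u m \<in> S"
      unfolding S_def
    proof (clarsimp simp: u)
      fix g0 and \<epsilon> :: real assume g0: "g0 \<in> carrier G" and e: "0 < \<epsilon>"
      define h where "h = d (fst (prod_decode m))"
      have h: "h \<in> carrier G" by (simp add: h_def d_in)
      define k where "k = snd (prod_decode m)"
      obtain U where U: "openin T U" "g0 \<otimes>\<^bsub>G\<^esub> h \<in> U"
        "\<And>g. g \<in> U \<Longrightarrow> nrm (\<lambda>x. \<rho> g (w k) x - \<rho> (g0 \<otimes>\<^bsub>G\<^esub> h) (w k) x) < \<epsilon>"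
        using w_cont[of "g0 \<otimes>\<^bsub>G\<^esub> h" \<epsilon> k] g0 h e by auto
      \<comment> \<open>Continuity of the orbit map of the translate of \<open>w k\<close> by
        \<open>h\<close> at \<open>g0\<close> is continuity of the orbit map of \<open>w k\<close>
        at \<open>g0 \<otimes> h\<close>, pulled back along right translation.\<close>
      have "continuous_map T T ((\<lambda>(x, y). x \<otimes>\<^bsub>G\<^esub> y) \<circ> (\<lambda>x. (x, h)))"
        using tg h tsp unfolding topological_group_def
        by (intro continuous_map_compose[where X' = "prod_topology T T"]) (auto intro!: continuous_intros)
      then have cm: "continuous_map T T (\<lambda>x. x \<otimes>\<^bsub>G\<^esub> h)" by (simp add: o_def)
      have "openin T {x \<in> topspace T. x \<otimes>\<^bsub>G\<^esub> h \<in> U}"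
        by (rule openin_continuous_map_preimage[OF cm U(1)])
      moreover have "nrm (\<lambda>x. \<rho> g (u m) x - \<rho> g0 (u m) x) < \<epsilon>" if "g \<in> {x \<in> topspace T. x \<otimes>\<^bsub>G\<^esub> h \<in> U}" for g
        using that U(3)[of "g \<otimes>\<^bsub>G\<^esub> h"] g0 h tsp by (simp add: u_def \<rho>_mult w_in flip: h_def k_def)
      ultimately show "\<exists>U. openin T U \<and> g0 \<in> U \<and> (\<forall>g\<in>U. nrm (\<lambda>x. \<rho> g (u m) x - \<rho> g0 (u m) x) < \<epsilon>)"
        using g0 tsp U(2) by (intro exI[of _ "{x \<in> topspace T. x \<otimes>\<^bsub>G\<^esub> h \<in> U}"]) auto
    qed
  next
    fix f h a b assume f: "f \<in> S" and h: "h \<in> S"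
    then have fV: "f \<in> V" "h \<in> V" by (auto simp: S_def)
    show "(\<lambda>x. a * f x + b * h x) \<in> S"
      unfolding S_def
    proof (clarsimp simp: V_lin fV)
      fix g0 and \<epsilon> :: real assume g0: "g0 \<in> carrier G" and e: "0 < \<epsilon>"
      define \<delta> where "\<delta> = \<epsilon> / (cmod a + cmod b + 1)"
      have sp: "cmod a + cmod b + 1 > 0" by (simp add: add_nonneg_pos)
      have d: "\<delta> > 0" using e sp by (simp add: \<delta>_def)
      obtain U1 where U1: "openin T U1" "g0 \<in> U1" "\<And>g. g \<in> U1 \<Longrightarrow> nrm (\<lambda>x. \<rho> g f x - \<rho> g0 f x) < \<delta>"
        using SD[OF f g0 d] by auto
      obtain U2 where U2: "openin T U2" "g0 \<in> U2" "\<And>g. g \<in> U2 \<Longrightarrow> nrm (\<lambda>x. \<rho> g h x - \<rho> g0 h x) < \<delta>"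
        using SD[OF h g0 d] by auto
      note U = U1 U2
      have "nrm (\<lambda>x. \<rho> g (\<lambda>x. a * f x + b * h x) x - \<rho> g0 (\<lambda>x. a * f x + b * h x) x) < \<epsilon>" if g: "g \<in> U1 \<inter> U2" for g
      proof -
        have gc: "g \<in> carrier G" using g U(1) openin_subset tsp by fastforce
        have m: "\<rho> g f \<in> V" "\<rho> g h \<in> V" "\<rho> g0 f \<in> V" "\<rho> g0 h \<in> V" using gc g0 fV \<rho>_in by auto
        have "(\<lambda>x. \<rho> g (\<lambda>x. a * f x + b * h x) x - \<rho> g0 (\<lambda>x. a * f x + b * h x) x)
          = (\<lambda>x. a * (\<rho> g f x - \<rho> g0 f x) + b * (\<rho> g h x - \<rho> g0 h x))"
          using gc g0 fV by (auto simp: \<rho>_lin algebra_simps)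
        then have "nrm (\<lambda>x. \<rho> g (\<lambda>x. a * f x + b * h x) x - \<rho> g0 (\<lambda>x. a * f x + b * h x) x)
            \<le> cmod a * nrm (\<lambda>x. \<rho> g f x - \<rho> g0 f x) + cmod b * nrm (\<lambda>x. \<rho> g h x - \<rho> g0 h x)"
          using nrm_triangle[OF V_scale[OF V_diff[OF m(1) m(3)], of a] V_scale[OF V_diff[OF m(2) m(4)], of b]]
          by (simp add: nrm_scale V_diff m)
        also have "\<dots> \<le> cmod a * \<delta> + cmod b * \<delta>"
          using U(3)[of g] U(6)[of g] g by (intro add_mono mult_left_mono) auto
        also have "\<dots> < (cmod a + cmod b + 1) * \<delta>" using d by (simp add: algebra_simps)
        also have "\<dots> = \<epsilon>" using sp by (simp add: \<delta>_def)
        finally show ?thesis .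
      qed
      then show "\<exists>U. openin T U \<and> g0 \<in> U \<and> (\<forall>g\<in>U. nrm (\<lambda>x. \<rho> g (\<lambda>x. a * f x + b * h x) x - \<rho> g0 (\<lambda>x. a * f x + b * h x) x) < \<epsilon>)"
        using U by (intro exI[of _ "U1 \<inter> U2"]) auto
    qed
  next
    fix f assume fV: "f \<in> V" and ap: "\<And>\<epsilon>. \<epsilon> > 0 \<Longrightarrow> \<exists>h\<in>S. nrm (\<lambda>x. f x - h x) < \<epsilon>"
    show "f \<in> S"
      unfolding S_def
    proof (clarsimp simp: fV)
      fix g0 and \<epsilon> :: real assume g0: "g0 \<in> carrier G" and e: "0 < \<epsilon>"
      obtain h where h: "h \<in> S" "nrm (\<lambda>x. f x - h x) < \<epsilon> / 3" using ap[of "\<epsilon>/3"] e by auto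
      have hV: "h \<in> V" using h by (simp add: S_def)
      obtain U where U: "openin T U" "g0 \<in> U" "\<And>g. g \<in> U \<Longrightarrow> nrm (\<lambda>x. \<rho> g h x - \<rho> g0 h x) < \<epsilon> / 3"
        using SD[OF h(1) g0, of "\<epsilon>/3"] e by auto
      have "nrm (\<lambda>x. \<rho> g f x - \<rho> g0 f x) < \<epsilon>" if g: "g \<in> U" for g
      proof -
        have gc: "g \<in> carrier G" using g U(1) openin_subset tsp by fastforce
        have m: "\<rho> g f \<in> V" "\<rho> g h \<in> V" "\<rho> g0 f \<in> V" "\<rho> g0 h \<in> V" using gc g0 fV hV \<rho>_in by auto
        have "nrm (\<lambda>x. \<rho> g f x - \<rho> g0 f x) \<le> nrm (\<lambda>x. \<rho> g f x - \<rho> g h x) + nrm (\<lambda>x. \<rho> g h x - \<rho> g0 f x)"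
          by (rule nrm_triangle_diff) (use m in auto)
        also have "nrm (\<lambda>x. \<rho> g h x - \<rho> g0 f x) \<le> nrm (\<lambda>x. \<rho> g h x - \<rho> g0 h x) + nrm (\<lambda>x. \<rho> g0 h x - \<rho> g0 f x)"
          by (rule nrm_triangle_diff) (use m in auto)
        finally show ?thesis
          using U(3)[OF g] h(2) \<rho>_dist[OF gc fV hV] \<rho>_dist[OF g0 hV fV] nrm_minus_commute[OF fV hV] by linarith
      qed
      then show "\<exists>U. openin T U \<and> g0 \<in> U \<and> (\<forall>g\<in>U. nrm (\<lambda>x. \<rho> g f x - \<rho> g0 f x) < \<epsilon>)"
        using U by blast
    qed
  qed
  define I where "I = gs_index u"
  define \<pi> where "\<pi> g c = coef u (\<rho> g (synth u c))" for g c
  have sy: "synth u c \<in> V" "synth u c \<in> cspan u" "coef u (synth u c) = c" "nrm (synth u c) = l2_norm c"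
    if "c \<in> l2_space I" for c
    using that synth(1)[of u, OF u] synth_cspan[of u, OF u] coef_synth[of u, OF u] nrm_synth[of u, OF u] by (auto simp: I_def)
  have \<pi>_in: "\<pi> g c \<in> l2_space I" if "g \<in> carrier G" "c \<in> l2_space I" for g c
    unfolding \<pi>_def I_def using that sy by (intro coef_l2[of u, OF u] \<rho>_in)
  have l2_lin: "(\<lambda>n. a * c n + b * e n) \<in> l2_space I" if "c \<in> l2_space I" "e \<in> l2_space I" for a b c e
    using coef_l2[of u, OF u V_lin[OF sy(1)[OF that(1)] sy(1)[OF that(2)]], of a b] that
    by (simp add: coef_lin[of u, OF u] sy I_def[symmetric])
  \<comment> \<open>\<open>synth\<close> respects linear combinations only up to a null vector, but
    \<open>\<rho> g\<close> preserves norm zero and \<open>coef\<close> does not see null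
    vectors.\<close>
  have \<pi>_lin: "\<pi> g (\<lambda>n. a * c n + b * e n) = (\<lambda>n. a * \<pi> g c n + b * \<pi> g e n)"
    if g: "g \<in> carrier G" and c: "c \<in> l2_space I" and e: "e \<in> l2_space I" for g a b c e
  proof -
    let ?s = "\<lambda>x. a * synth u c x + b * synth u e x"
    have s: "?s \<in> V" "?s \<in> cspan u" using sy[OF c] sy[OF e] by (auto intro: V_lin cspan_lin[of u, OF u])
    have l: "(\<lambda>n. a * c n + b * e n) \<in> l2_space I" by (rule l2_lin[OF c e])
    have "coef u ?s = (\<lambda>n. a * c n + b * e n)" using sy[OF c] sy[OF e] by (simp add: coef_lin[of u, OF u])
    then have "nrm (\<lambda>x. synth u (\<lambda>n. a * c n + b * e n) x - ?s x) = 0"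
      using sy[OF l] s by (intro cspan_eq[of u, OF u]) auto
    then have "nrm (\<lambda>x. \<rho> g (synth u (\<lambda>n. a * c n + b * e n)) x - \<rho> g ?s x) = 0"
      using \<rho>_dist[OF g sy(1)[OF l] s(1)] by simp
    then have "\<pi> g (\<lambda>n. a * c n + b * e n) = coef u (\<rho> g ?s)"
      unfolding \<pi>_def using g sy[OF l] s by (intro coef_cong[of u, OF u] \<rho>_in)
    also have "\<dots> = (\<lambda>n. a * \<pi> g c n + b * \<pi> g e n)"
      using g sy(1)[OF c] sy(1)[OF e] by (simp add: \<rho>_lin coef_lin[of u, OF u] \<rho>_in \<pi>_def)
    finally show ?thesis .
  qed
  have \<pi>_norm: "l2_norm (\<pi> g c) = l2_norm c" if "g \<in> carrier G" "c \<in> l2_space I" for g c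
    unfolding \<pi>_def using that sy[OF that(2)] by (simp add: parseval[of u, OF u] inv \<rho>_nrm)
  have \<pi>_coef: "\<pi> g (coef u f) = coef u (\<rho> g f)" if g: "g \<in> carrier G" and f: "f \<in> cspan u" for g f
  proof -
    have fV: "f \<in> V" using f by (simp add: cspan_def)
    have c: "coef u f \<in> l2_space I" unfolding I_def by (rule coef_l2[of u, OF u fV])
    have "nrm (\<lambda>x. \<rho> g (synth u (coef u f)) x - \<rho> g f x) = 0"
      using \<rho>_dist[OF g sy(1)[OF c] fV] synth_coef[of u, OF u f] by simp
    then show ?thesis
      unfolding \<pi>_def using g sy[OF c] fV by (intro coef_cong[of u, OF u] \<rho>_in)
  qed
  have \<pi>_mult: "\<pi> (g \<otimes>\<^bsub>G\<^esub> h) c = \<pi> g (\<pi> h c)" if "g \<in> carrier G" "h \<in> carrier G" "c \<in> l2_space I" for g h c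
    using \<pi>_coef[OF that(1) inv[OF that(2) sy(2)[OF that(3)]]] that sy(1)[OF that(3)]
    by (simp add: \<pi>_def \<rho>_mult)
  have \<pi>_one: "\<pi> \<one>\<^bsub>G\<^esub> c = c" if "c \<in> l2_space I" for c
    using sy[OF that] by (simp add: \<pi>_def \<rho>_one)
  have "unitary_rep G T I \<pi>"
    unfolding unitary_rep_def unitary_on_def
  proof (intro conjI ballI allI impI)
    fix g assume g: "g \<in> carrier G"
    show "bij_betw (\<pi> g) (l2_space I) (l2_space I)"
    proof (rule bij_betw_byWitness[where f' = "\<pi> (inv\<^bsub>G\<^esub> g)"])
      show "\<forall>c\<in>l2_space I. \<pi> (inv\<^bsub>G\<^esub> g) (\<pi> g c) = c"
        using g by (auto simp: \<pi>_mult[symmetric] \<pi>_one)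
      show "\<forall>c\<in>l2_space I. \<pi> g (\<pi> (inv\<^bsub>G\<^esub> g) c) = c"
        using g by (auto simp: \<pi>_mult[symmetric] \<pi>_one)
    qed (use g \<pi>_in in auto)
  next
    fix c g0 and \<epsilon> :: real assume c: "c \<in> l2_space I" and g0: "g0 \<in> carrier G" and e: "0 < \<epsilon>"
    obtain U where U: "openin T U" "g0 \<in> U" "\<And>g. g \<in> U \<Longrightarrow> nrm (\<lambda>x. \<rho> g (synth u c) x - \<rho> g0 (synth u c) x) < \<epsilon>"
      using SD[OF cont[OF sy(2)[OF c]] g0 e] by auto
    have "l2_norm (\<lambda>n. \<pi> g c n - \<pi> g0 c n) < \<epsilon>" if g: "g \<in> U" for g
    proof -
      have gc: "g \<in> carrier G" using g U(1) openin_subset tsp by fastforce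
      have m: "\<rho> g (synth u c) \<in> V" "\<rho> g0 (synth u c) \<in> V" using gc g0 sy[OF c] \<rho>_in by auto
      then have "(\<lambda>n. \<pi> g c n - \<pi> g0 c n) = coef u (\<lambda>x. \<rho> g (synth u c) x - \<rho> g0 (synth u c) x)"
        by (simp add: \<pi>_def coef_diff[of u, OF u])
      then show ?thesis
        using coef_norm_le[of u, OF u V_diff[OF m]] U(3)[OF g] by simp
    qed
    then show "\<exists>U. openin T U \<and> g0 \<in> U \<and> (\<forall>g\<in>U. l2_norm (\<lambda>n. \<pi> g c n - \<pi> g0 c n) < \<epsilon>)"
      using U by blast
  qed (auto simp: \<pi>_lin \<pi>_norm \<pi>_mult \<pi>_one)
  moreover have "has_almost_invariant_vectors G T I \<pi>"
    unfolding has_almost_invariant_vectors_def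
  proof (intro allI impI)
    fix K and \<epsilon> :: real assume K: "compactin T K \<and> 0 < \<epsilon>"
    then obtain k where k: "\<And>g. g \<in> K \<Longrightarrow> nrm (\<lambda>x. \<rho> g (w k) x - w k x) < \<epsilon>" using w_ai[of K \<epsilon>] by auto
    have wk: "w k \<in> cspan u" using gw[of "\<one>\<^bsub>G\<^esub>" k] by (simp add: \<rho>_one w_in)
    have "l2_norm (coef u (w k)) = 1" using parseval[of u, OF u wk] w_nrm by simp
    moreover have "l2_norm (\<lambda>n. \<pi> g (coef u (w k)) n - coef u (w k) n) < \<epsilon>" if g: "g \<in> K" for g
    proof -
      have gc: "g \<in> carrier G" using g K compactin_subset_topspace tsp by fastforce
      have "(\<lambda>n. \<pi> g (coef u (w k)) n - coef u (w k) n) = coef u (\<lambda>x. \<rho> g (w k) x - w k x)"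
        using gc w_in by (simp add: \<pi>_coef wk coef_diff[of u, OF u] \<rho>_in)
      then show ?thesis
        using order_le_less_trans[OF coef_norm_le[of u, OF u V_diff[OF \<rho>_in[OF gc w_in[of k]] w_in[of k]]] k[OF g]] by simp
    qed
    ultimately show "\<exists>f\<in>l2_space I. l2_norm f = 1 \<and> (\<forall>g\<in>K. l2_norm (\<lambda>n. \<pi> g f n - f n) < \<epsilon>)"
      using coef_l2[of u, OF u w_in[of k]] unfolding I_def by (intro bexI[of _ "coef u (w k)"]) auto
  qed
  ultimately have "has_nonzero_invariant_vector G I \<pi>"
    using T unfolding kazhdan_T_def by blast
  then obtain c where c: "c \<in> l2_space I" "c \<noteq> (\<lambda>n. 0)" "\<And>g. g \<in> carrier G \<Longrightarrow> \<pi> g c = c"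
    unfolding has_nonzero_invariant_vector_def by blast
  have "nrm (synth u c) \<noteq> 0"
  proof
    assume "nrm (synth u c) = 0"
    then have "coef u (synth u c) = coef u (\<lambda>x. 0)"
      using sy[OF c(1)] by (intro coef_cong[of u, OF u] V_zero) auto
    then show False using c sy[OF c(1)] gs_in[of u, OF u] by (auto simp: coef_def B_zero)
  qed
  moreover have "nrm (\<lambda>x. \<rho> g (synth u c) x - synth u c x) = 0" if g: "g \<in> carrier G" for g
    using c(3)[OF g] sy[OF c(1)] g by (intro cspan_eq[of u, OF u] inv) (auto simp: \<pi>_def)
  ultimately show ?thesis using sy(1)[OF c(1)] by blast
qed

end

section \<open>Square-integrable functions and completeness\<close>

definition sq_int :: "'x measure \<Rightarrow> ('x \<Rightarrow> complex) \<Rightarrow> bool" where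
  "sq_int N f \<longleftrightarrow> f \<in> borel_measurable N \<and> integrable N (\<lambda>x. (cmod (f x))\<^sup>2)"

definition ip :: "'x measure \<Rightarrow> ('x \<Rightarrow> complex) \<Rightarrow> ('x \<Rightarrow> complex) \<Rightarrow> complex" where
  "ip N f h = (\<integral>x. f x * cnj (h x) \<partial>N)"

lemma sq_intI_nn:
  assumes [measurable]: "f \<in> borel_measurable N" and "(\<integral>\<^sup>+x. ennreal ((cmod (f x))\<^sup>2) \<partial>N) < \<infinity>"
  shows "sq_int N f"
  unfolding sq_int_def using assms by (auto intro!: integrableI_bounded)

lemma sq_int_nn:
  assumes "sq_int N f"
  shows "(\<integral>\<^sup>+x. ennreal ((cmod (f x))\<^sup>2) \<partial>N) = ennreal (\<integral>x. (cmod (f x))\<^sup>2 \<partial>N)"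
  using assms by (intro nn_integral_eq_integral) (auto simp: sq_int_def)

lemma cmod_mult_le_sq: "cmod (a * cnj b) \<le> (cmod a)\<^sup>2 + (cmod b)\<^sup>2"
proof -
  have "0 \<le> (cmod a - cmod b)\<^sup>2" by simp
  then have "2 * (cmod a * cmod b) \<le> (cmod a)\<^sup>2 + (cmod b)\<^sup>2" by (simp add: power2_diff)
  moreover have "0 \<le> cmod a * cmod b" by simp
  ultimately have "cmod a * cmod b \<le> (cmod a)\<^sup>2 + (cmod b)\<^sup>2" by linarith
  then show ?thesis by (simp add: norm_mult)
qed

lemma cmod_lincomb_sq_le: "(cmod (a * x + b * y))\<^sup>2 \<le> 2 * (cmod a)\<^sup>2 * (cmod x)\<^sup>2 + 2 * (cmod b)\<^sup>2 * (cmod y)\<^sup>2"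
proof -
  have "cmod (a * x + b * y) \<le> cmod (a * x) + cmod (b * y)"
    by (rule norm_triangle_ineq)
  then have "(cmod (a * x + b * y))\<^sup>2 \<le> (cmod (a * x) + cmod (b * y))\<^sup>2"
    by (rule power_mono) simp
  moreover have "0 \<le> (cmod (a * x) - cmod (b * y))\<^sup>2" by simp
  ultimately show ?thesis
    by (simp add: norm_mult power2_diff power2_sum power_mult_distrib)
qed

lemma cnj_borel_measurable:
  assumes "f \<in> borel_measurable M"
  shows "(\<lambda>x. cnj (f x)) \<in> borel_measurable M"
  by (rule borel_measurable_continuous_on[OF _ assms]) (intro continuous_intros)

lemma sq_int_ip_integrable:
  assumes "sq_int N f" "sq_int N h"
  shows "integrable N (\<lambda>x. f x * cnj (h x))"
proof (rule Bochner_Integration.integrable_bound)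
  show "integrable N (\<lambda>x. (cmod (f x))\<^sup>2 + (cmod (h x))\<^sup>2)"
    using assms by (auto simp: sq_int_def)
  show "(\<lambda>x. f x * cnj (h x)) \<in> borel_measurable N"
    using assms cnj_borel_measurable by (auto simp: sq_int_def intro!: borel_measurable_times)
  show "AE x in N. norm (f x * cnj (h x)) \<le> norm ((cmod (f x))\<^sup>2 + (cmod (h x))\<^sup>2)"
    using cmod_mult_le_sq by auto
qed

lemma sq_int_lincomb:
  assumes "sq_int N f" "sq_int N h"
  shows "sq_int N (\<lambda>x. a * f x + b * h x)"
  unfolding sq_int_def
proof
  show 1: "(\<lambda>x. a * f x + b * h x) \<in> borel_measurable N"
    using assms by (auto simp: sq_int_def)
  show "integrable N (\<lambda>x. (cmod (a * f x + b * h x))\<^sup>2)"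
  proof (rule Bochner_Integration.integrable_bound)
    show "integrable N (\<lambda>x. 2 * (cmod a)\<^sup>2 * (cmod (f x))\<^sup>2 + 2 * (cmod b)\<^sup>2 * (cmod (h x))\<^sup>2)"
      using assms by (auto simp: sq_int_def)
    show "AE x in N. norm ((cmod (a * f x + b * h x))\<^sup>2) \<le> norm (2 * (cmod a)\<^sup>2 * (cmod (f x))\<^sup>2 + 2 * (cmod b)\<^sup>2 * (cmod (h x))\<^sup>2)"
      using cmod_lincomb_sq_le by auto
  qed (use 1 in measurable)
qed

lemma sq_int_diff: "sq_int N f \<Longrightarrow> sq_int N h \<Longrightarrow> sq_int N (\<lambda>x. f x - h x)"
  using sq_int_lincomb[of N f h 1 "-1"] by simp

lemma ip_self: "sq_int N f \<Longrightarrow> ip N f f = of_real (\<integral>x. (cmod (f x))\<^sup>2 \<partial>N)"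
  unfolding ip_def complex_norm_square[symmetric] by (rule integral_complex_of_real)

text \<open>More than completeness: the almost everywhere convergent subsequence is exported, and
  every measurable function to which it converges is a mean square limit of the whole sequence. This
  leaves the freedom to choose a representative of the limit with exact equivariance.\<close>

lemma riesz_fischer:
  fixes F :: "nat \<Rightarrow> 'x \<Rightarrow> complex"
  assumes F: "\<And>k. sq_int N (F k)"
    and cauchy: "\<And>\<epsilon>. \<epsilon> > 0 \<Longrightarrow> \<exists>K. \<forall>k\<ge>K. \<forall>l\<ge>K. (\<integral>x. (cmod (F k x - F l x))\<^sup>2 \<partial>N) < \<epsilon>"
  obtains r :: "nat \<Rightarrow> nat" where
    "strict_mono r" "AE x in N. convergent (\<lambda>i. F (r i) x)"
    "\<And>f. f \<in> borel_measurable N \<Longrightarrow> AE x in N. (\<lambda>i. F (r i) x) \<longlonglongrightarrow> f x \<Longrightarrow>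
       sq_int N f \<and> (\<lambda>k. \<integral>x. (cmod (F k x - f x))\<^sup>2 \<partial>N) \<longlonglongrightarrow> 0"
proof -
  have meas [measurable]: "F k \<in> borel_measurable N" for k
    using F by (simp add: sq_int_def)
  \<comment> \<open>Squared distances below \<open>(1/4) ^ i\<close> leave room for the weight
    \<open>2 ^ i\<close>: the weighted integrals are still bounded by
    \<open>(1/2) ^ i\<close>.\<close>
  obtain K where K: "\<And>i k l. k \<ge> K i \<Longrightarrow> l \<ge> K i \<Longrightarrow> (\<integral>x. (cmod (F k x - F l x))\<^sup>2 \<partial>N) < (1/4) ^ i"
  proof -
    have "\<forall>i. \<exists>K. \<forall>k\<ge>K. \<forall>l\<ge>K. (\<integral>x. (cmod (F k x - F l x))\<^sup>2 \<partial>N) < (1/4) ^ i"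
      using cauchy by simp
    then show ?thesis using that by metis
  qed
  define r where "r = rec_nat (K 0) (\<lambda>i m. max (Suc m) (K (Suc i)))"
  have r_Suc: "r (Suc i) = max (Suc (r i)) (K (Suc i))" for i by (simp add: r_def)
  have rK: "r i \<ge> K i" for i by (cases i) (auto simp: r_def)
  have sm: "strict_mono r" by (rule strict_monoI_Suc) (simp add: r_Suc)
  define d where "d i x = F (r (Suc i)) x - F (r i) x" for i x
  have d_meas [measurable]: "d i \<in> borel_measurable N" for i unfolding d_def by measurable
  have sd: "sq_int N (d i)" for i unfolding d_def by (intro sq_int_diff F)
  have dn: "(\<integral>\<^sup>+x. ennreal (2 ^ i * (cmod (d i x))\<^sup>2) \<partial>N) \<le> ennreal ((1/2) ^ i)" for i
  proof -
    have "(\<integral>x. (cmod (d i x))\<^sup>2 \<partial>N) \<le> (1/4) ^ i"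
      unfolding d_def using K[of i "r (Suc i)" "r i"] rK[of i] sm by (simp add: r_Suc less_imp_le)
    then have le: "2 ^ i * (\<integral>x. (cmod (d i x))\<^sup>2 \<partial>N) \<le> 2 ^ i * (1/4) ^ i"
      by (intro mult_left_mono) auto
    have "(\<integral>\<^sup>+x. ennreal (2 ^ i * (cmod (d i x))\<^sup>2) \<partial>N) = ennreal (2 ^ i) * (\<integral>\<^sup>+x. ennreal ((cmod (d i x))\<^sup>2) \<partial>N)"
      by (subst nn_integral_cmult[symmetric]) (auto simp: ennreal_mult)
    also have "\<dots> = ennreal (2 ^ i * (\<integral>x. (cmod (d i x))\<^sup>2 \<partial>N))"
      unfolding sq_int_nn[OF sd] by (simp add: ennreal_mult)
    also have "\<dots> \<le> ennreal (2 ^ i * (1/4) ^ i)"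
      using le by (rule ennreal_leI)
    also have "(2::real) ^ i * (1/4) ^ i = (1/2) ^ i"
      by (simp add: power_mult_distrib[symmetric])
    finally show ?thesis .
  qed
  have "(\<integral>\<^sup>+x. (\<Sum>i. ennreal (2 ^ i * (cmod (d i x))\<^sup>2)) \<partial>N) = (\<Sum>i. \<integral>\<^sup>+x. ennreal (2 ^ i * (cmod (d i x))\<^sup>2) \<partial>N)"
    by (intro nn_integral_suminf) measurable
  also have "\<dots> \<le> (\<Sum>i. ennreal ((1/2) ^ i))"
    by (intro suminf_le dn) auto
  also have "\<dots> < \<infinity>"
    by (simp add: suminf_ennreal2 summable_geometric ennreal_less_top)
  finally have "(\<integral>\<^sup>+x. (\<Sum>i. ennreal (2 ^ i * (cmod (d i x))\<^sup>2)) \<partial>N) \<noteq> \<infinity>" by simp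
  then have "AE x in N. (\<Sum>i. ennreal (2 ^ i * (cmod (d i x))\<^sup>2)) \<noteq> \<infinity>"
    by (intro nn_integral_noteq_infinite) measurable
  then have conv: "AE x in N. convergent (\<lambda>i. F (r i) x)"
  proof eventually_elim
    case (elim x)
    have s1: "summable (\<lambda>i. 2 ^ i * (cmod (d i x))\<^sup>2)"
      by (rule summable_suminf_not_top) (use elim in auto)
    have s2: "summable (\<lambda>i. (1/2 :: real) ^ i)" by (simp add: summable_geometric)
    have "summable (\<lambda>i. d i x)"
    proof (rule summable_comparison_test')
      show "summable (\<lambda>i. 2 ^ i * (cmod (d i x))\<^sup>2 + (1/2) ^ i)" by (rule summable_add[OF s1 s2])
      \<comment> \<open>Expanding the square of \<open>?c - (1/2) ^ i\<close> with weight
        \<open>2 ^ i\<close> gives this; it turns summability of the weighted squares into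
        summability of the increments.\<close>
      show "norm (d i x) \<le> 2 ^ i * (cmod (d i x))\<^sup>2 + (1/2) ^ i" if "i \<ge> 0" for i
      proof -
        let ?c = "cmod (d i x)"
        have "0 \<le> 2 ^ i * (?c - (1/2) ^ i)\<^sup>2" by simp
        also have "\<dots> = 2 ^ i * ?c\<^sup>2 + (2 ^ i * (1/2) ^ i) * (1/2) ^ i - 2 * ?c * (2 ^ i * (1/2) ^ i)"
          by (simp add: power2_eq_square algebra_simps)
        also have "(2::real) ^ i * (1/2) ^ i = 1" by (simp add: power_mult_distrib[symmetric])
        finally show ?thesis using norm_ge_zero[of "d i x"] by (smt (verit) mult_cancel_right1)
      qed
    qed
    then have "convergent (\<lambda>n. F (r 0) x + (\<Sum>i<n. d i x))"
      by (intro convergent_add convergent_const) (simp add: summable_iff_convergent)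
    moreover have "F (r 0) x + (\<Sum>i<n. d i x) = F (r n) x" for n
      by (induction n) (simp_all add: d_def algebra_simps)
    ultimately show ?case by simp
  qed
  have lim: "sq_int N f \<and> (\<lambda>k. \<integral>x. (cmod (F k x - f x))\<^sup>2 \<partial>N) \<longlonglongrightarrow> 0"
    if [measurable]: "f \<in> borel_measurable N" and ae: "AE x in N. (\<lambda>i. F (r i) x) \<longlonglongrightarrow> f x" for f
  proof -
    \<comment> \<open>Fatou's lemma along the subsequence bounds the distance from
      \<open>F k\<close> to the limit by the Cauchy bound.\<close>
    have bound: "\<exists>M. \<forall>k\<ge>M. (\<integral>\<^sup>+x. ennreal ((cmod (F k x - f x))\<^sup>2) \<partial>N) \<le> ennreal \<epsilon>" if e: "\<epsilon> > 0" for \<epsilon>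
    proof -
      obtain M where M: "\<And>k l. k \<ge> M \<Longrightarrow> l \<ge> M \<Longrightarrow> (\<integral>x. (cmod (F k x - F l x))\<^sup>2 \<partial>N) < \<epsilon>"
        using cauchy[OF e] by auto
      have "(\<integral>\<^sup>+x. ennreal ((cmod (F k x - f x))\<^sup>2) \<partial>N) \<le> ennreal \<epsilon>" if k: "k \<ge> M" for k
      proof -
        have "(\<integral>\<^sup>+x. ennreal ((cmod (F k x - f x))\<^sup>2) \<partial>N)
            = (\<integral>\<^sup>+x. liminf (\<lambda>i. ennreal ((cmod (F k x - F (r i) x))\<^sup>2)) \<partial>N)"
        proof (rule nn_integral_cong_AE)
          show "AE x in N. ennreal ((cmod (F k x - f x))\<^sup>2) = liminf (\<lambda>i. ennreal ((cmod (F k x - F (r i) x))\<^sup>2))"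
            using ae
          proof eventually_elim
            case (elim x)
            have "(\<lambda>i. ennreal ((cmod (F k x - F (r i) x))\<^sup>2)) \<longlonglongrightarrow> ennreal ((cmod (F k x - f x))\<^sup>2)"
              by (intro tendsto_ennrealI tendsto_power tendsto_norm tendsto_diff tendsto_const elim)
            from lim_imp_Liminf[OF sequentially_bot this] show ?case by simp
          qed
        qed
        also have "\<dots> \<le> liminf (\<lambda>i. \<integral>\<^sup>+x. ennreal ((cmod (F k x - F (r i) x))\<^sup>2) \<partial>N)"
          by (intro nn_integral_liminf) measurable
        also have "\<dots> \<le> ennreal \<epsilon>"
        proof (rule order_trans[OF Liminf_mono[of _ "\<lambda>_. ennreal \<epsilon>"]])
          show "\<forall>\<^sub>F i in sequentially. (\<integral>\<^sup>+x. ennreal ((cmod (F k x - F (r i) x))\<^sup>2) \<partial>N) \<le> ennreal \<epsilon>"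
          proof (rule eventually_sequentiallyI[of M])
            fix i assume "M \<le> i"
            then have "M \<le> r i" using strict_mono_imp_increasing[OF sm, of i] by linarith
            then show "(\<integral>\<^sup>+x. ennreal ((cmod (F k x - F (r i) x))\<^sup>2) \<partial>N) \<le> ennreal \<epsilon>"
              unfolding sq_int_nn[OF sq_int_diff[OF F F]] using M[OF k] by (intro ennreal_leI) (simp add: less_imp_le)
          qed
          show "liminf (\<lambda>_::nat. ennreal \<epsilon>) \<le> ennreal \<epsilon>" by (simp add: Liminf_const)
        qed
        finally show ?thesis .
      qed
      then show ?thesis by blast
    qed
    obtain M where M': "\<And>k. k \<ge> M \<Longrightarrow> (\<integral>\<^sup>+x. ennreal ((cmod (F k x - f x))\<^sup>2) \<partial>N) \<le> ennreal 1"
      using bound[of 1] by auto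
    have M: "sq_int N (\<lambda>x. F k x - f x)" if "k \<ge> M" for k
      using order_le_less_trans[OF M'[OF that]] by (intro sq_intI_nn) auto
    have "sq_int N (\<lambda>x. F M x - (F M x - f x))" by (rule sq_int_diff[OF F M]) simp
    then have sf: "sq_int N f" by simp
    have "(\<lambda>k. \<integral>x. (cmod (F k x - f x))\<^sup>2 \<partial>N) \<longlonglongrightarrow> 0"
    proof (rule LIMSEQ_I)
      fix \<epsilon> :: real assume e: "\<epsilon> > 0"
      then obtain M where M: "\<And>k. k \<ge> M \<Longrightarrow> (\<integral>\<^sup>+x. ennreal ((cmod (F k x - f x))\<^sup>2) \<partial>N) \<le> ennreal (\<epsilon>/2)"
        using bound[of "\<epsilon>/2"] by auto
      have "norm ((\<integral>x. (cmod (F k x - f x))\<^sup>2 \<partial>N) - 0) < \<epsilon>" if "k \<ge> M" for k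
      proof -
        have "(\<integral>x. (cmod (F k x - f x))\<^sup>2 \<partial>N) \<le> \<epsilon>/2"
          using M[OF that] e unfolding sq_int_nn[OF sq_int_diff[OF F sf]] by simp
        moreover have "0 \<le> (\<integral>x. (cmod (F k x - f x))\<^sup>2 \<partial>N)" by simp
        ultimately show ?thesis using e by simp
      qed
      then show "\<exists>M. \<forall>k\<ge>M. norm ((\<integral>x. (cmod (F k x - f x))\<^sup>2 \<partial>N) - 0) < \<epsilon>" by blast
    qed
    with sf show ?thesis by blast
  qed
  show thesis by (rule that[OF sm conv lim])
qed

text \<open>The last hypothesis asks \<open>W\<close> to contain an almost everywhere limit of each
  of its almost everywhere convergent sequences; together with \<open>riesz_fischer\<close> this is
  completeness. It serves both for square-summable sequences and for equivariant functions.\<close>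

lemma semi_hilbert_L2:
  assumes meas: "\<And>f. f \<in> W \<Longrightarrow> f \<in> borel_measurable N"
    and zero: "(\<lambda>x. 0) \<in> W"
    and lin: "\<And>f h a b. f \<in> W \<Longrightarrow> h \<in> W \<Longrightarrow> (\<lambda>x. a * f x + b * h x) \<in> W"
    and closed: "\<And>F. (\<And>i::nat. F i \<in> W) \<Longrightarrow> AE x in N. convergent (\<lambda>i. F i x) \<Longrightarrow>
          \<exists>f\<in>W. AE x in N. (\<lambda>i. F i x) \<longlonglongrightarrow> f x"
  shows "semi_hilbert {f \<in> W. sq_int N f} (ip N)"
proof
  show "(\<lambda>x. 0) \<in> {f \<in> W. sq_int N f}" using zero by (simp add: sq_int_def)
  show "(\<lambda>x. a * f x + b * h x) \<in> {f \<in> W. sq_int N f}"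
    if "f \<in> {f \<in> W. sq_int N f}" "h \<in> {f \<in> W. sq_int N f}" for f h a b
    using that lin sq_int_lincomb by auto
  show "ip N (\<lambda>x. a * f x + b * h x) k = a * ip N f k + b * ip N h k"
    if "f \<in> {f \<in> W. sq_int N f}" "h \<in> {f \<in> W. sq_int N f}" "k \<in> {f \<in> W. sq_int N f}" for f h k a b
  proof -
    have i: "integrable N (\<lambda>x. f x * cnj (k x))" "integrable N (\<lambda>x. h x * cnj (k x))"
      using that sq_int_ip_integrable by auto
    have "ip N (\<lambda>x. a * f x + b * h x) k = (\<integral>x. a * (f x * cnj (k x)) + b * (h x * cnj (k x)) \<partial>N)"
      unfolding ip_def by (simp add: algebra_simps)
    also have "\<dots> = a * ip N f k + b * ip N h k"
      unfolding ip_def using i by (subst Bochner_Integration.integral_add) auto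
    finally show ?thesis .
  qed
  show "ip N h f = cnj (ip N f h)" if "f \<in> {f \<in> W. sq_int N f}" "h \<in> {f \<in> W. sq_int N f}" for f h
    using Bochner_Integration.integral_cnj[of N "\<lambda>x. f x * cnj (h x)"] unfolding ip_def by (simp add: mult.commute)
  show "0 \<le> Re (ip N f f)" if "f \<in> {f \<in> W. sq_int N f}" for f
    using that by (simp add: ip_self)
  fix F :: "nat \<Rightarrow> 'a \<Rightarrow> complex"
  assume F: "\<And>k. F k \<in> {f \<in> W. sq_int N f}"
    and c: "\<And>\<epsilon>. \<epsilon> > 0 \<Longrightarrow> \<exists>K. \<forall>k\<ge>K. \<forall>l\<ge>K. Re (ip N (\<lambda>x. F k x - F l x) (\<lambda>x. F k x - F l x)) < \<epsilon>"
  have sF: "sq_int N (F k)" for k using F by simp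
  have c': "\<exists>K. \<forall>k\<ge>K. \<forall>l\<ge>K. (\<integral>x. (cmod (F k x - F l x))\<^sup>2 \<partial>N) < \<epsilon>" if "\<epsilon> > 0" for \<epsilon>
    using c[OF that] by (simp add: ip_self sq_int_diff sF)
  obtain r :: "nat \<Rightarrow> nat" where r: "strict_mono r" "AE x in N. convergent (\<lambda>i. F (r i) x)"
    "\<And>f. f \<in> borel_measurable N \<Longrightarrow> AE x in N. (\<lambda>i. F (r i) x) \<longlonglongrightarrow> f x \<Longrightarrow>
       sq_int N f \<and> (\<lambda>k. \<integral>x. (cmod (F k x - f x))\<^sup>2 \<partial>N) \<longlonglongrightarrow> 0"
    by (rule riesz_fischer[OF sF c']) (assumption | rule that)+
  obtain f where f: "f \<in> W" "AE x in N. (\<lambda>i. F (r i) x) \<longlonglongrightarrow> f x"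
    using closed[OF _ r(2)] F by auto
  have "sq_int N f" and "(\<lambda>k. \<integral>x. (cmod (F k x - f x))\<^sup>2 \<partial>N) \<longlonglongrightarrow> 0"
    using r(3)[OF meas[OF f(1)] f(2)] by auto
  then show "\<exists>f\<in>{f \<in> W. sq_int N f}. (\<lambda>k. Re (ip N (\<lambda>x. F k x - f x) (\<lambda>x. F k x - f x))) \<longlonglongrightarrow> 0"
    using f(1) by (intro bexI[of _ f]) (auto simp: ip_self sq_int_diff sF)
qed

lemma l2_space_UNIV: "l2_space UNIV = {f \<in> UNIV. sq_int (count_space UNIV) f}"
  by (auto simp: l2_space_def sq_int_def integrable_count_space_nat_iff)

lemma semi_hilbert_l2: "semi_hilbert (l2_space UNIV) (ip (count_space UNIV))"
  unfolding l2_space_UNIV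
proof (rule semi_hilbert_L2)
  fix F :: "nat \<Rightarrow> nat \<Rightarrow> complex" assume "AE x in count_space UNIV. convergent (\<lambda>i. F i x)"
  then show "\<exists>f\<in>UNIV. AE x in count_space UNIV. (\<lambda>i. F i x) \<longlonglongrightarrow> f x"
    by (intro bexI[of _ "\<lambda>x. lim (\<lambda>i. F i x)"]) (auto simp: AE_count_space convergent_LIMSEQ_iff)
qed auto

lemma nrm_l2:
  assumes "f \<in> l2_space UNIV"
  shows "semi_hilbert.nrm (ip (count_space UNIV)) f = l2_norm f"
proof -
  have "sq_int (count_space UNIV) f" using assms by (simp add: l2_space_UNIV)
  then show ?thesis
    by (simp add: semi_hilbert.nrm_def[OF semi_hilbert_l2] ip_self l2_norm_def sq_int_def integral_count_space_nat)
qed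

section \<open>Topological groups and Haar measures\<close>

definition borel_of :: "'a topology \<Rightarrow> 'a measure" where
  "borel_of T = sigma (topspace T) {U. openin T U}"

lemma borel_of_opens_Pow: "{U. openin T U} \<subseteq> Pow (topspace T)"
  using openin_subset by blast

lemma space_borel_of [simp]: "space (borel_of T) = topspace T"
  by (simp add: borel_of_def space_measure_of_conv)

lemma sets_borel_of: "sets (borel_of T) = borel_sets_of T"
  unfolding borel_of_def borel_sets_of_def by (rule sets_measure_of[OF borel_of_opens_Pow])

lemma openin_sets_borel_of: "openin T U \<Longrightarrow> U \<in> sets (borel_of T)"
  by (simp add: sets_borel_of borel_sets_of_def)

lemma continuous_map_measurable_borel_of:
  assumes "continuous_map T S f"
  shows "f \<in> measurable (borel_of T) (borel_of S)"
  unfolding borel_of_def[of S]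
proof (rule measurable_measure_of[OF borel_of_opens_Pow])
  show "f \<in> space (borel_of T) \<rightarrow> topspace S"
    using assms by (auto simp: continuous_map_def)
  fix U assume "U \<in> {U. openin S U}"
  then have "openin T {x \<in> topspace T. f x \<in> U}"
    using assms by (auto simp: continuous_map_def)
  moreover have "f -` U \<inter> space (borel_of T) = {x \<in> topspace T. f x \<in> U}" by auto
  ultimately show "f -` U \<inter> space (borel_of T) \<in> sets (borel_of T)"
    by (simp add: openin_sets_borel_of)
qed

text \<open>Second countability makes every open set of the product a countable union of open
  rectangles. The equality is what makes Fubini's theorem applicable to Borel functions on a
  product.\<close>

lemma sets_borel_of_prod:
  assumes S: "second_countable S" and T: "second_countable T"
  shows "sets (borel_of (prod_topology S T)) = sets (borel_of S \<Otimes>\<^sub>M borel_of T)"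
proof -
  have f: "fst \<in> measurable (borel_of (prod_topology S T)) (borel_of S)"
    and s: "snd \<in> measurable (borel_of (prod_topology S T)) (borel_of T)"
    by (intro continuous_map_measurable_borel_of continuous_map_fst continuous_map_snd)+
  have le1: "sets (borel_of S \<Otimes>\<^sub>M borel_of T) \<subseteq> sets (borel_of (prod_topology S T))"
    unfolding sets_pair_measure
  proof (rule sets.sigma_sets_subset')
    show "{a \<times> b |a b. a \<in> sets (borel_of S) \<and> b \<in> sets (borel_of T)} \<subseteq> sets (borel_of (prod_topology S T))"
    proof clarify
      fix a b assume a: "a \<in> sets (borel_of S)" and b: "b \<in> sets (borel_of T)"
      have "a \<times> b = (fst -` a \<inter> space (borel_of (prod_topology S T))) \<inter> (snd -` b \<inter> space (borel_of (prod_topology S T)))"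
        using sets.sets_into_space[OF a] sets.sets_into_space[OF b] by auto
      also have "\<dots> \<in> sets (borel_of (prod_topology S T))"
        using measurable_sets[OF f a] measurable_sets[OF s b] by (rule sets.Int)
      finally show "a \<times> b \<in> sets (borel_of (prod_topology S T))" .
    qed
    show "space (borel_of S) \<times> space (borel_of T) \<in> sets (borel_of (prod_topology S T))"
      using sets.top[of "borel_of (prod_topology S T)"] by simp
  qed
  obtain BS where BS: "countable BS" "\<And>V. V \<in> BS \<Longrightarrow> openin S V"
    "\<And>U x. openin S U \<Longrightarrow> x \<in> U \<Longrightarrow> \<exists>V\<in>BS. x \<in> V \<and> V \<subseteq> U"
    using S unfolding second_countable_def by metis
  obtain BT where BT: "countable BT" "\<And>V. V \<in> BT \<Longrightarrow> openin T V"
    "\<And>U x. openin T U \<Longrightarrow> x \<in> U \<Longrightarrow> \<exists>V\<in>BT. x \<in> V \<and> V \<subseteq> U"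
    using T unfolding second_countable_def by metis
  have op: "W \<in> sets (borel_of S \<Otimes>\<^sub>M borel_of T)" if W: "openin (prod_topology S T) W" for W
  proof -
    have "W = (\<Union>p\<in>{p \<in> BS \<times> BT. fst p \<times> snd p \<subseteq> W}. fst p \<times> snd p)"
    proof
      show "W \<subseteq> (\<Union>p\<in>{p \<in> BS \<times> BT. fst p \<times> snd p \<subseteq> W}. fst p \<times> snd p)"
      proof
        fix z assume "z \<in> W"
        then obtain x y where xy: "z = (x, y)" "(x, y) \<in> W" by (cases z) auto
        obtain U V where UV: "openin S U" "openin T V" "x \<in> U" "y \<in> V" "U \<times> V \<subseteq> W"
          using W xy(2) unfolding openin_prod_topology_alt by metis
        obtain U' where U': "U' \<in> BS" "x \<in> U'" "U' \<subseteq> U" using BS(3)[OF UV(1,3)] by auto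
        obtain V' where V': "V' \<in> BT" "y \<in> V'" "V' \<subseteq> V" using BT(3)[OF UV(2,4)] by auto
        show "z \<in> (\<Union>p\<in>{p \<in> BS \<times> BT. fst p \<times> snd p \<subseteq> W}. fst p \<times> snd p)"
          using xy U' V' UV(5) by (intro UN_I[of "(U', V')"]) auto
      qed
    qed auto
    also have "\<dots> \<in> sets (borel_of S \<Otimes>\<^sub>M borel_of T)"
    proof (rule sets.countable_UN'')
      show "countable {p \<in> BS \<times> BT. fst p \<times> snd p \<subseteq> W}"
        using BS(1) BT(1) by (intro countable_subset[OF _ countable_SIGMA[of BS "\<lambda>_. BT"]]) auto
      show "fst p \<times> snd p \<in> sets (borel_of S \<Otimes>\<^sub>M borel_of T)" if "p \<in> {p \<in> BS \<times> BT. fst p \<times> snd p \<subseteq> W}" for p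
        using that BS(2) BT(2) by (intro pair_measureI openin_sets_borel_of) auto
    qed
    finally show ?thesis .
  qed
  have "sigma_sets (topspace (prod_topology S T)) {U. openin (prod_topology S T) U} \<subseteq> sets (borel_of S \<Otimes>\<^sub>M borel_of T)"
    using op op[OF openin_topspace] by (intro sets.sigma_sets_subset') blast+
  then have "sets (borel_of (prod_topology S T)) \<subseteq> sets (borel_of S \<Otimes>\<^sub>M borel_of T)"
    by (simp only: sets_borel_of borel_sets_of_def)
  then show ?thesis using le1 by (rule equalityI)
qed

text \<open>A countable neighbourhood base at \<open>x\<close> reduces continuity to sequences,
  along which Fatou's lemma and dominated convergence are available.\<close>

lemma sequential_nhd:
  fixes \<phi> :: "'a \<Rightarrow> real"
  assumes sc: "second_countable T" and x: "x \<in> topspace T"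
    and seq: "\<And>s. (\<And>k::nat. s k \<in> topspace T) \<Longrightarrow> limitin T s x sequentially \<Longrightarrow> (\<lambda>k. \<phi> (s k)) \<longlonglongrightarrow> l"
    and e: "\<epsilon> > 0"
  shows "\<exists>U. openin T U \<and> x \<in> U \<and> (\<forall>y\<in>U. \<bar>\<phi> y - l\<bar> < \<epsilon>)"
proof (rule ccontr)
  assume no: "\<not> ?thesis"
  obtain B where B: "countable B" "\<And>V. V \<in> B \<Longrightarrow> openin T V"
    "\<And>U x. openin T U \<Longrightarrow> x \<in> U \<Longrightarrow> \<exists>V\<in>B. x \<in> V \<and> V \<subseteq> U"
    using sc unfolding second_countable_def by metis
  define C where "C = {V \<in> B. x \<in> V}"
  have C: "countable C" "C \<noteq> {}"
    using B(1) B(3)[OF openin_topspace x] by (auto simp: C_def)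
  \<comment> \<open>A decreasing base of neighbourhoods of \<open>x\<close>, so that counterexamples
    chosen in the sets \<open>U n\<close> converge to \<open>x\<close>.\<close>
  define U where "U n = (\<Inter>i\<le>n. from_nat_into C i)" for n :: nat
  have Ci: "from_nat_into C i \<in> C" for i using C by (simp add: from_nat_into)
  have Uo: "openin T (U n)" "x \<in> U n" for n
    unfolding U_def using Ci B(2) by (auto intro!: openin_INT2 simp: C_def)
  have "\<exists>y. y \<in> U n \<and> \<not> \<bar>\<phi> y - l\<bar> < \<epsilon>" for n using no Uo by blast
  then obtain s where s: "\<And>n. s n \<in> U n" "\<And>n. \<not> \<bar>\<phi> (s n) - l\<bar> < \<epsilon>" by metis
  have lim: "limitin T s x sequentially"
    unfolding limitin_def
  proof (intro conjI x allI impI)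
    fix W assume "openin T W \<and> x \<in> W"
    then obtain V where "V \<in> B" "x \<in> V" and V: "V \<subseteq> W" using B(3)[of W x] by auto
    then have "V \<in> C" by (simp add: C_def)
    note V = this V
    then obtain i where i: "from_nat_into C i = V" using C from_nat_into_surj by metis
    show "\<forall>\<^sub>F n in sequentially. s n \<in> W"
    proof (rule eventually_sequentiallyI[of i])
      fix n assume "i \<le> n"
      then have "s n \<in> from_nat_into C i" using s(1)[of n] by (auto simp: U_def)
      then show "s n \<in> W" using i V by auto
    qed
  qed
  have "s k \<in> topspace T" for k using s(1) Uo(1) openin_subset by blast
  from seq[OF this lim] have "\<forall>\<^sub>F n in sequentially. \<bar>\<phi> (s n) - l\<bar> < \<epsilon>"
    using e by (auto simp: tendsto_iff dist_real_def)
  then show False using s(2) by simp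
qed

text \<open>A weakening of \<open>left_haar_measure\<close> without positivity on open sets, so that
  push-forwards of densities, which may vanish, also qualify.\<close>

definition left_inv_measure :: "('a, 'm) monoid_scheme \<Rightarrow> 'a topology \<Rightarrow> 'a measure \<Rightarrow> bool" where
  "left_inv_measure G T M \<longleftrightarrow>
     space M = topspace T \<and> sets M = borel_sets_of T
     \<and> (\<forall>g\<in>carrier G. \<forall>A\<in>sets M. emeasure M ((\<lambda>x. g \<otimes>\<^bsub>G\<^esub> x) ` A) = emeasure M A)
     \<and> (\<forall>K. compactin T K \<longrightarrow> emeasure M K < \<infinity>)"

text \<open>Triviality of all continuous homomorphisms to the additive reals. The logarithm of the
  modular function is such a homomorphism, so this condition yields unimodularity.\<close>

definition no_real_chars :: "('a, 'm) monoid_scheme \<Rightarrow> 'a topology \<Rightarrow> bool" where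
  "no_real_chars G T \<longleftrightarrow> (\<forall>\<xi>. continuous_map T euclideanreal \<xi>
      \<and> (\<forall>g\<in>carrier G. \<forall>h\<in>carrier G. \<xi> (g \<otimes>\<^bsub>G\<^esub> h) = \<xi> g + \<xi> h)
      \<longrightarrow> (\<forall>g\<in>carrier G. \<xi> g = 0))"

section \<open>Translations in second countable locally compact groups\<close>

locale sc_group =
  fixes G :: "('a, 'm) monoid_scheme" (structure) and T :: "'a topology"
  assumes sc_group: "second_countable_lc_group G T"

sublocale sc_group \<subseteq> group G
  using sc_group by (simp add: second_countable_lc_group_def lc_group_def topological_group_def)

context sc_group
begin

lemma topspace_T [simp]: "topspace T = carrier G"
  and second_countable_T: "second_countable T"
  and locally_compact_T: "locally_compact_space T"
  and mult_continuous: "continuous_map (prod_topology T T) T (\<lambda>(x, y). x \<otimes> y)"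
  and inv_continuous: "continuous_map T T (\<lambda>x. inv x)"
  using sc_group by (auto simp: second_countable_lc_group_def lc_group_def topological_group_def)

lemma continuous_map_mult:
  assumes "continuous_map S T f" "continuous_map S T h"
  shows "continuous_map S T (\<lambda>x. f x \<otimes> h x)"
proof -
  have "continuous_map S T ((\<lambda>(x, y). x \<otimes> y) \<circ> (\<lambda>x. (f x, h x)))"
    using assms by (intro continuous_map_compose[OF _ mult_continuous]) (simp add: continuous_map_pairwise o_def)
  then show ?thesis by (simp add: o_def)
qed

lemma left_continuous: "g \<in> carrier G \<Longrightarrow> continuous_map T T (\<lambda>x. g \<otimes> x)"
  by (intro continuous_map_mult) auto

lemma right_continuous: "g \<in> carrier G \<Longrightarrow> continuous_map T T (\<lambda>x. x \<otimes> g)"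
  by (intro continuous_map_mult) auto

lemma left_image:
  assumes "g \<in> carrier G" "A \<subseteq> carrier G"
  shows "(\<lambda>x. g \<otimes> x) ` A = {x \<in> carrier G. inv g \<otimes> x \<in> A}"
proof (intro equalityI subsetI)
  fix x assume "x \<in> {x \<in> carrier G. inv g \<otimes> x \<in> A}"
  then show "x \<in> (\<lambda>x. g \<otimes> x) ` A"
    using assms by (intro image_eqI[of _ _ "inv g \<otimes> x"]) (auto simp: m_assoc[symmetric])
qed (use assms in \<open>auto simp: m_assoc[symmetric] subsetD\<close>)

lemma right_image:
  assumes "g \<in> carrier G" "A \<subseteq> carrier G"
  shows "(\<lambda>x. x \<otimes> g) ` A = {x \<in> carrier G. x \<otimes> inv g \<in> A}"
proof (intro equalityI subsetI)
  fix x assume "x \<in> {x \<in> carrier G. x \<otimes> inv g \<in> A}"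
  then show "x \<in> (\<lambda>x. x \<otimes> g) ` A"
    using assms by (intro image_eqI[of _ _ "x \<otimes> inv g"]) (auto simp: m_assoc)
qed (use assms in \<open>auto simp: m_assoc subsetD\<close>)

lemma sets_borel_carrier: "A \<in> sets (borel_of T) \<Longrightarrow> A \<subseteq> carrier G"
  using sets.sets_into_space[of A "borel_of T"] by simp

lemma left_measurable: "g \<in> carrier G \<Longrightarrow> (\<lambda>x. g \<otimes> x) \<in> measurable (borel_of T) (borel_of T)"
  by (intro continuous_map_measurable_borel_of left_continuous)

lemma right_measurable: "g \<in> carrier G \<Longrightarrow> (\<lambda>x. x \<otimes> g) \<in> measurable (borel_of T) (borel_of T)"
  by (intro continuous_map_measurable_borel_of right_continuous)

lemma right_image_sets:
  assumes "g \<in> carrier G" "A \<in> sets (borel_of T)"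
  shows "(\<lambda>x. x \<otimes> g) ` A \<in> sets (borel_of T)"
  using measurable_sets[OF right_measurable[of "inv g"] assms(2)] assms sets_borel_carrier[OF assms(2)]
  by (simp add: right_image vimage_def Int_def conj_commute)

lemma left_image_sets:
  assumes "g \<in> carrier G" "A \<in> sets (borel_of T)"
  shows "(\<lambda>x. g \<otimes> x) ` A \<in> sets (borel_of T)"
  using measurable_sets[OF left_measurable[of "inv g"] assms(2)] assms sets_borel_carrier[OF assms(2)]
  by (simp add: left_image vimage_def Int_def conj_commute)

lemma right_image_open:
  assumes "g \<in> carrier G" "openin T A"
  shows "openin T ((\<lambda>x. x \<otimes> g) ` A)"
  using openin_continuous_map_preimage[OF right_continuous[of "inv g"] assms(2)] assms openin_subset[OF assms(2)]
  by (simp add: right_image)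

lemma left_image_open:
  assumes "g \<in> carrier G" "openin T A"
  shows "openin T ((\<lambda>x. g \<otimes> x) ` A)"
  using openin_continuous_map_preimage[OF left_continuous[of "inv g"] assms(2)] assms openin_subset[OF assms(2)]
  by (simp add: left_image)

lemma mult_limitin:
  assumes "limitin T s a F" "limitin T t b F"
  shows "limitin T (\<lambda>k. s k \<otimes> t k) (a \<otimes> b) F"
proof -
  have "limitin (prod_topology T T) (\<lambda>k. (s k, t k)) (a, b) F"
    using assms by (simp add: limitin_pairwise o_def)
  from continuous_map_limit[OF mult_continuous this] show ?thesis by (simp add: o_def)
qed

lemma inv_limitin:
  assumes "limitin T s a F"
  shows "limitin T (\<lambda>k. inv (s k)) (inv a) F"
  using continuous_map_limit[OF inv_continuous assms] by (simp add: o_def)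

lemma const_limitin: "a \<in> carrier G \<Longrightarrow> limitin T (\<lambda>k. a) a F"
  by (auto simp: limitin_def)

text \<open>The members of a countable base that lie inside compact sets cover the group by local
  compactness; the \<open>O' i\<close> are their finite unions.\<close>

lemma exhaustion:
  obtains O' :: "nat \<Rightarrow> 'a set" where
    "\<And>i. openin T (O' i)" "incseq O'" "(\<Union>i. O' i) = carrier G" "\<And>i. \<exists>K. compactin T K \<and> O' i \<subseteq> K"
proof -
  obtain B where B: "countable B" "\<And>V. V \<in> B \<Longrightarrow> openin T V"
    "\<And>U x. openin T U \<Longrightarrow> x \<in> U \<Longrightarrow> \<exists>V\<in>B. x \<in> V \<and> V \<subseteq> U"
    using second_countable_T unfolding second_countable_def by metis
  define C where "C = {V \<in> B. \<exists>K. compactin T K \<and> V \<subseteq> K}"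
  have cov: "\<exists>V\<in>C. x \<in> V" if x: "x \<in> carrier G" for x
  proof -
    obtain U K where UK: "openin T U" "compactin T K" "x \<in> U" "U \<subseteq> K"
      using locally_compact_T x unfolding locally_compact_space_def by auto
    obtain V where "V \<in> B" "x \<in> V" "V \<subseteq> U" using B(3)[OF UK(1,3)] by auto
    then show ?thesis using UK by (auto simp: C_def)
  qed
  have C: "countable C" "C \<noteq> {}" using B(1) cov[OF one_closed] by (auto simp: C_def)
  have Ci: "from_nat_into C i \<in> C" for i using C by (simp add: from_nat_into)
  define Q where "Q n = (\<Union>i\<le>n. from_nat_into C i)" for n :: nat
  show thesis
  proof (rule that[of Q])
    show "openin T (Q i)" for i unfolding Q_def using Ci B(2) by (intro openin_Union) (auto simp: C_def)
    show "incseq Q" unfolding Q_def incseq_def by fastforce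
    show "(\<Union>i. Q i) = carrier G"
    proof
      have "from_nat_into C i \<subseteq> carrier G" for i
        using Ci[of i] B(2) openin_subset[of T] by (auto simp: C_def)
      then show "(\<Union>i. Q i) \<subseteq> carrier G" by (auto simp: Q_def)
      show "carrier G \<subseteq> (\<Union>i. Q i)"
      proof
        fix x assume "x \<in> carrier G"
        then obtain V where V: "V \<in> C" "x \<in> V" using cov by auto
        then obtain i where "from_nat_into C i = V" using C from_nat_into_surj by metis
        then show "x \<in> (\<Union>i. Q i)" using V by (auto simp: Q_def intro!: exI[of _ i])
      qed
    qed
    have "\<forall>i. \<exists>K. compactin T K \<and> from_nat_into C i \<subseteq> K" using Ci by (auto simp: C_def)
    then obtain K where K: "\<And>i. compactin T (K i)" "\<And>i. from_nat_into C i \<subseteq> K i" by metis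
    show "\<exists>K. compactin T K \<and> Q n \<subseteq> K" for n
      using K by (intro exI[of _ "\<Union>i\<le>n. K i"] conjI compactin_Union) (auto simp: Q_def)
  qed
qed

section \<open>Left invariant measures and the modular function\<close>

lemma left_inv_space: "left_inv_measure G T M \<Longrightarrow> space M = carrier G"
  by (simp add: left_inv_measure_def)

lemma left_inv_sets: "left_inv_measure G T M \<Longrightarrow> sets M = sets (borel_of T)"
  by (simp add: left_inv_measure_def sets_borel_of)

lemma left_inv_distr:
  assumes M: "left_inv_measure G T M" and g: "g \<in> carrier G"
  shows "distr M M (\<lambda>x. g \<otimes> x) = M"
proof (rule measure_eqI)
  note s = left_inv_sets[OF M]
  have meas: "(\<lambda>x. g \<otimes> x) \<in> measurable M M"
    using left_measurable[OF g] by (simp add: measurable_cong_sets[OF s s])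
  fix A assume "A \<in> sets (distr M M ((\<otimes>) g))"
  then have A: "A \<in> sets M" by simp
  then have sub: "A \<subseteq> carrier G" using sets.sets_into_space left_inv_space[OF M] by fastforce
  have "(\<lambda>x. g \<otimes> x) -` A \<inter> space M = (\<lambda>x. inv g \<otimes> x) ` A"
    using g sub by (simp add: left_inv_space[OF M] left_image vimage_def Int_def conj_commute)
  then show "emeasure (distr M M (\<lambda>x. g \<otimes> x)) A = emeasure M A"
    using M A g meas by (simp add: emeasure_distr left_inv_measure_def)
qed simp

lemma left_inv_nn_integral:
  assumes M: "left_inv_measure G T M" and g: "g \<in> carrier G" and f: "f \<in> borel_measurable (borel_of T)"
  shows "(\<integral>\<^sup>+x. f (g \<otimes> x) \<partial>M) = (\<integral>\<^sup>+x. f x \<partial>M)"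
proof -
  note s = left_inv_sets[OF M]
  have meas: "(\<lambda>x. g \<otimes> x) \<in> measurable M M"
    using left_measurable[OF g] by (simp add: measurable_cong_sets[OF s s])
  have "(\<integral>\<^sup>+x. f x \<partial>M) = (\<integral>\<^sup>+x. f x \<partial>(distr M M (\<lambda>x. g \<otimes> x)))"
    by (simp add: left_inv_distr[OF M g])
  also have "\<dots> = (\<integral>\<^sup>+x. f (g \<otimes> x) \<partial>M)"
    using meas f by (intro nn_integral_distr) (simp_all add: measurable_cong_sets[OF s refl])
  finally show ?thesis by simp
qed

lemma left_inv_sigma_finite:
  assumes M: "left_inv_measure G T M"
  shows "sigma_finite_measure M"
proof
  obtain Q :: "nat \<Rightarrow> 'a set" where Q: "\<And>i. openin T (Q i)" "incseq Q" "(\<Union>i. Q i) = carrier G" "\<And>i. \<exists>K. compactin T K \<and> Q i \<subseteq> K"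
    by (rule exhaustion) (rule that)
  have "emeasure M (Q i) \<noteq> \<infinity>" for i
  proof -
    obtain K where K: "compactin T K" "Q i \<subseteq> K" using Q(4) by blast
    have "closedin T K"
      using sc_group K(1) by (auto simp: second_countable_lc_group_def lc_group_def compactin_imp_closedin)
    then have "K \<in> sets M"
      using sets.compl_sets[OF openin_sets_borel_of[of T "topspace T - K"]] compactin_subset_topspace[OF K(1)]
      by (simp add: left_inv_sets[OF M] closedin_def double_diff)
    then have "emeasure M (Q i) \<le> emeasure M K" using K by (intro emeasure_mono)
    also have "\<dots> < \<infinity>" using M K(1) by (simp add: left_inv_measure_def)
    finally show ?thesis by simp
  qed
  then show "\<exists>A. countable A \<and> A \<subseteq> sets M \<and> \<Union> A = space M \<and> (\<forall>a\<in>A. emeasure M a \<noteq> \<infinity>)"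
    using Q openin_sets_borel_of[OF Q(1)]
    by (intro exI[of _ "range Q"]) (auto simp: left_inv_sets[OF M] left_inv_space[OF M])
qed

lemma compact_sets: "compactin T K \<Longrightarrow> K \<in> sets (borel_of T)"
proof -
  assume K: "compactin T K"
  have "closedin T K"
    using sc_group K by (auto simp: second_countable_lc_group_def lc_group_def compactin_imp_closedin)
  then show "K \<in> sets (borel_of T)"
    using sets.compl_sets[OF openin_sets_borel_of[of T "topspace T - K"]] compactin_subset_topspace[OF K]
    by (simp add: closedin_def double_diff)
qed

lemma left_inv_rel_compact:
  assumes M: "left_inv_measure G T M" and "compactin T K" "A \<subseteq> K"
  shows "emeasure M A < \<infinity>"
proof -
  have "emeasure M A \<le> emeasure M K"
    using assms compact_sets by (intro emeasure_mono) (auto simp: left_inv_sets[OF M])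
  also have "\<dots> < \<infinity>" using assms by (simp add: left_inv_measure_def)
  finally show ?thesis .
qed

lemma right_image_compact: "g \<in> carrier G \<Longrightarrow> compactin T K \<Longrightarrow> compactin T ((\<lambda>x. x \<otimes> g) ` K)"
  by (rule image_compactin[OF _ right_continuous])

text \<open>The translates of \<open>U\<close> cover the group, countably many of them suffice by
  the Lindelof property, and each is null.\<close>

lemma left_inv_zero:
  assumes M: "left_inv_measure G T M" and U: "openin T U" "U \<noteq> {}" "emeasure M U = 0"
    and A: "A \<in> sets M"
  shows "emeasure M A = 0"
proof -
  obtain u where u: "u \<in> U" using U by auto
  have Us: "U \<subseteq> carrier G" using openin_subset[OF U(1)] by simp
  let ?\<U> = "(\<lambda>g. (\<lambda>x. g \<otimes> x) ` U) ` carrier G"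
  have lin: "Lindelof_space T" by (rule second_countable_imp_Lindelof_space[OF second_countable_T])
  have cov: "topspace T \<subseteq> \<Union>?\<U>"
  proof
    fix x assume "x \<in> topspace T"
    then have "x \<in> (\<lambda>y. (x \<otimes> inv u) \<otimes> y) ` U"
      using u Us by (intro image_eqI[of _ _ u]) (auto simp: m_assoc)
    then show "x \<in> \<Union>?\<U>" using \<open>x \<in> topspace T\<close> u Us by (intro UnionI[of "(\<lambda>y. (x \<otimes> inv u) \<otimes> y) ` U"]) auto
  qed
  obtain \<V> where V: "countable \<V>" "\<V> \<subseteq> ?\<U>" "topspace T \<subseteq> \<Union>\<V>"
  proof -
    have "\<forall>W\<in>?\<U>. openin T W" using left_image_open[OF _ U(1)] by auto
    then show ?thesis
      using mp[OF spec[OF lin[unfolded Lindelof_space_alt], of ?\<U>] conjI[OF _ cov]] that by auto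
  qed
  have "\<V> \<subseteq> null_sets M"
  proof
    fix W assume "W \<in> \<V>"
    then obtain g where g: "g \<in> carrier G" "W = (\<lambda>x. g \<otimes> x) ` U" using V by auto
    have "U \<in> sets M" using openin_sets_borel_of[OF U(1)] by (simp add: left_inv_sets[OF M])
    then show "W \<in> null_sets M"
      using M g U left_image_sets[OF g(1)] by (auto simp: null_sets_def left_inv_measure_def left_inv_sets[OF M] sets_borel_of)
  qed
  then have "\<Union>\<V> \<in> null_sets M"
    using V(1) null_sets_UN'[of \<V> "\<lambda>x. x"] by auto
  moreover have "A \<subseteq> \<Union>\<V>" using V(3) sets.sets_into_space[OF A] left_inv_space[OF M] by auto
  ultimately show ?thesis
    using emeasure_mono[of A "\<Union>\<V>" M] by (auto simp: null_sets_def)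
qed

lemma mult_pair_measurable:
  "(\<lambda>(x, y). x \<otimes> y) \<in> measurable (borel_of T \<Otimes>\<^sub>M borel_of T) (borel_of T)"
  using continuous_map_measurable_borel_of[OF mult_continuous]
  by (simp add: measurable_cong_sets[OF sets_borel_of_prod[OF second_countable_T second_countable_T] refl])

lemma inv_measurable: "(\<lambda>x. inv x) \<in> measurable (borel_of T) (borel_of T)"
  by (rule continuous_map_measurable_borel_of[OF inv_continuous])

text \<open>Weil's uniqueness argument: the last factor does not depend on \<open>M\<close>.\<close>

lemma left_inv_formula:
  assumes M: "left_inv_measure G T M" and N: "left_inv_measure G T N"
    and pos: "\<And>U. openin T U \<Longrightarrow> U \<noteq> {} \<Longrightarrow> emeasure N U > 0"
    and U: "openin T U" "U \<noteq> {}" "compactin T K" "U \<subseteq> K"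
    and A: "A \<in> sets (borel_of T)"
  defines "D \<equiv> \<lambda>x. \<integral>\<^sup>+t. indicator U (t \<otimes> x) \<partial>N"
  shows "emeasure M A = emeasure M U * (\<integral>\<^sup>+y. indicator A (inv y) / D (inv y) \<partial>N)"
proof -
  note sM = left_inv_sets[OF M] and sN = left_inv_sets[OF N]
  note spM = left_inv_space[OF M] and spN = left_inv_space[OF N]
  interpret M: sigma_finite_measure M by (rule left_inv_sigma_finite[OF M])
  interpret N: sigma_finite_measure N by (rule left_inv_sigma_finite[OF N])
  interpret MN: pair_sigma_finite M N ..
  have [measurable_cong]: "sets M = sets (borel_of T)" "sets N = sets (borel_of T)" by (fact sM sN)+
  have [measurable]: "U \<in> sets (borel_of T)" "A \<in> sets (borel_of T)"
    using U A by (auto simp: openin_sets_borel_of)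
  note [measurable] = inv_measurable
  have mm [measurable (raw)]: "(\<lambda>z. f z \<otimes> h z) \<in> measurable L (borel_of T)"
    if "f \<in> measurable L (borel_of T)" "h \<in> measurable L (borel_of T)" for f h and L :: "('b::type) measure"
    using measurable_compose[OF measurable_Pair[OF that] mult_pair_measurable] by simp
  have mm2 [measurable (raw)]: "(\<lambda>z. f z \<otimes> h z) \<in> measurable L (borel_of T)"
    if "f \<in> measurable L (borel_of T)" "h \<in> measurable L (borel_of T)" for f h and L :: "('a \<times> 'a) measure"
    using measurable_compose[OF measurable_Pair[OF that] mult_pair_measurable] by simp
  have mm3 [measurable (raw)]: "(\<lambda>z. f z \<otimes> h z) \<in> measurable L (borel_of T)"
    if "f \<in> measurable L (borel_of T)" "h \<in> measurable L (borel_of T)" for f h and L :: "'a measure"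
    using measurable_compose[OF measurable_Pair[OF that] mult_pair_measurable] by simp
  have Dm [measurable]: "D \<in> borel_measurable (borel_of T)"
    unfolding D_def by measurable
  \<comment> \<open>\<open>D x\<close> is the measure of the right translate of \<open>U\<close> by
    \<open>inv x\<close>: positive because it is open and nonempty, finite because it lies in a
    compact set.\<close>
  have Dx: "D x \<noteq> 0 \<and> D x \<noteq> \<infinity>" if x: "x \<in> carrier G" for x
  proof -
    have Us: "U \<subseteq> carrier G" using openin_subset[OF U(1)] by simp
    have "D x = (\<integral>\<^sup>+t. indicator ((\<lambda>y. y \<otimes> inv x) ` U) t \<partial>N)"
      unfolding D_def using x Us
      by (intro nn_integral_cong) (auto simp: right_image spN indicator_def)
    also have "\<dots> = emeasure N ((\<lambda>y. y \<otimes> inv x) ` U)"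
      using right_image_sets[of "inv x" U] x openin_sets_borel_of[OF U(1)] by (intro nn_integral_indicator) (simp add: sN)
    finally have eq: "D x = emeasure N ((\<lambda>y. y \<otimes> inv x) ` U)" .
    have "emeasure N ((\<lambda>y. y \<otimes> inv x) ` U) > 0"
      using U x by (intro pos right_image_open) auto
    moreover have "emeasure N ((\<lambda>y. y \<otimes> inv x) ` U) < \<infinity>"
      by (rule left_inv_rel_compact[OF N right_image_compact[of "inv x" K]]) (use U x in auto)
    ultimately show ?thesis unfolding eq by auto
  qed
  have "emeasure M A = (\<integral>\<^sup>+x. indicator A x \<partial>M)"
    using A by (simp add: sM)
  \<comment> \<open>Inserting \<open>D x / D x\<close> creates a double integral. Replacing
    \<open>x\<close> by \<open>inv y \<otimes> x\<close> under \<open>M\<close> and, with the order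
    exchanged, \<open>y\<close> by \<open>x \<otimes> y\<close> under \<open>N\<close> separates it
    into a function of \<open>x\<close> times a function of \<open>y\<close>.\<close>
  also have "\<dots> = (\<integral>\<^sup>+x. (\<integral>\<^sup>+y. indicator A x / D x * indicator U (y \<otimes> x) \<partial>N) \<partial>M)"
  proof (rule nn_integral_cong)
    fix x assume "x \<in> space M"
    then have x [simp]: "x \<in> carrier G" by (simp add: spM)
    have "(\<integral>\<^sup>+y. indicator A x / D x * indicator U (y \<otimes> x) \<partial>N) = indicator A x / D x * D x"
      unfolding D_def by (rule nn_integral_cmult) measurable
    also have "\<dots> = indicator A x"
      using Dx[OF x] ennreal_divide_self[of "D x"]
      by (simp add: ennreal_divide_times top.not_eq_extremum)
    finally show "indicator A x = (\<integral>\<^sup>+y. indicator A x / D x * indicator U (y \<otimes> x) \<partial>N)" by simp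
  qed
  also have "\<dots> = (\<integral>\<^sup>+y. (\<integral>\<^sup>+x. indicator A x / D x * indicator U (y \<otimes> x) \<partial>M) \<partial>N)"
    by (subst MN.Fubini') simp_all
  also have "\<dots> = (\<integral>\<^sup>+y. (\<integral>\<^sup>+x. indicator A (inv y \<otimes> x) / D (inv y \<otimes> x) * indicator U x \<partial>M) \<partial>N)"
  proof (rule nn_integral_cong)
    fix y assume "y \<in> space N"
    then have y: "y \<in> carrier G" by (simp add: spN)
    have "(\<integral>\<^sup>+x. indicator A x / D x * indicator U (y \<otimes> x) \<partial>M)
      = (\<integral>\<^sup>+x. indicator A (inv y \<otimes> x) / D (inv y \<otimes> x) * indicator U (y \<otimes> (inv y \<otimes> x)) \<partial>M)"
      using y by (intro left_inv_nn_integral[OF M, symmetric]) measurable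
    also have "\<dots> = (\<integral>\<^sup>+x. indicator A (inv y \<otimes> x) / D (inv y \<otimes> x) * indicator U x \<partial>M)"
      using y by (intro nn_integral_cong) (simp add: spM m_assoc[symmetric])
    finally show "(\<integral>\<^sup>+x. indicator A x / D x * indicator U (y \<otimes> x) \<partial>M)
      = (\<integral>\<^sup>+x. indicator A (inv y \<otimes> x) / D (inv y \<otimes> x) * indicator U x \<partial>M)" .
  qed
  also have "\<dots> = (\<integral>\<^sup>+x. (\<integral>\<^sup>+y. indicator A (inv y \<otimes> x) / D (inv y \<otimes> x) * indicator U x \<partial>N) \<partial>M)"
    by (subst MN.Fubini') simp_all
  also have "\<dots> = (\<integral>\<^sup>+x. indicator U x * (\<integral>\<^sup>+y. indicator A (inv y) / D (inv y) \<partial>N) \<partial>M)"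
  proof (rule nn_integral_cong)
    fix x assume "x \<in> space M"
    then have x: "x \<in> carrier G" by (simp add: spM)
    have "(\<integral>\<^sup>+y. indicator A (inv y \<otimes> x) / D (inv y \<otimes> x) * indicator U x \<partial>N)
       = (\<integral>\<^sup>+y. indicator A (inv (x \<otimes> y) \<otimes> x) / D (inv (x \<otimes> y) \<otimes> x) * indicator U x \<partial>N)"
      using x by (intro left_inv_nn_integral[OF N, symmetric]) measurable
    also have "\<dots> = (\<integral>\<^sup>+y. indicator U x * (indicator A (inv y) / D (inv y)) \<partial>N)"
      using x by (intro nn_integral_cong) (simp add: spN inv_mult_group m_assoc mult.commute)
    also have "\<dots> = indicator U x * (\<integral>\<^sup>+y. indicator A (inv y) / D (inv y) \<partial>N)"
      by (rule nn_integral_cmult) measurable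
    finally show "(\<integral>\<^sup>+y. indicator A (inv y \<otimes> x) / D (inv y \<otimes> x) * indicator U x \<partial>N)
       = indicator U x * (\<integral>\<^sup>+y. indicator A (inv y) / D (inv y) \<partial>N)" .
  qed
  also have "\<dots> = emeasure M U * (\<integral>\<^sup>+y. indicator A (inv y) / D (inv y) \<partial>N)"
    by (subst nn_integral_multc) (simp_all add: sM)
  finally show ?thesis .
qed

text \<open>Left and right translations commute. The push-forward runs along right multiplication by
  \<open>inv g\<close>, so that \<open>A\<close> receives the measure of its right translate by
  \<open>g\<close>.\<close>

lemma right_shift_left_inv:
  assumes M: "left_inv_measure G T M" and g: "g \<in> carrier G"
  shows "left_inv_measure G T (distr M (borel_of T) (\<lambda>x. x \<otimes> inv g))"
    and "A \<in> sets (borel_of T) \<Longrightarrow> emeasure (distr M (borel_of T) (\<lambda>x. x \<otimes> inv g)) A = emeasure M ((\<lambda>x. x \<otimes> g) ` A)"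
proof -
  note sM = left_inv_sets[OF M] and spM = left_inv_space[OF M]
  have meas: "(\<lambda>x. x \<otimes> inv g) \<in> measurable M (borel_of T)"
    using right_measurable[of "inv g"] g by (simp add: measurable_cong_sets[OF sM refl])
  show em: "emeasure (distr M (borel_of T) (\<lambda>x. x \<otimes> inv g)) A = emeasure M ((\<lambda>x. x \<otimes> g) ` A)"
    if A: "A \<in> sets (borel_of T)" for A
    using meas A g sets_borel_carrier[OF A]
    by (simp add: emeasure_distr right_image spM vimage_def Int_def conj_commute)
  show "left_inv_measure G T (distr M (borel_of T) (\<lambda>x. x \<otimes> inv g))"
    unfolding left_inv_measure_def
  proof (intro conjI ballI allI impI)
    fix h A assume h: "h \<in> carrier G" and "A \<in> sets (distr M (borel_of T) (\<lambda>x. x \<otimes> inv g))"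
    then have A: "A \<in> sets (borel_of T)" by simp
    have sub: "A \<subseteq> carrier G" by (rule sets_borel_carrier[OF A])
    have "(\<lambda>x. x \<otimes> g) ` (\<lambda>x. h \<otimes> x) ` A = (\<lambda>x. h \<otimes> x) ` (\<lambda>x. x \<otimes> g) ` A"
      unfolding image_image using h g sub by (intro image_cong) (auto simp: m_assoc)
    moreover have "emeasure M ((\<lambda>x. h \<otimes> x) ` (\<lambda>x. x \<otimes> g) ` A) = emeasure M ((\<lambda>x. x \<otimes> g) ` A)"
      using M h right_image_sets[OF g A] by (simp add: left_inv_measure_def sets_borel_of)
    ultimately show "emeasure (distr M (borel_of T) (\<lambda>x. x \<otimes> inv g)) ((\<lambda>x. h \<otimes> x) ` A)
        = emeasure (distr M (borel_of T) (\<lambda>x. x \<otimes> inv g)) A"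
      using em[OF A] em[OF left_image_sets[OF h A]] by simp
  next
    fix K assume K: "compactin T K"
    show "emeasure (distr M (borel_of T) (\<lambda>x. x \<otimes> inv g)) K < \<infinity>"
      unfolding em[OF compact_sets[OF K]]
      by (rule left_inv_rel_compact[OF M right_image_compact[OF g K]]) simp
  qed (simp_all add: sets_borel_of)
qed

text \<open>The uniqueness formula for \<open>M\<close> and for its right translate has the same
  last factor, so right translation by \<open>g\<close> scales all Borel sets alike. The common
  ratio is the modular function, here written without division.\<close>

lemma left_inv_ratio:
  assumes M: "left_inv_measure G T M"
    and pos: "\<And>U. openin T U \<Longrightarrow> U \<noteq> {} \<Longrightarrow> emeasure M U > 0"
    and U: "openin T U" "U \<noteq> {}" "compactin T K" "U \<subseteq> K"
    and A: "A \<in> sets (borel_of T)" and g: "g \<in> carrier G"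
  shows "emeasure M ((\<lambda>x. x \<otimes> g) ` A) * emeasure M U = emeasure M ((\<lambda>x. x \<otimes> g) ` U) * emeasure M A"
proof -
  define C where "C = (\<integral>\<^sup>+y. indicator A (inv y) / (\<integral>\<^sup>+t. indicator U (t \<otimes> inv y) \<partial>M) \<partial>M)"
  have 1: "emeasure M ((\<lambda>x. x \<otimes> g) ` A) = emeasure M ((\<lambda>x. x \<otimes> g) ` U) * C"
    unfolding C_def
    using left_inv_formula[OF right_shift_left_inv(1)[OF M g] M pos U A]
    unfolding right_shift_left_inv(2)[OF M g A] right_shift_left_inv(2)[OF M g openin_sets_borel_of[OF U(1)]] .
  have 2: "emeasure M A = emeasure M U * C"
    unfolding C_def by (rule left_inv_formula[OF M M pos U A])
  show ?thesis by (simp add: 1 2 mult_ac)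
qed

text \<open>The modular function is a continuous homomorphism to the positive reals, so its
  logarithm is a real character and vanishes. A measure that is zero on some nonempty open set is
  zero altogether, which settles the other case.\<close>

lemma left_inv_right_inv:
  assumes nc: "no_real_chars G T" and M: "left_inv_measure G T M"
    and g: "g \<in> carrier G" and A: "A \<in> sets (borel_of T)"
  shows "emeasure M ((\<lambda>x. x \<otimes> g) ` A) = emeasure M A"
proof (cases "\<exists>U. openin T U \<and> U \<noteq> {} \<and> emeasure M U = 0")
  case True
  then obtain U where U: "openin T U" "U \<noteq> {}" "emeasure M U = 0" by auto
  show ?thesis
    using left_inv_zero[OF M U, of A] left_inv_zero[OF M U right_image_sets[OF g A, unfolded left_inv_sets[OF M, symmetric]]] A
    by (simp add: left_inv_sets[OF M])
next
  case False
  then have pos: "emeasure M U > 0" if "openin T U" "U \<noteq> {}" for U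
    using that by (auto simp: zero_less_iff_neq_zero)
  obtain U K where U: "openin T U" "compactin T K" "\<one> \<in> U" "U \<subseteq> K"
    using bspec[OF locally_compact_T[unfolded locally_compact_space_def topspace_T] one_closed] by blast
  have Une: "U \<noteq> {}" and Us: "U \<in> sets (borel_of T)" and Uc: "U \<subseteq> carrier G"
    using U openin_sets_borel_of openin_subset[OF U(1)] by auto
  have fin: "emeasure M ((\<lambda>x. x \<otimes> g) ` U) < \<infinity>" if "g \<in> carrier G" for g
    by (rule left_inv_rel_compact[OF M right_image_compact[OF that U(2)]]) (use U(4) in auto)
  have posg: "emeasure M ((\<lambda>x. x \<otimes> g) ` U) > 0" if "g \<in> carrier G" for g
    using pos[OF right_image_open[OF that U(1)]] Une by auto
  have finU: "emeasure M U < \<infinity>" and posU: "emeasure M U > 0"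
    using left_inv_rel_compact[OF M U(2,4)] pos[OF U(1) Une] by auto
  define m where "m g = measure M ((\<lambda>x. x \<otimes> g) ` U)" for g
  have em: "emeasure M ((\<lambda>x. x \<otimes> g) ` U) = ennreal (m g)" if "g \<in> carrier G" for g
    unfolding m_def by (rule emeasure_eq_ennreal_measure) (use fin[OF that] in auto)
  define mU where "mU = measure M U"
  have emU: "emeasure M U = ennreal mU"
    unfolding mU_def by (rule emeasure_eq_ennreal_measure) (use finU in auto)
  have mU: "mU > 0" using posU unfolding emU by simp
  have mg: "m g > 0" if "g \<in> carrier G" for g using posg[OF that] unfolding em[OF that] by simp
  define \<Delta> where "\<Delta> g = m g / mU" for g
  have \<Delta>_pos: "\<Delta> g > 0" if "g \<in> carrier G" for g using mg[OF that] mU by (simp add: \<Delta>_def)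
  have \<Delta>_mult: "\<Delta> (g \<otimes> h) = \<Delta> g * \<Delta> h" if g: "g \<in> carrier G" and h: "h \<in> carrier G" for g h
  proof -
    have "(\<lambda>x. x \<otimes> h) ` (\<lambda>x. x \<otimes> g) ` U = (\<lambda>x. x \<otimes> (g \<otimes> h)) ` U"
      unfolding image_image using g h Uc by (intro image_cong) (auto simp: m_assoc)
    then have "emeasure M ((\<lambda>x. x \<otimes> (g \<otimes> h)) ` U) * emeasure M U
      = emeasure M ((\<lambda>x. x \<otimes> h) ` U) * emeasure M ((\<lambda>x. x \<otimes> g) ` U)"
      using left_inv_ratio[OF M pos U(1) Une U(2,4) right_image_sets[OF g Us] h] by simp
    then have "ennreal (m (g \<otimes> h) * mU) = ennreal (m h * m g)"
      using g h mU mg by (simp add: em emU ennreal_mult less_imp_le)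
    then have "m (g \<otimes> h) * mU = m h * m g"
      using g h mU mg[of "g \<otimes> h"] mg[of g] mg[of h] by (simp add: ennreal_eq_0_iff)
    then show ?thesis using mU by (simp add: \<Delta>_def field_simps)
  qed
  have \<Delta>_one: "\<Delta> \<one> = 1"
    using \<Delta>_mult[of \<one> \<one>] \<Delta>_pos[of \<one>] by simp
  have \<Delta>_inv: "\<Delta> (inv g) = 1 / \<Delta> g" if "g \<in> carrier G" for g
    using \<Delta>_mult[of g "inv g"] \<Delta>_pos[OF that] \<Delta>_one that by (simp add: field_simps)
  \<comment> \<open>Lower semicontinuity by Fatou's lemma: as \<open>U\<close> is open, a point of
    the translate by \<open>g\<close> lies in all late translates by \<open>s k\<close>.\<close>
  have lsc: "\<forall>\<^sub>F k in sequentially. a < \<Delta> (s k)"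
    if s: "\<And>k. s k \<in> carrier G" "limitin T s g sequentially" and a: "a < \<Delta> g" for s :: "nat \<Rightarrow> 'a" and g a
  proof -
    have g: "g \<in> carrier G" using s(2) by (auto simp: limitin_def)
    have "ennreal (m g) = (\<integral>\<^sup>+x. indicator ((\<lambda>x. x \<otimes> g) ` U) x \<partial>M)"
      using right_image_sets[OF g Us] em[OF g] by (simp add: left_inv_sets[OF M])
    also have "\<dots> \<le> (\<integral>\<^sup>+x. liminf (\<lambda>k. indicator ((\<lambda>x. x \<otimes> s k) ` U) x) \<partial>M)"
    proof (rule nn_integral_mono)
      fix x assume "x \<in> space M"
      then have x: "x \<in> carrier G" by (simp add: left_inv_space[OF M])
      show "indicator ((\<lambda>x. x \<otimes> g) ` U) x \<le> liminf (\<lambda>k. indicator ((\<lambda>x. x \<otimes> s k) ` U) x :: ennreal)"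
      proof (cases "x \<in> (\<lambda>x. x \<otimes> g) ` U")
        case True
        then have "x \<otimes> inv g \<in> U" using g Uc by (simp add: right_image)
        moreover have "limitin T (\<lambda>k. x \<otimes> inv (s k)) (x \<otimes> inv g) sequentially"
          by (intro mult_limitin const_limitin x inv_limitin s)
        ultimately have "\<forall>\<^sub>F k in sequentially. x \<otimes> inv (s k) \<in> U"
          using U(1) by (auto simp: limitin_def)
        then have "\<forall>\<^sub>F k in sequentially. (1::ennreal) \<le> indicator ((\<lambda>x. x \<otimes> s k) ` U) x"
          by eventually_elim (use s x Uc in \<open>simp add: right_image\<close>)
        then have "(1::ennreal) \<le> liminf (\<lambda>k. indicator ((\<lambda>x. x \<otimes> s k) ` U) x)"
          by (rule Liminf_bounded)
        then show ?thesis using True by simp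
      qed simp
    qed
    also have "\<dots> \<le> liminf (\<lambda>k. \<integral>\<^sup>+x. indicator ((\<lambda>x. x \<otimes> s k) ` U) x \<partial>M)"
      using right_image_sets[OF s(1) Us] by (intro nn_integral_liminf borel_measurable_indicator) (simp add: left_inv_sets[OF M])
    also have "\<dots> = liminf (\<lambda>k. ennreal (m (s k)))"
      using right_image_sets[OF s(1) Us] em[OF s(1)] by (simp add: left_inv_sets[OF M])
    finally have le: "ennreal (m g) \<le> liminf (\<lambda>k. ennreal (m (s k)))" .
    show ?thesis
    proof (cases "a \<ge> 0")
      case True
      have "a * mU < m g" using a mU by (simp add: \<Delta>_def field_simps)
      then have "ennreal (a * mU) < ennreal (m g)" using True mU by (simp add: ennreal_less_iff)
      then have "\<forall>\<^sub>F k in sequentially. ennreal (a * mU) < ennreal (m (s k))"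
        using le by (simp add: le_Liminf_iff)
      then show ?thesis
        by eventually_elim (use True mU in \<open>simp add: \<Delta>_def field_simps ennreal_less_iff\<close>)
    next
      case False
      have "a < \<Delta> (s k)" for k using \<Delta>_pos[OF s(1)[of k]] False by simp
      then show ?thesis by simp
    qed
  qed
  have \<Delta>_lim: "(\<lambda>k. \<Delta> (s k)) \<longlonglongrightarrow> \<Delta> g"
    if s: "\<And>k. s k \<in> carrier G" "limitin T s g sequentially" for s :: "nat \<Rightarrow> 'a" and g
  proof (rule order_tendstoI)
    have g: "g \<in> carrier G" using s(2) by (auto simp: limitin_def)
    fix a
    show "\<forall>\<^sub>F k in sequentially. a < \<Delta> (s k)" if "a < \<Delta> g" by (rule lsc[OF s that])
    \<comment> \<open>Upper semicontinuity is lower semicontinuity at the inverses, where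
      \<open>\<Delta>\<close> takes reciprocal values.\<close>
    show "\<forall>\<^sub>F k in sequentially. \<Delta> (s k) < a" if a: "\<Delta> g < a"
    proof -
      have a0: "a > 0" using a \<Delta>_pos[OF g] by simp
      have "1 / a < \<Delta> (inv g)"
        using a \<Delta>_pos[OF g] by (simp add: \<Delta>_inv[OF g] frac_less2)
      then have "\<forall>\<^sub>F k in sequentially. 1 / a < \<Delta> (inv (s k))"
        by (intro lsc[OF _ inv_limitin[OF s(2)]]) (simp_all add: s(1))
      then show ?thesis
      proof eventually_elim
        case (elim k)
        then show ?case using \<Delta>_pos[OF s(1)[of k]] a0 by (simp add: \<Delta>_inv[OF s(1)] field_simps)
      qed
    qed
  qed
  have "continuous_map T euclideanreal (\<lambda>g. ln (\<Delta> g))"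
    unfolding continuous_map_def
  proof (intro conjI allI impI)
    fix W :: "real set" assume "openin euclidean W"
    then have W: "open W" by simp
    show "openin T {x \<in> topspace T. ln (\<Delta> x) \<in> W}"
      unfolding openin_subopen[of T "{x \<in> topspace T. ln (\<Delta> x) \<in> W}"]
    proof
      fix x assume x: "x \<in> {x \<in> topspace T. ln (\<Delta> x) \<in> W}"
      then obtain e where e: "e > 0" "ball (ln (\<Delta> x)) e \<subseteq> W" using W by (auto simp: open_contains_ball)
      have "\<exists>U. openin T U \<and> x \<in> U \<and> (\<forall>y\<in>U. \<bar>ln (\<Delta> y) - ln (\<Delta> x)\<bar> < e)"
      proof (rule sequential_nhd[OF second_countable_T])
        fix s :: "nat \<Rightarrow> 'a" assume "\<And>k. s k \<in> topspace T" "limitin T s x sequentially"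
        then show "(\<lambda>k. ln (\<Delta> (s k))) \<longlonglongrightarrow> ln (\<Delta> x)"
          using x \<Delta>_pos[of x] by (intro tendsto_ln \<Delta>_lim) auto
      qed (use x e in auto)
      then obtain U where U: "openin T U" "x \<in> U" "\<And>y. y \<in> U \<Longrightarrow> \<bar>ln (\<Delta> y) - ln (\<Delta> x)\<bar> < e" by auto
      have "U \<subseteq> {x \<in> topspace T. ln (\<Delta> x) \<in> W}"
        using U openin_subset[OF U(1)] e(2) by (fastforce simp: dist_real_def)
      then show "\<exists>S. openin T S \<and> x \<in> S \<and> S \<subseteq> {x \<in> topspace T. ln (\<Delta> x) \<in> W}" using U by blast
    qed
  qed simp
  moreover have "\<forall>g\<in>carrier G. \<forall>h\<in>carrier G. ln (\<Delta> (g \<otimes> h)) = ln (\<Delta> g) + ln (\<Delta> h)"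
    using \<Delta>_mult \<Delta>_pos by (auto simp: ln_mult_pos)
  ultimately have "ln (\<Delta> g) = 0"
    using nc[unfolded no_real_chars_def, rule_format, of "\<lambda>g. ln (\<Delta> g)" g] g by simp
  then have "\<Delta> g = 1" using \<Delta>_pos[OF g] by simp
  then have eq: "emeasure M ((\<lambda>x. x \<otimes> g) ` U) = emeasure M U"
    using mU by (simp add: em[OF g] emU \<Delta>_def)
  have "emeasure M U * emeasure M ((\<lambda>x. x \<otimes> g) ` A) = emeasure M U * emeasure M A"
    using left_inv_ratio[OF M pos U(1) Une U(2,4) A g] eq by (simp add: mult.commute)
  then show ?thesis
    using finU posU by (auto simp: ennreal_mult_cancel_left)
qed

end

section \<open>Characters of Kazhdan groups and of minimally almost periodic groups\<close>

lemma cis_diff_le: "cmod (cis a - cis b) \<le> \<bar>a - b\<bar>"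
proof -
  have "cis a - cis b = cis b * (cis (a - b) - 1)"
    by (simp add: algebra_simps cis_mult)
  then have "cmod (cis a - cis b) = cmod (exp (\<i> * of_real (a - b)) - 1)"
    by (simp add: norm_mult cis_conv_exp)
  also have "\<dots> \<le> \<bar>a - b\<bar>"
    using abs_sin_x_le_abs_x[of "(a - b) / 2"] dist_exp_i_1[of "a - b"] by simp
  finally show ?thesis .
qed

text \<open>A unitary character is a one-dimensional unitary representation, realised on
  \<open>l2_space {0}\<close>.\<close>

lemma map_trivial_character:
  fixes G (structure)
  assumes tg: "topological_group G T" and map: "minimally_almost_periodic G T"
    and cont: "continuous_map T euclidean \<mu>"
    and hom: "\<And>a b. a \<in> carrier G \<Longrightarrow> b \<in> carrier G \<Longrightarrow> \<mu> (a \<otimes> b) = \<mu> a * \<mu> b"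
    and norm: "\<And>a. a \<in> carrier G \<Longrightarrow> cmod (\<mu> a) = 1"
    and g: "g \<in> carrier G"
  shows "\<mu> g = (1 :: complex)"
proof -
  interpret group G using tg by (simp add: topological_group_def)
  have tsp: "topspace T = carrier G" using tg by (simp add: topological_group_def)
  have nz: "\<mu> a \<noteq> 0" if "a \<in> carrier G" for a using norm[OF that] by auto
  have m1: "\<mu> \<one> = 1" using hom[of \<one> \<one>] nz[of \<one>] by simp
  define \<pi> where "\<pi> h f = (\<lambda>n. \<mu> h * f n)" for h and f :: "nat \<Rightarrow> complex"
  have l2: "\<pi> h f \<in> l2_space {0}" if "f \<in> l2_space {0}" for h f
    using that by (simp add: l2_space_def \<pi>_def norm_mult power_mult_distrib summable_mult)
  have mult: "\<pi> (a \<otimes> b) f = \<pi> a (\<pi> b f)" if "a \<in> carrier G" "b \<in> carrier G" for a b f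
    using that by (simp add: \<pi>_def hom mult.assoc)
  have one: "\<pi> \<one> f = f" for f by (simp add: \<pi>_def m1)
  have nrm: "l2_norm f = cmod (f 0)" if "f \<in> l2_space {0}" for f
    unfolding l2_norm_def using that by (subst suminf_finite[of "{0}"]) (auto simp: l2_space_def)
  have "unitary_rep G T {0} \<pi>"
    unfolding unitary_rep_def unitary_on_def
  proof (intro conjI ballI allI impI)
    fix h assume h: "h \<in> carrier G"
    show "bij_betw (\<pi> h) (l2_space {0}) (l2_space {0})"
    proof (rule bij_betw_byWitness[where f' = "\<pi> (inv h)"])
      show "\<forall>f\<in>l2_space {0}. \<pi> (inv h) (\<pi> h f) = f" using h by (simp add: mult[symmetric] one)
      show "\<forall>f\<in>l2_space {0}. \<pi> h (\<pi> (inv h) f) = f" using h by (simp add: mult[symmetric] one)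
    qed (use l2 in auto)
    show "l2_norm (\<pi> h f) = l2_norm f" if "f \<in> l2_space {0}" for f
      using nrm[OF that] nrm[OF l2[OF that, of h]] norm[OF h] by (simp add: \<pi>_def norm_mult)
    show "\<pi> h (\<lambda>n. a * f n + b * k n) = (\<lambda>n. a * \<pi> h f n + b * \<pi> h k n)" for a b f k
      by (auto simp: \<pi>_def algebra_simps)
  next
    fix f g0 and \<epsilon> :: real assume f: "f \<in> l2_space {0}" and g0: "g0 \<in> carrier G" and e: "0 < \<epsilon>"
    define \<delta> where "\<delta> = \<epsilon> / (cmod (f 0) + 1)"
    have sp: "cmod (f 0) + 1 > 0" by (simp add: add_nonneg_pos)
    have \<delta>: "\<delta> > 0" using e sp by (simp add: \<delta>_def)
    define U where "U = {h \<in> topspace T. \<mu> h \<in> ball (\<mu> g0) \<delta>}"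
    have "openin T U" unfolding U_def
      using cont by (intro openin_continuous_map_preimage[where Y = euclidean]) auto
    moreover have "g0 \<in> U" using g0 \<delta> by (simp add: U_def tsp)
    moreover have "l2_norm (\<lambda>n. \<pi> h f n - \<pi> g0 f n) < \<epsilon>" if h: "h \<in> U" for h
    proof -
      have "(\<lambda>n. \<pi> h f n - \<pi> g0 f n) = (\<lambda>n. (\<mu> h - \<mu> g0) * f n)" by (auto simp: \<pi>_def algebra_simps)
      moreover have "(\<lambda>n. (\<mu> h - \<mu> g0) * f n) \<in> l2_space {0}"
        using f by (simp add: l2_space_def norm_mult power_mult_distrib summable_mult)
      ultimately have "l2_norm (\<lambda>n. \<pi> h f n - \<pi> g0 f n) = cmod (\<mu> h - \<mu> g0) * cmod (f 0)"
        by (simp add: nrm norm_mult)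
      also have "\<dots> \<le> cmod (\<mu> h - \<mu> g0) * (cmod (f 0) + 1)" by (intro mult_left_mono) auto
      also have "\<dots> < \<delta> * (cmod (f 0) + 1)"
        using h sp by (intro mult_strict_right_mono) (auto simp: U_def dist_norm norm_minus_commute)
      also have "\<dots> = \<epsilon>" using sp by (simp add: \<delta>_def)
      finally show ?thesis .
    qed
    ultimately show "\<exists>U. openin T U \<and> g0 \<in> U \<and> (\<forall>h\<in>U. l2_norm (\<lambda>n. \<pi> h f n - \<pi> g0 f n) < \<epsilon>)"
      by blast
  qed (simp_all add: mult one)
  moreover define f :: "nat \<Rightarrow> complex" where "f = (\<lambda>m. if m = 0 then 1 else 0)"
  have f: "f \<in> l2_space {0}" unfolding l2_space_def f_def
    by (auto intro!: summable_finite[of "{0::nat}"] split: if_splits)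
  ultimately have "\<pi> g f = f"
    using map g unfolding minimally_almost_periodic_def by blast
  then have "\<pi> g f 0 = f 0" by simp
  then show ?thesis by (simp add: \<pi>_def f_def)
qed

lemma map_no_real_chars:
  fixes G (structure)
  assumes tg: "topological_group G T" and map: "minimally_almost_periodic G T"
  shows "no_real_chars G T"
  unfolding no_real_chars_def
proof (intro allI impI ballI)
  interpret group G using tg by (simp add: topological_group_def)
  have tsp: "topspace T = carrier G" using tg by (simp add: topological_group_def)
  fix \<xi> :: "'a \<Rightarrow> real" and g
  assume x: "continuous_map T euclideanreal \<xi> \<and> (\<forall>g\<in>carrier G. \<forall>h\<in>carrier G. \<xi> (g \<otimes> h) = \<xi> g + \<xi> h)"
    and g: "g \<in> carrier G"
  show "\<xi> g = 0"
  proof (rule ccontr)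
    assume nz: "\<xi> g \<noteq> 0"
    \<comment> \<open>Scaled so that \<open>\<mu> g = cis pi = - 1\<close>, which is not 1.\<close>
    define \<mu> where "\<mu> h = cis (pi * \<xi> h / \<xi> g)" for h
    have "continuous_map T euclidean \<mu>"
    proof -
      have "continuous_on UNIV (\<lambda>t. cis (pi * t / \<xi> g))" using nz by (intro continuous_intros) auto
      then have "continuous_map euclideanreal euclidean (\<lambda>t. cis (pi * t / \<xi> g))"
        by simp
      from continuous_map_compose[OF conjunct1[OF x] this] show ?thesis by (simp add: o_def \<mu>_def[abs_def])
    qed
    moreover have "\<mu> (a \<otimes> b) = \<mu> a * \<mu> b" if "a \<in> carrier G" "b \<in> carrier G" for a b
      using x that by (simp add: \<mu>_def cis_mult distrib_left add_divide_distrib)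
    moreover have "cmod (\<mu> a) = 1" for a by (simp add: \<mu>_def)
    ultimately have "\<mu> g = 1" by (intro map_trivial_character[OF tg map _ _ _ g])
    then show False using nz by (simp add: \<mu>_def)
  qed
qed

text \<open>The direct sum of the characters \<open>cis (t n * \<xi> h)\<close>, with
  \<open>t n\<close> tending to zero, has almost invariant vectors, namely the unit vectors. It has
  no nonzero invariant vector because no \<open>t n * \<xi> g\<close> is a multiple of
  \<open>2 * pi\<close>.\<close>

lemma kazhdan_no_real_chars:
  fixes G (structure)
  assumes tg: "topological_group G T" and kt: "kazhdan_T G T"
  shows "no_real_chars G T"
  unfolding no_real_chars_def
proof (intro allI impI ballI)
  interpret group G using tg by (simp add: topological_group_def)
  have tsp: "topspace T = carrier G" using tg by (simp add: topological_group_def)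
  fix \<xi> :: "'a \<Rightarrow> real" and g
  assume x: "continuous_map T euclideanreal \<xi> \<and> (\<forall>g\<in>carrier G. \<forall>h\<in>carrier G. \<xi> (g \<otimes> h) = \<xi> g + \<xi> h)"
    and g: "g \<in> carrier G"
  have hom: "\<xi> (a \<otimes> b) = \<xi> a + \<xi> b" if "a \<in> carrier G" "b \<in> carrier G" for a b using x that by blast
  have x1: "\<xi> \<one> = 0" using hom[of \<one> \<one>] by simp
  have xinv: "\<xi> (inv a) = - \<xi> a" if "a \<in> carrier G" for a
    using hom[of a "inv a"] that x1 by simp
  show "\<xi> g = 0"
  proof (rule ccontr)
    assume nz: "\<xi> g \<noteq> 0"
    \<comment> \<open>This choice gives \<open>t n * \<xi> g = pi / (n + 1)\<close>, which is
      positive and at most \<open>pi\<close>, where the cosine is below 1; the summand 1 keeps the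
      denominator nonzero at \<open>n = 0\<close>.\<close>
    define t where "t n = pi / (\<xi> g * (real n + 1))" for n :: nat
    define C where "C = pi / \<bar>\<xi> g\<bar>"
    have C: "C > 0" using nz by (simp add: C_def)
    have tC: "\<bar>t n\<bar> \<le> C / (real n + 1)" for n
      by (simp add: t_def C_def abs_mult)
    have tC': "\<bar>t n\<bar> \<le> C" for n
    proof -
      have "C / (real n + 1) \<le> C / 1" using C by (intro divide_left_mono) auto
      then show ?thesis using tC[of n] by simp
    qed
    define \<pi> where "\<pi> h f = (\<lambda>n. cis (t n * \<xi> h) * f n)" for h and f :: "nat \<Rightarrow> complex"
    have l2: "\<pi> h f \<in> l2_space UNIV" if "f \<in> l2_space UNIV" for h f
      using that by (simp add: l2_space_def \<pi>_def norm_mult)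
    have mult: "\<pi> (a \<otimes> b) f = \<pi> a (\<pi> b f)" if "a \<in> carrier G" "b \<in> carrier G" for a b f
      using that by (simp add: \<pi>_def hom distrib_left mult.assoc flip: cis_mult)
    have one: "\<pi> \<one> f = f" for f by (simp add: \<pi>_def x1)
    have "unitary_rep G T UNIV \<pi>"
      unfolding unitary_rep_def unitary_on_def
    proof (intro conjI ballI allI impI)
      fix h assume h: "h \<in> carrier G"
      show "bij_betw (\<pi> h) (l2_space UNIV) (l2_space UNIV)"
      proof (rule bij_betw_byWitness[where f' = "\<pi> (inv h)"])
        show "\<forall>f\<in>l2_space UNIV. \<pi> (inv h) (\<pi> h f) = f" using h by (simp add: mult[symmetric] one)
        show "\<forall>f\<in>l2_space UNIV. \<pi> h (\<pi> (inv h) f) = f" using h by (simp add: mult[symmetric] one)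
      qed (use l2 in auto)
      show "l2_norm (\<pi> h f) = l2_norm f" for f by (simp add: l2_norm_def \<pi>_def norm_mult)
      show "\<pi> h (\<lambda>n. a * f n + b * k n) = (\<lambda>n. a * \<pi> h f n + b * \<pi> h k n)" for a b f k
        by (auto simp: \<pi>_def algebra_simps)
    next
      fix f g0 and \<epsilon> :: real assume f: "f \<in> l2_space UNIV" and g0: "g0 \<in> carrier G" and e: "0 < \<epsilon>"
      define \<delta> where "\<delta> = \<epsilon> / (C * (l2_norm f + 1))"
      have nf: "l2_norm f \<ge> 0" using f by (simp add: l2_norm_def l2_space_def suminf_nonneg)
      have \<delta>: "\<delta> > 0" using e C nf by (simp add: \<delta>_def)
      define U where "U = {h \<in> topspace T. \<xi> h \<in> ball (\<xi> g0) \<delta>}"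
      have "openin T U" unfolding U_def
        using x by (intro openin_continuous_map_preimage[where Y = euclideanreal]) auto
      moreover have "g0 \<in> U" using g0 \<delta> by (simp add: U_def tsp)
      moreover have "l2_norm (\<lambda>n. \<pi> h f n - \<pi> g0 f n) < \<epsilon>" if h: "h \<in> U" for h
      proof -
        let ?d = "\<bar>\<xi> h - \<xi> g0\<bar>"
        have d: "?d < \<delta>" using h by (simp add: U_def dist_real_def abs_minus_commute)
        have pt: "(cmod (\<pi> h f n - \<pi> g0 f n))\<^sup>2 \<le> (C * ?d)\<^sup>2 * (cmod (f n))\<^sup>2" for n
        proof -
          have "\<pi> h f n - \<pi> g0 f n = (cis (t n * \<xi> h) - cis (t n * \<xi> g0)) * f n"
            by (simp add: \<pi>_def algebra_simps)
          moreover have "cmod (cis (t n * \<xi> h) - cis (t n * \<xi> g0)) \<le> C * ?d"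
          proof -
            have "cmod (cis (t n * \<xi> h) - cis (t n * \<xi> g0)) \<le> \<bar>t n * \<xi> h - t n * \<xi> g0\<bar>"
              by (rule cis_diff_le)
            also have "\<dots> = \<bar>t n\<bar> * ?d" by (simp add: right_diff_distrib flip: abs_mult)
            also have "\<dots> \<le> C * ?d" using tC'[of n] by (intro mult_right_mono) auto
            finally show ?thesis .
          qed
          ultimately have "cmod (\<pi> h f n - \<pi> g0 f n) \<le> (C * ?d) * cmod (f n)"
            by (simp add: norm_mult mult_right_mono)
          then show ?thesis
            unfolding power_mult_distrib[symmetric] by (rule power_mono) simp
        qed
        have s: "summable (\<lambda>n. (C * ?d)\<^sup>2 * (cmod (f n))\<^sup>2)"
          using f by (intro summable_mult) (simp add: l2_space_def)
        have "(\<Sum>n. (cmod (\<pi> h f n - \<pi> g0 f n))\<^sup>2) \<le> (\<Sum>n. (C * ?d)\<^sup>2 * (cmod (f n))\<^sup>2)"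
          by (intro suminf_le pt s summable_comparison_test'[OF s, of 0]) (use pt in auto)
        also have "\<dots> = (C * ?d)\<^sup>2 * (\<Sum>n. (cmod (f n))\<^sup>2)"
          using f by (intro suminf_mult) (simp add: l2_space_def)
        finally have "l2_norm (\<lambda>n. \<pi> h f n - \<pi> g0 f n) \<le> sqrt ((C * ?d)\<^sup>2 * (\<Sum>n. (cmod (f n))\<^sup>2))"
          unfolding l2_norm_def by (rule real_sqrt_le_mono)
        also have "\<dots> = C * ?d * l2_norm f"
          using C by (simp add: real_sqrt_mult l2_norm_def)
        also have "\<dots> \<le> C * ?d * (l2_norm f + 1)"
          using C by (intro mult_left_mono) auto
        also have "\<dots> < C * \<delta> * (l2_norm f + 1)"
          using C d nf by (intro mult_strict_right_mono mult_strict_left_mono) auto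
        also have "\<dots> = \<epsilon>" using C nf by (simp add: \<delta>_def)
        finally show ?thesis .
      qed
      ultimately show "\<exists>U. openin T U \<and> g0 \<in> U \<and> (\<forall>h\<in>U. l2_norm (\<lambda>n. \<pi> h f n - \<pi> g0 f n) < \<epsilon>)"
        by blast
    qed (simp_all add: mult one)
    moreover have "has_almost_invariant_vectors G T UNIV \<pi>"
      unfolding has_almost_invariant_vectors_def
    proof (intro allI impI)
      fix K and \<epsilon> :: real assume K: "compactin T K \<and> 0 < \<epsilon>"
      have "compactin euclideanreal (\<xi> ` K)"
        using K x by (intro image_compactin[where X = T]) auto
      then have "bounded (\<xi> ` K)" by (simp add: compact_imp_bounded)
      then obtain R where R: "R > 0" "\<And>h. h \<in> K \<Longrightarrow> \<bar>\<xi> h\<bar> \<le> R"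
        unfolding bounded_pos by auto
      obtain n where n: "C * R / \<epsilon> < real n" using reals_Archimedean2 by blast
      define f :: "nat \<Rightarrow> complex" where "f = (\<lambda>m. if m = n then 1 else 0)"
      have f: "f \<in> l2_space UNIV" unfolding l2_space_def f_def
        by (auto intro!: summable_finite[of "{n}"] split: if_splits)
      have single: "l2_norm (\<lambda>m. z * f m) = cmod z" for z
        unfolding l2_norm_def by (subst suminf_finite[of "{n}"]) (auto simp: f_def)
      have "l2_norm (\<lambda>m. \<pi> h f m - f m) < \<epsilon>" if h: "h \<in> K" for h
      proof -
        have "(\<lambda>m. \<pi> h f m - f m) = (\<lambda>m. (cis (t n * \<xi> h) - 1) * f m)"
          by (auto simp: \<pi>_def f_def)
        then have "l2_norm (\<lambda>m. \<pi> h f m - f m) = cmod (cis (t n * \<xi> h) - cis 0)"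
          by (simp add: single)
        also have "\<dots> \<le> \<bar>t n * \<xi> h - 0\<bar>" by (rule cis_diff_le)
        also have "\<dots> \<le> C / (real n + 1) * R"
          using tC[of n] R(2)[OF h] C by (simp add: abs_mult del: times_divide_eq_left) (intro mult_mono, auto)
        also have "\<dots> < \<epsilon>" using n K by (simp add: field_simps)
        finally show ?thesis .
      qed
      moreover have "l2_norm f = 1" using single[of 1] by simp
      ultimately show "\<exists>f\<in>l2_space UNIV. l2_norm f = 1 \<and> (\<forall>g\<in>K. l2_norm (\<lambda>n. \<pi> g f n - f n) < \<epsilon>)"
        using f by blast
    qed
    ultimately obtain f where f: "f \<noteq> (\<lambda>n. 0)" "\<And>h. h \<in> carrier G \<Longrightarrow> \<pi> h f = f"
      using kt unfolding kazhdan_T_def has_nonzero_invariant_vector_def by metis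
    then obtain n where n: "f n \<noteq> 0" by auto
    have "\<pi> g f n = f n" using f(2)[OF g] by simp
    then have "cis (t n * \<xi> g) = 1" using n by (simp add: \<pi>_def)
    moreover have "t n * \<xi> g = pi / (real n + 1)" using nz by (simp add: t_def)
    ultimately have c: "cos (pi / (real n + 1)) = 1"
      by (metis cis.simps(1) one_complex.simps(1))
    have "0 < pi / (real n + 1)" "pi / (real n + 1) \<le> pi"
      by (simp_all add: field_simps)
    then have "cos (pi / (real n + 1)) < cos 0"
      by (intro cos_monotone_0_pi) auto
    then show False using c by simp
  qed
qed

section \<open>Monomial actions and the Mazur map\<close>

text \<open>The modulus is raised to the power \<open>\<theta>\<close> and the phase is kept. For
  \<open>\<theta> = p / 2\<close> unit vectors of \<open>lp_space p\<close> become unit vectors of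
  \<open>l2_space UNIV\<close>, and the map commutes with permutations of the coordinates and with
  unimodular factors.\<close>

definition mazur :: "real \<Rightarrow> complex \<Rightarrow> complex" where
  "mazur \<theta> z = of_real (cmod z powr (\<theta> - 1)) * z"

lemma cmod_mazur: "cmod (mazur \<theta> z) = cmod z powr \<theta>"
proof (cases "z = 0")
  case False
  then have "cmod z powr \<theta> = cmod z powr (\<theta> - 1) * cmod z powr 1"
    by (subst powr_add[symmetric]) simp
  then show ?thesis by (simp add: mazur_def norm_mult)
qed (simp add: mazur_def)

lemma mazur_unit: "cmod a = 1 \<Longrightarrow> mazur \<theta> (a * z) = a * mazur \<theta> z"
  by (simp add: mazur_def norm_mult)

lemma mazur_inverse:
  assumes "\<theta> > 0"
  shows "mazur (1 / \<theta>) (mazur \<theta> z) = z"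
proof (cases "z = 0")
  case False
  have "mazur (1 / \<theta>) (mazur \<theta> z) = of_real (cmod z powr (\<theta> * (1 / \<theta> - 1)) * cmod z powr (\<theta> - 1)) * z"
    unfolding mazur_def[of "1/\<theta>"] cmod_mazur by (simp add: mazur_def powr_powr)
  also have "cmod z powr (\<theta> * (1 / \<theta> - 1)) * cmod z powr (\<theta> - 1) = 1"
    using assms False by (subst powr_add[symmetric]) (simp add: algebra_simps)
  finally show ?thesis by simp
qed (simp add: mazur_def)

lemma mazur_scale: "t > 0 \<Longrightarrow> mazur \<theta> (of_real t * z) = of_real (t powr \<theta>) * mazur \<theta> z"
proof -
  assume t: "t > 0"
  have "t powr \<theta> = t powr (\<theta> - 1) * t powr 1"
    using t by (subst powr_add[symmetric]) simp
  then show ?thesis using t by (simp add: mazur_def norm_mult powr_mult)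
qed

lemma mazur_continuous:
  assumes "\<theta> > 0"
  shows "continuous_on UNIV (mazur \<theta>)"
proof -
  have "isCont (mazur \<theta>) z" for z
  proof (cases "z = 0")
    case True
    have "((\<lambda>z. cmod (mazur \<theta> z)) \<longlongrightarrow> 0) (at 0)"
      unfolding cmod_mazur
    proof (rule tendsto_zero_powrI)
      show "(cmod \<longlongrightarrow> 0) (at 0)" using tendsto_norm_zero[OF tendsto_ident_at[of "0::complex" UNIV]] by simp
    qed (use assms in auto)
    then have "(mazur \<theta> \<longlongrightarrow> 0) (at 0)" by (rule tendsto_norm_zero_cancel)
    then show ?thesis using True by (simp add: isCont_def mazur_def)
  next
    case False
    then show ?thesis unfolding mazur_def[abs_def] by (intro continuous_intros) auto
  qed
  then show ?thesis by (simp add: continuous_on_eq_continuous_at)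
qed

text \<open>Both sides are homogeneous of degree \<open>p = \<theta> * r\<close>, so
  \<open>z\<close> and \<open>w\<close> may be scaled into the unit disc. There uniform continuity
  handles close points, and for distant points the last term dominates.\<close>

lemma mazur_ineq:
  assumes \<theta>: "\<theta> > 0" and r: "r > 0" and p: "p = \<theta> * r" and e: "\<epsilon> > 0"
  obtains C where "C \<ge> 0"
    "\<And>z w. cmod (mazur \<theta> z - mazur \<theta> w) powr r \<le> \<epsilon> * (cmod z powr p + cmod w powr p) + C * cmod (z - w) powr p"
proof -
  have "uniformly_continuous_on (cball 0 1) (mazur \<theta>)"
    by (intro compact_uniformly_continuous continuous_on_subset[OF mazur_continuous[OF \<theta>]]) auto
  moreover have "\<epsilon> powr (1/r) > 0" using e by simp
  ultimately obtain \<delta> where \<delta>: "\<delta> > 0"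
    "\<And>z w. cmod z \<le> 1 \<Longrightarrow> cmod w \<le> 1 \<Longrightarrow> cmod (z - w) < \<delta> \<Longrightarrow> cmod (mazur \<theta> z - mazur \<theta> w) < \<epsilon> powr (1/r)"
    unfolding uniformly_continuous_on_def dist_norm by (metis mem_cball_0)
  have p0: "p > 0" using \<theta> r p by simp
  \<comment> \<open>On the unit disc two values of the Mazur map differ by at most 2, and the term
    with \<open>C\<close> is called upon only when the scaled points are at least
    \<open>\<delta>\<close> apart.\<close>
  define C where "C = 2 powr r / \<delta> powr p"
  have C: "C \<ge> 0" by (simp add: C_def)
  have "cmod (mazur \<theta> z - mazur \<theta> w) powr r \<le> \<epsilon> * (cmod z powr p + cmod w powr p) + C * cmod (z - w) powr p" for z w
  proof (cases "z = 0 \<and> w = 0")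
    case True
    then show ?thesis using p0 r by (simp add: mazur_def)
  next
    case False
    define t where "t = max (cmod z) (cmod w)"
    have t: "t > 0" using False by (auto simp: t_def less_max_iff_disj)
    have tp: "t powr p \<le> cmod z powr p + cmod w powr p" by (auto simp: t_def max_def)
    define z' where "z' = z / of_real t" define w' where "w' = w / of_real t"
    have zw: "z = of_real t * z'" "w = of_real t * w'" using t by (auto simp: z'_def w'_def)
    have le1: "cmod z' \<le> 1" "cmod w' \<le> 1" using t by (auto simp: z'_def w'_def norm_divide t_def)
    have scale: "cmod (mazur \<theta> z - mazur \<theta> w) powr r = t powr p * cmod (mazur \<theta> z' - mazur \<theta> w') powr r"
    proof -
      have "mazur \<theta> z - mazur \<theta> w = of_real (t powr \<theta>) * (mazur \<theta> z' - mazur \<theta> w')"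
        unfolding zw mazur_scale[OF t] by (simp add: algebra_simps)
      then show ?thesis by (simp add: norm_mult powr_mult powr_powr p)
    qed
    show ?thesis
    proof (cases "cmod (z' - w') < \<delta>")
      case True
      have "cmod (mazur \<theta> z' - mazur \<theta> w') powr r \<le> (\<epsilon> powr (1/r)) powr r"
        using \<delta>(2)[OF le1 True] r by (intro powr_mono2) auto
      also have "\<dots> = \<epsilon>" using e r by (simp add: powr_powr)
      finally have "cmod (mazur \<theta> z - mazur \<theta> w) powr r \<le> t powr p * \<epsilon>"
        unfolding scale by (intro mult_left_mono) auto
      also have "\<dots> \<le> \<epsilon> * (cmod z powr p + cmod w powr p)" using tp e by (simp add: mult.commute)
      also have "\<dots> \<le> \<epsilon> * (cmod z powr p + cmod w powr p) + C * cmod (z - w) powr p" using C by simp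
      finally show ?thesis .
    next
      case False
      have "cmod (mazur \<theta> z' - mazur \<theta> w') \<le> cmod z' powr \<theta> + cmod w' powr \<theta>"
        using norm_triangle_ineq4[of "mazur \<theta> z'" "mazur \<theta> w'"] by (simp add: cmod_mazur)
      also have "\<dots> \<le> 1 powr \<theta> + 1 powr \<theta>" using le1 \<theta> by (intro add_mono powr_mono2) auto
      finally have "cmod (mazur \<theta> z' - mazur \<theta> w') powr r \<le> 2 powr r" using r by (intro powr_mono2) auto
      then have "cmod (mazur \<theta> z - mazur \<theta> w) powr r \<le> t powr p * 2 powr r"
        unfolding scale by (intro mult_left_mono) auto
      also have "\<dots> = C * (t * \<delta>) powr p" using t \<delta>(1) by (simp add: C_def powr_mult)
      also have "\<dots> \<le> C * cmod (z - w) powr p"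
      proof -
        have "cmod (z - w) = t * cmod (z' - w')"
          unfolding zw using t by (simp add: norm_mult flip: right_diff_distrib)
        then have "t * \<delta> \<le> cmod (z - w)" using False t by simp
        then show ?thesis using C p0 t \<delta>(1) by (intro mult_left_mono powr_mono2) auto
      qed
      also have "\<dots> \<le> \<epsilon> * (cmod z powr p + cmod w powr p) + C * cmod (z - w) powr p" using e by simp
      finally show ?thesis .
    qed
  qed
  then show thesis using that C by blast
qed

text \<open>Uniform continuity of the Mazur map on bounded sets, by summing the pointwise
  inequality: its first term is small through the common bound \<open>A\<close>, its second through
  the assumed convergence.\<close>

lemma mazur_limit:
  fixes a b :: "nat \<Rightarrow> nat \<Rightarrow> complex"
  assumes \<theta>: "\<theta> > 0" and r: "r > 0" and p: "p = \<theta> * r"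
    and a: "\<And>k. a k \<in> lp_space p" "\<And>k. (\<Sum>n. cmod (a k n) powr p) \<le> A"
    and b: "\<And>k. b k \<in> lp_space p" "\<And>k. (\<Sum>n. cmod (b k n) powr p) \<le> A"
    and lim: "(\<lambda>k. \<Sum>n. cmod (a k n - b k n) powr p) \<longlonglongrightarrow> 0"
  shows "(\<lambda>k. \<Sum>n. cmod (mazur \<theta> (a k n) - mazur \<theta> (b k n)) powr r) \<longlonglongrightarrow> 0"
proof (rule LIMSEQ_I)
  fix \<epsilon> :: real assume e: "\<epsilon> > 0"
  have p0: "p > 0" using \<theta> r p by simp
  have A: "A \<ge> 0" using a(2)[of 0] suminf_nonneg[of "\<lambda>n. cmod (a 0 n) powr p"] a(1)[of 0]
    by (simp add: lp_space_def)
  \<comment> \<open>The two sums bounded by \<open>A\<close> contribute at most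
    \<open>2 * A * \<eta>\<close>, hence at most \<open>\<epsilon> / 2\<close>; \<open>A + 1\<close>
    keeps the denominator positive.\<close>
  define \<eta> where "\<eta> = \<epsilon> / (4 * (A + 1))"
  have \<eta>: "\<eta> > 0" using e A by (simp add: \<eta>_def)
  obtain C where C: "C \<ge> 0"
    "\<And>z w. cmod (mazur \<theta> z - mazur \<theta> w) powr r \<le> \<eta> * (cmod z powr p + cmod w powr p) + C * cmod (z - w) powr p"
    using mazur_ineq[OF \<theta> r p \<eta>] by metis
  have "\<epsilon> / (2 * (C + 1)) > 0" using e C by simp
  from LIMSEQ_D[OF lim this] obtain N where
    N: "\<And>k. k \<ge> N \<Longrightarrow> norm ((\<Sum>n. cmod (a k n - b k n) powr p) - 0) < \<epsilon> / (2 * (C + 1))" by blast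
  have "norm ((\<Sum>n. cmod (mazur \<theta> (a k n) - mazur \<theta> (b k n)) powr r) - 0) < \<epsilon>" if k: "k \<ge> N" for k
  proof -
    have s: "summable (\<lambda>n. cmod (a k n) powr p)" "summable (\<lambda>n. cmod (b k n) powr p)"
      "summable (\<lambda>n. cmod (a k n - b k n) powr p)"
      using a b lp_space_diff[OF p0 a(1) b(1)] by (auto simp: lp_space_def)
    let ?m = "\<lambda>n. \<eta> * (cmod (a k n) powr p + cmod (b k n) powr p) + C * cmod (a k n - b k n) powr p"
    have sm: "summable ?m" by (intro summable_add summable_mult s)
    have sl: "summable (\<lambda>n. cmod (mazur \<theta> (a k n) - mazur \<theta> (b k n)) powr r)"
      by (rule summable_comparison_test'[OF sm, of 0]) (use C in auto)
    have nn: "0 \<le> (\<Sum>n. cmod (mazur \<theta> (a k n) - mazur \<theta> (b k n)) powr r)"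
      by (rule suminf_nonneg[OF sl]) simp
    have D0: "0 \<le> (\<Sum>n. cmod (a k n - b k n) powr p)" by (rule suminf_nonneg[OF s(3)]) simp
    have "(\<Sum>n. cmod (mazur \<theta> (a k n) - mazur \<theta> (b k n)) powr r) \<le> (\<Sum>n. ?m n)"
      by (rule suminf_le[OF _ sl sm]) (use C in auto)
    also have "\<dots> = \<eta> * ((\<Sum>n. cmod (a k n) powr p) + (\<Sum>n. cmod (b k n) powr p)) + C * (\<Sum>n. cmod (a k n - b k n) powr p)"
      using s by (simp add: suminf_add[symmetric] suminf_mult summable_add summable_mult)
    also have "\<dots> \<le> \<eta> * (A + A) + (C + 1) * (\<Sum>n. cmod (a k n - b k n) powr p)"
      using a(2)[of k] b(2)[of k] \<eta> D0 by (intro add_mono mult_left_mono mult_right_mono) auto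
    also have "\<eta> * (A + A) \<le> \<epsilon> / 2" using e A by (simp add: \<eta>_def field_simps)
    also have "(C + 1) * (\<Sum>n. cmod (a k n - b k n) powr p) < (C + 1) * (\<epsilon> / (2 * (C + 1)))"
      using N[OF k] D0 C by (intro mult_strict_left_mono) auto
    also have "(C + 1) * (\<epsilon> / (2 * (C + 1))) = \<epsilon> / 2" using C by (simp add: field_simps)
    finally show ?thesis using nn by simp
  qed
  then show "\<exists>N. \<forall>k\<ge>N. norm ((\<Sum>n. cmod (mazur \<theta> (a k n) - mazur \<theta> (b k n)) powr r) - 0) < \<epsilon>" by blast
qed

text \<open>\<open>op g\<close> reads its argument at \<open>s g m\<close>, so the index maps
  compose in reverse order: \<open>s\<close> is a right action on the indices, and \<open>c\<close>
  is a unimodular cocycle over it.\<close>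

locale monomial_action =
  fixes H :: "('g, 'm) monoid_scheme" and c :: "'g \<Rightarrow> nat \<Rightarrow> complex" and s :: "'g \<Rightarrow> nat \<Rightarrow> nat"
  assumes group_H: "group H"
    and c_unit: "g \<in> carrier H \<Longrightarrow> cmod (c g m) = 1"
    and c_mult: "g \<in> carrier H \<Longrightarrow> h \<in> carrier H \<Longrightarrow> c (g \<otimes>\<^bsub>H\<^esub> h) m = c g m * c h (s g m)"
    and s_mult: "g \<in> carrier H \<Longrightarrow> h \<in> carrier H \<Longrightarrow> s (g \<otimes>\<^bsub>H\<^esub> h) m = s h (s g m)"
    and c_one: "c \<one>\<^bsub>H\<^esub> m = 1"
    and s_one: "s \<one>\<^bsub>H\<^esub> m = m"
begin

definition op :: "'g \<Rightarrow> (nat \<Rightarrow> complex) \<Rightarrow> nat \<Rightarrow> complex" where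
  "op g f = (\<lambda>m. c g m * f (s g m))"

definition orbit :: "nat \<Rightarrow> nat set" where
  "orbit n = (\<lambda>g. s g n) ` carrier H"

text \<open>An invariant vector has constant modulus along an orbit, so if it is square-summable its
  support consists of finite orbits; on a single orbit it is unique up to a factor. Finite support
  therefore loses nothing.\<close>

definition is_inv_vec :: "nat \<Rightarrow> (nat \<Rightarrow> complex) \<Rightarrow> bool" where
  "is_inv_vec n h \<longleftrightarrow> finite {m. h m \<noteq> 0} \<and> {m. h m \<noteq> 0} \<subseteq> orbit n \<and> h n \<noteq> 0 \<and> (\<forall>g\<in>carrier H. op g h = h)"

text \<open>Zero is the default when the orbit of \<open>n\<close> carries no invariant vector;
  \<open>perp\<close> then imposes no condition at \<open>n\<close>.\<close>

definition inv_vec :: "nat \<Rightarrow> nat \<Rightarrow> complex" where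
  "inv_vec n = (if \<exists>h. is_inv_vec n h then SOME h. is_inv_vec n h else (\<lambda>_. 0))"

text \<open>Orthogonality is written with finite sums, so it makes sense without square-summability
  and passes to pointwise limits and to integrals.\<close>

definition perp :: "(nat \<Rightarrow> complex) \<Rightarrow> bool" where
  "perp f \<longleftrightarrow> (\<forall>n. (\<Sum>m | inv_vec n m \<noteq> 0. f m * cnj (inv_vec n m)) = 0)"

lemma perp_scale: "perp f \<Longrightarrow> perp (\<lambda>m. a * f m)"
  by (simp add: perp_def mult.assoc sum_distrib_left[symmetric])

lemma op_mult: "g \<in> carrier H \<Longrightarrow> h \<in> carrier H \<Longrightarrow> op (g \<otimes>\<^bsub>H\<^esub> h) f = op g (op h f)"
  by (auto simp: op_def c_mult s_mult mult.assoc)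

lemma op_one: "op \<one>\<^bsub>H\<^esub> f = f"
  by (simp add: op_def c_one s_one)

lemma bij_s:
  assumes g: "g \<in> carrier H"
  shows "bij (s g)"
proof (rule o_bij)
  interpret group H by (rule group_H)
  show "s (inv\<^bsub>H\<^esub> g) \<circ> s g = id"
    using s_mult[OF g, of "inv\<^bsub>H\<^esub> g"] g by (auto simp: s_one)
  show "s g \<circ> s (inv\<^bsub>H\<^esub> g) = id"
    using s_mult[OF _ g, of "inv\<^bsub>H\<^esub> g"] g by (auto simp: s_one)
qed

lemma inv_vec_cases: "inv_vec n = (\<lambda>_. 0) \<or> is_inv_vec n (inv_vec n)"
  unfolding inv_vec_def using someI_ex[of "is_inv_vec n"] by auto

lemma inv_vec_finite: "finite {m. inv_vec n m \<noteq> 0}"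
  using inv_vec_cases[of n] by (auto simp: is_inv_vec_def)

lemma inv_vec_op: "g \<in> carrier H \<Longrightarrow> op g (inv_vec n) = inv_vec n"
  using inv_vec_cases[of n] by (auto simp: is_inv_vec_def op_def)

lemma l2_space_finite: "finite {m. h m \<noteq> 0} \<Longrightarrow> h \<in> l2_space UNIV"
  unfolding l2_space_def by (auto intro!: summable_finite)

lemma op_sums:
  fixes q :: "complex \<Rightarrow> real"
  assumes g: "g \<in> carrier H" and q: "\<And>z a. cmod a = 1 \<Longrightarrow> q (a * z) = q z" and nn: "\<And>z. q z \<ge> 0"
    and sm: "summable (\<lambda>m. q (f m))"
  shows "summable (\<lambda>m. q (op g f m))" and "(\<Sum>m. q (op g f m)) = (\<Sum>m. q (f m))"
proof -
  have eq: "(\<lambda>m. q (op g f m)) = (\<lambda>m. q (f (s g m)))"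
    using q[OF c_unit[OF g]] by (auto simp: op_def)
  have int: "integrable (count_space UNIV) (\<lambda>m. q (f m))"
    using sm nn by (simp add: integrable_count_space_nat_iff)
  have int': "integrable (count_space UNIV) (\<lambda>m. q (f (s g m)))"
    using integrable_bij_count_space[OF bij_s[OF g], of "\<lambda>m. q (f m)"] int by simp
  show "summable (\<lambda>m. q (op g f m))"
    unfolding eq using int' nn by (simp add: integrable_count_space_nat_iff)
  show "(\<Sum>m. q (op g f m)) = (\<Sum>m. q (f m))"
    unfolding eq using integral_bij_count_space[OF bij_s[OF g], of "\<lambda>m. q (f m)"] int int'
    by (simp add: integral_count_space_nat)
qed

lemma op_l2: "g \<in> carrier H \<Longrightarrow> f \<in> l2_space UNIV \<Longrightarrow> op g f \<in> l2_space UNIV"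
  using op_sums(1)[of g "\<lambda>z. (cmod z)\<^sup>2" f] by (simp add: l2_space_def norm_mult)

lemma op_l2_norm: "g \<in> carrier H \<Longrightarrow> f \<in> l2_space UNIV \<Longrightarrow> l2_norm (op g f) = l2_norm f"
  using op_sums(2)[of g "\<lambda>z. (cmod z)\<^sup>2" f] by (simp add: l2_space_def l2_norm_def norm_mult)

lemma op_lin: "op g (\<lambda>m. a * f m + b * h m) = (\<lambda>m. a * op g f m + b * op g h m)"
  by (auto simp: op_def algebra_simps)

lemma op_diff: "op g (\<lambda>m. f m - h m) = (\<lambda>m. op g f m - op g h m)"
  by (auto simp: op_def algebra_simps)

lemma l2_norm_zeroD:
  assumes "f \<in> l2_space UNIV" "l2_norm f = 0"
  shows "f = (\<lambda>_. 0)"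
  using assms suminf_eq_zero_iff[of "\<lambda>n. (cmod (f n))\<^sup>2"] by (auto simp: l2_norm_def l2_space_def)

text \<open>\<open>h\<close> is the orthogonal projection of \<open>v\<close> to the closed span of
  the vectors \<open>inv_vec n\<close>. The operators \<open>op g\<close> are isometric, so being
  fixed by them passes to norm limits, and the whole span consists of invariant vectors.\<close>

lemma projection_l2:
  assumes v: "v \<in> l2_space UNIV"
  shows "\<exists>h\<in>l2_space UNIV. (\<forall>g\<in>carrier H. op g h = h) \<and> perp (\<lambda>m. v m - h m)"
proof -
  interpret L: semi_hilbert "l2_space UNIV" "ip (count_space UNIV)" by (rule semi_hilbert_l2)
  have u: "inv_vec n \<in> l2_space UNIV" for n by (rule l2_space_finite[OF inv_vec_finite])
  obtain h where h: "h \<in> L.cspan inv_vec" "\<And>n. ip (count_space UNIV) (\<lambda>m. v m - h m) (inv_vec n) = 0"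
    using L.projection[of inv_vec, OF u v] by auto
  have "h \<in> {f \<in> l2_space UNIV. \<forall>g\<in>carrier H. op g f = f}"
  proof (rule L.cspan_induct[of inv_vec, OF u _ _ _ h(1)])
    show "inv_vec n \<in> {f \<in> l2_space UNIV. \<forall>g\<in>carrier H. op g f = f}" for n
      using u inv_vec_op by simp
  next
    fix f k a b
    assume "f \<in> {f \<in> l2_space UNIV. \<forall>g\<in>carrier H. op g f = f}" "k \<in> {f \<in> l2_space UNIV. \<forall>g\<in>carrier H. op g f = f}"
    then show "(\<lambda>m. a * f m + b * k m) \<in> {f \<in> l2_space UNIV. \<forall>g\<in>carrier H. op g f = f}"
      by (simp add: L.V_lin op_lin)
  next
    fix f assume f: "f \<in> l2_space UNIV"
      and ap: "\<And>\<epsilon>. \<epsilon> > 0 \<Longrightarrow> \<exists>k\<in>{f \<in> l2_space UNIV. \<forall>g\<in>carrier H. op g f = f}. L.nrm (\<lambda>m. f m - k m) < \<epsilon>"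
    have "op g f = f" if g: "g \<in> carrier H" for g
    proof -
      have of: "op g f \<in> l2_space UNIV" by (rule op_l2[OF g f])
      have d: "(\<lambda>m. op g f m - f m) \<in> l2_space UNIV" by (rule L.V_diff[OF of f])
      have "L.nrm (\<lambda>m. op g f m - f m) \<le> \<epsilon>" if e: "\<epsilon> > 0" for \<epsilon>
      proof -
        obtain k where k: "k \<in> l2_space UNIV" "op g k = k" "L.nrm (\<lambda>m. f m - k m) < \<epsilon> / 2"
          using ap[of "\<epsilon>/2"] e g by auto
        have fk: "(\<lambda>m. f m - k m) \<in> l2_space UNIV" by (rule L.V_diff[OF f k(1)])
        have "L.nrm (\<lambda>m. op g f m - f m) \<le> L.nrm (\<lambda>m. op g f m - k m) + L.nrm (\<lambda>m. k m - f m)"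
          by (rule L.nrm_triangle_diff[OF of k(1) f])
        also have "(\<lambda>m. op g f m - k m) = op g (\<lambda>m. f m - k m)" by (simp add: op_diff k(2))
        also have "L.nrm (op g (\<lambda>m. f m - k m)) = L.nrm (\<lambda>m. f m - k m)"
          by (simp add: nrm_l2 op_l2[OF g fk] fk op_l2_norm[OF g fk])
        also have "L.nrm (\<lambda>m. k m - f m) = L.nrm (\<lambda>m. f m - k m)"
          by (rule L.nrm_minus_commute[OF k(1) f])
        finally show ?thesis using k(3) by simp
      qed
      then have "L.nrm (\<lambda>m. op g f m - f m) \<le> 0" by (rule field_le_epsilon) simp
      then have "l2_norm (\<lambda>m. op g f m - f m) = 0"
        using nrm_l2[OF d] L.nrm_nonneg[OF d] by simp
      from fun_cong[OF l2_norm_zeroD[OF d this]] show ?thesis by (auto simp: fun_eq_iff)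
    qed
    then show "f \<in> {f \<in> l2_space UNIV. \<forall>g\<in>carrier H. op g f = f}" using f by simp
  qed
  then have hl: "h \<in> l2_space UNIV" "\<forall>g\<in>carrier H. op g h = h" by auto
  have "(\<Sum>m | inv_vec n m \<noteq> 0. (v m - h m) * cnj (inv_vec n m)) = ip (count_space UNIV) (\<lambda>m. v m - h m) (inv_vec n)" for n
    unfolding ip_def
    by (subst lebesgue_integral_count_space_finite_support) (auto intro!: finite_subset[OF _ inv_vec_finite[of n]] sum.mono_neutral_right)
  then have "perp (\<lambda>m. v m - h m)" by (simp add: perp_def h(2))
  with hl show ?thesis by blast
qed

end

text \<open>Lamperti's theorem provides a permutation and scalars for each \<open>g\<close>
  separately. Unit vectors determine both, so multiplicativity of \<open>\<pi>\<close> becomes the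
  action law of \<open>s\<close> and the cocycle law of \<open>c\<close>.\<close>

lemma orth_rep_monomial:
  assumes H: "group H" and p: "1 < p" "p \<noteq> 2" and \<pi>: "orth_rep H p \<pi>"
  obtains c s where "monomial_action H c s"
    "\<And>g f. g \<in> carrier H \<Longrightarrow> f \<in> lp_space p \<Longrightarrow> \<pi> g f = (\<lambda>m. c g m * f (s g m))"
proof -
  interpret group H by (rule H)
  have iso: "lp_isometry p (\<pi> g)" if "g \<in> carrier H" for g
    using \<pi> that by (simp add: orth_rep_def)
  have "\<forall>g\<in>carrier H. \<exists>cs. (\<forall>m. cmod (fst cs m) = 1) \<and> (\<forall>f\<in>lp_space p. \<forall>m. \<pi> g f m = fst cs m * f (snd cs m))"
  proof
    fix g assume "g \<in> carrier H"
    then obtain c s where "bij s" "\<And>m. cmod (c m) = 1" "\<And>f m. f \<in> lp_space p \<Longrightarrow> \<pi> g f m = c m * f (s m)"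
      using lamperti[OF p iso] by metis
    then show "\<exists>cs. (\<forall>m. cmod (fst cs m) = 1) \<and> (\<forall>f\<in>lp_space p. \<forall>m. \<pi> g f m = fst cs m * f (snd cs m))"
      by (intro exI[of _ "(c, s)"]) simp
  qed
  then obtain cs where cs: "\<And>g m. g \<in> carrier H \<Longrightarrow> cmod (fst (cs g) m) = 1"
    "\<And>g f m. g \<in> carrier H \<Longrightarrow> f \<in> lp_space p \<Longrightarrow> \<pi> g f m = fst (cs g) m * f (snd (cs g) m)"
    by (metis bchoice)
  define c where "c g = fst (cs g)" for g
  define s where "s g = snd (cs g)" for g
  have cu: "cmod (c g m) = 1" if "g \<in> carrier H" for g m using cs(1)[OF that] by (simp add: c_def)
  have c0: "c g m \<noteq> 0" if "g \<in> carrier H" for g m using cu[OF that, of m] by auto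
  have op: "\<pi> g f m = c g m * f (s g m)" if "g \<in> carrier H" "f \<in> lp_space p" for g f m
    using cs(2)[OF that] by (simp add: c_def s_def)
  have in_lp: "\<pi> g f \<in> lp_space p" if "g \<in> carrier H" "f \<in> lp_space p" for g f
    using iso[OF that(1)] that(2) by (auto simp: lp_isometry_def bij_betw_def)
  have uniq: "a = b \<and> n = k" if "a \<noteq> 0" "\<And>f. f \<in> lp_space p \<Longrightarrow> a * f n = b * f k" for a b :: complex and n k
    using that(1) that(2)[OF unit_vec_lp, of n] that(2)[OF unit_vec_lp, of k] by (auto simp: unit_vec_def split: if_splits)
  have mult: "c (g \<otimes>\<^bsub>H\<^esub> h) m = c g m * c h (s g m) \<and> s (g \<otimes>\<^bsub>H\<^esub> h) m = s h (s g m)"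
    if g: "g \<in> carrier H" and h: "h \<in> carrier H" for g h m
  proof (rule uniq)
    fix f assume f: "f \<in> lp_space p"
    have "\<pi> (g \<otimes>\<^bsub>H\<^esub> h) f m = \<pi> g (\<pi> h f) m"
      using \<pi> g h f by (simp add: orth_rep_def)
    then show "c (g \<otimes>\<^bsub>H\<^esub> h) m * f (s (g \<otimes>\<^bsub>H\<^esub> h) m) = c g m * c h (s g m) * f (s h (s g m))"
      using g h f in_lp[OF h f] by (simp add: op mult.assoc)
  qed (use g h c0 in simp)
  have one: "c \<one>\<^bsub>H\<^esub> m = 1 \<and> s \<one>\<^bsub>H\<^esub> m = m" for m
  proof (rule uniq)
    fix f assume f: "f \<in> lp_space p"
    have "\<pi> \<one>\<^bsub>H\<^esub> f m = f m" using \<pi> f by (simp add: orth_rep_def)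
    then show "c \<one>\<^bsub>H\<^esub> m * f (s \<one>\<^bsub>H\<^esub> m) = 1 * f m" using f by (simp add: op)
  qed (use c0 in simp)
  have "monomial_action H c s"
    by standard (use H cu mult one in auto)
  moreover have "\<pi> g f = (\<lambda>m. c g m * f (s g m))" if "g \<in> carrier H" "f \<in> lp_space p" for g f
    using op[OF that] by auto
  ultimately show thesis using that by blast
qed

section \<open>Almost invariant vectors carried from \<open>lp_space p\<close> to
  \<open>l2_space UNIV\<close>\<close>

context monomial_action
begin

text \<open>This is the duality map of \<open>lp_space p\<close>. The exponent \<open>p - 1\<close>
  is the one that lands in the conjugate space, and the unimodular factor of \<open>op\<close>
  cancels against its conjugate, so invariance of \<open>y\<close> passes to the dual
  vector.\<close>

lemma dual_vector_invariant:
  assumes p: "1 < p" and y: "y \<in> lp_space p" "\<And>g. g \<in> carrier H \<Longrightarrow> op g y = y"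
    and \<pi>: "\<And>g f. g \<in> carrier H \<Longrightarrow> f \<in> lp_space p \<Longrightarrow> \<pi> g f = op g f"
  shows "(\<lambda>m. cnj (mazur (p - 1) (y m))) \<in> dual_invariant_vectors H p \<pi>"
proof -
  interpret group H by (rule group_H)
  let ?h = "\<lambda>m. cnj (mazur (p - 1) (y m))"
  have ch: "cmod (?h m) = cmod (y m) powr (p - 1)" for m by (simp add: cmod_mazur)
  have sy: "summable (\<lambda>m. cmod (y m) powr p)" using y by (simp add: lp_space_def)
  have "?h \<in> lp_space (conj_exp p)"
    unfolding lp_space_def mem_Collect_eq ch powr_powr conj_exp_def using sy p by simp
  moreover have "pairing (\<pi> (inv\<^bsub>H\<^esub> g) f) ?h = pairing f ?h" if g: "g \<in> carrier H" and f: "f \<in> lp_space p" for g f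
  proof -
    have ig: "inv\<^bsub>H\<^esub> g \<in> carrier H" using g by simp
    let ?g = "inv\<^bsub>H\<^esub> g"
    have sf: "summable (\<lambda>m. cmod (f m) powr p)" using f by (simp add: lp_space_def)
    have pt: "op ?g f m * ?h m = f (s ?g m) * ?h (s ?g m)" for m
    proof -
      have "y m = c ?g m * y (s ?g m)" using fun_cong[OF y(2)[OF ig], of m] by (simp add: op_def)
      then have "mazur (p - 1) (y m) = c ?g m * mazur (p - 1) (y (s ?g m))"
        using c_unit[OF ig] by (simp add: mazur_unit)
      moreover have "c ?g m * cnj (c ?g m) = 1"
        using c_unit[OF ig, of m] complex_norm_square[of "c ?g m"] by simp
      ultimately show ?thesis by (simp add: op_def mult_ac)
    qed
    have "summable (\<lambda>m. cmod (f m * ?h m))"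
    proof (rule summable_comparison_test')
      show "summable (\<lambda>m. cmod (f m) powr p + cmod (y m) powr p)" by (rule summable_add[OF sf sy])
      fix m
      have "cmod (f m) * cmod (y m) powr (p - 1) \<le> max (cmod (f m)) (cmod (y m)) * max (cmod (f m)) (cmod (y m)) powr (p - 1)"
        using p by (intro mult_mono powr_mono2) (auto simp: le_max_iff_disj)
      also have "\<dots> \<le> max (cmod (f m)) (cmod (y m)) powr p"
      proof (cases "max (cmod (f m)) (cmod (y m)) = 0")
        case False
        then have "max (cmod (f m)) (cmod (y m)) powr p = max (cmod (f m)) (cmod (y m)) powr 1 * max (cmod (f m)) (cmod (y m)) powr (p - 1)"
          by (subst powr_add[symmetric]) simp
        moreover have "max (cmod (f m)) (cmod (y m)) \<ge> 0" by (simp add: le_max_iff_disj)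
        ultimately show ?thesis by simp
      qed simp
      also have "\<dots> \<le> cmod (f m) powr p + cmod (y m) powr p" by (auto simp: max_def)
      finally show "norm (cmod (f m * ?h m)) \<le> cmod (f m) powr p + cmod (y m) powr p"
        using ch[of m] by (simp add: norm_mult)
    qed
    then have int: "integrable (count_space UNIV) (\<lambda>m. f m * ?h m)"
      by (simp add: integrable_count_space_nat_iff)
    have int': "integrable (count_space UNIV) (\<lambda>m. f (s ?g m) * ?h (s ?g m))"
      using integrable_bij_count_space[OF bij_s[OF ig], of "\<lambda>m. f m * ?h m"] int by simp
    have "pairing (\<pi> ?g f) ?h = (\<Sum>m. f (s ?g m) * ?h (s ?g m))"
      unfolding pairing_def \<pi>[OF ig f] pt ..
    also have "\<dots> = pairing f ?h"
      unfolding pairing_def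
      using integral_bij_count_space[OF bij_s[OF ig], of "\<lambda>m. f m * ?h m"]
      by (simp only: integral_count_space_nat[OF int] integral_count_space_nat[OF int'])
    finally show ?thesis .
  qed
  ultimately show ?thesis by (simp add: dual_invariant_vectors_def)
qed

text \<open>The pairing of \<open>y\<close> with its dual vector is the left-hand sum, and as
  \<open>F\<close> annihilates that vector, it equals minus the pairing of \<open>F - y\<close>. A
  Young inequality bounds the latter by half of the left-hand sum, which is absorbed, plus a
  multiple of the right-hand sum.\<close>

lemma annihilator_estimate:
  assumes p: "1 < p" and F: "F \<in> lp_prime H p \<pi>"
    and y: "y \<in> lp_space p" "\<And>g. g \<in> carrier H \<Longrightarrow> op g y = y"
    and \<pi>: "\<And>g f. g \<in> carrier H \<Longrightarrow> f \<in> lp_space p \<Longrightarrow> \<pi> g f = op g f"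
  shows "(\<Sum>m. cmod (y m) powr p) \<le> 2 powr p * (\<Sum>m. cmod (F m - y m) powr p)"
proof -
  have p0: "p > 0" using p by simp
  let ?h = "\<lambda>m. cnj (mazur (p - 1) (y m))"
  have Flp: "F \<in> lp_space p" using F by (simp add: lp_prime_def)
  have z: "pairing F ?h = 0"
    using F dual_vector_invariant[OF p y \<pi>] by (simp add: lp_prime_def)
  have sy: "summable (\<lambda>m. cmod (y m) powr p)" using y by (simp add: lp_space_def)
  have sd: "summable (\<lambda>m. cmod (F m - y m) powr p)"
    using lp_space_diff[OF p0 Flp y(1)] by (simp add: lp_space_def)
  have yh: "y m * ?h m = of_real (cmod (y m) powr p)" for m
  proof (cases "y m = 0")
    case False
    have "y m * ?h m = of_real (cmod (y m) powr (p - 2)) * (y m * cnj (y m))"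
      by (simp add: mazur_def)
    also have "\<dots> = of_real (cmod (y m) powr (p - 2) * cmod (y m) powr 2)"
      by (simp add: complex_norm_square[symmetric])
    also have "cmod (y m) powr (p - 2) * cmod (y m) powr 2 = cmod (y m) powr p"
      by (subst powr_add[symmetric]) simp
    finally show ?thesis .
  qed (simp add: mazur_def)
  \<comment> \<open>If \<open>cmod (F m - y m)\<close> is at most half of \<open>cmod (y m)\<close>,
    the first term suffices. Otherwise \<open>cmod (y m)\<close> is less than twice the difference,
    which is the origin of \<open>2 powr (p - 1)\<close>.\<close>
  let ?b = "\<lambda>m. (1/2) * cmod (y m) powr p + 2 powr (p - 1) * cmod (F m - y m) powr p"
  have young: "cmod ((F m - y m) * ?h m) \<le> ?b m" for m
  proof -
    let ?d = "cmod (F m - y m)" and ?y = "cmod (y m)"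
    have e: "cmod ((F m - y m) * ?h m) = ?d * ?y powr (p - 1)" by (simp add: norm_mult cmod_mazur)
    show ?thesis
    proof (cases "?d \<le> ?y / 2")
      case True
      have yy: "?y * ?y powr (p - 1) = ?y powr p"
      proof (cases "?y = 0")
        case False
        then have "?y powr p = ?y powr 1 * ?y powr (p - 1)" by (subst powr_add[symmetric]) simp
        then show ?thesis by simp
      qed (use p in simp)
      have "?d * ?y powr (p - 1) \<le> (?y / 2) * ?y powr (p - 1)"
        using True by (intro mult_right_mono) auto
      also have "\<dots> = (1/2) * ?y powr p" using yy by simp
      also have "\<dots> \<le> ?b m" by simp
      finally show ?thesis unfolding e .
    next
      case False
      then have d0: "?d > 0" using norm_ge_zero[of "y m"] by linarith
      have "?d * ?y powr (p - 1) \<le> ?d * (2 * ?d) powr (p - 1)"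
        using False p by (intro mult_left_mono powr_mono2) auto
      also have "\<dots> = 2 powr (p - 1) * (?d powr 1 * ?d powr (p - 1))"
        using d0 by (simp add: powr_mult)
      also have "?d powr 1 * ?d powr (p - 1) = ?d powr p"
        by (subst powr_add[symmetric]) simp
      also have "2 powr (p - 1) * ?d powr p \<le> ?b m" by simp
      finally show ?thesis unfolding e .
    qed
  qed
  have sb: "summable ?b" by (intro summable_add summable_mult sy sd)
  have sn: "summable (\<lambda>m. norm ((F m - y m) * ?h m))"
    by (rule summable_comparison_test'[OF sb, of 0]) (use young in auto)
  have s1: "summable (\<lambda>m. (F m - y m) * ?h m)" by (rule summable_norm_cancel[OF sn])
  have s2: "summable (\<lambda>m. y m * ?h m)" unfolding yh using sy by (rule summable_of_real)
  have "(\<Sum>m. (F m - y m) * ?h m) + (\<Sum>m. y m * ?h m) = (\<Sum>m. F m * ?h m)"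
    by (subst suminf_add[OF s1 s2]) (simp add: algebra_simps)
  then have "(\<Sum>m. y m * ?h m) = - (\<Sum>m. (F m - y m) * ?h m)"
    using z by (simp add: pairing_def add_eq_0_iff)
  then have "cmod (\<Sum>m. y m * ?h m) = cmod (\<Sum>m. (F m - y m) * ?h m)" by simp
  also have "\<dots> \<le> (\<Sum>m. norm ((F m - y m) * ?h m))" by (rule summable_norm[OF sn])
  also have "\<dots> \<le> (\<Sum>m. ?b m)" by (rule suminf_le[OF young sn sb])
  also have "\<dots> = (1/2) * (\<Sum>m. cmod (y m) powr p) + 2 powr (p - 1) * (\<Sum>m. cmod (F m - y m) powr p)"
    using sy sd by (simp add: suminf_add[symmetric] suminf_mult summable_mult suminf_divide)
  finally have "cmod (\<Sum>m. y m * ?h m) \<le> (1/2) * (\<Sum>m. cmod (y m) powr p) + 2 powr (p - 1) * (\<Sum>m. cmod (F m - y m) powr p)" .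
  moreover have "cmod (\<Sum>m. y m * ?h m) = (\<Sum>m. cmod (y m) powr p)"
    unfolding yh using sy by (simp add: suminf_of_real[symmetric] suminf_nonneg)
  moreover have "(2::real) powr p = 2 * 2 powr (p - 1)"
    using powr_add[of 2 1 "p - 1"] by simp
  ultimately show ?thesis by simp
qed

text \<open>If the \<open>\<ell>\<^sub>2\<close>-images of the almost invariant vectors under the Mazur map approached the invariant
vectors, so would the original vectors, which annihilate the dual invariant vectors.\<close>

lemma reduction_to_l2:
  assumes p: "1 < p"
    and \<pi>: "\<And>g f. g \<in> carrier H \<Longrightarrow> f \<in> lp_space p \<Longrightarrow> \<pi> g f = op g f"
    and F: "\<And>k. F k \<in> lp_prime H p \<pi>" "\<And>k. lp_norm p (F k) = 1"
    and ai: "\<And>g. g \<in> carrier H \<Longrightarrow> (\<lambda>k. lp_norm p (\<lambda>n. \<pi> g (F k) n - F k n)) \<longlonglongrightarrow> 0"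
  obtains v where "\<And>k. v k \<in> l2_space UNIV" "\<And>k. l2_norm (v k) = 1" "\<And>k. perp (v k)"
    "\<And>g. g \<in> carrier H \<Longrightarrow> (\<lambda>k. l2_norm (\<lambda>n. op g (v k) n - v k n)) \<longlonglongrightarrow> 0"
proof -
  interpret L: semi_hilbert "l2_space UNIV" "ip (count_space UNIV)" by (rule semi_hilbert_l2)
  have p0: "p > 0" using p by simp
  have sq: "x powr 2 = x\<^sup>2" if "x \<ge> 0" for x :: real using that by simp
  have Flp: "F k \<in> lp_space p" for k using F by (simp add: lp_prime_def)
  have F1: "(\<Sum>n. cmod (F k n) powr p) = 1" for k
    using lp_norm_powr[OF p0 Flp[of k]] F(2)[of k] by simp
  \<comment> \<open>With the exponent \<open>p / 2\<close> the squared moduli of \<open>w k\<close>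
    are the \<open>p\<close>-th powers of those of \<open>F k\<close>, so \<open>w k\<close> has
    norm 1.\<close>
  define w where "w k n = mazur (p / 2) (F k n)" for k n
  have w2: "(cmod (w k n))\<^sup>2 = cmod (F k n) powr p" for k n
    unfolding w_def cmod_mazur using sq[of "cmod (F k n) powr (p/2)"] by (simp add: powr_powr)
  have wl: "w k \<in> l2_space UNIV" for k
    using Flp[of k] by (simp add: l2_space_def w2 lp_space_def)
  have opF: "op g (F k) \<in> lp_space p" "(\<Sum>n. cmod (op g (F k) n) powr p) = 1" if "g \<in> carrier H" for g k
    using op_sums[OF that, of "\<lambda>z. cmod z powr p" "F k"] Flp[of k] F1[of k]
    by (auto simp: lp_space_def norm_mult)
  have w_ai: "(\<lambda>k. l2_norm (\<lambda>n. op g (w k) n - w k n)) \<longlonglongrightarrow> 0" if g: "g \<in> carrier H" for g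
  proof -
    have "(\<lambda>k. lp_norm p (\<lambda>n. \<pi> g (F k) n - F k n) powr p) \<longlonglongrightarrow> 0 powr p"
      using p0 by (intro tendsto_powr'[OF ai[OF g] tendsto_const]) (auto simp: lp_norm_def)
    moreover have "lp_norm p (\<lambda>n. \<pi> g (F k) n - F k n) powr p = (\<Sum>n. cmod (op g (F k) n - F k n) powr p)" for k
      unfolding \<pi>[OF g Flp] by (rule lp_norm_powr[OF p0 lp_space_diff[OF p0 opF(1)[OF g] Flp]])
    ultimately have "(\<lambda>k. \<Sum>n. cmod (op g (F k) n - F k n) powr p) \<longlonglongrightarrow> 0" by simp
    then have "(\<lambda>k. \<Sum>n. cmod (mazur (p/2) (op g (F k) n) - mazur (p/2) (F k n)) powr 2) \<longlonglongrightarrow> 0"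
      using p0 opF[OF g] Flp F1 by (intro mazur_limit[where p = p and A = 1]) auto
    moreover have "mazur (p/2) (op g (F k) n) = op g (w k) n" for k n
      by (simp add: op_def w_def mazur_unit c_unit[OF g])
    ultimately have "(\<lambda>k. \<Sum>n. (cmod (op g (w k) n - w k n))\<^sup>2) \<longlonglongrightarrow> 0"
      by (simp add: w_def)
    from tendsto_real_sqrt[OF this] show ?thesis by (simp add: l2_norm_def)
  qed
  have "\<forall>k. \<exists>h. h \<in> l2_space UNIV \<and> (\<forall>g\<in>carrier H. op g h = h) \<and> perp (\<lambda>m. w k m - h m)"
    using projection_l2[OF wl] by blast
  then obtain P where P: "\<And>k. P k \<in> l2_space UNIV" "\<And>k g. g \<in> carrier H \<Longrightarrow> op g (P k) = P k"
    "\<And>k. perp (\<lambda>m. w k m - P k m)"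
    by metis
  define r where "r k = (\<lambda>m. w k m - P k m)" for k
  have rl: "r k \<in> l2_space UNIV" for k unfolding r_def by (rule L.V_diff[OF wl P(1)])
  have nonneg: "l2_norm f \<ge> 0" if "f \<in> l2_space UNIV" for f
    using nrm_l2[OF that] L.nrm_nonneg[OF that] by simp
  have l2sq: "(l2_norm f)\<^sup>2 = (\<Sum>n. (cmod (f n))\<^sup>2)" if "f \<in> l2_space UNIV" for f
    using that by (simp add: l2_norm_def l2_space_def suminf_nonneg)
  have not0: "\<not> (\<lambda>k. l2_norm (r k)) \<longlonglongrightarrow> 0"
  proof
    assume lim: "(\<lambda>k. l2_norm (r k)) \<longlonglongrightarrow> 0"
    then have bdd: "Bseq (\<lambda>k. l2_norm (r k))" by (intro convergent_imp_Bseq convergentI)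
    then obtain R where R: "\<And>k. norm (l2_norm (r k)) \<le> R" unfolding Bseq_def by blast
    have w1: "l2_norm (w k) = 1" for k using F1[of k] by (simp add: l2_norm_def w2)
    have Pn: "l2_norm (P k) \<le> R + 1" for k
    proof -
      have "L.nrm (P k) \<le> L.nrm (w k) + L.nrm (\<lambda>m. w k m - P k m)"
        using L.nrm_diff_le[OF wl P(1), of k k] by linarith
      then show ?thesis using R[of k] w1[of k] nrm_l2[OF P(1)] nrm_l2[OF wl] nrm_l2[OF rl] by (simp add: r_def)
    qed
    define A where "A = max 1 ((R + 1)\<^sup>2)"
    have "(\<lambda>k. (l2_norm (r k))\<^sup>2) \<longlonglongrightarrow> 0\<^sup>2" by (rule tendsto_power[OF lim])
    then have lim2: "(\<lambda>k. \<Sum>n. cmod (w k n - P k n) powr 2) \<longlonglongrightarrow> 0"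
      unfolding l2sq[OF rl] by (simp add: r_def)
    have lp2: "f \<in> lp_space 2" if "f \<in> l2_space UNIV" for f
      using that by (simp add: lp_space_def l2_space_def)
    have PA: "(\<Sum>n. cmod (P k n) powr 2) \<le> A" for k
      using l2sq[OF P(1)] power_mono[OF Pn[of k] nonneg[OF P(1)], of 2] by (simp add: A_def le_max_iff_disj)
    have wA: "(\<Sum>n. cmod (w k n) powr 2) \<le> A" for k
      using F1[of k] by (simp add: w2 A_def)
    have "(\<lambda>k. \<Sum>n. cmod (mazur (2/p) (w k n) - mazur (2/p) (P k n)) powr p) \<longlonglongrightarrow> 0"
      by (rule mazur_limit[where p = 2 and A = A]) (use p0 lp2[OF wl] lp2[OF P(1)] PA wA lim2 in auto)
    moreover have "mazur (2/p) (w k n) = F k n" for k n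
      using mazur_inverse[of "p/2" "F k n"] p0 by (simp add: w_def)
    ultimately have d: "(\<lambda>k. \<Sum>n. cmod (F k n - mazur (2/p) (P k n)) powr p) \<longlonglongrightarrow> 0" by simp
    define y where "y k n = mazur (2/p) (P k n)" for k n
    have ylp: "y k \<in> lp_space p" for k
      using P(1)[of k] p0 by (simp add: lp_space_def y_def cmod_mazur powr_powr l2_space_def)
    have yinv: "op g (y k) = y k" if g: "g \<in> carrier H" for g k
    proof
      fix m
      have "op g (y k) m = mazur (2/p) (op g (P k) m)"
        by (simp add: op_def y_def mazur_unit c_unit[OF g])
      then show "op g (y k) m = y k m" by (simp add: P(2)[OF g] y_def)
    qed
    \<comment> \<open>\<open>annihilator_estimate\<close> bounds \<open>y k\<close> by
      \<open>F k - y k\<close>, hence also the unit vector \<open>F k\<close>; the distance from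
      \<open>F k\<close> to \<open>y k\<close> is thus bounded below independently of
      \<open>k\<close>.\<close>
    have le: "1 \<le> 2 powr p * ((1 + 2 powr p) * (\<Sum>n. cmod (F k n - y k n) powr p))" for k
    proof -
      have sd: "summable (\<lambda>m. cmod (F k m - y k m) powr p)" and sy: "summable (\<lambda>m. cmod (y k m) powr p)"
        using lp_space_diff[OF p0 Flp ylp] ylp by (auto simp: lp_space_def)
      have sF: "summable (\<lambda>m. cmod (F k m) powr p)" using Flp by (simp add: lp_space_def)
      have "1 = (\<Sum>n. cmod (F k n) powr p)" by (simp add: F1)
      also have "\<dots> \<le> (\<Sum>n. 2 powr p * (cmod (F k n - y k n) powr p + cmod (y k n) powr p))"
      proof (intro suminf_le sF summable_mult summable_add sd sy)
        show "cmod (F k n) powr p \<le> 2 powr p * (cmod (F k n - y k n) powr p + cmod (y k n) powr p)" for n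
          using cmod_add_powr_le[OF p0, of "F k n - y k n" "y k n"] by simp
      qed
      also have "\<dots> = 2 powr p * ((\<Sum>n. cmod (F k n - y k n) powr p) + (\<Sum>n. cmod (y k n) powr p))"
        using sd sy by (simp add: suminf_add[symmetric] suminf_mult summable_add)
      also have "\<dots> \<le> 2 powr p * ((\<Sum>n. cmod (F k n - y k n) powr p) + 2 powr p * (\<Sum>n. cmod (F k n - y k n) powr p))"
        using annihilator_estimate[OF p F(1) ylp yinv \<pi>, of k k] by (intro mult_left_mono add_left_mono) auto
      finally show ?thesis by (simp add: algebra_simps)
    qed
    have "(\<lambda>k. 2 powr p * ((1 + 2 powr p) * (\<Sum>n. cmod (F k n - y k n) powr p))) \<longlonglongrightarrow> 2 powr p * ((1 + 2 powr p) * 0)"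
      using d by (intro tendsto_mult tendsto_const) (simp add: y_def)
    then have "1 \<le> 2 powr p * ((1 + 2 powr p) * (0::real))"
      by (rule LIMSEQ_le_const) (use le in blast)
    then show False by simp
  qed
  then obtain \<epsilon> where e: "\<epsilon> > 0" "\<And>N. \<exists>k\<ge>N. \<not> norm (l2_norm (r k) - 0) < \<epsilon>"
    unfolding LIMSEQ_iff by blast
  \<comment> \<open>Along \<open>\<kappa>\<close> the components \<open>r\<close> stay away from
    zero and can be normalised at bounded cost; \<open>\<kappa> N \<ge> N\<close> preserves the
    limits.\<close>
  then obtain \<kappa> where \<kappa>: "\<And>N. \<kappa> N \<ge> N" "\<And>N. \<epsilon> \<le> l2_norm (r (\<kappa> N))"
    using nonneg[OF rl] by (metis abs_of_nonneg diff_zero not_less real_norm_def)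
  define v where "v N = (\<lambda>m. of_real (1 / l2_norm (r (\<kappa> N))) * r (\<kappa> N) m)" for N
  have vl: "v N \<in> l2_space UNIV" for N unfolding v_def by (rule L.V_scale[OF rl])
  have rpos: "l2_norm (r (\<kappa> N)) > 0" for N using \<kappa>(2)[of N] e(1) by linarith
  have l2_scale: "l2_norm (\<lambda>m. of_real a * f m) = \<bar>a\<bar> * l2_norm f" if "f \<in> l2_space UNIV" for a f
    using nrm_l2[OF that] nrm_l2[OF L.V_scale[OF that, of "of_real a"]] L.nrm_scale[OF that, of "of_real a"] by simp
  show thesis
  proof (rule that[of v])
    show "v N \<in> l2_space UNIV" for N by (rule vl)
    show "l2_norm (v N) = 1" for N unfolding v_def l2_scale[OF rl] using rpos[of N] by simp
    show "perp (v N)" for N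
      unfolding v_def r_def by (rule perp_scale[OF P(3)])
    show "(\<lambda>k. l2_norm (\<lambda>n. op g (v k) n - v k n)) \<longlonglongrightarrow> 0" if g: "g \<in> carrier H" for g
    proof (rule Lim_null_comparison)
      have "filterlim \<kappa> sequentially sequentially"
        by (rule filterlim_at_top_mono[OF filterlim_ident]) (use \<kappa>(1) in simp)
      then have "(\<lambda>N. l2_norm (\<lambda>n. op g (w (\<kappa> N)) n - w (\<kappa> N) n)) \<longlonglongrightarrow> 0"
        using filterlim_compose[OF w_ai[OF g]] by blast
      from tendsto_mult_right_zero[OF this, of "1 / \<epsilon>"]
      show "(\<lambda>N. (1 / \<epsilon>) * l2_norm (\<lambda>n. op g (w (\<kappa> N)) n - w (\<kappa> N) n)) \<longlonglongrightarrow> 0" .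
      have "norm (l2_norm (\<lambda>n. op g (v N) n - v N n)) \<le> (1 / \<epsilon>) * l2_norm (\<lambda>n. op g (w (\<kappa> N)) n - w (\<kappa> N) n)" for N
      proof -
        have d: "(\<lambda>n. op g (w (\<kappa> N)) n - w (\<kappa> N) n) \<in> l2_space UNIV" by (rule L.V_diff[OF op_l2[OF g wl] wl])
        define a where "a = complex_of_real (1 / l2_norm (r (\<kappa> N)))"
        have va: "v N = (\<lambda>m. a * r (\<kappa> N) m)" by (simp add: v_def a_def)
        have "op g (v N) n - v N n = a * (op g (r (\<kappa> N)) n - r (\<kappa> N) n)" for n
          unfolding va op_def by (simp add: algebra_simps)
        \<comment> \<open>The invariant part \<open>P\<close> cancels, so \<open>r\<close> is moved
          by \<open>op g\<close> exactly as much as \<open>w\<close> is.\<close>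
        moreover have "op g (r (\<kappa> N)) n - r (\<kappa> N) n = op g (w (\<kappa> N)) n - w (\<kappa> N) n" for n
          using P(2)[OF g, of "\<kappa> N"] by (simp add: r_def op_diff)
        ultimately have "(\<lambda>n. op g (v N) n - v N n) = (\<lambda>n. of_real (1 / l2_norm (r (\<kappa> N))) * (op g (w (\<kappa> N)) n - w (\<kappa> N) n))"
          by (simp only: a_def)
        then have "l2_norm (\<lambda>n. op g (v N) n - v N n) = (1 / l2_norm (r (\<kappa> N))) * l2_norm (\<lambda>n. op g (w (\<kappa> N)) n - w (\<kappa> N) n)"
          using l2_scale[OF d, of "1 / l2_norm (r (\<kappa> N))"] rpos[of N] by (simp only: abs_of_pos divide_pos_pos zero_less_one)
        also have "\<dots> \<le> (1 / \<epsilon>) * l2_norm (\<lambda>n. op g (w (\<kappa> N)) n - w (\<kappa> N) n)"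
          using \<kappa>(2)[of N] e(1) nonneg[OF d] by (intro mult_right_mono divide_left_mono) auto
        finally show ?thesis
          using nonneg[OF L.V_diff[OF op_l2[OF g vl] vl]] by simp
      qed
      then show "\<forall>\<^sub>F N in sequentially. norm (l2_norm (\<lambda>n. op g (v N) n - v N n)) \<le> (1 / \<epsilon>) * l2_norm (\<lambda>n. op g (w (\<kappa> N)) n - w (\<kappa> N) n)"
        by simp
    qed
  qed
qed

end

section \<open>Lattices in products\<close>

lemma (in sc_group) left_inv_Diff_swap:
  assumes M: "left_inv_measure G T M" and A: "A \<in> sets (borel_of T)" "emeasure M A < \<infinity>" and g: "g \<in> carrier G"
  shows "measure M {x \<in> carrier G. x \<notin> A \<and> inv g \<otimes> x \<in> A} = measure M {x \<in> A. inv g \<otimes> x \<notin> A}"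
proof -
  have sub: "A \<subseteq> carrier G" by (rule sets_borel_carrier[OF A(1)])
  let ?B = "(\<lambda>x. g \<otimes> x) ` A"
  have B: "?B \<in> sets (borel_of T)" by (rule left_image_sets[OF g A(1)])
  have eB: "emeasure M ?B = emeasure M A" using M g A by (simp add: left_inv_measure_def sets_borel_of)
  have Bx: "x \<in> ?B \<longleftrightarrow> x \<in> carrier G \<and> inv g \<otimes> x \<in> A" for x using left_image[OF g sub] by simp
  have sM: "A \<in> sets M" "?B \<in> sets M" using A B by (auto simp: left_inv_sets[OF M])
  have fin: "emeasure M A \<noteq> \<infinity>" "emeasure M ?B \<noteq> \<infinity>" using A eB by auto
  have "{x \<in> carrier G. x \<notin> A \<and> inv g \<otimes> x \<in> A} = ?B - (A \<inter> ?B)" using Bx by auto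
  moreover have "{x \<in> A. inv g \<otimes> x \<notin> A} = A - (A \<inter> ?B)" using Bx sub by auto
  moreover have "measure M (?B - (A \<inter> ?B)) = measure M ?B - measure M (A \<inter> ?B)"
    using sM fin by (intro measure_Diff) auto
  moreover have "measure M (A - (A \<inter> ?B)) = measure M A - measure M (A \<inter> ?B)"
    using sM fin by (intro measure_Diff) auto
  ultimately show ?thesis using eB by (simp add: measure_def)
qed

lemma (in sc_group) shift_set:
  assumes "A \<in> sets (borel_of T)" "g \<in> carrier G"
  shows "{x \<in> A. inv g \<otimes> x \<notin> A} \<in> sets (borel_of T)"
proof -
  have "{x \<in> A. inv g \<otimes> x \<notin> A} = A - (\<lambda>x. g \<otimes> x) ` A"
    using assms left_image[OF assms(2) sets_borel_carrier[OF assms(1)]] sets_borel_carrier[OF assms(1)] by auto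
  then show ?thesis using assms left_image_sets by auto
qed

text \<open>For open sets the indicator functions converge pointwise; the general case follows by
  generating the Borel sets from the open ones. Cutting with an open \<open>W\<close> of finite
  measure keeps complements under control.\<close>

lemma (in sc_group) shift_continuity_in_open:
  assumes M: "left_inv_measure G T M" and s: "\<And>k::nat. s k \<in> carrier G" "limitin T s \<one> sequentially"
    and W: "openin T W" "emeasure M W < \<infinity>" and A: "A \<in> sets (borel_of T)"
  shows "(\<lambda>k. measure M {x \<in> A \<inter> W. inv (s k) \<otimes> x \<notin> A \<inter> W}) \<longlonglongrightarrow> 0"
proof -
  note sM = left_inv_sets[OF M]
  have Ws: "W \<in> sets (borel_of T)" by (rule openin_sets_borel_of[OF W(1)])
  have Wc: "W \<subseteq> carrier G" by (rule sets_borel_carrier[OF Ws])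
  have fin: "emeasure M B \<noteq> \<infinity>" if "B \<subseteq> W" for B
    using emeasure_mono[OF that, of M] Ws W(2) sM by (auto simp: top_unique)
  have op: "(\<lambda>k. measure M {x \<in> U. inv (s k) \<otimes> x \<notin> U}) \<longlonglongrightarrow> 0" if U: "openin T U" "U \<subseteq> W" for U
  proof -
    have Us: "U \<in> sets (borel_of T)" by (rule openin_sets_borel_of[OF U(1)])
    have Uc: "U \<subseteq> carrier G" by (rule sets_borel_carrier[OF Us])
    have E: "{x \<in> U. inv (s k) \<otimes> x \<notin> U} \<in> sets M" for k
      using shift_set[OF Us s(1)] by (simp add: sM)
    have "(\<lambda>k. \<integral>x. indicator {x \<in> U. inv (s k) \<otimes> x \<notin> U} x \<partial>M) \<longlonglongrightarrow> (\<integral>x. (0::real) \<partial>M)"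
    proof (rule integral_dominated_convergence[where w = "indicator U"])
      show "integrable M (indicator U :: 'a \<Rightarrow> real)"
        using Us fin[OF U(2)] by (simp add: sM integrable_indicator_iff less_top)
      show "AE x in M. (\<lambda>k. indicator {x \<in> U. inv (s k) \<otimes> x \<notin> U} x) \<longlonglongrightarrow> (0::real)"
      proof (rule AE_I2)
        fix x assume "x \<in> space M"
        show "(\<lambda>k. indicator {x \<in> U. inv (s k) \<otimes> x \<notin> U} x) \<longlonglongrightarrow> (0::real)"
        proof (cases "x \<in> U")
          case True
          then have x: "x \<in> carrier G" using Uc by auto
          have "limitin T (\<lambda>k. inv (s k) \<otimes> x) (inv \<one> \<otimes> x) sequentially"
            by (rule mult_limitin[OF inv_limitin[OF s(2)] const_limitin[OF x]])
          then have "\<forall>\<^sub>F k in sequentially. inv (s k) \<otimes> x \<in> U"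
            using True U(1) x by (auto simp: limitin_def)
          then have "\<forall>\<^sub>F k in sequentially. indicator {x \<in> U. inv (s k) \<otimes> x \<notin> U} x = (0::real)"
            by eventually_elim auto
          then show ?thesis by (rule tendsto_eventually)
        qed simp
      qed
      show "AE x in M. norm (indicator {x \<in> U. inv (s k) \<otimes> x \<notin> U} x :: real) \<le> indicator U x" for k
        by (auto simp: indicator_def)
      show "(indicator {x \<in> U. inv (s k) \<otimes> x \<notin> U} :: 'a \<Rightarrow> real) \<in> borel_measurable M" for k
        using E by (intro borel_measurable_indicator)
    qed simp
    then show ?thesis using E by simp
  qed
  have A': "A \<in> sigma_sets (topspace T) {U. openin T U}"
    using A by (simp only: sets_borel_of borel_sets_of_def)
  have "Int_stable {U. openin T U}" by (auto simp: Int_stable_def)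
  from this borel_of_opens_Pow A' show ?thesis
  proof (induction rule: sigma_sets_induct_disjoint)
    case (basic U)
    then show ?case using W by (intro op) auto
  next
    case empty
    show ?case by simp
  next
    case (compl A)
    then have As: "A \<in> sets (borel_of T)" by (simp only: sets_borel_of borel_sets_of_def)
    have AW: "A \<inter> W \<in> sets (borel_of T)" using As Ws by auto
    \<comment> \<open>A point of the complement in \<open>W\<close> that is moved out of it either
      leaves \<open>W\<close> or enters \<open>A \<inter> W\<close>; by
      \<open>left_inv_Diff_swap\<close> entering has the same measure as leaving.\<close>
    have le: "measure M {x \<in> (topspace T - A) \<inter> W. inv (s k) \<otimes> x \<notin> (topspace T - A) \<inter> W}
       \<le> measure M {x \<in> W. inv (s k) \<otimes> x \<notin> W} + measure M {x \<in> A \<inter> W. inv (s k) \<otimes> x \<notin> A \<inter> W}" for k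
    proof -
      have swap: "measure M {x \<in> carrier G. x \<notin> A \<inter> W \<and> inv (s k) \<otimes> x \<in> A \<inter> W} = measure M {x \<in> A \<inter> W. inv (s k) \<otimes> x \<notin> A \<inter> W}"
        using fin[of "A \<inter> W"] by (intro left_inv_Diff_swap[OF M AW _ s(1)]) (auto simp: less_top)
      have m1: "{x \<in> W. inv (s k) \<otimes> x \<notin> W} \<in> sets M" using shift_set[OF Ws s(1)] by (simp add: sM)
      have m2: "{x \<in> carrier G. x \<notin> A \<inter> W \<and> inv (s k) \<otimes> x \<in> A \<inter> W} \<in> sets M"
      proof -
        have "{x \<in> carrier G. x \<notin> A \<inter> W \<and> inv (s k) \<otimes> x \<in> A \<inter> W} = (\<lambda>x. s k \<otimes> x) ` (A \<inter> W) - A \<inter> W"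
          using left_image[OF s(1) sets_borel_carrier[OF AW]] by auto
        then show ?thesis using left_image_sets[OF s(1)[of k] AW] AW by (auto simp: sM)
      qed
      have f1: "emeasure M {x \<in> W. inv (s k) \<otimes> x \<notin> W} \<noteq> \<infinity>" by (rule fin) auto
      have f2: "emeasure M {x \<in> carrier G. x \<notin> A \<inter> W \<and> inv (s k) \<otimes> x \<in> A \<inter> W} \<noteq> \<infinity>"
      proof -
        have "emeasure M {x \<in> carrier G. x \<notin> A \<inter> W \<and> inv (s k) \<otimes> x \<in> A \<inter> W} \<le> emeasure M ((\<lambda>x. s k \<otimes> x) ` (A \<inter> W))"
          using left_image[OF s(1) sets_borel_carrier[OF AW]] left_image_sets[OF s(1)[of k] AW]
          by (intro emeasure_mono) (auto simp: sM)
        also have "\<dots> = emeasure M (A \<inter> W)" using M s(1) AW by (simp add: left_inv_measure_def sets_borel_of)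
        finally show ?thesis using fin[of "A \<inter> W"] by (auto simp: top_unique)
      qed
      have "measure M {x \<in> (topspace T - A) \<inter> W. inv (s k) \<otimes> x \<notin> (topspace T - A) \<inter> W}
        \<le> measure M ({x \<in> W. inv (s k) \<otimes> x \<notin> W} \<union> {x \<in> carrier G. x \<notin> A \<inter> W \<and> inv (s k) \<otimes> x \<in> A \<inter> W})"
        using m1 m2 f1 f2 Wc s(1) by (intro measure_mono_fmeasurable fmeasurable.Un)
          (auto simp: fmeasurable_def less_top sM intro!: shift_set[OF _ s(1), of "(carrier G - A) \<inter> W", unfolded topspace_T, simplified] sets.Int sets.Diff As Ws sets.top[of "borel_of T", simplified])
      also have "\<dots> \<le> measure M {x \<in> W. inv (s k) \<otimes> x \<notin> W} + measure M {x \<in> carrier G. x \<notin> A \<inter> W \<and> inv (s k) \<otimes> x \<in> A \<inter> W}"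
        using m1 m2 by (intro measure_Un_le)
      finally show ?thesis unfolding swap .
    qed
    have "(\<lambda>k. measure M {x \<in> W. inv (s k) \<otimes> x \<notin> W} + measure M {x \<in> A \<inter> W. inv (s k) \<otimes> x \<notin> A \<inter> W}) \<longlonglongrightarrow> 0"
      using tendsto_add[OF op[OF W(1) order_refl] compl(2)] by simp
    then show ?case
      by (rule Lim_null_comparison[rotated]) (use le in simp)
  next
    case (union A)
    then have As: "A i \<in> sets (borel_of T)" for i by (auto simp: sets_borel_of borel_sets_of_def)
    let ?U = "\<Union>i. A i"
    show ?case
    proof (rule LIMSEQ_I)
      fix \<epsilon> :: real assume e: "\<epsilon> > 0"
      have sums: "(\<lambda>i. measure M (A i \<inter> W)) sums measure M (\<Union>i. A i \<inter> W)"
        using union(1) As Ws fin[of "\<Union>i. A i \<inter> W"]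
        by (intro measure_UNION) (auto simp: disjoint_family_on_def sM)
      obtain N where N: "norm ((\<Sum>i<N. measure M (A i \<inter> W)) - measure M (\<Union>i. A i \<inter> W)) < \<epsilon>/2"
        using LIMSEQ_D[OF sums[unfolded sums_def], of "\<epsilon>/2"] e by auto
      have "(\<lambda>k. \<Sum>i<N. measure M {x \<in> A i \<inter> W. inv (s k) \<otimes> x \<notin> A i \<inter> W}) \<longlonglongrightarrow> (\<Sum>i<N. 0)"
        by (intro tendsto_sum union(3))
      then obtain K where K: "\<And>k. k \<ge> K \<Longrightarrow> norm ((\<Sum>i<N. measure M {x \<in> A i \<inter> W. inv (s k) \<otimes> x \<notin> A i \<inter> W}) - 0) < \<epsilon>/2"
        using LIMSEQ_D[of "\<lambda>k. \<Sum>i<N. measure M {x \<in> A i \<inter> W. inv (s k) \<otimes> x \<notin> A i \<inter> W}" 0 "\<epsilon>/2"] e by auto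
      have "norm (measure M {x \<in> ?U \<inter> W. inv (s k) \<otimes> x \<notin> ?U \<inter> W} - 0) < \<epsilon>" if k: "k \<ge> K" for k
      proof -
        \<comment> \<open>The first \<open>N\<close> pieces are covered by the induction hypothesis;
          the remaining ones form a tail whose small measure does not depend on the shift.\<close>
        let ?R = "(\<Union>i. A i \<inter> W) - (\<Union>i<N. A i \<inter> W)"
        have mA: "{x \<in> A i \<inter> W. inv (s k) \<otimes> x \<notin> A i \<inter> W} \<in> fmeasurable M" for i
          using shift_set[OF _ s(1), of "A i \<inter> W"] As Ws fin[of "{x \<in> A i \<inter> W. inv (s k) \<otimes> x \<notin> A i \<inter> W}"]
          by (auto simp: fmeasurable_def less_top sM)
        have mR: "?R \<in> fmeasurable M"
          using As Ws fin[of ?R] by (auto simp: fmeasurable_def less_top sM)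
        have "measure M {x \<in> ?U \<inter> W. inv (s k) \<otimes> x \<notin> ?U \<inter> W}
          \<le> measure M ((\<Union>i<N. {x \<in> A i \<inter> W. inv (s k) \<otimes> x \<notin> A i \<inter> W}) \<union> ?R)"
        proof (rule measure_mono_fmeasurable)
          show "{x \<in> ?U \<inter> W. inv (s k) \<otimes> x \<notin> ?U \<inter> W} \<subseteq> (\<Union>i<N. {x \<in> A i \<inter> W. inv (s k) \<otimes> x \<notin> A i \<inter> W}) \<union> ?R"
            by auto
          show "{x \<in> ?U \<inter> W. inv (s k) \<otimes> x \<notin> ?U \<inter> W} \<in> sets M"
            using shift_set[OF _ s(1), of "?U \<inter> W"] As Ws by (auto simp: sM)
          show "(\<Union>i<N. {x \<in> A i \<inter> W. inv (s k) \<otimes> x \<notin> A i \<inter> W}) \<union> ?R \<in> fmeasurable M"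
            using mA mR by (intro fmeasurable.Un fmeasurable.finite_UN) auto
        qed
        also have "\<dots> \<le> measure M (\<Union>i<N. {x \<in> A i \<inter> W. inv (s k) \<otimes> x \<notin> A i \<inter> W}) + measure M ?R"
          using mA mR by (intro measure_Un_le sets.finite_UN) auto
        also have "measure M (\<Union>i<N. {x \<in> A i \<inter> W. inv (s k) \<otimes> x \<notin> A i \<inter> W})
          \<le> (\<Sum>i<N. measure M {x \<in> A i \<inter> W. inv (s k) \<otimes> x \<notin> A i \<inter> W})"
          using mA by (intro measure_UNION_le) auto
        also have "measure M ?R = measure M (\<Union>i. A i \<inter> W) - measure M (\<Union>i<N. A i \<inter> W)"
          using As Ws fin[of "\<Union>i. A i \<inter> W"] by (intro measure_Diff) (auto simp: sM)
        also have "measure M (\<Union>i<N. A i \<inter> W) = (\<Sum>i<N. measure M (A i \<inter> W))"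
          using As Ws union(1) fin by (intro measure_finite_Union) (auto simp: sM disjoint_family_on_def)
        finally show ?thesis using K[OF k] N by (simp add: abs_if split: if_splits)
      qed
      then show "\<exists>K. \<forall>k\<ge>K. norm (measure M {x \<in> ?U \<inter> W. inv (s k) \<otimes> x \<notin> ?U \<inter> W} - 0) < \<epsilon>" by blast
    qed
  qed
qed

text \<open>Up to measure \<open>\<epsilon> / 2\<close> the set \<open>A\<close> lies in one
  relatively compact open \<open>Q i\<close>, where the local version applies.\<close>

lemma (in sc_group) shift_continuity:
  assumes M: "left_inv_measure G T M" and s: "\<And>k::nat. s k \<in> carrier G" "limitin T s \<one> sequentially"
    and A: "A \<in> sets (borel_of T)" "emeasure M A < \<infinity>"
  shows "(\<lambda>k. measure M {x \<in> A. inv (s k) \<otimes> x \<notin> A}) \<longlonglongrightarrow> 0"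
proof (rule LIMSEQ_I)
  fix \<epsilon> :: real assume e: "\<epsilon> > 0"
  note sM = left_inv_sets[OF M]
  obtain Q :: "nat \<Rightarrow> 'a set" where Q: "\<And>i. openin T (Q i)" "incseq Q" "(\<Union>i. Q i) = carrier G" "\<And>i. \<exists>K. compactin T K \<and> Q i \<subseteq> K"
    by (rule exhaustion) (rule that)
  have Qs: "Q i \<in> sets (borel_of T)" for i by (rule openin_sets_borel_of[OF Q(1)])
  have fin: "emeasure M B \<noteq> \<infinity>" if "B \<subseteq> A" for B
    using emeasure_mono[OF that, of M] A sM by (auto simp: top_unique)
  have "(\<lambda>i. measure M (A \<inter> Q i)) \<longlonglongrightarrow> measure M (\<Union>i. A \<inter> Q i)"
    using A Qs Q(2) fin[of "\<Union>i. A \<inter> Q i"] by (intro Lim_measure_incseq) (auto simp: sM incseq_def)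
  moreover have "(\<Union>i. A \<inter> Q i) = A" using Q(3) sets_borel_carrier[OF A(1)] by auto
  ultimately have "(\<lambda>i. measure M (A \<inter> Q i)) \<longlonglongrightarrow> measure M A" by simp
  from LIMSEQ_D[OF this, of "\<epsilon>/2"] e obtain i where i: "norm (measure M (A \<inter> Q i) - measure M A) < \<epsilon>/2"
    by auto
  have "emeasure M (Q i) < \<infinity>"
    using Q(4)[of i] left_inv_rel_compact[OF M] by auto
  from LIMSEQ_D[OF shift_continuity_in_open[OF M s Q(1) this A(1)], of "\<epsilon>/2"] e
  obtain K where K: "\<And>k. k \<ge> K \<Longrightarrow> norm (measure M {x \<in> A \<inter> Q i. inv (s k) \<otimes> x \<notin> A \<inter> Q i} - 0) < \<epsilon>/2"
    by auto
  have "norm (measure M {x \<in> A. inv (s k) \<otimes> x \<notin> A} - 0) < \<epsilon>" if k: "k \<ge> K" for k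
  proof -
    have m1: "{x \<in> A \<inter> Q i. inv (s k) \<otimes> x \<notin> A \<inter> Q i} \<in> fmeasurable M"
      using shift_set[OF _ s(1), of "A \<inter> Q i"] A Qs fin[of "{x \<in> A \<inter> Q i. inv (s k) \<otimes> x \<notin> A \<inter> Q i}"]
      by (auto simp: fmeasurable_def less_top sM)
    have m2: "A - A \<inter> Q i \<in> fmeasurable M"
      using A Qs fin[of "A - A \<inter> Q i"] by (auto simp: fmeasurable_def less_top sM)
    have "measure M {x \<in> A. inv (s k) \<otimes> x \<notin> A} \<le> measure M ({x \<in> A \<inter> Q i. inv (s k) \<otimes> x \<notin> A \<inter> Q i} \<union> (A - A \<inter> Q i))"
      using m1 m2 shift_set[OF A(1) s(1)] by (intro measure_mono_fmeasurable fmeasurable.Un) (auto simp: sM)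
    also have "\<dots> \<le> measure M {x \<in> A \<inter> Q i. inv (s k) \<otimes> x \<notin> A \<inter> Q i} + measure M (A - A \<inter> Q i)"
      using m1 m2 by (intro measure_Un_le) auto
    also have "measure M (A - A \<inter> Q i) = measure M A - measure M (A \<inter> Q i)"
      using A Qs fin[of A] by (intro measure_Diff) (auto simp: sM)
    finally show ?thesis using K[OF k] i by (simp add: abs_if split: if_splits)
  qed
  then show "\<exists>K. \<forall>k\<ge>K. norm (measure M {x \<in> A. inv (s k) \<otimes> x \<notin> A} - 0) < \<epsilon>" by blast
qed

text \<open>The measure with density \<open>\<phi>\<close>, pushed to the factor \<open>G'\<close>,
  is left invariant, hence right invariant as \<open>G'\<close> has no real characters. Right
  translation in one factor is thus controlled without writing \<open>M\<close> as a product
  measure; \<open>\<iota>\<close> lifts left translations of the factor along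
  \<open>pr\<close>.\<close>

lemma (in sc_group) slab_right_inv:
  fixes G' :: "('b, 'n) monoid_scheme" and \<phi> :: "'a \<Rightarrow> ennreal"
  assumes M: "left_inv_measure G T M" and S': "sc_group G' T'" and nc: "no_real_chars G' T'"
    and pr [measurable]: "pr \<in> measurable (borel_of T) (borel_of T')"
    and \<iota>: "\<And>g. g \<in> carrier G' \<Longrightarrow> \<iota> g \<in> carrier G"
      "\<And>g z. g \<in> carrier G' \<Longrightarrow> z \<in> carrier G \<Longrightarrow> pr (\<iota> g \<otimes> z) = g \<otimes>\<^bsub>G'\<^esub> pr z"
    and \<phi> [measurable]: "\<phi> \<in> borel_measurable (borel_of T)"
    and \<phi>_inv: "\<And>g. g \<in> carrier G' \<Longrightarrow> AE z in M. \<phi> (\<iota> g \<otimes> z) = \<phi> z"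
    and fin: "\<And>K. compactin T' K \<Longrightarrow> (\<integral>\<^sup>+z. indicator K (pr z) * \<phi> z \<partial>M) < \<infinity>"
    and g: "g \<in> carrier G'" and A: "A \<in> sets (borel_of T')"
  shows "(\<integral>\<^sup>+z. indicator ((\<lambda>x. x \<otimes>\<^bsub>G'\<^esub> g) ` A) (pr z) * \<phi> z \<partial>M) = (\<integral>\<^sup>+z. indicator A (pr z) * \<phi> z \<partial>M)"
proof -
  interpret S: sc_group G' T' by (rule S')
  note sM = left_inv_sets[OF M]
  have [measurable_cong]: "sets M = sets (borel_of T)" by (rule sM)
  define \<nu> where "\<nu> = distr (density M \<phi>) (borel_of T') pr"
  have em: "emeasure \<nu> B = (\<integral>\<^sup>+z. indicator B (pr z) * \<phi> z \<partial>M)" if [measurable]: "B \<in> sets (borel_of T')" for B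
  proof -
    have "emeasure \<nu> B = emeasure (density M \<phi>) (pr -` B \<inter> space M)"
      unfolding \<nu>_def by (subst emeasure_distr) auto
    also have "\<dots> = (\<integral>\<^sup>+z. \<phi> z * indicator (pr -` B \<inter> space M) z \<partial>M)"
      by (rule emeasure_density) measurable
    also have "\<dots> = (\<integral>\<^sup>+z. indicator B (pr z) * \<phi> z \<partial>M)"
      by (intro nn_integral_cong) (auto simp: indicator_def)
    finally show ?thesis .
  qed
  have "left_inv_measure G' T' \<nu>"
    unfolding left_inv_measure_def
  proof (intro conjI ballI allI impI)
    fix h B assume h: "h \<in> carrier G'" and "B \<in> sets \<nu>"
    then have B [measurable]: "B \<in> sets (borel_of T')" by (simp add: \<nu>_def)
    have hB [measurable]: "(\<lambda>x. h \<otimes>\<^bsub>G'\<^esub> x) ` B \<in> sets (borel_of T')" by (rule S.left_image_sets[OF h B])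
    have Bc: "B \<subseteq> carrier G'" by (rule S.sets_borel_carrier[OF B])
    have "emeasure \<nu> ((\<lambda>x. h \<otimes>\<^bsub>G'\<^esub> x) ` B) = (\<integral>\<^sup>+z. indicator ((\<lambda>x. h \<otimes>\<^bsub>G'\<^esub> x) ` B) (pr z) * \<phi> z \<partial>M)"
      by (rule em[OF hB])
    also have "\<dots> = (\<integral>\<^sup>+z. indicator ((\<lambda>x. h \<otimes>\<^bsub>G'\<^esub> x) ` B) (pr (\<iota> h \<otimes> z)) * \<phi> (\<iota> h \<otimes> z) \<partial>M)"
      by (rule left_inv_nn_integral[OF M \<iota>(1)[OF h], symmetric]) measurable
    also have "\<dots> = (\<integral>\<^sup>+z. indicator B (pr z) * \<phi> z \<partial>M)"
    proof (rule nn_integral_cong_AE)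
      show "AE z in M. indicator ((\<lambda>x. h \<otimes>\<^bsub>G'\<^esub> x) ` B) (pr (\<iota> h \<otimes> z)) * \<phi> (\<iota> h \<otimes> z) = indicator B (pr z) * \<phi> z"
        using \<phi>_inv[OF h] AE_space
      proof eventually_elim
        case (elim z)
        then have z: "z \<in> carrier G" by (simp add: left_inv_space[OF M])
        have "pr z \<in> carrier G'" using measurable_space[OF pr, of z] z by simp
        then have "h \<otimes>\<^bsub>G'\<^esub> pr z \<in> (\<lambda>x. h \<otimes>\<^bsub>G'\<^esub> x) ` B \<longleftrightarrow> pr z \<in> B"
          using h Bc by (auto simp: S.left_image S.m_assoc[symmetric])
        then show ?case using elim \<iota>(2)[OF h z] by (simp add: indicator_def)
      qed
    qed
    finally show "emeasure \<nu> ((\<lambda>x. h \<otimes>\<^bsub>G'\<^esub> x) ` B) = emeasure \<nu> B" by (simp add: em[OF B])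
  next
    fix K assume "compactin T' K"
    then show "emeasure \<nu> K < \<infinity>" using fin by (simp add: em S.compact_sets)
  qed (simp_all add: \<nu>_def sets_borel_of)
  from S.left_inv_right_inv[OF nc this g A] show ?thesis
    using em[OF A] em[OF S.right_image_sets[OF g A]] by simp
qed

section \<open>Lattices in a product of two groups\<close>

lemma mult_prod: "(a, b) \<otimes>\<^bsub>G1 \<times>\<times> G2\<^esub> (a', b') = (a \<otimes>\<^bsub>G1\<^esub> a', b \<otimes>\<^bsub>G2\<^esub> b')"
  by (simp add: DirProd_def)

lemma mult_prod_alt: "x \<otimes>\<^bsub>G1 \<times>\<times> G2\<^esub> y = (fst x \<otimes>\<^bsub>G1\<^esub> fst y, snd x \<otimes>\<^bsub>G2\<^esub> snd y)"
  by (cases x; cases y) (simp add: mult_prod)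

lemma sc_group_prod:
  assumes "sc_group G1 T1" "sc_group G2 T2"
  shows "sc_group (G1 \<times>\<times> G2) (prod_topology T1 T2)"
proof
  interpret S1: sc_group G1 T1 by fact
  interpret S2: sc_group G2 T2 by fact
  have grp: "group (G1 \<times>\<times> G2)" by (intro DirProd_group S1.is_group S2.is_group)
  have "Hausdorff_space T1" "Hausdorff_space T2"
    using S1.sc_group S2.sc_group by (auto simp: second_countable_lc_group_def lc_group_def)
  then have H: "Hausdorff_space (prod_topology T1 T2)" by (simp add: Hausdorff_space_prod_topology)
  have L: "locally_compact_space (prod_topology T1 T2)"
    using S1.locally_compact_T S2.locally_compact_T by (simp add: locally_compact_space_prod_topology)
  have sc: "second_countable (prod_topology T1 T2)"
  proof -
    obtain B1 where B1: "countable B1" "\<And>V. V \<in> B1 \<Longrightarrow> openin T1 V"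
      "\<And>U x. openin T1 U \<Longrightarrow> x \<in> U \<Longrightarrow> \<exists>V\<in>B1. x \<in> V \<and> V \<subseteq> U"
      using S1.second_countable_T unfolding second_countable_def by metis
    obtain B2 where B2: "countable B2" "\<And>V. V \<in> B2 \<Longrightarrow> openin T2 V"
      "\<And>U x. openin T2 U \<Longrightarrow> x \<in> U \<Longrightarrow> \<exists>V\<in>B2. x \<in> V \<and> V \<subseteq> U"
      using S2.second_countable_T unfolding second_countable_def by metis
    show ?thesis
      unfolding second_countable_def
    proof (intro exI[of _ "(\<lambda>(U, V). U \<times> V) ` (B1 \<times> B2)"] conjI allI impI)
      show "countable ((\<lambda>(U, V). U \<times> V) ` (B1 \<times> B2))" using B1 B2 by auto
      show "\<forall>V\<in>(\<lambda>(U, V). U \<times> V) ` (B1 \<times> B2). openin (prod_topology T1 T2) V"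
        using B1(2) B2(2) by (auto simp: openin_prod_Times_iff)
      fix U x assume Ux: "openin (prod_topology T1 T2) U \<and> x \<in> U"
      obtain a b where x: "x = (a, b)" by (cases x)
      then obtain V W where VW: "openin T1 V" "openin T2 W" "a \<in> V" "b \<in> W" "V \<times> W \<subseteq> U"
        using Ux unfolding openin_prod_topology_alt by metis
      obtain V' where V': "V' \<in> B1" "a \<in> V'" "V' \<subseteq> V" using B1(3)[OF VW(1,3)] by auto
      obtain W' where W': "W' \<in> B2" "b \<in> W'" "W' \<subseteq> W" using B2(3)[OF VW(2,4)] by auto
      show "\<exists>V\<in>(\<lambda>(U, V). U \<times> V) ` (B1 \<times> B2). x \<in> V \<and> V \<subseteq> U"
        using V' W' VW(5) x by (intro bexI[of _ "V' \<times> W'"]) auto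
    qed
  qed
  have c1: "continuous_map (prod_topology (prod_topology T1 T2) (prod_topology T1 T2)) T1 (\<lambda>z. fst (fst z) \<otimes>\<^bsub>G1\<^esub> fst (snd z))"
    by (intro S1.continuous_map_mult continuous_map_fst_of continuous_map_fst continuous_map_snd
        continuous_map_compose[OF continuous_map_fst continuous_map_fst, unfolded o_def]
        continuous_map_compose[OF continuous_map_snd continuous_map_fst, unfolded o_def])
  have c2: "continuous_map (prod_topology (prod_topology T1 T2) (prod_topology T1 T2)) T2 (\<lambda>z. snd (fst z) \<otimes>\<^bsub>G2\<^esub> snd (snd z))"
    by (intro S2.continuous_map_mult
        continuous_map_compose[OF continuous_map_fst continuous_map_snd, unfolded o_def]
        continuous_map_compose[OF continuous_map_snd continuous_map_snd, unfolded o_def])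
  have "continuous_map (prod_topology (prod_topology T1 T2) (prod_topology T1 T2)) (prod_topology T1 T2)
     (\<lambda>z. (fst (fst z) \<otimes>\<^bsub>G1\<^esub> fst (snd z), snd (fst z) \<otimes>\<^bsub>G2\<^esub> snd (snd z)))"
    using c1 c2 by (simp add: continuous_map_pairwise o_def)
  then have cm: "continuous_map (prod_topology (prod_topology T1 T2) (prod_topology T1 T2)) (prod_topology T1 T2)
     (\<lambda>(x, y). x \<otimes>\<^bsub>G1 \<times>\<times> G2\<^esub> y)"
    by (simp add: mult_prod_alt case_prod_unfold)
  have i1: "continuous_map (prod_topology T1 T2) T1 (\<lambda>z. inv\<^bsub>G1\<^esub> (fst z))"
    using continuous_map_compose[OF continuous_map_fst S1.inv_continuous, of T2] by (simp add: o_def)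
  have i2: "continuous_map (prod_topology T1 T2) T2 (\<lambda>z. inv\<^bsub>G2\<^esub> (snd z))"
    using continuous_map_compose[OF continuous_map_snd S2.inv_continuous, of T1] by (simp add: o_def)
  have "continuous_map (prod_topology T1 T2) (prod_topology T1 T2) (\<lambda>z. (inv\<^bsub>G1\<^esub> (fst z), inv\<^bsub>G2\<^esub> (snd z)))"
    using i1 i2 by (simp add: continuous_map_pairwise o_def)
  then have ci: "continuous_map (prod_topology T1 T2) (prod_topology T1 T2) (\<lambda>x. inv\<^bsub>G1 \<times>\<times> G2\<^esub> x)"
    by (rule continuous_map_eq) (auto simp: inv_DirProd[OF S1.is_group S2.is_group])
  show "second_countable_lc_group (G1 \<times>\<times> G2) (prod_topology T1 T2)"
    using grp H L sc cm ci
    by (simp add: second_countable_lc_group_def lc_group_def topological_group_def)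
qed

text \<open>Of property (T) and minimal almost periodicity only \<open>no_real_chars\<close> enters
  here, as the source of unimodularity. \<open>M\<close> and \<open>F\<close> witness that \<Gamma>
  has finite covolume.\<close>

locale product_lattice =
  fixes G1 :: "('a, 'm) monoid_scheme" and T1 :: "'a topology"
    and G2 :: "('b, 'n) monoid_scheme" and T2 :: "'b topology"
    and \<Gamma> :: "('a \<times> 'b) set" and M :: "('a \<times> 'b) measure" and F :: "('a \<times> 'b) set"
  assumes S1: "sc_group G1 T1" and S2: "sc_group G2 T2"
    and nc1: "no_real_chars G1 T1" and nc2: "no_real_chars G2 T2"
    and haar: "left_haar_measure (G1 \<times>\<times> G2) (prod_topology T1 T2) M"
    and subgroup_\<Gamma>: "subgroup \<Gamma> (G1 \<times>\<times> G2)"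
    and discrete_\<Gamma>: "subtopology (prod_topology T1 T2) \<Gamma> = discrete_topology \<Gamma>"
    and domain_F: "fundamental_domain (G1 \<times>\<times> G2) (prod_topology T1 T2) \<Gamma> F"
    and finite_F: "emeasure M F < \<infinity>"

sublocale product_lattice \<subseteq> S1: sc_group G1 T1 by (rule S1)
sublocale product_lattice \<subseteq> S2: sc_group G2 T2 by (rule S2)
sublocale product_lattice \<subseteq> sc_group "G1 \<times>\<times> G2" "prod_topology T1 T2" by (rule sc_group_prod[OF S1 S2])

context product_lattice
begin

abbreviation G :: "('a \<times> 'b) monoid" where "G \<equiv> G1 \<times>\<times> G2"
abbreviation T :: "('a \<times> 'b) topology" where "T \<equiv> prod_topology T1 T2"

lemma left_inv_M: "left_inv_measure G T M"
  using haar by (simp add: left_haar_measure_def left_inv_measure_def)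

lemma sets_M: "sets M = sets (borel_of T)"
  by (rule left_inv_sets[OF left_inv_M])

lemma space_M: "space M = carrier G"
  by (rule left_inv_space[OF left_inv_M])

lemma carrier_G: "carrier G = carrier G1 \<times> carrier G2"
  by simp

lemma fst_measurable: "fst \<in> measurable (borel_of T) (borel_of T1)"
  and snd_measurable: "snd \<in> measurable (borel_of T) (borel_of T2)"
  by (intro continuous_map_measurable_borel_of continuous_map_fst continuous_map_snd)+

lemma Times_sets:
  assumes "A \<in> sets (borel_of T1)" "B \<in> sets (borel_of T2)"
  shows "A \<times> B \<in> sets (borel_of T)"
  unfolding sets_borel_of_prod[OF S1.second_countable_T S2.second_countable_T]
  using assms by (rule pair_measureI)

lemma emeasure_Times:
  assumes "A \<in> sets (borel_of T1)" "B \<in> sets (borel_of T2)"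
  shows "(\<integral>\<^sup>+z. indicator A (fst z) * indicator B (snd z) \<partial>M) = emeasure M (A \<times> B)"
proof -
  have "(\<integral>\<^sup>+z. indicator A (fst z) * indicator B (snd z) \<partial>M) = (\<integral>\<^sup>+z. indicator (A \<times> B) z \<partial>M)"
    by (intro nn_integral_cong) (auto simp: indicator_def)
  also have "\<dots> = emeasure M (A \<times> B)"
    using Times_sets[OF assms] by (intro nn_integral_indicator) (simp add: sets_M)
  finally show ?thesis .
qed

lemma emeasure_compact_Times: "compactin T1 K \<Longrightarrow> compactin T2 L \<Longrightarrow> emeasure M (K \<times> L) < \<infinity>"
  using left_inv_M by (auto simp: left_inv_measure_def compactin_Times)

text \<open>This is \<open>slab_right_inv\<close> with the indicator of a piece of \<open>B\<close>
  as density. The pieces are cut out by a relatively compact exhaustion, which makes the projected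
  measure finite on compact sets.\<close>

lemma right_fst:
  assumes g: "g \<in> carrier G1" and A: "A \<in> sets (borel_of T1)" and B: "B \<in> sets (borel_of T2)"
  shows "emeasure M (((\<lambda>x. x \<otimes>\<^bsub>G1\<^esub> g) ` A) \<times> B) = emeasure M (A \<times> B)"
proof -
  obtain Q :: "nat \<Rightarrow> 'b set" where Q: "\<And>i. openin T2 (Q i)" "incseq Q" "(\<Union>i. Q i) = carrier G2" "\<And>i. \<exists>K. compactin T2 K \<and> Q i \<subseteq> K"
    by (rule S2.exhaustion) (rule that)
  have Qs: "Q i \<in> sets (borel_of T2)" for i by (rule openin_sets_borel_of[OF Q(1)])
  have gA: "(\<lambda>x. x \<otimes>\<^bsub>G1\<^esub> g) ` A \<in> sets (borel_of T1)" by (rule S1.right_image_sets[OF g A])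
  have sup: "emeasure M (C \<times> B) = (SUP i. emeasure M (C \<times> (B \<inter> Q i)))" if C: "C \<in> sets (borel_of T1)" for C
  proof -
    have "(SUP i. emeasure M (C \<times> (B \<inter> Q i))) = emeasure M (\<Union>i. C \<times> (B \<inter> Q i))"
      using Times_sets[OF C sets.Int[OF B Qs]] Q(2)
      by (intro SUP_emeasure_incseq) (auto simp: sets_M incseq_def)
    moreover have "(\<Union>i. C \<times> (B \<inter> Q i)) = C \<times> B" using Q(3) S2.sets_borel_carrier[OF B] by auto
    ultimately show ?thesis by simp
  qed
  have "emeasure M (((\<lambda>x. x \<otimes>\<^bsub>G1\<^esub> g) ` A) \<times> (B \<inter> Q i)) = emeasure M (A \<times> (B \<inter> Q i))" for i
  proof -
    have BQ: "B \<inter> Q i \<in> sets (borel_of T2)" using B Qs by auto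
    obtain L where L: "compactin T2 L" "Q i \<subseteq> L" using Q(4) by blast
    have "(\<integral>\<^sup>+z. indicator ((\<lambda>x. x \<otimes>\<^bsub>G1\<^esub> g) ` A) (fst z) * indicator (B \<inter> Q i) (snd z) \<partial>M)
        = (\<integral>\<^sup>+z. indicator A (fst z) * indicator (B \<inter> Q i) (snd z) \<partial>M)"
    proof (rule slab_right_inv[OF left_inv_M S1 nc1 fst_measurable _ _ _ _ _ g A, where \<iota> = "\<lambda>g. (g, \<one>\<^bsub>G2\<^esub>)"])
      show "(\<lambda>z. indicator (B \<inter> Q i) (snd z)) \<in> borel_measurable (borel_of T)"
        using BQ snd_measurable by measurable
      show "(\<integral>\<^sup>+z. indicator K (fst z) * indicator (B \<inter> Q i) (snd z) \<partial>M) < \<infinity>" if K: "compactin T1 K" for K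
      proof -
        have "emeasure M (K \<times> (B \<inter> Q i)) \<le> emeasure M (K \<times> L)"
          using L Times_sets[OF S1.compact_sets[OF K] S2.compact_sets[OF L(1)]] by (intro emeasure_mono) (auto simp: sets_M)
        also have "\<dots> < \<infinity>" by (rule emeasure_compact_Times[OF K L(1)])
        finally show ?thesis by (simp add: emeasure_Times[OF S1.compact_sets[OF K] BQ])
      qed
      show "AE z in M. indicator (B \<inter> Q i) (snd ((h, \<one>\<^bsub>G2\<^esub>) \<otimes>\<^bsub>G\<^esub> z)) = (indicator (B \<inter> Q i) (snd z) :: ennreal)" if "h \<in> carrier G1" for h
        by (rule AE_I2) (auto simp: mult_prod_alt space_M)
    qed (auto simp: mult_prod_alt)
    then show ?thesis by (simp add: emeasure_Times[OF gA BQ] emeasure_Times[OF A BQ])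
  qed
  then show ?thesis using sup[OF A] sup[OF gA] by simp
qed

lemma right_snd:
  assumes g: "g \<in> carrier G2" and A: "A \<in> sets (borel_of T1)" and B: "B \<in> sets (borel_of T2)"
  shows "emeasure M (A \<times> ((\<lambda>x. x \<otimes>\<^bsub>G2\<^esub> g) ` B)) = emeasure M (A \<times> B)"
proof -
  obtain Q :: "nat \<Rightarrow> 'a set" where Q: "\<And>i. openin T1 (Q i)" "incseq Q" "(\<Union>i. Q i) = carrier G1" "\<And>i. \<exists>K. compactin T1 K \<and> Q i \<subseteq> K"
    by (rule S1.exhaustion) (rule that)
  have Qs: "Q i \<in> sets (borel_of T1)" for i by (rule openin_sets_borel_of[OF Q(1)])
  have gB: "(\<lambda>x. x \<otimes>\<^bsub>G2\<^esub> g) ` B \<in> sets (borel_of T2)" by (rule S2.right_image_sets[OF g B])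
  have sup: "emeasure M (A \<times> C) = (SUP i. emeasure M ((A \<inter> Q i) \<times> C))" if C: "C \<in> sets (borel_of T2)" for C
  proof -
    have "(SUP i. emeasure M ((A \<inter> Q i) \<times> C)) = emeasure M (\<Union>i. (A \<inter> Q i) \<times> C)"
      using Times_sets[OF sets.Int[OF A Qs] C] Q(2)
      by (intro SUP_emeasure_incseq) (auto simp: sets_M incseq_def)
    moreover have "(\<Union>i. (A \<inter> Q i) \<times> C) = A \<times> C" using Q(3) S1.sets_borel_carrier[OF A] by auto
    ultimately show ?thesis by simp
  qed
  have "emeasure M ((A \<inter> Q i) \<times> ((\<lambda>x. x \<otimes>\<^bsub>G2\<^esub> g) ` B)) = emeasure M ((A \<inter> Q i) \<times> B)" for i
  proof -
    have AQ: "A \<inter> Q i \<in> sets (borel_of T1)" using A Qs by auto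
    obtain L where L: "compactin T1 L" "Q i \<subseteq> L" using Q(4) by blast
    have "(\<integral>\<^sup>+z. indicator ((\<lambda>x. x \<otimes>\<^bsub>G2\<^esub> g) ` B) (snd z) * indicator (A \<inter> Q i) (fst z) \<partial>M)
        = (\<integral>\<^sup>+z. indicator B (snd z) * indicator (A \<inter> Q i) (fst z) \<partial>M)"
    proof (rule slab_right_inv[OF left_inv_M S2 nc2 snd_measurable _ _ _ _ _ g B, where \<iota> = "\<lambda>g. (\<one>\<^bsub>G1\<^esub>, g)"])
      show "(\<lambda>z. indicator (A \<inter> Q i) (fst z)) \<in> borel_measurable (borel_of T)"
        using AQ fst_measurable by measurable
      show "(\<integral>\<^sup>+z. indicator K (snd z) * indicator (A \<inter> Q i) (fst z) \<partial>M) < \<infinity>" if K: "compactin T2 K" for K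
      proof -
        have "emeasure M ((A \<inter> Q i) \<times> K) \<le> emeasure M (L \<times> K)"
          using L Times_sets[OF S1.compact_sets[OF L(1)] S2.compact_sets[OF K]] by (intro emeasure_mono) (auto simp: sets_M)
        also have "\<dots> < \<infinity>" by (rule emeasure_compact_Times[OF L(1) K])
        finally show ?thesis using emeasure_Times[OF AQ S2.compact_sets[OF K]] by (simp add: mult.commute)
      qed
      show "AE z in M. indicator (A \<inter> Q i) (fst ((\<one>\<^bsub>G1\<^esub>, h) \<otimes>\<^bsub>G\<^esub> z)) = (indicator (A \<inter> Q i) (fst z) :: ennreal)" if "h \<in> carrier G2" for h
        by (rule AE_I2) (auto simp: mult_prod_alt space_M)
    qed (auto simp: mult_prod_alt)
    then show ?thesis using emeasure_Times[OF AQ gB] emeasure_Times[OF AQ B] by (simp add: mult.commute)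
  qed
  then show ?thesis using sup[OF B] sup[OF gB] by simp
qed

text \<open>Unimodularity of the product. Right translation preserves the measure of rectangles one
  factor at a time; rectangles are stable under intersection, generate the Borel sets and include an
  exhaustion of finite measure.\<close>

lemma right_inv_distr:
  assumes g: "g \<in> carrier G"
  shows "distr M (borel_of T) (\<lambda>x. x \<otimes>\<^bsub>G\<^esub> inv\<^bsub>G\<^esub> g) = M"
proof -
  obtain g1 g2 where gg: "g = (g1, g2)" "g1 \<in> carrier G1" "g2 \<in> carrier G2" using g by auto
  let ?N = "distr M (borel_of T) (\<lambda>x. x \<otimes>\<^bsub>G\<^esub> inv\<^bsub>G\<^esub> g)"
  let ?E = "{A \<times> B |A B. A \<in> sets (borel_of T1) \<and> B \<in> sets (borel_of T2)}"
  obtain Q :: "nat \<Rightarrow> 'a set" where Q: "\<And>i. openin T1 (Q i)" "incseq Q" "(\<Union>i. Q i) = carrier G1" "\<And>i. \<exists>K. compactin T1 K \<and> Q i \<subseteq> K"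
    by (rule S1.exhaustion) (rule that)
  obtain R :: "nat \<Rightarrow> 'b set" where R: "\<And>i. openin T2 (R i)" "incseq R" "(\<Union>i. R i) = carrier G2" "\<And>i. \<exists>K. compactin T2 K \<and> R i \<subseteq> K"
    by (rule S2.exhaustion) (rule that)
  have gen: "sets (borel_of T) = sigma_sets (carrier G) ?E"
    unfolding sets_borel_of_prod[OF S1.second_countable_T S2.second_countable_T] sets_pair_measure by simp
  have rect: "emeasure ?N X = emeasure M X" if X: "X \<in> ?E" for X
  proof -
    obtain A B where AB: "X = A \<times> B" "A \<in> sets (borel_of T1)" "B \<in> sets (borel_of T2)" using X by auto
    have "(\<lambda>x. x \<otimes>\<^bsub>G\<^esub> g) ` (A \<times> B) = ((\<lambda>x. x \<otimes>\<^bsub>G1\<^esub> g1) ` A) \<times> ((\<lambda>x. x \<otimes>\<^bsub>G2\<^esub> g2) ` B)"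
      unfolding gg by (force simp: mult_prod_alt image_iff)
    then have "emeasure ?N X = emeasure M (((\<lambda>x. x \<otimes>\<^bsub>G1\<^esub> g1) ` A) \<times> ((\<lambda>x. x \<otimes>\<^bsub>G2\<^esub> g2) ` B))"
      using right_shift_left_inv(2)[OF left_inv_M g Times_sets[OF AB(2,3)]] by (simp add: AB(1))
    also have "\<dots> = emeasure M (A \<times> ((\<lambda>x. x \<otimes>\<^bsub>G2\<^esub> g2) ` B))"
      by (rule right_fst[OF gg(2) AB(2) S2.right_image_sets[OF gg(3) AB(3)]])
    also have "\<dots> = emeasure M (A \<times> B)" by (rule right_snd[OF gg(3) AB(2,3)])
    finally show ?thesis by (simp add: AB(1))
  qed
  have QRE: "Q i \<times> R i \<in> ?E" for i
    by (intro CollectI exI[of _ "Q i"] exI[of _ "R i"] conjI refl openin_sets_borel_of Q(1) R(1))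
  show ?thesis
  proof (rule measure_eqI_generator_eq[where E = ?E and \<Omega> = "carrier G" and A = "\<lambda>i. Q i \<times> R i"])
    show "Int_stable ?E"
      unfolding Int_stable_def by (clarsimp simp: Times_Int_Times) (metis sets.Int)
    show "?E \<subseteq> Pow (carrier G)" using S1.sets_borel_carrier S2.sets_borel_carrier by fastforce
    show "emeasure ?N X = emeasure M X" if "X \<in> ?E" for X by (rule rect[OF that])
    show "sets ?N = sigma_sets (carrier G) ?E" using gen by simp
    show "sets M = sigma_sets (carrier G) ?E" using gen by (simp add: sets_M)
    show "range (\<lambda>i. Q i \<times> R i) \<subseteq> ?E" using QRE by (rule image_subsetI)
    show "(\<Union>i. Q i \<times> R i) = carrier G"
    proof
      show "(\<Union>i. Q i \<times> R i) \<subseteq> carrier G" using Q(3) R(3) by auto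
      show "carrier G \<subseteq> (\<Union>i. Q i \<times> R i)"
      proof
        fix x assume "x \<in> carrier G"
        then obtain i j where ij: "fst x \<in> Q i" "snd x \<in> R j" using Q(3) R(3) by force
        then have "fst x \<in> Q (max i j)" "snd x \<in> R (max i j)"
          using Q(2) R(2) by (meson incseqD max.cobounded1 max.cobounded2 subsetD)+
        then show "x \<in> (\<Union>i. Q i \<times> R i)" by (cases x) auto
      qed
    qed
    show "emeasure ?N (Q i \<times> R i) \<noteq> \<infinity>" for i
    proof -
      obtain K where K: "compactin T1 K" "Q i \<subseteq> K" using Q(4) by blast
      obtain L where L: "compactin T2 L" "R i \<subseteq> L" using R(4) by blast
      have "emeasure M (Q i \<times> R i) \<le> emeasure M (K \<times> L)"
        using K L Times_sets[OF S1.compact_sets[OF K(1)] S2.compact_sets[OF L(1)]] by (intro emeasure_mono) (auto simp: sets_M)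
      also have "\<dots> < \<infinity>" by (rule emeasure_compact_Times[OF K(1) L(1)])
      finally show ?thesis unfolding rect[OF QRE] by simp
    qed
  qed
qed

lemma right_nn_integral:
  assumes g: "g \<in> carrier G" and f: "f \<in> borel_measurable (borel_of T)"
  shows "(\<integral>\<^sup>+x. f (x \<otimes>\<^bsub>G\<^esub> g) \<partial>M) = (\<integral>\<^sup>+x. f x \<partial>M)"
proof -
  have m: "(\<lambda>x. x \<otimes>\<^bsub>G\<^esub> g) \<in> measurable M (borel_of T)"
    using right_measurable[OF g] by (simp add: measurable_cong_sets[OF sets_M refl])
  have "(\<integral>\<^sup>+x. f x \<partial>M) = (\<integral>\<^sup>+x. f x \<partial>(distr M (borel_of T) (\<lambda>x. x \<otimes>\<^bsub>G\<^esub> inv\<^bsub>G\<^esub> (inv\<^bsub>G\<^esub> g))))"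
    using right_inv_distr[OF inv_closed[OF g]] by simp
  also have "\<dots> = (\<integral>\<^sup>+x. f x \<partial>(distr M (borel_of T) (\<lambda>x. x \<otimes>\<^bsub>G\<^esub> g)))"
    using inv_inv[OF g] by simp
  also have "\<dots> = (\<integral>\<^sup>+x. f (x \<otimes>\<^bsub>G\<^esub> g) \<partial>M)"
    using m f by (intro nn_integral_distr) auto
  finally show ?thesis by simp
qed

lemma \<Gamma>_carrier: "\<gamma> \<in> \<Gamma> \<Longrightarrow> \<gamma> \<in> carrier G"
  using subgroup.subset[OF subgroup_\<Gamma>] by blast

lemma \<Gamma>_closed: "\<gamma> \<in> \<Gamma> \<Longrightarrow> \<delta> \<in> \<Gamma> \<Longrightarrow> \<gamma> \<otimes>\<^bsub>G\<^esub> \<delta> \<in> \<Gamma>" "\<one>\<^bsub>G\<^esub> \<in> \<Gamma>" "\<gamma> \<in> \<Gamma> \<Longrightarrow> inv\<^bsub>G\<^esub> \<gamma> \<in> \<Gamma>"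
  using subgroup.m_closed[OF subgroup_\<Gamma>] subgroup.one_closed[OF subgroup_\<Gamma>] subgroup.m_inv_closed[OF subgroup_\<Gamma>]
  by blast+

lemma countable_\<Gamma>: "countable \<Gamma>"
  using second_countable_subtopology[OF second_countable_T, of \<Gamma>]
  by (simp add: discrete_\<Gamma> second_countable_discrete_topology)

section \<open>The fundamental domain and unfolding of integrals\<close>

lemma F_sets: "F \<in> sets (borel_of T)" and F_carrier: "F \<subseteq> carrier G"
  using domain_F by (auto simp: fundamental_domain_def sets_borel_of)

text \<open>The second component of \<open>x\<close> in the unique factorisation of the group into
  \<open>F\<close> times \<Gamma>; it yields the cocycle by which representations of \<Gamma> are
  induced.\<close>

definition gam :: "'a \<times> 'b \<Rightarrow> 'a \<times> 'b" where
  "gam x = snd (THE p. fst p \<in> F \<and> snd p \<in> \<Gamma> \<and> x = fst p \<otimes>\<^bsub>G\<^esub> snd p)"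

definition base :: "'a \<times> 'b \<Rightarrow> 'a \<times> 'b" where
  "base x = fst (THE p. fst p \<in> F \<and> snd p \<in> \<Gamma> \<and> x = fst p \<otimes>\<^bsub>G\<^esub> snd p)"

lemma decomposition:
  assumes "x \<in> carrier G"
  shows "base x \<in> F" "gam x \<in> \<Gamma>" "x = base x \<otimes>\<^bsub>G\<^esub> gam x"
proof -
  have "\<exists>!p. fst p \<in> F \<and> snd p \<in> \<Gamma> \<and> x = fst p \<otimes>\<^bsub>G\<^esub> snd p"
    using domain_F assms unfolding fundamental_domain_def by blast
  from theI'[OF this] show "base x \<in> F" "gam x \<in> \<Gamma>" "x = base x \<otimes>\<^bsub>G\<^esub> gam x"
    by (auto simp: base_def gam_def)
qed

lemma decomposition_unique:
  assumes "y \<in> F" "\<gamma> \<in> \<Gamma>"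
  shows "gam (y \<otimes>\<^bsub>G\<^esub> \<gamma>) = \<gamma>" "base (y \<otimes>\<^bsub>G\<^esub> \<gamma>) = y"
proof -
  have x: "y \<otimes>\<^bsub>G\<^esub> \<gamma> \<in> carrier G" using assms F_carrier \<Gamma>_carrier by blast
  have ex: "\<exists>!p. fst p \<in> F \<and> snd p \<in> \<Gamma> \<and> y \<otimes>\<^bsub>G\<^esub> \<gamma> = fst p \<otimes>\<^bsub>G\<^esub> snd p"
    using domain_F x unfolding fundamental_domain_def by blast
  have "(THE p. fst p \<in> F \<and> snd p \<in> \<Gamma> \<and> y \<otimes>\<^bsub>G\<^esub> \<gamma> = fst p \<otimes>\<^bsub>G\<^esub> snd p) = (y, \<gamma>)"
    by (rule the1_equality[OF ex]) (use assms in auto)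
  then show "gam (y \<otimes>\<^bsub>G\<^esub> \<gamma>) = \<gamma>" "base (y \<otimes>\<^bsub>G\<^esub> \<gamma>) = y" by (auto simp: gam_def base_def)
qed

lemma gam_right:
  assumes "x \<in> carrier G" "\<gamma> \<in> \<Gamma>"
  shows "gam (x \<otimes>\<^bsub>G\<^esub> \<gamma>) = gam x \<otimes>\<^bsub>G\<^esub> \<gamma>"
proof -
  note d = decomposition[OF assms(1)]
  have b: "base x \<in> carrier G" using d(1) F_carrier by blast
  have "x \<otimes>\<^bsub>G\<^esub> \<gamma> = base x \<otimes>\<^bsub>G\<^esub> (gam x \<otimes>\<^bsub>G\<^esub> \<gamma>)"
    by (subst d(3)) (rule m_assoc[OF b \<Gamma>_carrier[OF d(2)] \<Gamma>_carrier[OF assms(2)]])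
  then show ?thesis using decomposition_unique(1)[OF d(1) \<Gamma>_closed(1)[OF d(2) assms(2)]] by simp
qed

lemma gam_F: "y \<in> F \<Longrightarrow> gam y = \<one>\<^bsub>G\<^esub>"
  using decomposition_unique(1)[OF _ \<Gamma>_closed(2), of y] r_one[of y] F_carrier by (auto simp del: one_DirProd)

lemma right_in_F_iff:
  assumes x: "x \<in> carrier G" and \<gamma>: "\<gamma> \<in> \<Gamma>"
  shows "x \<otimes>\<^bsub>G\<^esub> inv\<^bsub>G\<^esub> \<gamma> \<in> F \<longleftrightarrow> \<gamma> = gam x"
proof
  note \<gamma>c = \<Gamma>_carrier[OF \<gamma>]
  assume "x \<otimes>\<^bsub>G\<^esub> inv\<^bsub>G\<^esub> \<gamma> \<in> F"
  from decomposition_unique(1)[OF this \<gamma>] show "\<gamma> = gam x"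
    using m_assoc[OF x inv_closed[OF \<gamma>c] \<gamma>c] l_inv[OF \<gamma>c] r_one[OF x] by simp
next
  note d = decomposition[OF x]
  have b: "base x \<in> carrier G" using d(1) F_carrier by blast
  note gc = \<Gamma>_carrier[OF d(2)]
  assume "\<gamma> = gam x"
  then have "x \<otimes>\<^bsub>G\<^esub> inv\<^bsub>G\<^esub> \<gamma> = (base x \<otimes>\<^bsub>G\<^esub> gam x) \<otimes>\<^bsub>G\<^esub> inv\<^bsub>G\<^esub> (gam x)" using d(3) by simp
  also have "\<dots> = base x" using m_assoc[OF b gc inv_closed[OF gc]] r_inv[OF gc] r_one[OF b] by simp
  finally show "x \<otimes>\<^bsub>G\<^esub> inv\<^bsub>G\<^esub> \<gamma> \<in> F" using d(1) by simp
qed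

text \<open>Exactly one \<gamma> has its inverse move \<open>x\<close> into \<open>F\<close> from
  the right, so the indicators of the translates of \<open>F\<close> sum to 1; right invariance of
  \<open>M\<close> then brings each translate back to \<open>F\<close>.\<close>

lemma unfolding_formula:
  fixes k :: "'a \<times> 'b \<Rightarrow> ennreal"
  assumes k: "k \<in> borel_measurable (borel_of T)"
  shows "(\<integral>\<^sup>+x. k x \<partial>M) = (\<integral>\<^sup>+\<gamma>. (\<integral>\<^sup>+x. indicator F x * k (x \<otimes>\<^bsub>G\<^esub> \<gamma>) \<partial>M) \<partial>count_space \<Gamma>)"
proof -
  note [measurable_cong] = sets_M
  note [measurable] = k F_sets
  have "(\<integral>\<^sup>+x. k x \<partial>M) = (\<integral>\<^sup>+x. (\<integral>\<^sup>+\<gamma>. indicator F (x \<otimes>\<^bsub>G\<^esub> inv\<^bsub>G\<^esub> \<gamma>) * k x \<partial>count_space \<Gamma>) \<partial>M)"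
  proof (rule nn_integral_cong)
    fix x assume "x \<in> space M"
    then have x: "x \<in> carrier G" by (simp add: space_M)
    have "(\<integral>\<^sup>+\<gamma>. indicator F (x \<otimes>\<^bsub>G\<^esub> inv\<^bsub>G\<^esub> \<gamma>) * k x \<partial>count_space \<Gamma>) = (\<integral>\<^sup>+\<gamma>. k x * indicator {gam x} \<gamma> \<partial>count_space \<Gamma>)"
      by (intro nn_integral_cong) (auto simp: right_in_F_iff[OF x] indicator_def)
    also have "\<dots> = k x" using decomposition(2)[OF x] by (subst nn_integral_indicator_singleton) auto
    finally show "k x = (\<integral>\<^sup>+\<gamma>. indicator F (x \<otimes>\<^bsub>G\<^esub> inv\<^bsub>G\<^esub> \<gamma>) * k x \<partial>count_space \<Gamma>)" by simp
  qed
  also have "\<dots> = (\<integral>\<^sup>+\<gamma>. (\<integral>\<^sup>+x. indicator F (x \<otimes>\<^bsub>G\<^esub> inv\<^bsub>G\<^esub> \<gamma>) * k x \<partial>M) \<partial>count_space \<Gamma>)"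
  proof (rule nn_integral_count_space_nn_integral[OF countable_\<Gamma>])
    fix \<gamma> assume "\<gamma> \<in> \<Gamma>"
    note [measurable] = right_measurable[OF inv_closed[OF \<Gamma>_carrier[OF this]]]
    show "(\<lambda>x. indicator F (x \<otimes>\<^bsub>G\<^esub> inv\<^bsub>G\<^esub> \<gamma>) * k x) \<in> borel_measurable M" by measurable
  qed
  also have "\<dots> = (\<integral>\<^sup>+\<gamma>. (\<integral>\<^sup>+x. indicator F x * k (x \<otimes>\<^bsub>G\<^esub> \<gamma>) \<partial>M) \<partial>count_space \<Gamma>)"
  proof (rule nn_integral_cong)
    fix \<gamma> assume "\<gamma> \<in> space (count_space \<Gamma>)"
    then have \<gamma>: "\<gamma> \<in> carrier G" using \<Gamma>_carrier by simp
    note [measurable] = right_measurable[OF inv_closed[OF \<gamma>]]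
    have "(\<integral>\<^sup>+x. indicator F (x \<otimes>\<^bsub>G\<^esub> inv\<^bsub>G\<^esub> \<gamma>) * k x \<partial>M)
      = (\<integral>\<^sup>+x. indicator F ((x \<otimes>\<^bsub>G\<^esub> \<gamma>) \<otimes>\<^bsub>G\<^esub> inv\<^bsub>G\<^esub> \<gamma>) * k (x \<otimes>\<^bsub>G\<^esub> \<gamma>) \<partial>M)"
      by (rule right_nn_integral[OF \<gamma>, symmetric]) measurable
    also have "\<dots> = (\<integral>\<^sup>+x. indicator F x * k (x \<otimes>\<^bsub>G\<^esub> \<gamma>) \<partial>M)"
    proof (rule nn_integral_cong)
      fix x assume "x \<in> space M"
      then have x: "x \<in> carrier G" by (simp add: space_M)
      have "(x \<otimes>\<^bsub>G\<^esub> \<gamma>) \<otimes>\<^bsub>G\<^esub> inv\<^bsub>G\<^esub> \<gamma> = x"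
        using m_assoc[OF x \<gamma> inv_closed[OF \<gamma>]] r_inv[OF \<gamma>] r_one[OF x] by simp
      then show "indicator F ((x \<otimes>\<^bsub>G\<^esub> \<gamma>) \<otimes>\<^bsub>G\<^esub> inv\<^bsub>G\<^esub> \<gamma>) * k (x \<otimes>\<^bsub>G\<^esub> \<gamma>) = indicator F x * k (x \<otimes>\<^bsub>G\<^esub> \<gamma>)" by simp
    qed
    finally show "(\<integral>\<^sup>+x. indicator F (x \<otimes>\<^bsub>G\<^esub> inv\<^bsub>G\<^esub> \<gamma>) * k x \<partial>M) = (\<integral>\<^sup>+x. indicator F x * k (x \<otimes>\<^bsub>G\<^esub> \<gamma>) \<partial>M)" .
  qed
  finally show ?thesis .
qed

definition right_invariant :: "('a \<times> 'b \<Rightarrow> 'c) \<Rightarrow> bool" where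
  "right_invariant k \<longleftrightarrow> (\<forall>x\<in>carrier G. \<forall>\<gamma>\<in>\<Gamma>. k (x \<otimes>\<^bsub>G\<^esub> \<gamma>) = k x)"

text \<open>For a right invariant function, unfolding only has to count how many \<Gamma>-translates
  of a point of \<open>F\<close> fall into \<open>S\<close>.\<close>

lemma unfolding_invariant:
  fixes k :: "'a \<times> 'b \<Rightarrow> ennreal"
  assumes k: "k \<in> borel_measurable (borel_of T)" "right_invariant k" and S: "S \<in> sets (borel_of T)"
  shows "(\<integral>\<^sup>+x. indicator S x * k x \<partial>M)
    = (\<integral>\<^sup>+x. indicator F x * k x * (\<integral>\<^sup>+\<gamma>. indicator S (x \<otimes>\<^bsub>G\<^esub> \<gamma>) \<partial>count_space \<Gamma>) \<partial>M)"
proof -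
  note [measurable_cong] = sets_M
  note [measurable] = k(1) F_sets S
  have "(\<integral>\<^sup>+x. indicator S x * k x \<partial>M)
    = (\<integral>\<^sup>+\<gamma>. (\<integral>\<^sup>+x. indicator F x * (indicator S (x \<otimes>\<^bsub>G\<^esub> \<gamma>) * k (x \<otimes>\<^bsub>G\<^esub> \<gamma>)) \<partial>M) \<partial>count_space \<Gamma>)"
    by (rule unfolding_formula) measurable
  also have "\<dots> = (\<integral>\<^sup>+\<gamma>. (\<integral>\<^sup>+x. indicator F x * k x * indicator S (x \<otimes>\<^bsub>G\<^esub> \<gamma>) \<partial>M) \<partial>count_space \<Gamma>)"
  proof (intro nn_integral_cong)
    fix \<gamma> x assume "\<gamma> \<in> space (count_space \<Gamma>)" "x \<in> space M"
    then have "k (x \<otimes>\<^bsub>G\<^esub> \<gamma>) = k x" using k(2) space_M by (metis right_invariant_def space_count_space)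
    then show "indicator F x * (indicator S (x \<otimes>\<^bsub>G\<^esub> \<gamma>) * k (x \<otimes>\<^bsub>G\<^esub> \<gamma>)) = indicator F x * k x * indicator S (x \<otimes>\<^bsub>G\<^esub> \<gamma>)"
      by (simp only: mult_ac)
  qed
  also have "\<dots> = (\<integral>\<^sup>+x. (\<integral>\<^sup>+\<gamma>. indicator F x * k x * indicator S (x \<otimes>\<^bsub>G\<^esub> \<gamma>) \<partial>count_space \<Gamma>) \<partial>M)"
  proof (rule nn_integral_count_space_nn_integral[OF countable_\<Gamma>, symmetric])
    fix \<gamma> assume "\<gamma> \<in> \<Gamma>"
    note [measurable] = right_measurable[OF \<Gamma>_carrier[OF this]]
    show "(\<lambda>x. indicator F x * k x * indicator S (x \<otimes>\<^bsub>G\<^esub> \<gamma>)) \<in> borel_measurable M" by measurable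
  qed
  also have "\<dots> = (\<integral>\<^sup>+x. indicator F x * k x * (\<integral>\<^sup>+\<gamma>. indicator S (x \<otimes>\<^bsub>G\<^esub> \<gamma>) \<partial>count_space \<Gamma>) \<partial>M)"
    by (intro nn_integral_cong nn_integral_cmult) simp
  finally show ?thesis .
qed

text \<open>The translate of \<open>F\<close> by \<open>g\<close> also meets every coset of \<Gamma>
  exactly once, so the counting factor of \<open>unfolding_invariant\<close> is 1. This is the
  source of unitarity of the induced action.\<close>

lemma left_shift_integral:
  fixes k :: "'a \<times> 'b \<Rightarrow> ennreal"
  assumes k: "k \<in> borel_measurable (borel_of T)" "right_invariant k" and g: "g \<in> carrier G"
  shows "(\<integral>\<^sup>+x. indicator F x * k (g \<otimes>\<^bsub>G\<^esub> x) \<partial>M) = (\<integral>\<^sup>+x. indicator F x * k x \<partial>M)"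
proof -
  let ?S = "(\<lambda>x. g \<otimes>\<^bsub>G\<^esub> x) ` F"
  have S: "?S \<in> sets (borel_of T)" by (rule left_image_sets[OF g F_sets])
  note [measurable_cong] = sets_M
  note [measurable] = k(1) F_sets S
  have "(\<integral>\<^sup>+x. indicator F x * k (g \<otimes>\<^bsub>G\<^esub> x) \<partial>M) = (\<integral>\<^sup>+x. indicator ?S (g \<otimes>\<^bsub>G\<^esub> x) * k (g \<otimes>\<^bsub>G\<^esub> x) \<partial>M)"
  proof (rule nn_integral_cong)
    fix x assume "x \<in> space M"
    then have x: "x \<in> carrier G" by (simp add: space_M)
    have "g \<otimes>\<^bsub>G\<^esub> x \<in> ?S \<longleftrightarrow> x \<in> F"
      unfolding left_image[OF g F_carrier] using m_assoc[OF inv_closed[OF g] g x] l_inv[OF g] l_one[OF x] m_closed[OF g x]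
      by (simp del: carrier_DirProd mult_DirProd one_DirProd)
    then show "indicator F x * k (g \<otimes>\<^bsub>G\<^esub> x) = indicator ?S (g \<otimes>\<^bsub>G\<^esub> x) * k (g \<otimes>\<^bsub>G\<^esub> x)"
      by (simp add: indicator_def)
  qed
  also have "\<dots> = (\<integral>\<^sup>+x. indicator ?S x * k x \<partial>M)"
    by (rule left_inv_nn_integral[OF left_inv_M g]) measurable
  also have "\<dots> = (\<integral>\<^sup>+x. indicator F x * k x * (\<integral>\<^sup>+\<gamma>. indicator ?S (x \<otimes>\<^bsub>G\<^esub> \<gamma>) \<partial>count_space \<Gamma>) \<partial>M)"
    by (rule unfolding_invariant[OF k S])
  also have "\<dots> = (\<integral>\<^sup>+x. indicator F x * k x \<partial>M)"
  proof (rule nn_integral_cong)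
    fix x assume "x \<in> space M"
    then have x: "x \<in> carrier G" by (simp add: space_M)
    let ?z = "inv\<^bsub>G\<^esub> g \<otimes>\<^bsub>G\<^esub> x"
    have z: "?z \<in> carrier G" using inv_closed[OF g] x by (rule m_closed)
    have iff: "x \<otimes>\<^bsub>G\<^esub> \<gamma> \<in> ?S \<longleftrightarrow> \<gamma> = inv\<^bsub>G\<^esub> (gam ?z)" if \<gamma>: "\<gamma> \<in> \<Gamma>" for \<gamma>
    proof -
      note \<gamma>c = \<Gamma>_carrier[OF \<gamma>]
      have "x \<otimes>\<^bsub>G\<^esub> \<gamma> \<in> ?S \<longleftrightarrow> inv\<^bsub>G\<^esub> g \<otimes>\<^bsub>G\<^esub> (x \<otimes>\<^bsub>G\<^esub> \<gamma>) \<in> F"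
        using left_image[OF g F_carrier] m_closed[OF x \<gamma>c] by (simp del: carrier_DirProd)
      also have "inv\<^bsub>G\<^esub> g \<otimes>\<^bsub>G\<^esub> (x \<otimes>\<^bsub>G\<^esub> \<gamma>) = ?z \<otimes>\<^bsub>G\<^esub> inv\<^bsub>G\<^esub> (inv\<^bsub>G\<^esub> \<gamma>)"
        using m_assoc[OF inv_closed[OF g] x \<gamma>c] inv_inv[OF \<gamma>c] by simp
      also have "\<dots> \<in> F \<longleftrightarrow> inv\<^bsub>G\<^esub> \<gamma> = gam ?z" by (rule right_in_F_iff[OF z \<Gamma>_closed(3)[OF \<gamma>]])
      also have "\<dots> \<longleftrightarrow> \<gamma> = inv\<^bsub>G\<^esub> (gam ?z)"
        using inv_inv[OF \<gamma>c] inv_inv[OF \<Gamma>_carrier[OF decomposition(2)[OF z]]] by metis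
      finally show ?thesis .
    qed
    have "(\<integral>\<^sup>+\<gamma>. indicator ?S (x \<otimes>\<^bsub>G\<^esub> \<gamma>) \<partial>count_space \<Gamma>) = (\<integral>\<^sup>+\<gamma>. 1 * indicator {inv\<^bsub>G\<^esub> (gam ?z)} \<gamma> \<partial>count_space \<Gamma>)"
      using iff by (intro nn_integral_cong) (auto simp: indicator_def)
    also have "\<dots> = 1" using \<Gamma>_closed(3)[OF decomposition(2)[OF z]] by (subst nn_integral_indicator_singleton) auto
    finally show "indicator F x * k x * (\<integral>\<^sup>+\<gamma>. indicator ?S (x \<otimes>\<^bsub>G\<^esub> \<gamma>) \<partial>count_space \<Gamma>) = indicator F x * k x" by simp
  qed
  finally show ?thesis .
qed

lemma null_transfer:
  assumes N: "N \<in> sets (borel_of T)" "right_invariant (\<lambda>x. x \<in> N)" and z: "emeasure M (F \<inter> N) = 0"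
  shows "emeasure M N = 0"
proof -
  note [measurable_cong] = sets_M
  note [measurable] = F_sets N(1)
  have "emeasure M N = (\<integral>\<^sup>+x. indicator N x \<partial>M)" using N by (simp add: sets_M)
  also have "\<dots> = (\<integral>\<^sup>+\<gamma>. (\<integral>\<^sup>+x. indicator F x * indicator N (x \<otimes>\<^bsub>G\<^esub> \<gamma>) \<partial>M) \<partial>count_space \<Gamma>)"
    by (rule unfolding_formula) measurable
  also have "\<dots> = (\<integral>\<^sup>+\<gamma>. (\<integral>\<^sup>+x. indicator (F \<inter> N) x \<partial>M) \<partial>count_space \<Gamma>)"
    using N(2) by (intro nn_integral_cong) (auto simp: right_invariant_def space_M indicator_def)
  also have "\<dots> = 0" using z by (simp add: sets_M)
  finally show ?thesis .
qed

text \<open>Discreteness at the identity: for two points of a small neighbourhood of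
  \<open>x\<close> the product of the inverse of one with the other is so near to the identity that
  it can lie in \<Gamma> only trivially. Such a neighbourhood injects into the quotient by
  \<Gamma>.\<close>

lemma injective_nhd:
  assumes x: "x \<in> carrier G"
  obtains U where "openin T U" "x \<in> U" "\<And>z \<gamma> \<delta>. z \<in> carrier G \<Longrightarrow> \<gamma> \<in> \<Gamma> \<Longrightarrow> \<delta> \<in> \<Gamma> \<Longrightarrow> z \<otimes>\<^bsub>G\<^esub> \<gamma> \<in> U \<Longrightarrow> z \<otimes>\<^bsub>G\<^esub> \<delta> \<in> U \<Longrightarrow> \<gamma> = \<delta>"
proof -
  have "openin (subtopology T \<Gamma>) {\<one>\<^bsub>G\<^esub>}" using \<Gamma>_closed(2) by (simp add: discrete_\<Gamma> del: one_DirProd)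
  then obtain P where P: "openin T P" "P \<inter> \<Gamma> = {\<one>\<^bsub>G\<^esub>}" unfolding openin_subtopology by blast
  have c: "continuous_map (prod_topology T T) T (\<lambda>z. inv\<^bsub>G\<^esub> (fst z) \<otimes>\<^bsub>G\<^esub> snd z)"
    by (intro continuous_map_mult continuous_map_compose[OF continuous_map_fst inv_continuous, unfolded o_def] continuous_map_snd)
  let ?R = "{z \<in> topspace (prod_topology T T). inv\<^bsub>G\<^esub> (fst z) \<otimes>\<^bsub>G\<^esub> snd z \<in> P}"
  have op: "openin (prod_topology T T) ?R" by (rule openin_continuous_map_preimage[OF c P(1)])
  have xx: "(x, x) \<in> ?R"
    using x P(2) l_inv[OF x] by (auto simp del: one_DirProd)
  obtain U V where UV: "openin T U" "openin T V" "x \<in> U" "x \<in> V" "U \<times> V \<subseteq> ?R"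
    using iffD1[OF openin_prod_topology_alt op, rule_format, OF xx] by (elim exE conjE) (rule that)
  show thesis
  proof (rule that[of "U \<inter> V"])
    show "openin T (U \<inter> V)" "x \<in> U \<inter> V" using UV by auto
    fix z \<gamma> \<delta> assume z: "z \<in> carrier G" and \<gamma>: "\<gamma> \<in> \<Gamma>" and \<delta>: "\<delta> \<in> \<Gamma>" and zz: "z \<otimes>\<^bsub>G\<^esub> \<gamma> \<in> U \<inter> V" "z \<otimes>\<^bsub>G\<^esub> \<delta> \<in> U \<inter> V"
    note \<gamma>c = \<Gamma>_carrier[OF \<gamma>] and \<delta>c = \<Gamma>_carrier[OF \<delta>]
    have "(z \<otimes>\<^bsub>G\<^esub> \<gamma>, z \<otimes>\<^bsub>G\<^esub> \<delta>) \<in> ?R" using UV(5) zz by blast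
    then have "inv\<^bsub>G\<^esub> (z \<otimes>\<^bsub>G\<^esub> \<gamma>) \<otimes>\<^bsub>G\<^esub> (z \<otimes>\<^bsub>G\<^esub> \<delta>) \<in> P" by simp
    also have "inv\<^bsub>G\<^esub> (z \<otimes>\<^bsub>G\<^esub> \<gamma>) \<otimes>\<^bsub>G\<^esub> (z \<otimes>\<^bsub>G\<^esub> \<delta>) = inv\<^bsub>G\<^esub> \<gamma> \<otimes>\<^bsub>G\<^esub> \<delta>"
    proof -
      have "inv\<^bsub>G\<^esub> (z \<otimes>\<^bsub>G\<^esub> \<gamma>) \<otimes>\<^bsub>G\<^esub> (z \<otimes>\<^bsub>G\<^esub> \<delta>) = inv\<^bsub>G\<^esub> \<gamma> \<otimes>\<^bsub>G\<^esub> (inv\<^bsub>G\<^esub> z \<otimes>\<^bsub>G\<^esub> (z \<otimes>\<^bsub>G\<^esub> \<delta>))"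
        unfolding inv_mult_group[OF z \<gamma>c] by (rule m_assoc[OF inv_closed[OF \<gamma>c] inv_closed[OF z] m_closed[OF z \<delta>c]])
      also have "inv\<^bsub>G\<^esub> z \<otimes>\<^bsub>G\<^esub> (z \<otimes>\<^bsub>G\<^esub> \<delta>) = \<delta>"
        using m_assoc[OF inv_closed[OF z] z \<delta>c] l_inv[OF z] l_one[OF \<delta>c] by simp
      finally show ?thesis .
    qed
    finally have "inv\<^bsub>G\<^esub> \<gamma> \<otimes>\<^bsub>G\<^esub> \<delta> \<in> P \<inter> \<Gamma>" using \<Gamma>_closed(1)[OF \<Gamma>_closed(3)[OF \<gamma>] \<delta>] by simp
    then have "inv\<^bsub>G\<^esub> \<gamma> \<otimes>\<^bsub>G\<^esub> \<delta> = \<one>\<^bsub>G\<^esub>" using P(2) by blast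
    from inv_equality[OF this \<delta>c inv_closed[OF \<gamma>c]] show "\<gamma> = \<delta>"
      using inv_inv[OF \<gamma>c] inv_inv[OF \<delta>c] by metis
  qed
qed

lemma compact_integral_finite:
  fixes k :: "'a \<times> 'b \<Rightarrow> ennreal"
  assumes k: "k \<in> borel_measurable (borel_of T)" "right_invariant k" and fin: "(\<integral>\<^sup>+x. indicator F x * k x \<partial>M) < \<infinity>"
    and K: "compactin T K"
  shows "(\<integral>\<^sup>+x. indicator K x * k x \<partial>M) < \<infinity>"
proof -
  note [measurable_cong] = sets_M
  note [measurable] = k(1) F_sets
  define \<U> where "\<U> = {U. openin T U \<and> (\<integral>\<^sup>+x. indicator U x * k x \<partial>M) < \<infinity>}"
  have "\<exists>U\<in>\<U>. x \<in> U" if x: "x \<in> carrier G" for x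
  proof -
    obtain U where U: "openin T U" "x \<in> U" "\<And>z \<gamma> \<delta>. z \<in> carrier G \<Longrightarrow> \<gamma> \<in> \<Gamma> \<Longrightarrow> \<delta> \<in> \<Gamma> \<Longrightarrow> z \<otimes>\<^bsub>G\<^esub> \<gamma> \<in> U \<Longrightarrow> z \<otimes>\<^bsub>G\<^esub> \<delta> \<in> U \<Longrightarrow> \<gamma> = \<delta>"
      by (rule injective_nhd[OF x]) (rule that)
    have "(\<integral>\<^sup>+x. indicator U x * k x \<partial>M) = (\<integral>\<^sup>+x. indicator F x * k x * (\<integral>\<^sup>+\<gamma>. indicator U (x \<otimes>\<^bsub>G\<^esub> \<gamma>) \<partial>count_space \<Gamma>) \<partial>M)"
      by (rule unfolding_invariant[OF k openin_sets_borel_of[OF U(1)]])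
    also have "\<dots> \<le> (\<integral>\<^sup>+x. indicator F x * k x * 1 \<partial>M)"
    proof (intro nn_integral_mono mult_left_mono)
      fix z assume "z \<in> space M"
      then have z: "z \<in> carrier G" by (simp add: space_M)
      show "(\<integral>\<^sup>+\<gamma>. indicator U (z \<otimes>\<^bsub>G\<^esub> \<gamma>) \<partial>count_space \<Gamma>) \<le> (1::ennreal)"
      proof (cases "\<exists>\<gamma>\<in>\<Gamma>. z \<otimes>\<^bsub>G\<^esub> \<gamma> \<in> U")
        case True
        then obtain \<gamma> where \<gamma>: "\<gamma> \<in> \<Gamma>" "z \<otimes>\<^bsub>G\<^esub> \<gamma> \<in> U" by blast
        have "(\<integral>\<^sup>+\<gamma>. indicator U (z \<otimes>\<^bsub>G\<^esub> \<gamma>) \<partial>count_space \<Gamma>) \<le> (\<integral>\<^sup>+\<delta>. 1 * indicator {\<gamma>} \<delta> \<partial>count_space \<Gamma>)"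
          using U(3)[OF z \<gamma>(1) _ \<gamma>(2)] by (intro nn_integral_mono) (auto simp: indicator_def)
        also have "\<dots> = 1" using \<gamma>(1) by (subst nn_integral_indicator_singleton) auto
        finally show ?thesis .
      next
        case False
        then have "(\<integral>\<^sup>+\<gamma>. indicator U (z \<otimes>\<^bsub>G\<^esub> \<gamma>) \<partial>count_space \<Gamma>) = (\<integral>\<^sup>+\<gamma>. (0::ennreal) \<partial>count_space \<Gamma>)"
          by (intro nn_integral_cong) auto
        then show ?thesis by simp
      qed
    qed simp
    also have "\<dots> < \<infinity>" using fin by simp
    finally show ?thesis using U by (auto simp: \<U>_def)
  qed
  moreover have "K \<subseteq> carrier G" using compactin_subset_topspace[OF K] by (simp only: topspace_T)
  ultimately have "K \<subseteq> \<Union>\<U>" by (meson UnionI subsetD subsetI)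
  moreover have "\<forall>U\<in>\<U>. openin T U" by (simp add: \<U>_def)
  ultimately have "\<exists>\<V>. finite \<V> \<and> \<V> \<subseteq> \<U> \<and> K \<subseteq> \<Union>\<V>"
    using conjunct2[OF K[unfolded compactin_def], rule_format, of \<U>] by simp
  then obtain \<V> where V: "finite \<V>" "\<V> \<subseteq> \<U>" "K \<subseteq> \<Union>\<V>" by (elim exE conjE) (rule that)
  have Vs: "U \<in> sets (borel_of T)" if "U \<in> \<V>" for U
    using that V(2) openin_sets_borel_of by (auto simp: \<U>_def)
  have "(\<integral>\<^sup>+x. indicator K x * k x \<partial>M) \<le> (\<integral>\<^sup>+x. (\<Sum>U\<in>\<V>. indicator U x * k x) \<partial>M)"
  proof (rule nn_integral_mono)
    fix x assume "x \<in> space M"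
    show "indicator K x * k x \<le> (\<Sum>U\<in>\<V>. indicator U x * k x)"
    proof (cases "x \<in> K")
      case True
      then obtain U where U: "U \<in> \<V>" "x \<in> U" using V(3) by blast
      have "indicator U x * k x \<le> (\<Sum>U\<in>\<V>. indicator U x * k x)" using V(1) U(1) by (intro member_le_sum) auto
      then show ?thesis using U True by simp
    qed simp
  qed
  also have "\<dots> = (\<Sum>U\<in>\<V>. \<integral>\<^sup>+x. indicator U x * k x \<partial>M)"
  proof (rule nn_integral_sum)
    fix U assume "U \<in> \<V>"
    note [measurable] = Vs[OF this]
    show "(\<lambda>x. indicator U x * k x) \<in> borel_measurable M" by measurable
  qed
  also have "\<dots> < \<infinity>" using V(1,2) by (auto simp: \<U>_def less_top)
  finally show ?thesis .
qed

lemma emeasure_F_pos: "emeasure M F > 0"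
proof (rule ccontr)
  assume "\<not> emeasure M F > 0"
  then have z: "emeasure M F = 0" by simp
  have "emeasure M (carrier G) = 0"
  proof (rule null_transfer)
    show "carrier G \<in> sets (borel_of T)" using sets.top[of "borel_of T"] by simp
    show "right_invariant (\<lambda>x. x \<in> carrier G)"
      unfolding right_invariant_def using \<Gamma>_carrier m_closed by blast
    show "emeasure M (F \<inter> carrier G) = 0" using z F_carrier by (simp add: Int_absorb2)
  qed
  moreover have "emeasure M (carrier G) > 0"
  proof -
    have "openin T (carrier G)" using openin_topspace[of T] by (simp only: topspace_T)
    moreover have "carrier G \<noteq> {}" using one_closed by blast
    ultimately show ?thesis using haar by (simp only: left_haar_measure_def simp_thms)
  qed
  ultimately show False by simp
qed

end

section \<open>The induced representation\<close>

locale lattice_action =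
  product_lattice G1 T1 G2 T2 \<Gamma> M F + monomial_action "(G1 \<times>\<times> G2)\<lparr>carrier := \<Gamma>\<rparr>" c s
  for G1 :: "('a, 'm) monoid_scheme" and T1 :: "'a topology"
    and G2 :: "('b, 'n) monoid_scheme" and T2 :: "'b topology"
    and \<Gamma> :: "('a \<times> 'b) set" and M :: "('a \<times> 'b) measure" and F :: "('a \<times> 'b) set"
    and c :: "'a \<times> 'b \<Rightarrow> nat \<Rightarrow> complex" and s :: "'a \<times> 'b \<Rightarrow> nat \<Rightarrow> nat"
begin

lemma c_norm: "\<gamma> \<in> \<Gamma> \<Longrightarrow> cmod (c \<gamma> m) = 1"
  using c_unit by simp

lemma c_nz: "\<gamma> \<in> \<Gamma> \<Longrightarrow> c \<gamma> m \<noteq> 0"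
  using c_norm[of \<gamma> m] by auto

lemma op_mul: "\<gamma> \<in> \<Gamma> \<Longrightarrow> \<delta> \<in> \<Gamma> \<Longrightarrow> op (\<gamma> \<otimes>\<^bsub>G\<^esub> \<delta>) f = op \<gamma> (op \<delta> f)"
  using op_mult[of \<gamma> \<delta> f] by simp

lemma op_1: "op \<one>\<^bsub>G\<^esub> f = f"
  using op_one[of f] by simp

lemma bij_s': "\<gamma> \<in> \<Gamma> \<Longrightarrow> bij (s \<gamma>)"
  using bij_s[of \<gamma>] by simp

lemma inv_mult_\<Gamma>: "\<gamma> \<in> \<Gamma> \<Longrightarrow> \<delta> \<in> \<Gamma> \<Longrightarrow> inv\<^bsub>G\<^esub> (\<gamma> \<otimes>\<^bsub>G\<^esub> \<delta>) = inv\<^bsub>G\<^esub> \<delta> \<otimes>\<^bsub>G\<^esub> inv\<^bsub>G\<^esub> \<gamma>"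
  using inv_mult_group \<Gamma>_carrier by blast

lemma perp_op:
  assumes g: "\<gamma> \<in> \<Gamma>" and f: "perp f"
  shows "perp (op \<gamma> f)"
  unfolding perp_def
proof
  fix n
  have u: "inv_vec n m = c \<gamma> m * inv_vec n (s \<gamma> m)" for m
    using fun_cong[OF inv_vec_op[of \<gamma> n], of m] g by (simp add: op_def)
  have "(\<Sum>m | inv_vec n m \<noteq> 0. op \<gamma> f m * cnj (inv_vec n m)) = (\<Sum>m | inv_vec n (s \<gamma> m) \<noteq> 0. f (s \<gamma> m) * cnj (inv_vec n (s \<gamma> m)))"
  proof (rule sum.cong)
    show "{m. inv_vec n m \<noteq> 0} = {m. inv_vec n (s \<gamma> m) \<noteq> 0}"
      using u c_nz[OF g] by (metis mult_eq_0_iff)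
    fix m
    have "c \<gamma> m * cnj (c \<gamma> m) = 1" using c_norm[OF g, of m] complex_norm_square[of "c \<gamma> m"] by simp
    then show "op \<gamma> f m * cnj (inv_vec n m) = f (s \<gamma> m) * cnj (inv_vec n (s \<gamma> m))"
      unfolding op_def u[of m] by (simp add: mult_ac)
  qed
  also have "\<dots> = (\<Sum>m | inv_vec n m \<noteq> 0. f m * cnj (inv_vec n m))"
  proof (rule sum.reindex_bij_betw)
    have "{m. inv_vec n (s \<gamma> m) \<noteq> 0} = s \<gamma> -` {m. inv_vec n m \<noteq> 0}" by auto
    then show "bij_betw (s \<gamma>) {m. inv_vec n (s \<gamma> m) \<noteq> 0} {m. inv_vec n m \<noteq> 0}"
      using bij_s'[OF g] by (metis bij_betw_def bij_is_inj bij_is_surj inj_on_subset subset_UNIV surj_image_vimage_eq)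
  qed
  also have "\<dots> = 0" using f by (simp add: perp_def)
  finally show "(\<Sum>m | inv_vec n m \<noteq> 0. op \<gamma> f m * cnj (inv_vec n m)) = 0" .
qed

section \<open>Equivariant functions with values in sequences\<close>

abbreviation sec :: "(nat \<times> 'a \<times> 'b \<Rightarrow> complex) \<Rightarrow> 'a \<times> 'b \<Rightarrow> nat \<Rightarrow> complex" where
  "sec f x \<equiv> (\<lambda>n. f (n, x))"

text \<open>Equivariance and orthogonality are required at every point, so values at single points
  can be manipulated; only norms ignore null sets. Zero outside \<open>carrier G\<close> is a
  normalisation that makes pointwise identities such as \<open>\<rho> \<one> f = f\<close> hold on
  the whole type.\<close>

definition W :: "(nat \<times> 'a \<times> 'b \<Rightarrow> complex) set" where
  "W = {f. (\<forall>n. (\<lambda>x. f (n, x)) \<in> borel_measurable (borel_of T))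
      \<and> (\<forall>n x. x \<notin> carrier G \<longrightarrow> f (n, x) = 0)
      \<and> (\<forall>x\<in>carrier G. \<forall>\<gamma>\<in>\<Gamma>. sec f (x \<otimes>\<^bsub>G\<^esub> \<gamma>) = op (inv\<^bsub>G\<^esub> \<gamma>) (sec f x))
      \<and> (\<forall>x\<in>carrier G. perp (sec f x))}"

lemma WI:
  assumes "\<And>n. (\<lambda>x. f (n, x)) \<in> borel_measurable (borel_of T)" "\<And>n x. x \<notin> carrier G \<Longrightarrow> f (n, x) = 0"
    "\<And>x \<gamma>. x \<in> carrier G \<Longrightarrow> \<gamma> \<in> \<Gamma> \<Longrightarrow> sec f (x \<otimes>\<^bsub>G\<^esub> \<gamma>) = op (inv\<^bsub>G\<^esub> \<gamma>) (sec f x)"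
    "\<And>x. x \<in> carrier G \<Longrightarrow> perp (sec f x)"
  shows "f \<in> W"
  unfolding W_def using assms by blast

lemma WD:
  assumes "f \<in> W"
  shows "(\<lambda>x. f (n, x)) \<in> borel_measurable (borel_of T)" "x \<notin> carrier G \<Longrightarrow> f (n, x) = 0"
    "x \<in> carrier G \<Longrightarrow> \<gamma> \<in> \<Gamma> \<Longrightarrow> sec f (x \<otimes>\<^bsub>G\<^esub> \<gamma>) = op (inv\<^bsub>G\<^esub> \<gamma>) (sec f x)"
    "x \<in> carrier G \<Longrightarrow> perp (sec f x)"
  using assms unfolding W_def by blast+

definition MF :: "('a \<times> 'b) measure" where
  "MF = density M (indicator F)"

text \<open>Equivariance recovers a function from its values on \<open>F\<close>, so the norm
  integrates over \<open>F\<close> alone. The index becomes an extra variable with counting measure,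
  which makes sequence-valued functions scalar ones.\<close>

definition N :: "(nat \<times> 'a \<times> 'b) measure" where
  "N = count_space UNIV \<Otimes>\<^sub>M MF"

text \<open>The squared norm of the section at \<open>x\<close>, extended-real because a section
  need not be square-summable at every point. For members of \<open>W\<close> it is right
  \<Gamma>-invariant, as monomial operators preserve it.\<close>

definition wt :: "(nat \<times> 'a \<times> 'b \<Rightarrow> complex) \<Rightarrow> 'a \<times> 'b \<Rightarrow> ennreal" where
  "wt f x = (\<integral>\<^sup>+n. ennreal ((cmod (f (n, x)))\<^sup>2) \<partial>count_space UNIV)"

lemma sets_MF: "sets MF = sets (borel_of T)"
  by (simp add: MF_def sets_M)

lemma finite_MF: "finite_measure MF"
proof
  have "emeasure MF (space MF) = (\<integral>\<^sup>+x. indicator F x * indicator (space M) x \<partial>M)"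
    using F_sets sets.top[of M] unfolding MF_def space_density
    by (intro emeasure_density borel_measurable_indicator) (simp_all add: sets_M)
  also have "\<dots> = (\<integral>\<^sup>+x. indicator F x \<partial>M)" by (intro nn_integral_cong) simp
  also have "\<dots> = emeasure M F" using F_sets by (simp add: sets_M)
  finally have "emeasure MF (space MF) = emeasure M F" .
  then show "emeasure MF (space MF) \<noteq> \<infinity>" using finite_F by simp
qed

lemma pair_N: "pair_sigma_finite (count_space (UNIV :: nat set)) MF"
  by (intro pair_sigma_finite.intro sigma_finite_measure_count_space finite_measure.axioms(1)[OF finite_MF])

lemma W_measurable: "f \<in> W \<Longrightarrow> f \<in> borel_measurable N"
  unfolding N_def by (rule measurable_pair_measure_countable1)
    (use WD(1) in \<open>auto simp: measurable_cong_sets[OF sets_MF refl]\<close>)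

lemma wt_suminf: "wt f x = (\<Sum>n. ennreal ((cmod (f (n, x)))\<^sup>2))"
  by (simp add: wt_def nn_integral_count_space_nat)

lemma wt_measurable: "f \<in> W \<Longrightarrow> wt f \<in> borel_measurable (borel_of T)"
proof -
  assume "f \<in> W"
  note [measurable] = WD(1)[OF this]
  show ?thesis unfolding wt_suminf[abs_def] by measurable
qed

lemma wt_invariant:
  assumes f: "f \<in> W"
  shows "right_invariant (wt f)"
  unfolding right_invariant_def
proof (intro ballI)
  fix x \<gamma> assume x: "x \<in> carrier G" and \<gamma>: "\<gamma> \<in> \<Gamma>"
  note i = \<Gamma>_closed(3)[OF \<gamma>]
  have "cmod (f (n, x \<otimes>\<^bsub>G\<^esub> \<gamma>)) = cmod (f (s (inv\<^bsub>G\<^esub> \<gamma>) n, x))" for n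
    using fun_cong[OF WD(3)[OF f x \<gamma>], of n] c_norm[OF i] by (simp add: op_def norm_mult)
  then have "wt f (x \<otimes>\<^bsub>G\<^esub> \<gamma>) = (\<integral>\<^sup>+n. ennreal ((cmod (f (s (inv\<^bsub>G\<^esub> \<gamma>) n, x)))\<^sup>2) \<partial>count_space UNIV)"
    by (simp add: wt_def)
  also have "\<dots> = wt f x"
    unfolding wt_def using bij_s'[OF i]
    by (rule nn_integral_bij_count_space[where f = "\<lambda>n. ennreal ((cmod (f (n, x)))\<^sup>2)"])
  finally show "wt f (x \<otimes>\<^bsub>G\<^esub> \<gamma>) = wt f x" .
qed

lemma N_integral:
  assumes f: "f \<in> W"
  shows "(\<integral>\<^sup>+z. ennreal ((cmod (f z))\<^sup>2) \<partial>N) = (\<integral>\<^sup>+x. indicator F x * wt f x \<partial>M)"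
proof -
  interpret pair_sigma_finite "count_space (UNIV :: nat set)" MF by (rule pair_N)
  note [measurable] = W_measurable[OF f, unfolded N_def]
  have "(\<integral>\<^sup>+z. ennreal ((cmod (f z))\<^sup>2) \<partial>N) = (\<integral>\<^sup>+x. wt f x \<partial>MF)"
    unfolding N_def wt_def by (subst nn_integral_snd[symmetric]) simp_all
  also have "\<dots> = (\<integral>\<^sup>+x. indicator F x * wt f x \<partial>M)"
    unfolding MF_def using F_sets wt_measurable[OF f]
    by (intro nn_integral_density) (simp_all add: sets_M measurable_cong_sets[OF sets_M refl])
  finally show ?thesis .
qed

lemma W_lin:
  assumes f: "f \<in> W" and h: "h \<in> W"
  shows "(\<lambda>z. a * f z + b * h z) \<in> W"
proof (rule WI)
  note [measurable] = WD(1)[OF f] WD(1)[OF h]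
  show "(\<lambda>x. a * f (n, x) + b * h (n, x)) \<in> borel_measurable (borel_of T)" for n by measurable
  show "a * f (n, x) + b * h (n, x) = 0" if "x \<notin> carrier G" for n x
    using WD(2)[OF f that] WD(2)[OF h that] by simp
  fix x assume x: "x \<in> carrier G"
  show "(\<lambda>n. a * f (n, x \<otimes>\<^bsub>G\<^esub> \<gamma>) + b * h (n, x \<otimes>\<^bsub>G\<^esub> \<gamma>)) = op (inv\<^bsub>G\<^esub> \<gamma>) (\<lambda>n. a * f (n, x) + b * h (n, x))" if "\<gamma> \<in> \<Gamma>" for \<gamma>
    using fun_cong[OF WD(3)[OF f x that]] fun_cong[OF WD(3)[OF h x that]] by (simp add: op_lin)
  have "(\<Sum>m\<in>A. (a * f (m, x) + b * h (m, x)) * q m) = a * (\<Sum>m\<in>A. f (m, x) * q m) + b * (\<Sum>m\<in>A. h (m, x) * q m)" for A and q :: "nat \<Rightarrow> complex"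
    by (simp add: sum_distrib_left sum.distrib algebra_simps)
  then show "perp (\<lambda>n. a * f (n, x) + b * h (n, x))"
    using WD(4)[OF f x] WD(4)[OF h x] by (simp add: perp_def)
qed

text \<open>Where some coordinate diverges, the limit is set to zero in all coordinates. This
  exceptional set is \<Gamma>-invariant, because equivariance only permutes the coordinates up to
  unimodular scalars, so the limit is equivariant at every point.\<close>

lemma W_limit:
  fixes Fs :: "nat \<Rightarrow> nat \<times> 'a \<times> 'b \<Rightarrow> complex"
  assumes Fs: "\<And>i. Fs i \<in> W"
  defines "f \<equiv> \<lambda>(n, x). if \<forall>m. convergent (\<lambda>i. Fs i (m, x)) then lim (\<lambda>i. Fs i (n, x)) else 0"
  shows "f \<in> W"
proof (rule WI)
  note [measurable] = WD(1)[OF Fs]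
  show "(\<lambda>x. f (n, x)) \<in> borel_measurable (borel_of T)" for n
  proof -
    have [measurable]: "Measurable.pred (borel_of T) (\<lambda>x. convergent (\<lambda>i. Fs i (m, x)))" for m
      unfolding Cauchy_convergent_iff[symmetric] pred_def by (rule sets_Collect_Cauchy) (rule WD(1)[OF Fs])
    have [measurable]: "(\<lambda>x. lim (\<lambda>i. Fs i (n, x))) \<in> borel_measurable (borel_of T)"
      by (rule borel_measurable_lim_metric) (rule WD(1)[OF Fs])
    show ?thesis unfolding f_def prod.case by measurable
  qed
  show "f (n, x) = 0" if "x \<notin> carrier G" for n x
    using WD(2)[OF Fs that] by (simp add: f_def limI)
  have conv: "(\<lambda>i. Fs i (n, x)) \<longlonglongrightarrow> f (n, x)" if "\<forall>m. convergent (\<lambda>i. Fs i (m, x))" for n x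
    using that by (simp add: f_def convergent_LIMSEQ_iff)
  have step: "(\<forall>m. convergent (\<lambda>i. Fs i (m, x \<otimes>\<^bsub>G\<^esub> \<gamma>))) \<and> sec f (x \<otimes>\<^bsub>G\<^esub> \<gamma>) = op (inv\<^bsub>G\<^esub> \<gamma>) (sec f x)"
    if x: "x \<in> carrier G" and \<gamma>: "\<gamma> \<in> \<Gamma>" and good: "\<forall>m. convergent (\<lambda>i. Fs i (m, x))" for x \<gamma>
  proof -
    have "(\<lambda>i. Fs i (n, x \<otimes>\<^bsub>G\<^esub> \<gamma>)) \<longlonglongrightarrow> op (inv\<^bsub>G\<^esub> \<gamma>) (sec f x) n" for n
    proof -
      have "Fs i (n, x \<otimes>\<^bsub>G\<^esub> \<gamma>) = c (inv\<^bsub>G\<^esub> \<gamma>) n * Fs i (s (inv\<^bsub>G\<^esub> \<gamma>) n, x)" for i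
        using fun_cong[OF WD(3)[OF Fs x \<gamma>], of i n] by (simp add: op_def)
      then show ?thesis unfolding op_def by (simp add: tendsto_mult[OF tendsto_const conv[OF good]])
    qed
    note L = this
    have "convergent (\<lambda>i. Fs i (m, x \<otimes>\<^bsub>G\<^esub> \<gamma>))" for m using L[of m] by (rule convergentI)
    then have good': "\<forall>m. convergent (\<lambda>i. Fs i (m, x \<otimes>\<^bsub>G\<^esub> \<gamma>))" by blast
    have "f (n, x \<otimes>\<^bsub>G\<^esub> \<gamma>) = op (inv\<^bsub>G\<^esub> \<gamma>) (sec f x) n" for n
      by (rule LIMSEQ_unique[OF conv[OF good'] L])
    with good' show ?thesis by blast
  qed
  fix x assume x: "x \<in> carrier G"
  show "sec f (x \<otimes>\<^bsub>G\<^esub> \<gamma>) = op (inv\<^bsub>G\<^esub> \<gamma>) (sec f x)" if \<gamma>: "\<gamma> \<in> \<Gamma>" for \<gamma>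
  proof (cases "\<forall>m. convergent (\<lambda>i. Fs i (m, x))")
    case True
    then show ?thesis using step[OF x \<gamma>] by blast
  next
    case False
    note \<gamma>c = \<Gamma>_carrier[OF \<gamma>]
    have xg: "(x \<otimes>\<^bsub>G\<^esub> \<gamma>) \<otimes>\<^bsub>G\<^esub> inv\<^bsub>G\<^esub> \<gamma> = x"
      using m_assoc[OF x \<gamma>c inv_closed[OF \<gamma>c]] r_inv[OF \<gamma>c] r_one[OF x] by simp
    have "\<not> (\<forall>m. convergent (\<lambda>i. Fs i (m, x \<otimes>\<^bsub>G\<^esub> \<gamma>)))"
      using step[OF m_closed[OF x \<gamma>c] \<Gamma>_closed(3)[OF \<gamma>]] False unfolding xg by blast
    then have "sec f (x \<otimes>\<^bsub>G\<^esub> \<gamma>) = (\<lambda>_. 0)" "sec f x = (\<lambda>_. 0)" using False by (simp_all only: f_def prod.case if_False)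
    then show ?thesis by (simp add: op_def)
  qed
  show "perp (sec f x)"
  proof (cases "\<forall>m. convergent (\<lambda>i. Fs i (m, x))")
    case True
    show ?thesis
      unfolding perp_def
    proof
      fix n
      have "(\<lambda>i. \<Sum>m | inv_vec n m \<noteq> 0. Fs i (m, x) * cnj (inv_vec n m)) \<longlonglongrightarrow> (\<Sum>m | inv_vec n m \<noteq> 0. f (m, x) * cnj (inv_vec n m))"
        by (intro tendsto_sum tendsto_mult conv[OF True] tendsto_const)
      moreover have "(\<Sum>m | inv_vec n m \<noteq> 0. Fs i (m, x) * cnj (inv_vec n m)) = 0" for i
        using WD(4)[OF Fs x] by (simp add: perp_def)
      ultimately show "(\<Sum>m | inv_vec n m \<noteq> 0. f (m, x) * cnj (inv_vec n m)) = 0"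
        by (simp add: LIMSEQ_const_iff)
    qed
  next
    case False
    then have "sec f x = (\<lambda>_. 0)" by (simp only: f_def prod.case if_False)
    then show ?thesis by (simp add: perp_def)
  qed
qed

lemma semi_hilbert_W: "semi_hilbert {f \<in> W. sq_int N f} (ip N)"
proof (rule semi_hilbert_L2)
  interpret pair_sigma_finite "count_space (UNIV :: nat set)" MF by (rule pair_N)
  show "f \<in> borel_measurable N" if "f \<in> W" for f by (rule W_measurable[OF that])
  show "(\<lambda>z. 0) \<in> W" by (rule WI) (auto simp: op_def perp_def)
  show "(\<lambda>z. a * f z + b * h z) \<in> W" if "f \<in> W" "h \<in> W" for f h a b by (rule W_lin[OF that])
  fix Fs :: "nat \<Rightarrow> nat \<times> 'a \<times> 'b \<Rightarrow> complex"
  assume Fs: "\<And>i. Fs i \<in> W" and conv: "AE z in N. convergent (\<lambda>i. Fs i z)"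
  define f where "f = (\<lambda>(n, x). if \<forall>m. convergent (\<lambda>i. Fs i (m, x)) then lim (\<lambda>i. Fs i (n, x)) else 0)"
  have fW: "f \<in> W" unfolding f_def by (rule W_limit[OF Fs])
  have "AE n in count_space UNIV. AE x in MF. convergent (\<lambda>i. Fs i (n, x))"
    using AE_pair[OF conv[unfolded N_def]] by simp
  then have "AE x in MF. \<forall>n. convergent (\<lambda>i. Fs i (n, x))"
    by (simp add: AE_count_space AE_all_countable)
  then have lim1: "AE x in MF. \<forall>n. (\<lambda>i. Fs i (n, x)) \<longlonglongrightarrow> f (n, x)"
    by eventually_elim (simp add: f_def convergent_LIMSEQ_iff)
  note [measurable] = W_measurable[OF Fs] W_measurable[OF fW]
  have "AE z in N. (\<lambda>i. Fs i z) \<longlonglongrightarrow> f z"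
    unfolding N_def
  proof (rule AE_pair_measure)
    have "{z \<in> space N. (\<lambda>i. Fs i z - f z) \<longlonglongrightarrow> 0} \<in> sets N" by measurable
    then show "{z \<in> space (count_space UNIV \<Otimes>\<^sub>M MF). (\<lambda>i. Fs i z) \<longlonglongrightarrow> f z} \<in> sets (count_space UNIV \<Otimes>\<^sub>M MF)"
      unfolding N_def by (simp add: LIM_zero_iff)
    show "AE n in count_space UNIV. AE x in MF. (\<lambda>i. Fs i (n, x)) \<longlonglongrightarrow> f (n, x)"
      using lim1 by (simp add: AE_count_space AE_all_countable)
  qed
  with fW show "\<exists>f\<in>W. AE z in N. (\<lambda>i. Fs i z) \<longlonglongrightarrow> f z" by blast
qed

section \<open>Translations by \<open>G1\<close> and induced vectors\<close>

definition emb :: "'a \<Rightarrow> 'a \<times> 'b" where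
  "emb g = (g, \<one>\<^bsub>G2\<^esub>)"

lemma emb_carrier: "g \<in> carrier G1 \<Longrightarrow> emb g \<in> carrier G"
  by (simp add: emb_def)

lemma emb_mult: "emb (g \<otimes>\<^bsub>G1\<^esub> h) = emb g \<otimes>\<^bsub>G\<^esub> emb h"
  by (simp add: emb_def mult_prod)

lemma emb_inv: "g \<in> carrier G1 \<Longrightarrow> emb (inv\<^bsub>G1\<^esub> g) = inv\<^bsub>G\<^esub> (emb g)"
  by (simp add: emb_def inv_DirProd[OF S1.is_group S2.is_group])

lemma emb_one: "emb \<one>\<^bsub>G1\<^esub> = \<one>\<^bsub>G\<^esub>"
  by (simp add: emb_def)

definition \<rho> :: "'a \<Rightarrow> (nat \<times> 'a \<times> 'b \<Rightarrow> complex) \<Rightarrow> nat \<times> 'a \<times> 'b \<Rightarrow> complex" where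
  "\<rho> g f = (\<lambda>(n, x). if x \<in> carrier G then f (n, inv\<^bsub>G\<^esub> (emb g) \<otimes>\<^bsub>G\<^esub> x) else 0)"

lemma sec_\<rho>: "x \<in> carrier G \<Longrightarrow> sec (\<rho> g f) x = sec f (inv\<^bsub>G\<^esub> (emb g) \<otimes>\<^bsub>G\<^esub> x)"
  by (simp add: \<rho>_def del: carrier_DirProd)

lemma \<rho>_W:
  assumes g: "g \<in> carrier G1" and f: "f \<in> W"
  shows "\<rho> g f \<in> W"
proof (rule WI)
  let ?h = "inv\<^bsub>G\<^esub> (emb g)"
  have h: "?h \<in> carrier G" by (rule inv_closed[OF emb_carrier[OF g]])
  show "(\<lambda>x. \<rho> g f (n, x)) \<in> borel_measurable (borel_of T)" for n
  proof -
    have "(\<lambda>x. f (n, ?h \<otimes>\<^bsub>G\<^esub> x)) \<in> borel_measurable (borel_of T)"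
      by (rule measurable_compose[OF left_measurable[OF h] WD(1)[OF f]])
    moreover have "\<rho> g f (n, x) = f (n, ?h \<otimes>\<^bsub>G\<^esub> x)" if "x \<in> space (borel_of T)" for x
    proof -
      have "x \<in> carrier G" using that by simp
      then show ?thesis by (simp add: \<rho>_def del: carrier_DirProd)
    qed
    ultimately show ?thesis
      using measurable_cong[of "borel_of T" "\<lambda>x. \<rho> g f (n, x)" "\<lambda>x. f (n, ?h \<otimes>\<^bsub>G\<^esub> x)" borel] by blast
  qed
  show "\<rho> g f (n, x) = 0" if "x \<notin> carrier G" for n x using that by (simp add: \<rho>_def del: carrier_DirProd)
  fix x assume x: "x \<in> carrier G"
  have hx: "?h \<otimes>\<^bsub>G\<^esub> x \<in> carrier G" by (rule m_closed[OF h x])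
  show "sec (\<rho> g f) (x \<otimes>\<^bsub>G\<^esub> \<gamma>) = op (inv\<^bsub>G\<^esub> \<gamma>) (sec (\<rho> g f) x)" if \<gamma>: "\<gamma> \<in> \<Gamma>" for \<gamma>
    using WD(3)[OF f hx \<gamma>] m_assoc[OF h x \<Gamma>_carrier[OF \<gamma>]]
    by (simp only: sec_\<rho>[OF x] sec_\<rho>[OF m_closed[OF x \<Gamma>_carrier[OF \<gamma>]]])
  show "perp (sec (\<rho> g f) x)" using WD(4)[OF f hx] by (simp only: sec_\<rho>[OF x])
qed

lemma wt_\<rho>: "x \<in> carrier G \<Longrightarrow> wt (\<rho> g f) x = wt f (inv\<^bsub>G\<^esub> (emb g) \<otimes>\<^bsub>G\<^esub> x)"
  unfolding wt_def by (simp add: \<rho>_def del: carrier_DirProd)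

lemma \<rho>_integral:
  assumes g: "g \<in> carrier G1" and f: "f \<in> W"
  shows "(\<integral>\<^sup>+x. indicator F x * wt (\<rho> g f) x \<partial>M) = (\<integral>\<^sup>+x. indicator F x * wt f x \<partial>M)"
proof -
  have "(\<integral>\<^sup>+x. indicator F x * wt (\<rho> g f) x \<partial>M) = (\<integral>\<^sup>+x. indicator F x * wt f (inv\<^bsub>G\<^esub> (emb g) \<otimes>\<^bsub>G\<^esub> x) \<partial>M)"
  proof (rule nn_integral_cong)
    fix x assume "x \<in> space M"
    then have "x \<in> carrier G" by (simp only: space_M)
    then show "indicator F x * wt (\<rho> g f) x = indicator F x * wt f (inv\<^bsub>G\<^esub> (emb g) \<otimes>\<^bsub>G\<^esub> x)" by (simp only: wt_\<rho>)
  qed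
  also have "\<dots> = (\<integral>\<^sup>+x. indicator F x * wt f x \<partial>M)"
    by (rule left_shift_integral[OF wt_measurable[OF f] wt_invariant[OF f] inv_closed[OF emb_carrier[OF g]]])
  finally show ?thesis .
qed

text \<open>The equivariant extension of the constant section \<open>v\<close> on \<open>F\<close>,
  where \<open>gam\<close> is the identity.\<close>

definition ind :: "(nat \<Rightarrow> complex) \<Rightarrow> nat \<times> 'a \<times> 'b \<Rightarrow> complex" where
  "ind v = (\<lambda>(n, x). if x \<in> carrier G then op (inv\<^bsub>G\<^esub> (gam x)) v n else 0)"

lemma sec_ind: "x \<in> carrier G \<Longrightarrow> sec (ind v) x = op (inv\<^bsub>G\<^esub> (gam x)) v"
  by (simp add: ind_def del: carrier_DirProd)

lemma gam_measurable: "gam \<in> measurable (borel_of T) (count_space \<Gamma>)"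
proof (subst measurable_count_space_eq_countable[OF countable_\<Gamma>], intro conjI ballI)
  have sp: "space (borel_of T) = carrier G" by (simp only: space_borel_of topspace_T)
  show "gam \<in> space (borel_of T) \<rightarrow> \<Gamma>" using decomposition(2) by (auto simp only: sp)
  fix \<gamma> assume \<gamma>: "\<gamma> \<in> \<Gamma>"
  have "gam -` {\<gamma>} \<inter> space (borel_of T) = (\<lambda>x. x \<otimes>\<^bsub>G\<^esub> inv\<^bsub>G\<^esub> \<gamma>) -` F \<inter> space (borel_of T)"
    unfolding sp using right_in_F_iff[OF _ \<gamma>] by blast
  also have "\<dots> \<in> sets (borel_of T)"
    by (rule measurable_sets[OF right_measurable[OF inv_closed[OF \<Gamma>_carrier[OF \<gamma>]]] F_sets])
  finally show "gam -` {\<gamma>} \<inter> space (borel_of T) \<in> sets (borel_of T)" .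
qed

lemma ind_W:
  assumes v: "perp v"
  shows "ind v \<in> W"
proof (rule WI)
  show "(\<lambda>x. ind v (n, x)) \<in> borel_measurable (borel_of T)" for n
  proof -
    have "(\<lambda>x. op (inv\<^bsub>G\<^esub> (gam x)) v n) \<in> borel_measurable (borel_of T)"
      by (rule measurable_compose[OF gam_measurable]) simp
    moreover have "ind v (n, x) = op (inv\<^bsub>G\<^esub> (gam x)) v n" if "x \<in> space (borel_of T)" for x
    proof -
      have "x \<in> carrier G" using that by simp
      then show ?thesis by (simp add: ind_def del: carrier_DirProd)
    qed
    ultimately show ?thesis
      using measurable_cong[of "borel_of T" "\<lambda>x. ind v (n, x)" "\<lambda>x. op (inv\<^bsub>G\<^esub> (gam x)) v n" borel] by blast
  qed
  show "ind v (n, x) = 0" if "x \<notin> carrier G" for n x using that by (simp add: ind_def del: carrier_DirProd)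
  fix x assume x: "x \<in> carrier G"
  note d = decomposition(2)[OF x]
  show "sec (ind v) (x \<otimes>\<^bsub>G\<^esub> \<gamma>) = op (inv\<^bsub>G\<^esub> \<gamma>) (sec (ind v) x)" if \<gamma>: "\<gamma> \<in> \<Gamma>" for \<gamma>
    unfolding sec_ind[OF x] sec_ind[OF m_closed[OF x \<Gamma>_carrier[OF \<gamma>]]] gam_right[OF x \<gamma>] inv_mult_\<Gamma>[OF d \<gamma>]
    by (rule op_mul[OF \<Gamma>_closed(3)[OF \<gamma>] \<Gamma>_closed(3)[OF d]])
  show "perp (sec (ind v) x)" unfolding sec_ind[OF x] by (rule perp_op[OF \<Gamma>_closed(3)[OF d] v])
qed

lemma wt_sec:
  assumes "sec f x = v" "v \<in> l2_space UNIV"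
  shows "wt f x = ennreal ((l2_norm v)\<^sup>2)"
proof -
  have "wt f x = (\<Sum>n. ennreal ((cmod (v n))\<^sup>2))" unfolding wt_suminf using fun_cong[OF assms(1)] by simp
  also have "\<dots> = ennreal (\<Sum>n. (cmod (v n))\<^sup>2)"
    using assms(2) by (intro suminf_ennreal2) (auto simp: l2_space_def)
  also have "(\<Sum>n. (cmod (v n))\<^sup>2) = (l2_norm v)\<^sup>2"
    using assms(2) by (simp add: l2_norm_def l2_space_def suminf_nonneg)
  finally show ?thesis .
qed

text \<open>A bound, independent of the vector, for the displacement of a normalised induced vector:
  the translated and the original section agree at points whose shift stays in \<open>F\<close>, and
  elsewhere two unit vectors differ by at most 2.\<close>

definition \<beta> :: "'a \<Rightarrow> real" where
  "\<beta> g = 2 * sqrt (measure M {x \<in> F. inv\<^bsub>G\<^esub> (emb g) \<otimes>\<^bsub>G\<^esub> x \<notin> F} / measure M F)"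

lemma measure_F_pos: "measure M F > 0"
  using emeasure_F_pos finite_F by (simp add: measure_def enn2real_positive_iff)

lemma emb_limitin: "limitin T1 t a sequentially \<Longrightarrow> limitin T (\<lambda>k. emb (t k)) (emb a) sequentially"
  by (simp add: limitin_pairwise o_def emb_def S2.const_limitin)

lemma \<beta>_nhd:
  assumes g0: "g0 \<in> carrier G1" and e: "\<epsilon> > 0"
  shows "\<exists>U. openin T1 U \<and> g0 \<in> U \<and> (\<forall>g\<in>U. \<beta> (inv\<^bsub>G1\<^esub> g0 \<otimes>\<^bsub>G1\<^esub> g) < \<epsilon>)"
proof -
  have "\<exists>U. openin T1 U \<and> g0 \<in> U \<and> (\<forall>g\<in>U. \<bar>\<beta> (inv\<^bsub>G1\<^esub> g0 \<otimes>\<^bsub>G1\<^esub> g) - 0\<bar> < \<epsilon>)"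
  proof (rule sequential_nhd[OF S1.second_countable_T])
    show "g0 \<in> topspace T1" using g0 by simp
    fix t :: "nat \<Rightarrow> 'a" assume t: "\<And>k. t k \<in> topspace T1" "limitin T1 t g0 sequentially"
    have "limitin T1 (\<lambda>k. inv\<^bsub>G1\<^esub> g0 \<otimes>\<^bsub>G1\<^esub> t k) (inv\<^bsub>G1\<^esub> g0 \<otimes>\<^bsub>G1\<^esub> g0) sequentially"
      by (rule S1.mult_limitin[OF S1.const_limitin t(2)]) (use g0 in simp)
    then have "limitin T1 (\<lambda>k. inv\<^bsub>G1\<^esub> g0 \<otimes>\<^bsub>G1\<^esub> t k) \<one>\<^bsub>G1\<^esub> sequentially" using g0 by simp
    from emb_limitin[OF this] have lim: "limitin T (\<lambda>k. emb (inv\<^bsub>G1\<^esub> g0 \<otimes>\<^bsub>G1\<^esub> t k)) \<one>\<^bsub>G\<^esub> sequentially"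
      unfolding emb_one .
    have car: "emb (inv\<^bsub>G1\<^esub> g0 \<otimes>\<^bsub>G1\<^esub> t k) \<in> carrier G" for k
      using t(1)[of k] g0 by (intro emb_carrier) simp
    have "(\<lambda>k. measure M {x \<in> F. inv\<^bsub>G\<^esub> (emb (inv\<^bsub>G1\<^esub> g0 \<otimes>\<^bsub>G1\<^esub> t k)) \<otimes>\<^bsub>G\<^esub> x \<notin> F}) \<longlonglongrightarrow> 0"
      by (rule shift_continuity[OF left_inv_M car lim F_sets finite_F])
    from tendsto_mult_right_zero[OF this, of "1 / measure M F"]
    have "(\<lambda>k. measure M {x \<in> F. inv\<^bsub>G\<^esub> (emb (inv\<^bsub>G1\<^esub> g0 \<otimes>\<^bsub>G1\<^esub> t k)) \<otimes>\<^bsub>G\<^esub> x \<notin> F} / measure M F) \<longlonglongrightarrow> 0"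
      by (simp del: mult_DirProd)
    from tendsto_mult_right_zero[OF tendsto_real_sqrt[OF this, unfolded real_sqrt_zero], of 2]
    show "(\<lambda>k. \<beta> (inv\<^bsub>G1\<^esub> g0 \<otimes>\<^bsub>G1\<^esub> t k)) \<longlonglongrightarrow> 0" unfolding \<beta>_def .
  qed (rule e)
  then show ?thesis by (auto simp: abs_less_iff)
qed

text \<open>The \<open>G1\<close>-part of the representation induced from \<open>\<Gamma>\<close> to \<open>G1 \<times> G2\<close> has almost invariant
vectors, so property (T) of \<open>G1\<close> yields an equivariant function that is \<open>G1\<close>-invariant.\<close>

lemma invariant_function:
  assumes kt: "kazhdan_T G1 T1"
    and v: "\<And>k. v k \<in> l2_space UNIV" "\<And>k. l2_norm (v k) = 1" "\<And>k. perp (v k)"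
    and ai: "\<And>\<gamma>. \<gamma> \<in> \<Gamma> \<Longrightarrow> (\<lambda>k. l2_norm (\<lambda>n. op \<gamma> (v k) n - v k n)) \<longlonglongrightarrow> 0"
  obtains f where "f \<in> W" "(\<integral>\<^sup>+x. indicator F x * wt f x \<partial>M) < \<infinity>" "(\<integral>\<^sup>+x. indicator F x * wt f x \<partial>M) \<noteq> 0"
    "\<And>g. g \<in> carrier G1 \<Longrightarrow> AE x in M. sec f (emb g \<otimes>\<^bsub>G\<^esub> x) = sec f x"
proof -
  interpret L: semi_hilbert "{f \<in> W. sq_int N f}" "ip N" by (rule semi_hilbert_W)
  interpret l2: semi_hilbert "l2_space UNIV" "ip (count_space UNIV)" by (rule semi_hilbert_l2)
  have nrm_sq: "ennreal ((L.nrm f)\<^sup>2) = (\<integral>\<^sup>+x. indicator F x * wt f x \<partial>M)" if "f \<in> W" "sq_int N f" for f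
  proof -
    have "ennreal ((L.nrm f)\<^sup>2) = (\<integral>\<^sup>+z. ennreal ((cmod (f z))\<^sup>2) \<partial>N)"
      using that by (simp add: L.nrm_def ip_self sq_int_nn)
    then show ?thesis using N_integral[OF that(1)] by simp
  qed
  have sqI: "sq_int N f" if "f \<in> W" "(\<integral>\<^sup>+x. indicator F x * wt f x \<partial>M) < \<infinity>" for f
    using that by (intro sq_intI_nn W_measurable) (simp_all add: N_integral)
  have \<rho>V: "\<rho> g f \<in> {f \<in> W. sq_int N f}" if g: "g \<in> carrier G1" and f: "f \<in> {f \<in> W. sq_int N f}" for g f
  proof -
    have f': "f \<in> W" "sq_int N f" using f by auto
    have "(\<integral>\<^sup>+x. indicator F x * wt (\<rho> g f) x \<partial>M) < \<infinity>"
      unfolding \<rho>_integral[OF g f'(1)] nrm_sq[OF f', symmetric] by simp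
    then show ?thesis using sqI \<rho>_W[OF g f'(1)] by simp
  qed
  have \<rho>_nrm: "L.nrm (\<rho> g f) = L.nrm f" if g: "g \<in> carrier G1" and f: "f \<in> {f \<in> W. sq_int N f}" for g f
  proof -
    have "ennreal ((L.nrm (\<rho> g f))\<^sup>2) = ennreal ((L.nrm f)\<^sup>2)"
      using nrm_sq[of "\<rho> g f"] nrm_sq[of f] \<rho>_integral[OF g, of f] \<rho>V[OF g f] f by simp
    then show ?thesis using L.nrm_nonneg[OF f] L.nrm_nonneg[OF \<rho>V[OF g f]] by simp
  qed
  have \<rho>_lin: "\<rho> g (\<lambda>z. a * f z + b * h z) = (\<lambda>z. a * \<rho> g f z + b * \<rho> g h z)" for g f h a b
    by (auto simp: \<rho>_def)
  have \<rho>_diff: "\<rho> g (\<lambda>z. f z - h z) = (\<lambda>z. \<rho> g f z - \<rho> g h z)" for g f h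
    by (auto simp: \<rho>_def)
  have \<rho>_mult: "\<rho> (g \<otimes>\<^bsub>G1\<^esub> h) f = \<rho> g (\<rho> h f)" if g: "g \<in> carrier G1" and h: "h \<in> carrier G1" for g h f
  proof
    fix z :: "nat \<times> 'a \<times> 'b"
    obtain n x where z: "z = (n, x)" by (cases z)
    note gi = inv_closed[OF emb_carrier[OF g]] and hi = inv_closed[OF emb_carrier[OF h]]
    show "\<rho> (g \<otimes>\<^bsub>G1\<^esub> h) f z = \<rho> g (\<rho> h f) z"
    proof (cases "x \<in> carrier G")
      case True
      have "inv\<^bsub>G\<^esub> (emb (g \<otimes>\<^bsub>G1\<^esub> h)) \<otimes>\<^bsub>G\<^esub> x = inv\<^bsub>G\<^esub> (emb h) \<otimes>\<^bsub>G\<^esub> (inv\<^bsub>G\<^esub> (emb g) \<otimes>\<^bsub>G\<^esub> x)"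
        unfolding emb_mult inv_mult_group[OF emb_carrier[OF g] emb_carrier[OF h]] by (rule m_assoc[OF hi gi True])
      then show ?thesis unfolding z \<rho>_def prod.case using True m_closed[OF gi True] by (simp only: if_True)
    next
      case False
      then show ?thesis unfolding z \<rho>_def prod.case by (simp only: if_False)
    qed
  qed
  have \<rho>_one: "\<rho> \<one>\<^bsub>G1\<^esub> f = f" if f: "f \<in> W" for f
  proof
    fix z :: "nat \<times> 'a \<times> 'b"
    obtain n x where z: "z = (n, x)" by (cases z)
    show "\<rho> \<one>\<^bsub>G1\<^esub> f z = f z"
    proof (cases "x \<in> carrier G")
      case True
      have "inv\<^bsub>G\<^esub> (emb \<one>\<^bsub>G1\<^esub>) \<otimes>\<^bsub>G\<^esub> x = x" unfolding emb_one inv_one by (rule l_one[OF True])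
      then show ?thesis unfolding z \<rho>_def prod.case using True by (simp only: if_True)
    next
      case False
      then show ?thesis unfolding z \<rho>_def prod.case using WD(2)[OF f False] by (simp only: if_False)
    qed
  qed
  \<comment> \<open>Normalisation: the sections of \<open>ind (v k)\<close> are unit vectors, so its
    norm is \<open>sqrt (measure M F)\<close>.\<close>
  define a where "a = complex_of_real (1 / sqrt (measure M F))"
  have mF: "measure M F > 0" by (rule measure_F_pos)
  have eF: "emeasure M F = ennreal (measure M F)" using finite_F by (simp add: emeasure_eq_ennreal_measure less_top)
  have ca: "cmod a = 1 / sqrt (measure M F)" using mF by (simp add: a_def norm_divide)
  have ca2: "(cmod a)\<^sup>2 = 1 / measure M F" using mF by (simp add: ca power_divide)
  have opl2: "op \<gamma> u \<in> l2_space UNIV" "l2_norm (op \<gamma> u) = l2_norm u" if "\<gamma> \<in> \<Gamma>" "u \<in> l2_space UNIV" for \<gamma> u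
    using op_l2[of \<gamma> u] op_l2_norm[of \<gamma> u] that by auto
  have indV: "ind (v k) \<in> {f \<in> W. sq_int N f}" and nrm_ind: "(L.nrm (ind (v k)))\<^sup>2 = measure M F" for k
  proof -
    have iw: "ind (v k) \<in> W" by (rule ind_W[OF v(3)])
    have "(\<integral>\<^sup>+x. indicator F x * wt (ind (v k)) x \<partial>M) = (\<integral>\<^sup>+x. indicator F x \<partial>M)"
    proof (rule nn_integral_cong)
      fix x assume "x \<in> space M"
      then have x: "x \<in> carrier G" by (simp only: space_M)
      have "wt (ind (v k)) x = 1"
        using wt_sec[OF sec_ind[OF x] opl2(1)[OF \<Gamma>_closed(3)[OF decomposition(2)[OF x]] v(1)]]
          opl2(2)[OF \<Gamma>_closed(3)[OF decomposition(2)[OF x]] v(1)] v(2) by simp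
      then show "indicator F x * wt (ind (v k)) x = indicator F x" by simp
    qed
    also have "\<dots> = ennreal (measure M F)" using F_sets eF by (simp add: sets_M)
    finally have i: "(\<integral>\<^sup>+x. indicator F x * wt (ind (v k)) x \<partial>M) = ennreal (measure M F)" .
    then have sq: "sq_int N (ind (v k))" by (intro sqI iw) simp
    then show "ind (v k) \<in> {f \<in> W. sq_int N f}" using iw by simp
    have "ennreal ((L.nrm (ind (v k)))\<^sup>2) = ennreal (measure M F)" using nrm_sq[OF iw sq] i by simp
    then show "(L.nrm (ind (v k)))\<^sup>2 = measure M F" by simp
  qed
  define w where "w k = (\<lambda>z. a * ind (v k) z)" for k
  have wV: "w k \<in> {f \<in> W. sq_int N f}" for k unfolding w_def by (rule L.V_scale[OF indV])
  have w1: "L.nrm (w k) = 1" for k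
  proof -
    have "L.nrm (ind (v k)) = sqrt (measure M F)"
      using nrm_ind[of k] L.nrm_nonneg[OF indV[of k]] by (metis real_sqrt_abs abs_of_nonneg)
    then show ?thesis unfolding w_def L.nrm_scale[OF indV] ca using mF by simp
  qed
  define D where "D g k x = op (inv\<^bsub>G\<^esub> (gam (inv\<^bsub>G\<^esub> (emb g) \<otimes>\<^bsub>G\<^esub> x))) (v k)" for g k x
  have Dl2: "(\<lambda>n. D g k x n - v k n) \<in> l2_space UNIV" "l2_norm (\<lambda>n. D g k x n - v k n) \<le> 2"
    if "g \<in> carrier G1" "x \<in> carrier G" for g k x
  proof -
    have gx: "inv\<^bsub>G\<^esub> (emb g) \<otimes>\<^bsub>G\<^esub> x \<in> carrier G" by (rule m_closed[OF inv_closed[OF emb_carrier[OF that(1)]] that(2)])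
    note o = opl2[OF \<Gamma>_closed(3)[OF decomposition(2)[OF gx]] v(1)[of k]]
    have d: "D g k x \<in> l2_space UNIV" "l2_norm (D g k x) = 1" unfolding D_def using o v(2)[of k] by auto
    show l: "(\<lambda>n. D g k x n - v k n) \<in> l2_space UNIV" by (rule l2.V_diff[OF d(1) v(1)])
    have neg: "(\<lambda>n. - 1 * v k n) \<in> l2_space UNIV" by (rule l2.V_scale[OF v(1)])
    have "l2.nrm (\<lambda>n. D g k x n + - 1 * v k n) \<le> l2.nrm (D g k x) + l2.nrm (\<lambda>n. - 1 * v k n)"
      by (rule l2.nrm_triangle[OF d(1) neg])
    also have "l2.nrm (\<lambda>n. - 1 * v k n) = l2.nrm (v k)" by (subst l2.nrm_scale[OF v(1)]) simp
    finally show "l2_norm (\<lambda>n. D g k x n - v k n) \<le> 2"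
      using nrm_l2[OF d(1)] nrm_l2[OF v(1)[of k]] nrm_l2[OF l] d(2) v(2)[of k] by simp
  qed
  have diffV: "(\<lambda>z. \<rho> g (ind (v k)) z - ind (v k) z) \<in> {f \<in> W. sq_int N f}" if "g \<in> carrier G1" for g k
    by (rule L.V_diff[OF \<rho>V[OF that indV] indV])
  have wt_diff: "wt (\<lambda>z. \<rho> g (ind (v k)) z - ind (v k) z) x = ennreal ((l2_norm (\<lambda>n. D g k x n - v k n))\<^sup>2)"
    if g: "g \<in> carrier G1" and x: "x \<in> F" for g k x
  proof (rule wt_sec)
    have xc: "x \<in> carrier G" using x F_carrier by blast
    have gx: "inv\<^bsub>G\<^esub> (emb g) \<otimes>\<^bsub>G\<^esub> x \<in> carrier G" by (rule m_closed[OF inv_closed[OF emb_carrier[OF g]] xc])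
    have "sec (ind (v k)) x = v k" unfolding sec_ind[OF xc] gam_F[OF x] inv_one op_1 ..
    moreover have "sec (\<rho> g (ind (v k))) x = D g k x" unfolding sec_\<rho>[OF xc] sec_ind[OF gx] D_def ..
    ultimately show "(\<lambda>n. \<rho> g (ind (v k)) (n, x) - ind (v k) (n, x)) = (\<lambda>n. D g k x n - v k n)"
      by (auto simp: fun_eq_iff)
    show "(\<lambda>n. D g k x n - v k n) \<in> l2_space UNIV" by (rule Dl2(1)[OF g xc])
  qed
  have nrm_w_diff: "(L.nrm (\<lambda>z. \<rho> g (w k) z - w k z))\<^sup>2 = (L.nrm (\<lambda>z. \<rho> g (ind (v k)) z - ind (v k) z))\<^sup>2 / measure M F"
    if g: "g \<in> carrier G1" for g k
  proof -
    have "(\<lambda>z. \<rho> g (w k) z - w k z) = (\<lambda>z. a * (\<rho> g (ind (v k)) z - ind (v k) z))"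
      by (auto simp: w_def \<rho>_def algebra_simps)
    then show ?thesis using L.nrm_scale[OF diffV[OF g], of a k] by (simp add: power_mult_distrib ca2)
  qed
  have sqrt_le: "x \<le> y" if "x\<^sup>2 \<le> y\<^sup>2" "y \<ge> 0" for x y :: real using that by (rule power2_le_imp_le)
  have bound: "L.nrm (\<lambda>z. \<rho> g (w k) z - w k z) \<le> \<beta> g" if g: "g \<in> carrier G1" for g k
  proof -
    let ?d = "\<lambda>z. \<rho> g (ind (v k)) z - ind (v k) z" and ?B = "{x \<in> F. inv\<^bsub>G\<^esub> (emb g) \<otimes>\<^bsub>G\<^esub> x \<notin> F}"
    have B: "?B \<in> sets M" using shift_set[OF F_sets emb_carrier[OF g]] by (simp only: sets_M)
    have Bfin: "emeasure M ?B \<noteq> \<infinity>"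
      using emeasure_mono[of ?B F M] F_sets finite_F by (auto simp: sets_M top_unique)
    have "ennreal ((L.nrm ?d)\<^sup>2) = (\<integral>\<^sup>+x. indicator F x * wt ?d x \<partial>M)" using diffV[OF g, of k] by (intro nrm_sq) auto
    also have "\<dots> \<le> (\<integral>\<^sup>+x. ennreal 4 * indicator ?B x \<partial>M)"
    proof (rule nn_integral_mono)
      fix x assume "x \<in> space M"
      show "indicator F x * wt ?d x \<le> ennreal 4 * indicator ?B x"
      proof (cases "x \<in> F")
        case True
        then have xc: "x \<in> carrier G" using F_carrier by blast
        show ?thesis
        proof (cases "inv\<^bsub>G\<^esub> (emb g) \<otimes>\<^bsub>G\<^esub> x \<in> F")
          case True2: True
          have "D g k x = v k" unfolding D_def gam_F[OF True2] inv_one op_1 ..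
          then have "wt ?d x = 0" unfolding wt_diff[OF g True] by (simp add: l2_norm_def)
          then show ?thesis by simp
        next
          case False
          have nn: "0 \<le> l2_norm (\<lambda>n. D g k x n - v k n)" using l2.nrm_nonneg[OF Dl2(1)[OF g xc]] nrm_l2[OF Dl2(1)[OF g xc]] by simp
          have "(l2_norm (\<lambda>n. D g k x n - v k n))\<^sup>2 \<le> 2\<^sup>2" by (rule power_mono[OF Dl2(2)[OF g xc] nn])
          then have "wt ?d x \<le> ennreal 4" unfolding wt_diff[OF g True] by (intro ennreal_leI) simp
          then show ?thesis using True False by simp
        qed
      qed simp
    qed
    also have "\<dots> = ennreal (4 * measure M ?B)"
      using B Bfin by (simp add: nn_integral_cmult_indicator emeasure_eq_ennreal_measure ennreal_mult)
    finally have "(L.nrm ?d)\<^sup>2 \<le> 4 * measure M ?B" by simp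
    then have "(L.nrm (\<lambda>z. \<rho> g (w k) z - w k z))\<^sup>2 \<le> 4 * measure M ?B / measure M F"
      unfolding nrm_w_diff[OF g] using mF by (simp add: divide_right_mono)
    also have "\<dots> = (\<beta> g)\<^sup>2" using mF by (simp add: \<beta>_def power_mult_distrib)
    finally show ?thesis by (rule sqrt_le) (simp add: \<beta>_def)
  qed
  \<comment> \<open>The bound does not involve \<open>k\<close>, so the orbit maps of all the
    \<open>w k\<close> are equicontinuous.\<close>
  have bound2: "L.nrm (\<lambda>z. \<rho> g (w k) z - \<rho> g0 (w k) z) \<le> \<beta> (inv\<^bsub>G1\<^esub> g0 \<otimes>\<^bsub>G1\<^esub> g)"
    if g: "g \<in> carrier G1" and g0: "g0 \<in> carrier G1" for g g0 k
  proof -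
    let ?h = "inv\<^bsub>G1\<^esub> g0 \<otimes>\<^bsub>G1\<^esub> g"
    have h: "?h \<in> carrier G1" using g g0 by simp
    have "g0 \<otimes>\<^bsub>G1\<^esub> ?h = g" using g g0 by (simp add: S1.m_assoc[symmetric])
    then have "\<rho> g (w k) = \<rho> g0 (\<rho> ?h (w k))" using \<rho>_mult[OF g0 h, of "w k"] by simp
    then have "(\<lambda>z. \<rho> g (w k) z - \<rho> g0 (w k) z) = \<rho> g0 (\<lambda>z. \<rho> ?h (w k) z - w k z)"
      by (simp add: \<rho>_diff)
    then have "L.nrm (\<lambda>z. \<rho> g (w k) z - \<rho> g0 (w k) z) = L.nrm (\<lambda>z. \<rho> ?h (w k) z - w k z)"
      using \<rho>_nrm[OF g0 L.V_diff[OF \<rho>V[OF h wV] wV], of k] by simp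
    then show ?thesis using bound[OF h, of k] by simp
  qed
  \<comment> \<open>At a fixed \<open>x\<close> the element of \<Gamma> that acts on
    \<open>v k\<close> is the same for all \<open>k\<close>, so almost invariance under \<Gamma>
    applies pointwise. The constant 4 on \<open>F\<close> dominates, as \<open>F\<close> has finite
    measure.\<close>
  have pointwise: "(\<lambda>k. L.nrm (\<lambda>z. \<rho> g (w k) z - w k z)) \<longlonglongrightarrow> 0" if g: "g \<in> carrier G1" for g
  proof -
    let ?d = "\<lambda>k z. \<rho> g (ind (v k)) z - ind (v k) z"
    have dW: "?d k \<in> W" "sq_int N (?d k)" for k using diffV[OF g, of k] by auto
    note [measurable_cong] = sets_M
    note [measurable] = F_sets wt_measurable[OF dW(1)]
    have "(\<lambda>k. \<integral>\<^sup>+x. indicator F x * wt (?d k) x \<partial>M) \<longlonglongrightarrow> (\<integral>\<^sup>+x. 0 \<partial>M)"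
    proof (rule nn_integral_dominated_convergence[where w = "\<lambda>x. ennreal 4 * indicator F x"])
      show "(\<lambda>x. indicator F x * wt (?d k) x) \<in> borel_measurable M" for k by measurable
      show "(\<integral>\<^sup>+x. ennreal 4 * indicator F x \<partial>M) < \<infinity>"
        using F_sets finite_F by (subst nn_integral_cmult_indicator) (auto simp: sets_M ennreal_mult_less_top)
      show "AE x in M. indicator F x * wt (?d k) x \<le> ennreal 4 * indicator F x" for k
      proof (rule AE_I2)
        fix x assume "x \<in> space M"
        show "indicator F x * wt (?d k) x \<le> ennreal 4 * indicator F x"
        proof (cases "x \<in> F")
          case True
          then have xc: "x \<in> carrier G" using F_carrier by blast
          have nn: "0 \<le> l2_norm (\<lambda>n. D g k x n - v k n)" using l2.nrm_nonneg[OF Dl2(1)[OF g xc]] nrm_l2[OF Dl2(1)[OF g xc]] by simp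
          have "(l2_norm (\<lambda>n. D g k x n - v k n))\<^sup>2 \<le> 2\<^sup>2" by (rule power_mono[OF Dl2(2)[OF g xc] nn])
          then have "wt (?d k) x \<le> ennreal 4" unfolding wt_diff[OF g True] by (intro ennreal_leI) simp
          then show ?thesis using True by simp
        qed simp
      qed
      show "AE x in M. (\<lambda>k. indicator F x * wt (?d k) x) \<longlonglongrightarrow> 0"
      proof (rule AE_I2)
        fix x assume "x \<in> space M"
        show "(\<lambda>k. indicator F x * wt (?d k) x) \<longlonglongrightarrow> 0"
        proof (cases "x \<in> F")
          case True
          then have xc: "x \<in> carrier G" using F_carrier by blast
          have gx: "inv\<^bsub>G\<^esub> (emb g) \<otimes>\<^bsub>G\<^esub> x \<in> carrier G" by (rule m_closed[OF inv_closed[OF emb_carrier[OF g]] xc])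
          have "(\<lambda>k. l2_norm (\<lambda>n. D g k x n - v k n)) \<longlonglongrightarrow> 0"
            unfolding D_def by (rule ai[OF \<Gamma>_closed(3)[OF decomposition(2)[OF gx]]])
          from tendsto_ennrealI[OF tendsto_power[OF this, of 2]] show ?thesis
            using True by (simp add: wt_diff[OF g True])
        qed simp
      qed
    qed measurable
    then have "(\<lambda>k. ennreal ((L.nrm (?d k))\<^sup>2)) \<longlonglongrightarrow> ennreal 0"
      using nrm_sq[OF dW] by simp
    then have "(\<lambda>k. (L.nrm (?d k))\<^sup>2) \<longlonglongrightarrow> 0"
      by (subst (asm) tendsto_ennreal_iff) auto
    from tendsto_mult_right_zero[OF this, of "1 / measure M F"]
    have "(\<lambda>k. (L.nrm (\<lambda>z. \<rho> g (w k) z - w k z))\<^sup>2) \<longlonglongrightarrow> 0"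
      unfolding nrm_w_diff[OF g] by simp
    from tendsto_real_sqrt[OF this] show ?thesis
      using L.nrm_nonneg[OF L.V_diff[OF \<rho>V[OF g wV] wV]] by simp
  qed
  have "\<exists>f\<in>{f \<in> W. sq_int N f}. L.nrm f \<noteq> 0 \<and> (\<forall>g\<in>carrier G1. L.nrm (\<lambda>z. \<rho> g f z - f z) = 0)"
  proof (rule L.kazhdan_invariant_vector[of G1 T1 \<rho> w])
    show "kazhdan_T G1 T1" by (rule kt)
    show "topological_group G1 T1" using S1.sc_group by (simp add: second_countable_lc_group_def lc_group_def)
    show "second_countable T1" by (rule S1.second_countable_T)
    show "\<rho> g f \<in> {f \<in> W. sq_int N f}" if "g \<in> carrier G1" "f \<in> {f \<in> W. sq_int N f}" for g f by (rule \<rho>V[OF that])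
    show "\<rho> g (\<lambda>x. a * f x + b * h x) = (\<lambda>x. a * \<rho> g f x + b * \<rho> g h x)" for g f h a b by (rule \<rho>_lin)
    show "L.nrm (\<rho> g f) = L.nrm f" if "g \<in> carrier G1" "f \<in> {f \<in> W. sq_int N f}" for g f by (rule \<rho>_nrm[OF that])
    show "\<rho> (g \<otimes>\<^bsub>G1\<^esub> h) f = \<rho> g (\<rho> h f)" if "g \<in> carrier G1" "h \<in> carrier G1" for g h f by (rule \<rho>_mult[OF that])
    show "\<rho> \<one>\<^bsub>G1\<^esub> f = f" if "f \<in> {f \<in> W. sq_int N f}" for f using that by (intro \<rho>_one) auto
    show "w k \<in> {f \<in> W. sq_int N f}" for k by (rule wV)
    show "L.nrm (w k) = 1" for k by (rule w1)
    show "\<exists>U. openin T1 U \<and> g0 \<in> U \<and> (\<forall>g\<in>U. L.nrm (\<lambda>x. \<rho> g (w k) x - \<rho> g0 (w k) x) < \<epsilon>)"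
      if g0: "g0 \<in> carrier G1" and e: "\<epsilon> > 0" for k g0 \<epsilon>
    proof -
      obtain U where U: "openin T1 U" "g0 \<in> U" "\<And>g. g \<in> U \<Longrightarrow> \<beta> (inv\<^bsub>G1\<^esub> g0 \<otimes>\<^bsub>G1\<^esub> g) < \<epsilon>"
        using \<beta>_nhd[OF g0 e] by auto
      have "L.nrm (\<lambda>x. \<rho> g (w k) x - \<rho> g0 (w k) x) < \<epsilon>" if "g \<in> U" for g
        using bound2[OF _ g0, of g k] U(3)[OF that] openin_subset[OF U(1)] that by fastforce
      then show ?thesis using U by (intro exI[of _ U]) simp
    qed
    fix K and \<epsilon> :: real assume K: "compactin T1 K" and e: "\<epsilon> > 0"
    \<comment> \<open>Equicontinuity covers the compact set by finitely many neighbourhoods on which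
      all \<open>w k\<close> move by less than \<open>\<epsilon> / 2\<close>; pointwise convergence
      is then used at the finitely many centres \<open>q U\<close> only.\<close>
    define \<U> where "\<U> = {U. openin T1 U \<and> (\<exists>g0\<in>carrier G1. \<forall>g\<in>U. \<beta> (inv\<^bsub>G1\<^esub> g0 \<otimes>\<^bsub>G1\<^esub> g) < \<epsilon> / 2)}"
    have "K \<subseteq> \<Union>\<U>"
    proof
      fix g0 assume "g0 \<in> K"
      then have g0: "g0 \<in> carrier G1" using compactin_subset_topspace[OF K] by auto
      obtain U where "openin T1 U" "g0 \<in> U" "\<And>g. g \<in> U \<Longrightarrow> \<beta> (inv\<^bsub>G1\<^esub> g0 \<otimes>\<^bsub>G1\<^esub> g) < \<epsilon> / 2"
        using \<beta>_nhd[OF g0, of "\<epsilon>/2"] e by auto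
      then have "U \<in> \<U>" "g0 \<in> U" using g0 unfolding \<U>_def by auto
      then show "g0 \<in> \<Union>\<U>" by blast
    qed
    moreover have "\<forall>U\<in>\<U>. openin T1 U" by (simp add: \<U>_def)
    ultimately have "\<exists>\<V>. finite \<V> \<and> \<V> \<subseteq> \<U> \<and> K \<subseteq> \<Union>\<V>"
      using conjunct2[OF K[unfolded compactin_def], rule_format, of \<U>] by simp
    then obtain \<V> where V: "finite \<V>" "\<V> \<subseteq> \<U>" "K \<subseteq> \<Union>\<V>" by (elim exE conjE) (rule that)
    have "\<forall>U\<in>\<V>. \<exists>g0. g0 \<in> carrier G1 \<and> (\<forall>g\<in>U. \<beta> (inv\<^bsub>G1\<^esub> g0 \<otimes>\<^bsub>G1\<^esub> g) < \<epsilon> / 2)"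
      using V(2) unfolding \<U>_def by blast
    then obtain q where q: "\<And>U. U \<in> \<V> \<Longrightarrow> q U \<in> carrier G1" "\<And>U g. U \<in> \<V> \<Longrightarrow> g \<in> U \<Longrightarrow> \<beta> (inv\<^bsub>G1\<^esub> (q U) \<otimes>\<^bsub>G1\<^esub> g) < \<epsilon> / 2"
      by (metis bchoice)
    have "\<forall>U\<in>\<V>. \<forall>\<^sub>F k in sequentially. L.nrm (\<lambda>z. \<rho> (q U) (w k) z - w k z) < \<epsilon> / 2"
      using pointwise[OF q(1)] e by (auto intro!: order_tendstoD(2))
    then have "\<forall>\<^sub>F k in sequentially. \<forall>U\<in>\<V>. L.nrm (\<lambda>z. \<rho> (q U) (w k) z - w k z) < \<epsilon> / 2"
      using V(1) by (simp add: eventually_ball_finite_distrib)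
    then obtain k where k: "\<And>U. U \<in> \<V> \<Longrightarrow> L.nrm (\<lambda>z. \<rho> (q U) (w k) z - w k z) < \<epsilon> / 2"
      by (auto simp: eventually_sequentially)
    have "L.nrm (\<lambda>z. \<rho> g (w k) z - w k z) < \<epsilon>" if g: "g \<in> K" for g
    proof -
      have gc: "g \<in> carrier G1" using g compactin_subset_topspace[OF K] by auto
      obtain U where U: "U \<in> \<V>" "g \<in> U" using V(3) g by blast
      have "L.nrm (\<lambda>z. \<rho> g (w k) z - w k z) \<le> L.nrm (\<lambda>z. \<rho> g (w k) z - \<rho> (q U) (w k) z) + L.nrm (\<lambda>z. \<rho> (q U) (w k) z - w k z)"
        by (rule L.nrm_triangle_diff[OF \<rho>V[OF gc wV] \<rho>V[OF q(1)[OF U(1)] wV] wV])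
      then show ?thesis using bound2[OF gc q(1)[OF U(1)], of k] q(2)[OF U] k[OF U(1)] by linarith
    qed
    then show "\<exists>k. \<forall>g\<in>K. L.nrm (\<lambda>x. \<rho> g (w k) x - w k x) < \<epsilon>" by blast
  qed
  then obtain f where f: "f \<in> W" "sq_int N f" "L.nrm f \<noteq> 0" "\<And>g. g \<in> carrier G1 \<Longrightarrow> L.nrm (\<lambda>z. \<rho> g f z - f z) = 0"
    by auto
  show thesis
  proof (rule that[of f])
    show "f \<in> W" by (rule f(1))
    show "(\<integral>\<^sup>+x. indicator F x * wt f x \<partial>M) < \<infinity>" using nrm_sq[OF f(1,2), symmetric] by simp
    show "(\<integral>\<^sup>+x. indicator F x * wt f x \<partial>M) \<noteq> 0" using nrm_sq[OF f(1,2), symmetric] f(3) by simp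
    show "AE x in M. sec f (emb g \<otimes>\<^bsub>G\<^esub> x) = sec f x" if g: "g \<in> carrier G1" for g
    proof -
      \<comment> \<open>The inverse compensates the one in the definition of \<open>\<rho>\<close>.
        Norm zero gives invariance almost everywhere on \<open>F\<close>; the set of failure is
        \<Gamma>-invariant, so \<open>null_transfer\<close> makes it null in the whole
        group.\<close>
      define h where "h = inv\<^bsub>G1\<^esub> g"
      have h: "h \<in> carrier G1" using g by (simp add: h_def)
      have ih: "inv\<^bsub>G\<^esub> (emb h) = emb g" using g by (simp add: h_def flip: emb_inv)
      let ?d = "\<lambda>z. \<rho> h f z - f z"
      have dV: "?d \<in> {f \<in> W. sq_int N f}" using f(1,2) by (intro L.V_diff \<rho>V[OF h]) auto
      then have dW: "?d \<in> W" "sq_int N ?d" by auto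
      note [measurable_cong] = sets_M
      note [measurable] = F_sets wt_measurable[OF dW(1)]
      have "(\<integral>\<^sup>+x. indicator F x * wt ?d x \<partial>M) = 0" using nrm_sq[OF dW, symmetric] f(4)[OF h] by simp
      then have ae: "AE x in M. indicator F x * wt ?d x = 0" by (subst (asm) nn_integral_0_iff_AE) auto
      define B where "B = {x \<in> space (borel_of T). wt ?d x \<noteq> 0}"
      have B [measurable]: "B \<in> sets (borel_of T)" unfolding B_def by measurable
      have "emeasure M B = 0"
      proof (rule null_transfer[OF B])
        show "right_invariant (\<lambda>x. x \<in> B)"
          using wt_invariant[OF dW(1)] m_closed[OF _ \<Gamma>_carrier]
          unfolding right_invariant_def B_def space_borel_of topspace_T by (auto simp del: carrier_DirProd mult_DirProd)
        have "AE x in M. x \<notin> F \<inter> B"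
          using ae by eventually_elim (auto simp: B_def)
        then have "emeasure M {x \<in> space M. x \<in> F \<inter> B} = 0" by (subst emeasure_eq_0_AE) auto
        moreover have "{x \<in> space M. x \<in> F \<inter> B} = F \<inter> B" using F_carrier unfolding space_M by blast
        ultimately show "emeasure M (F \<inter> B) = 0" by simp
      qed
      then have "AE x in M. x \<notin> B" using B by (intro AE_not_in) (simp add: null_sets_def sets_M)
      then show ?thesis
        using AE_space
      proof eventually_elim
        case (elim x)
        then have x: "x \<in> carrier G" by (simp only: space_M)
        then have "wt ?d x = 0" using elim by (simp add: B_def)
        then have "?d (n, x) = 0" for n
          unfolding wt_def by (subst (asm) nn_integral_0_iff_AE) (auto simp: AE_count_space ennreal_eq_0_iff)
        then have "\<rho> h f (n, x) = f (n, x)" for n by simp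
        then show ?case using fun_cong[OF sec_\<rho>[OF x, of h f]] unfolding ih by (auto simp: fun_eq_iff)
      qed
    qed
  qed
qed

end

section \<open>Equivariant coordinates on the second factor\<close>

context product_lattice
begin

lemma rectangles_Pow: "{U \<times> V |U V. openin T1 U \<and> openin T2 V} \<subseteq> Pow (carrier G)"
proof
  fix X assume "X \<in> {U \<times> V |U V. openin T1 U \<and> openin T2 V}"
  then obtain U V where "X = U \<times> V" "openin T1 U" "openin T2 V" by blast
  then show "X \<in> Pow (carrier G)" using openin_subset[of T1 U] openin_subset[of T2 V] by auto
qed

lemma sets_rectangles:
  "sets (borel_of T) = sigma_sets (carrier G) {U \<times> V |U V. openin T1 U \<and> openin T2 V}"
proof -
  have e: "{a \<times> b |a b. a \<in> {U. openin T1 U} \<and> b \<in> {V. openin T2 V}} = {U \<times> V |U V. openin T1 U \<and> openin T2 V}"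
    by auto
  have "sets (borel_of T) = sets (sigma (space (borel_of T1) \<times> space (borel_of T2)) {U \<times> V |U V. openin T1 U \<and> openin T2 V})"
    unfolding sets_borel_of_prod[OF S1.second_countable_T S2.second_countable_T] e[symmetric]
  proof (rule sets_pair_eq)
    show "{U. openin T1 U} \<subseteq> Pow (space (borel_of T1))" "{U. openin T2 U} \<subseteq> Pow (space (borel_of T2))"
      using borel_of_opens_Pow[of T1] borel_of_opens_Pow[of T2] by auto
    show "sets (borel_of T1) = sigma_sets (space (borel_of T1)) {U. openin T1 U}"
      "sets (borel_of T2) = sigma_sets (space (borel_of T2)) {U. openin T2 U}"
      by (simp_all add: sets_borel_of borel_sets_of_def)
    show "countable {topspace T1}" "countable {topspace T2}" "{topspace T1} \<subseteq> {U. openin T1 U}" "{topspace T2} \<subseteq> {U. openin T2 U}"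
      "\<Union>{topspace T1} = space (borel_of T1)" "\<Union>{topspace T2} = space (borel_of T2)"
      using openin_topspace[of T1] openin_topspace[of T2] by simp_all
  qed
  also have "\<dots> = sigma_sets (carrier G) {U \<times> V |U V. openin T1 U \<and> openin T2 V}"
    using rectangles_Pow by (subst sets_measure_of) simp_all
  finally show ?thesis .
qed

text \<open>Open rectangles generate the Borel sets and are stable under intersection, so vanishing
  integrals spread to all Borel subsets of \<open>Q i \<times> R i\<close>, on which
  \<open>h\<close> is integrable.\<close>

lemma locally_integrable_zero:
  fixes h :: "'a \<times> 'b \<Rightarrow> real"
  assumes h: "h \<in> borel_measurable (borel_of T)"
    and loc: "\<And>K. compactin T K \<Longrightarrow> integrable M (\<lambda>z. indicator K z * h z)"
    and zero: "\<And>U V K L. openin T1 U \<Longrightarrow> openin T2 V \<Longrightarrow> compactin T1 K \<Longrightarrow> compactin T2 L \<Longrightarrow> U \<subseteq> K \<Longrightarrow> V \<subseteq> L \<Longrightarrow>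
      (\<integral>z. indicator (U \<times> V) z * h z \<partial>M) = 0"
  shows "AE z in M. h z = 0"
proof -
  note [measurable_cong] = sets_M
  note [measurable] = h
  obtain Q :: "nat \<Rightarrow> 'a set" where Q: "\<And>i. openin T1 (Q i)" "incseq Q" "(\<Union>i. Q i) = carrier G1" "\<And>i. \<exists>K. compactin T1 K \<and> Q i \<subseteq> K"
    by (rule S1.exhaustion) (rule that)
  obtain R :: "nat \<Rightarrow> 'b set" where R: "\<And>i. openin T2 (R i)" "incseq R" "(\<Union>i. R i) = carrier G2" "\<And>i. \<exists>K. compactin T2 K \<and> R i \<subseteq> K"
    by (rule S2.exhaustion) (rule that)
  have loc0: "AE z in M. indicator (Q i \<times> R i) z * h z = 0" for i
  proof -
    let ?W = "Q i \<times> R i"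
    define k where "k z = indicator ?W z * h z" for z
    have Ws [measurable]: "?W \<in> sets (borel_of T)"
      by (intro Times_sets openin_sets_borel_of Q(1) R(1))
    obtain K where K: "compactin T1 K" "Q i \<subseteq> K" using Q(4) by blast
    obtain L where L: "compactin T2 L" "R i \<subseteq> L" using R(4) by blast
    have KL: "compactin T (K \<times> L)" using K L by (simp add: compactin_Times)
    have k: "integrable M k"
    proof (rule Bochner_Integration.integrable_bound[OF loc[OF KL]])
      show "k \<in> borel_measurable M" unfolding k_def[abs_def] by measurable
      show "AE z in M. norm (k z) \<le> norm (indicator (K \<times> L) z * h z)"
        using K L by (auto simp: k_def indicator_def)
    qed
    have zA: "(\<integral>z. indicator A z * k z \<partial>M) = 0" if A: "A \<in> sets (borel_of T)" for A
    proof -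
      have stab: "Int_stable {U \<times> V |U V. openin T1 U \<and> openin T2 V}"
        unfolding Int_stable_def by (clarsimp simp: Times_Int_Times) (metis openin_Int)
      have int: "integrable M (\<lambda>z. indicator B z * k z)" if "B \<in> sets (borel_of T)" for B
        using that k by (intro integrable_real_mult_indicator[of B M k, unfolded mult.commute[of _ "indicator B _"]]) (simp_all add: sets_M)
      have A': "A \<in> sigma_sets (carrier G) {U \<times> V |U V. openin T1 U \<and> openin T2 V}" using A sets_rectangles by simp
      from stab rectangles_Pow A' show ?thesis
      proof (induction rule: sigma_sets_induct_disjoint)
        case (basic A)
        then obtain U V where UV: "A = U \<times> V" "openin T1 U" "openin T2 V" by auto
        have "(\<integral>z. indicator ((U \<inter> Q i) \<times> (V \<inter> R i)) z * h z \<partial>M) = 0"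
          by (rule zero[OF openin_Int[OF UV(2) Q(1)] openin_Int[OF UV(3) R(1)] K(1) L(1)]) (use K L in auto)
        moreover have "indicator ((U \<inter> Q i) \<times> (V \<inter> R i)) z * h z = indicator A z * k z" for z
          by (auto simp: k_def UV indicator_def)
        ultimately show ?case by simp
      next
        case empty
        show ?case by simp
      next
        case (compl A)
        then have As: "A \<in> sets (borel_of T)" using sets_rectangles by simp
        have "(\<integral>z. k z \<partial>M) = (\<integral>z. indicator ?W z * h z \<partial>M)" by (simp add: k_def)
        also have "\<dots> = 0" by (rule zero[OF Q(1) R(1) K(1) L(1) K(2) L(2)])
        finally have tot: "(\<integral>z. k z \<partial>M) = 0" .
        have "(\<integral>z. indicator (carrier G - A) z * k z \<partial>M) = (\<integral>z. k z - indicator A z * k z \<partial>M)"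
          by (rule Bochner_Integration.integral_cong[OF refl]) (auto simp: space_M indicator_def)
        also have "\<dots> = 0" using k int[OF As] tot compl by simp
        finally show ?case .
      next
        case (union A)
        then have As: "A i \<in> sets (borel_of T)" for i using sets_rectangles by auto
        have d: "A i \<inter> A j = {}" if "i \<noteq> j" for i j using union(1) that by (auto simp: disjoint_family_on_def)
        have "set_integrable M (\<Union>i. A i) k"
          unfolding set_integrable_def real_scaleR_def by (rule int) (use As in auto)
        from lebesgue_integral_countable_add[OF _ d this] As union(3)
        show ?case by (simp add: set_lebesgue_integral_def sets_M)
      qed
    qed
    have "AE z in M. k z = (\<lambda>_. 0) z"
      using k by (intro density_unique_real) (auto simp: set_lebesgue_integral_def zA sets_M)
    then show ?thesis by (simp add: k_def)
  qed
  then have "AE z in M. \<forall>i. indicator (Q i \<times> R i) z * h z = 0" unfolding AE_all_countable by (rule allI)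
  then show ?thesis
    using AE_space
  proof eventually_elim
    case (elim z)
    then have "z \<in> carrier G" by (simp only: space_M)
    then obtain i j where ij: "fst z \<in> Q i" "snd z \<in> R j" using Q(3) R(3) by force
    then have "fst z \<in> Q (max i j)" "snd z \<in> R (max i j)"
      using Q(2) R(2) by (meson incseqD max.cobounded1 max.cobounded2 subsetD)+
    then show ?case using elim(1) by (metis indicator_simps(1) mem_Times_iff mult_1)
  qed
qed

text \<open>\<open>slab_right_inv\<close> for a function of both signs, by treating its positive and
  negative parts separately.\<close>

lemma slab_integral_right_inv:
  fixes h :: "'a \<times> 'b \<Rightarrow> real"
  assumes h: "h \<in> borel_measurable (borel_of T)"
    and loc: "\<And>K. compactin T K \<Longrightarrow> integrable M (\<lambda>z. indicator K z * h z)"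
    and inv: "\<And>g. g \<in> carrier G1 \<Longrightarrow> AE z in M. h ((g, \<one>\<^bsub>G2\<^esub>) \<otimes>\<^bsub>G\<^esub> z) = h z"
    and A: "A \<in> sets (borel_of T1)" "compactin T1 K" "A \<subseteq> K"
    and B: "B \<in> sets (borel_of T2)" "compactin T2 L" "B \<subseteq> L" and g: "g \<in> carrier G1"
  shows "(\<integral>z. indicator (((\<lambda>x. x \<otimes>\<^bsub>G1\<^esub> g) ` A) \<times> B) z * h z \<partial>M) = (\<integral>z. indicator (A \<times> B) z * h z \<partial>M)"
proof -
  note [measurable_cong] = sets_M
  note [measurable] = h fst_measurable snd_measurable
  have int: "integrable M (\<lambda>z. indicator (C \<times> B) z * h z)" if C: "C \<in> sets (borel_of T1)" "compactin T1 K'" "C \<subseteq> K'" for C K'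
  proof (rule Bochner_Integration.integrable_bound)
    show "integrable M (\<lambda>z. indicator (K' \<times> L) z * h z)" using C B by (intro loc) (simp add: compactin_Times)
    have [measurable]: "C \<times> B \<in> sets (borel_of T)" by (rule Times_sets[OF C(1) B(1)])
    show "(\<lambda>z. indicator (C \<times> B) z * h z) \<in> borel_measurable M" by measurable
    show "AE z in M. norm (indicator (C \<times> B) z * h z) \<le> norm (indicator (K' \<times> L) z * h z)"
      using C B by (auto simp: indicator_def)
  qed
  have gA: "(\<lambda>x. x \<otimes>\<^bsub>G1\<^esub> g) ` A \<in> sets (borel_of T1)" by (rule S1.right_image_sets[OF g A(1)])
  have gK: "compactin T1 ((\<lambda>x. x \<otimes>\<^bsub>G1\<^esub> g) ` K)" by (rule S1.right_image_compact[OF g A(2)])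
  \<comment> \<open>\<open>ennreal\<close> sends negative numbers to zero, so
    \<open>\<sigma> = 1\<close> and \<open>\<sigma> = - 1\<close> select the positive and the
    negative part.\<close>
  have part: "(\<integral>\<^sup>+z. ennreal (\<sigma> * (indicator (((\<lambda>x. x \<otimes>\<^bsub>G1\<^esub> g) ` A) \<times> B) z * h z)) \<partial>M) = (\<integral>\<^sup>+z. ennreal (\<sigma> * (indicator (A \<times> B) z * h z)) \<partial>M)"
    if \<sigma>: "\<sigma> = 1 \<or> \<sigma> = - 1" for \<sigma> :: real
  proof -
    let ?\<phi> = "\<lambda>z. indicator B (snd z) * ennreal (\<sigma> * h z)"
    have eq: "ennreal (\<sigma> * (indicator (C \<times> B) z * h z)) = indicator C (fst z) * ?\<phi> z" for C z
      by (cases z) (auto simp: indicator_def)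
    have "(\<integral>\<^sup>+z. indicator ((\<lambda>x. x \<otimes>\<^bsub>G1\<^esub> g) ` A) (fst z) * ?\<phi> z \<partial>M) = (\<integral>\<^sup>+z. indicator A (fst z) * ?\<phi> z \<partial>M)"
    proof (rule slab_right_inv[OF left_inv_M S1 nc1 fst_measurable _ _ _ _ _ g A(1), where \<iota> = "\<lambda>g. (g, \<one>\<^bsub>G2\<^esub>)"])
      show "?\<phi> \<in> borel_measurable (borel_of T)" using B(1) by measurable
      show "AE z in M. ?\<phi> ((g, \<one>\<^bsub>G2\<^esub>) \<otimes>\<^bsub>G\<^esub> z) = ?\<phi> z" if g: "g \<in> carrier G1" for g
        using inv[OF g] AE_space
      proof eventually_elim
        case (elim z)
        then show ?case by (auto simp: mult_prod_alt space_M)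
      qed
      show "(\<integral>\<^sup>+z. indicator K' (fst z) * ?\<phi> z \<partial>M) < \<infinity>" if K': "compactin T1 K'" for K'
      proof -
        have "(\<integral>\<^sup>+z. indicator K' (fst z) * ?\<phi> z \<partial>M) \<le> (\<integral>\<^sup>+z. ennreal (norm (indicator (K' \<times> B) z * h z)) \<partial>M)"
          unfolding eq[symmetric] using \<sigma> by (intro nn_integral_mono ennreal_leI) auto
        also have "\<dots> < \<infinity>"
          using int[OF S1.compact_sets[OF K'] K' order_refl] by (simp add: integrable_iff_bounded)
        finally show ?thesis .
      qed
    qed (auto simp: mult_prod_alt)
    then show ?thesis unfolding eq .
  qed
  show ?thesis
    using part[of 1] part[of "-1"]
    by (subst (1 2) real_lebesgue_integral_def) (use int[OF A] int[OF gA gK image_mono[OF A(3)]] in simp_all)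
qed

end

text \<open>A finite form of Baire's theorem. If \<open>V - C\<close> is nonempty, it is open and
  covered by the remaining closed sets; if it is empty, \<open>V\<close> itself lies in
  \<open>C\<close>.\<close>

lemma finite_closed_cover_interior:
  assumes "finite \<C>" "\<And>C. C \<in> \<C> \<Longrightarrow> closedin T C" "openin T V" "V \<noteq> {}" "V \<subseteq> \<Union>\<C>"
  shows "\<exists>C\<in>\<C>. \<exists>U. openin T U \<and> U \<noteq> {} \<and> U \<subseteq> C"
  using assms
proof (induction \<C> arbitrary: V rule: finite_induct)
  case (insert C \<C>)
  show ?case
  proof (cases "V - C = {}")
    case True
    then show ?thesis using insert.prems by (intro bexI[of _ C]) auto
  next
    case False
    have "openin T (V - C)" using insert.prems by (intro openin_diff) auto
    from insert.IH[OF _ this False] insert.prems show ?thesis by auto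
  qed
qed simp

lemma continuous_map_sequentialI:
  fixes h :: "'a \<Rightarrow> 'b :: metric_space"
  assumes sc: "second_countable T"
    and seq: "\<And>x s. x \<in> topspace T \<Longrightarrow> (\<And>k::nat. s k \<in> topspace T) \<Longrightarrow> limitin T s x sequentially \<Longrightarrow> (\<lambda>k. h (s k)) \<longlonglongrightarrow> h x"
  shows "continuous_map T euclidean h"
  unfolding continuous_map_def
proof (intro conjI allI impI)
  fix W :: "'b set" assume "openin euclidean W"
  then have W: "open W" by simp
  show "openin T {x \<in> topspace T. h x \<in> W}"
    unfolding openin_subopen[of T "{x \<in> topspace T. h x \<in> W}"]
  proof
    fix x assume x: "x \<in> {x \<in> topspace T. h x \<in> W}"
    then obtain e where e: "e > 0" "\<And>z. dist z (h x) < e \<Longrightarrow> z \<in> W" using W unfolding open_dist by blast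
    have xt: "x \<in> topspace T" using x by simp
    have "\<exists>U. openin T U \<and> x \<in> U \<and> (\<forall>y\<in>U. \<bar>dist (h y) (h x) - 0\<bar> < e)"
      by (rule sequential_nhd[OF sc xt _ e(1)]) (rule tendsto_dist[OF seq[OF xt] tendsto_const, of _ "h x", unfolded dist_self])
    then obtain U where U: "openin T U" "x \<in> U" "\<And>y. y \<in> U \<Longrightarrow> dist (h y) (h x) < e" by auto
    have "U \<subseteq> {x \<in> topspace T. h x \<in> W}" using openin_subset[OF U(1)] U(3) e(2) by blast
    then show "\<exists>S. openin T S \<and> x \<in> S \<and> S \<subseteq> {x \<in> topspace T. h x \<in> W}" using U by blast
  qed
qed simp

context product_lattice
begin

lemma right_integral:
  fixes h :: "'a \<times> 'b \<Rightarrow> complex"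
  assumes g: "g \<in> carrier G" and h: "h \<in> borel_measurable (borel_of T)"
  shows "(\<integral>x. h (x \<otimes>\<^bsub>G\<^esub> g) \<partial>M) = (\<integral>x. h x \<partial>M)"
proof -
  have m: "(\<lambda>x. x \<otimes>\<^bsub>G\<^esub> g) \<in> measurable M (borel_of T)"
    using right_measurable[OF g] by (simp add: measurable_cong_sets[OF sets_M refl])
  have e: "distr M (borel_of T) (\<lambda>x. x \<otimes>\<^bsub>G\<^esub> g) = M"
    using right_inv_distr[OF inv_closed[OF g]] unfolding inv_inv[OF g] .
  show ?thesis using integral_distr[OF m h] unfolding e by simp
qed

end

context lattice_action
begin

section \<open>Averages of an equivariant function over rectangles\<close>

context
  fixes f
  assumes f: "f \<in> W" and fin: "(\<integral>\<^sup>+x. indicator F x * wt f x \<partial>M) < \<infinity>"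
begin

definition I :: "nat \<Rightarrow> ('a \<times> 'b) set \<Rightarrow> complex" where
  "I n S = (\<integral>x. indicator S x *\<^sub>R f (n, x) \<partial>M)"

definition mass :: "('a \<times> 'b) set \<Rightarrow> nat \<Rightarrow> real" where
  "mass K n = (\<integral>x. indicator K x * (cmod (f (n, x)))\<^sup>2 \<partial>M)"

lemma local_finite: "compactin T K \<Longrightarrow> (\<integral>\<^sup>+x. indicator K x * wt f x \<partial>M) < \<infinity>"
  by (rule compact_integral_finite[OF wt_measurable[OF f] wt_invariant[OF f] fin])

lemma coord_le_wt: "ennreal ((cmod (f (n, x)))\<^sup>2) \<le> wt f x"
  unfolding wt_def by (rule nn_integral_ge_point[of n UNIV "\<lambda>n. ennreal ((cmod (f (n, x)))\<^sup>2)"]) simp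

lemma compact_finite: "compactin T K \<Longrightarrow> S \<subseteq> K \<Longrightarrow> emeasure M S < \<infinity>"
  by (rule left_inv_rel_compact[OF left_inv_M])

lemma sq_integrable:
  assumes K: "compactin T K"
  shows "integrable M (\<lambda>x. indicator K x * (cmod (f (n, x)))\<^sup>2)"
    and "(\<integral>\<^sup>+x. indicator K x * ennreal ((cmod (f (n, x)))\<^sup>2) \<partial>M) = ennreal (mass K n)"
proof -
  note [measurable_cong] = sets_M
  note [measurable] = compact_sets[OF K] WD(1)[OF f]
  have eq: "ennreal (indicator K x * (cmod (f (n, x)))\<^sup>2) = indicator K x * ennreal ((cmod (f (n, x)))\<^sup>2)" for x
    by (simp add: indicator_def)
  have "(\<integral>\<^sup>+x. indicator K x * ennreal ((cmod (f (n, x)))\<^sup>2) \<partial>M) \<le> (\<integral>\<^sup>+x. indicator K x * wt f x \<partial>M)"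
    by (intro nn_integral_mono mult_left_mono coord_le_wt) simp
  also note local_finite[OF K]
  finally have lt: "(\<integral>\<^sup>+x. indicator K x * ennreal ((cmod (f (n, x)))\<^sup>2) \<partial>M) < \<infinity>" .
  show i: "integrable M (\<lambda>x. indicator K x * (cmod (f (n, x)))\<^sup>2)"
  proof (rule integrableI_nonneg)
    show "(\<lambda>x. indicator K x * (cmod (f (n, x)))\<^sup>2) \<in> borel_measurable M" by measurable
    show "(\<integral>\<^sup>+x. ennreal (indicator K x * (cmod (f (n, x)))\<^sup>2) \<partial>M) < \<infinity>" unfolding eq by (rule lt)
  qed simp
  show "(\<integral>\<^sup>+x. indicator K x * ennreal ((cmod (f (n, x)))\<^sup>2) \<partial>M) = ennreal (mass K n)"
    unfolding mass_def eq[symmetric] by (rule nn_integral_eq_integral[OF i]) simp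
qed

lemma mass_nonneg: "mass K n \<ge> 0"
  unfolding mass_def by simp

text \<open>The sum over \<open>n\<close> is the integral of \<open>wt f\<close> over
  \<open>K\<close>, finite by \<open>compact_integral_finite\<close>. This local summability is what
  leaves only finitely many large coordinates.\<close>

lemma mass_summable:
  assumes K: "compactin T K"
  shows "summable (mass K)"
proof (rule summable_suminf_not_top)
  note [measurable_cong] = sets_M
  note [measurable] = compact_sets[OF K] WD(1)[OF f]
  have "(\<Sum>n. ennreal (mass K n)) = (\<Sum>n. \<integral>\<^sup>+x. indicator K x * ennreal ((cmod (f (n, x)))\<^sup>2) \<partial>M)"
    by (simp only: sq_integrable(2)[OF K])
  also have "\<dots> = (\<integral>\<^sup>+x. (\<Sum>n. indicator K x * ennreal ((cmod (f (n, x)))\<^sup>2)) \<partial>M)"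
    by (intro nn_integral_suminf[symmetric]) measurable
  also have "\<dots> = (\<integral>\<^sup>+x. indicator K x * wt f x \<partial>M)"
    by (simp only: wt_suminf ennreal_suminf_cmult)
  finally show "(\<Sum>n. ennreal (mass K n)) \<noteq> top_class.top" using local_finite[OF K] by auto
qed (rule mass_nonneg)

lemma I_integrable:
  assumes K: "compactin T K" "S \<subseteq> K" and S: "S \<in> sets (borel_of T)"
  shows "integrable M (\<lambda>x. indicator S x *\<^sub>R f (n, x))"
proof (rule Bochner_Integration.integrable_bound)
  note [measurable_cong] = sets_M
  note [measurable] = S WD(1)[OF f]
  show "integrable M (\<lambda>x. indicator K x + indicator K x * (cmod (f (n, x)))\<^sup>2)"
    using compact_finite[OF K(1) order_refl] compact_sets[OF K(1)]
    by (intro Bochner_Integration.integrable_add sq_integrable(1)[OF K(1)]) (simp add: sets_M)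
  show "(\<lambda>x. indicator S x *\<^sub>R f (n, x)) \<in> borel_measurable M" by measurable
  have "r \<le> 1 + r\<^sup>2" for r :: real
    using zero_le_power2[of "r - 1/2"] by (simp add: power2_eq_square algebra_simps)
  then show "AE x in M. norm (indicator S x *\<^sub>R f (n, x)) \<le> norm (indicator K x + indicator K x * (cmod (f (n, x)))\<^sup>2)"
    using K(2) by (auto simp: indicator_def)
qed

text \<open>From \<open>r \<le> t + r\<^sup>2 / t\<close>. The free parameter balances the two ways
  in which an average can be small: a set of small measure or a coordinate of small mass.\<close>

lemma I_bound:
  assumes K: "compactin T K" "S \<subseteq> K" and S: "S \<in> sets (borel_of T)" and t: "t > 0"
  shows "cmod (I n S) \<le> t * measure M S + mass K n / t"
proof -
  note i = I_integrable[OF K S, of n]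
  have iS: "integrable M (indicator S :: _ \<Rightarrow> real)"
    using S compact_finite[OF K] by (simp add: sets_M)
  have "cmod (I n S) \<le> (\<integral>x. norm (indicator S x *\<^sub>R f (n, x)) \<partial>M)"
    unfolding I_def by (rule integral_norm_bound)
  also have "\<dots> \<le> (\<integral>x. t * indicator S x + (1 / t) * (indicator K x * (cmod (f (n, x)))\<^sup>2) \<partial>M)"
  proof (rule integral_mono)
    show "integrable M (\<lambda>x. norm (indicator S x *\<^sub>R f (n, x)))" using i by (rule integrable_norm)
    show "integrable M (\<lambda>x. t * indicator S x + (1 / t) * (indicator K x * (cmod (f (n, x)))\<^sup>2))"
      using iS sq_integrable(1)[OF K(1)] by (intro Bochner_Integration.integrable_add integrable_mult_right)
    fix x
    have "r \<le> t + (1/t) * r\<^sup>2" if "r \<ge> 0" for r :: real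
    proof (cases "r \<le> t")
      case True
      then show ?thesis using t by (simp add: add_increasing2)
    next
      case False
      then have "r * t \<le> r * r" using that by (intro mult_left_mono) auto
      then have "r \<le> (1/t) * r\<^sup>2" using t by (simp add: field_simps power2_eq_square)
      then show ?thesis using t by simp
    qed
    then show "norm (indicator S x *\<^sub>R f (n, x)) \<le> t * indicator S x + (1 / t) * (indicator K x * (cmod (f (n, x)))\<^sup>2)"
      using K(2) t by (auto simp: indicator_def)
  qed
  also have "\<dots> = t * measure M S + (1 / t) * mass K n"
  proof -
    have "(\<integral>x. indicator S x \<partial>M) = measure M S" using S by (simp add: sets_M)
    then show ?thesis
      using iS sq_integrable(1)[OF K(1), of n] unfolding mass_def by (subst Bochner_Integration.integral_add) auto
  qed
  finally show ?thesis by simp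
qed

lemma I_diff:
  assumes K: "compactin T K" "S \<subseteq> K" "S' \<subseteq> K" and S: "S \<in> sets (borel_of T)" "S' \<in> sets (borel_of T)"
  shows "I n S - I n S' = I n (S - S') - I n (S' - S)"
proof -
  have i: "integrable M (\<lambda>x. indicator X x *\<^sub>R f (n, x))" if "X \<subseteq> K" "X \<in> sets (borel_of T)" for X
    by (rule I_integrable[OF K(1) that])
  have "I n S - I n S' = (\<integral>x. indicator S x *\<^sub>R f (n, x) - indicator S' x *\<^sub>R f (n, x) \<partial>M)"
    unfolding I_def by (rule Bochner_Integration.integral_diff[symmetric]) (intro i K S)+
  also have "\<dots> = (\<integral>x. indicator (S - S') x *\<^sub>R f (n, x) - indicator (S' - S) x *\<^sub>R f (n, x) \<partial>M)"
    by (rule Bochner_Integration.integral_cong) (auto simp: indicator_def)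
  also have "\<dots> = I n (S - S') - I n (S' - S)"
    unfolding I_def using K S by (intro Bochner_Integration.integral_diff i) auto
  finally show ?thesis .
qed

lemma Re_Im_I:
  assumes "compactin T K" "S \<subseteq> K" "S \<in> sets (borel_of T)"
  shows "Re (I n S) = (\<integral>z. indicator S z * Re (f (n, z)) \<partial>M)" "Im (I n S) = (\<integral>z. indicator S z * Im (f (n, z)) \<partial>M)"
  unfolding I_def using I_integrable[OF assms, of n] by (simp_all add: integral_Re[symmetric] integral_Im[symmetric] del: integral_Re integral_Im)

lemma Re_Im_locally_integrable:
  assumes K: "compactin T K"
  shows "integrable M (\<lambda>z. indicator K z * Re (f (n, z)))" "integrable M (\<lambda>z. indicator K z * Im (f (n, z)))"
  using integrable_Re[OF I_integrable[OF K order_refl compact_sets[OF K], of n]]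
    integrable_Im[OF I_integrable[OF K order_refl compact_sets[OF K], of n]] by simp_all

lemma Re_Im_measurable:
  "(\<lambda>z. Re (f (n, z))) \<in> borel_measurable (borel_of T)" "(\<lambda>z. Im (f (n, z))) \<in> borel_measurable (borel_of T)"
  using WD(1)[OF f, of n] by measurable

text \<open>If all these averages vanished, \<open>locally_integrable_zero\<close>, applied to real
  and imaginary parts, would make every coordinate zero almost everywhere.\<close>

lemma I_nonzero:
  assumes nz: "(\<integral>\<^sup>+x. indicator F x * wt f x \<partial>M) \<noteq> 0"
  obtains n U V K L where "openin T1 U" "openin T2 V" "compactin T1 K" "compactin T2 L" "U \<subseteq> K" "V \<subseteq> L" "I n (U \<times> V) \<noteq> 0"
proof -
  have "\<exists>n U V K L. openin T1 U \<and> openin T2 V \<and> compactin T1 K \<and> compactin T2 L \<and> U \<subseteq> K \<and> V \<subseteq> L \<and> I n (U \<times> V) \<noteq> 0"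
  proof (rule ccontr)
    assume no: "\<not> ?thesis"
    have z: "I n (U \<times> V) = 0"
      if "openin T1 U" "openin T2 V" "compactin T1 K" "compactin T2 L" "U \<subseteq> K" "V \<subseteq> L" for n U V K L
      using no that by blast
    have RI: "(\<integral>z. indicator (U \<times> V) z * Re (f (n, z)) \<partial>M) = 0" "(\<integral>z. indicator (U \<times> V) z * Im (f (n, z)) \<partial>M) = 0"
      if UV: "openin T1 U" "openin T2 V" "compactin T1 K" "compactin T2 L" "U \<subseteq> K" "V \<subseteq> L" for n U V K L
    proof -
      have KL: "compactin T (K \<times> L)" "U \<times> V \<subseteq> K \<times> L" "U \<times> V \<in> sets (borel_of T)"
        using UV by (simp_all add: compactin_Times Sigma_mono Times_sets openin_sets_borel_of)
      show "(\<integral>z. indicator (U \<times> V) z * Re (f (n, z)) \<partial>M) = 0" "(\<integral>z. indicator (U \<times> V) z * Im (f (n, z)) \<partial>M) = 0"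
        using z[OF UV, of n] Re_Im_I[OF KL, of n] by simp_all
    qed
    have "AE z in M. f (n, z) = 0" for n
    proof -
      have "AE z in M. Re (f (n, z)) = 0"
        by (rule locally_integrable_zero[OF Re_Im_measurable(1) Re_Im_locally_integrable(1) RI(1)])
      moreover have "AE z in M. Im (f (n, z)) = 0"
        by (rule locally_integrable_zero[OF Re_Im_measurable(2) Re_Im_locally_integrable(2) RI(2)])
      ultimately show ?thesis by eventually_elim (simp add: complex_eq_iff)
    qed
    then have "AE z in M. \<forall>n. f (n, z) = 0" unfolding AE_all_countable by (rule allI)
    then have "AE z in M. indicator F z * wt f z = 0" by eventually_elim (simp add: wt_def)
    then have "(\<integral>\<^sup>+x. indicator F x * wt f x \<partial>M) = (\<integral>\<^sup>+x. 0 \<partial>M)" by (rule nn_integral_cong_AE)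
    then show False using nz by simp
  qed
  then show thesis using that by (elim exE conjE) metis
qed

context
  fixes U1 K1 U2 K2
  assumes U1: "openin T1 U1" "compactin T1 K1" "U1 \<subseteq> K1" and U2: "openin T2 U2" "compactin T2 K2" "U2 \<subseteq> K2"
begin

definition slab :: "'b \<Rightarrow> ('a \<times> 'b) set" where
  "slab y = U1 \<times> ((\<lambda>u. u \<otimes>\<^bsub>G2\<^esub> y) ` U2)"

text \<open>\<open>f\<close> will be \<open>G1\<close>-invariant only up to null sets that depend on
  the translation, so it cannot simply be restricted to the second factor. The averages over the
  moved rectangles are defined for every \<open>y\<close>.\<close>

definition coord :: "nat \<Rightarrow> 'b \<Rightarrow> complex" where
  "coord n y = I n (slab y)"

lemma slab_sets: "y \<in> carrier G2 \<Longrightarrow> slab y \<in> sets (borel_of T)"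
  unfolding slab_def by (intro Times_sets openin_sets_borel_of U1 S2.right_image_open U2)

lemma slab_compact:
  assumes "y \<in> carrier G2"
  shows "compactin T (K1 \<times> ((\<lambda>u. u \<otimes>\<^bsub>G2\<^esub> y) ` K2))" "slab y \<subseteq> K1 \<times> ((\<lambda>u. u \<otimes>\<^bsub>G2\<^esub> y) ` K2)"
  using U1 U2 S2.right_image_compact[OF assms U2(2)] by (auto simp: slab_def compactin_Times)

lemma slab_emeasure: "y \<in> carrier G2 \<Longrightarrow> emeasure M (slab y) = emeasure M (U1 \<times> U2)"
  unfolding slab_def by (intro right_snd openin_sets_borel_of U1 U2)

text \<open>\<open>t\<close> is fixed so that the measure term of \<open>I_bound\<close> is at most
  \<open>\<delta> / 2\<close>, the summand 1 guarding against measure zero; the masses are summable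
  in \<open>n\<close>, so the other term is eventually below \<open>\<delta> / 2\<close>.\<close>

lemma coord_small_finite:
  assumes y: "y \<in> carrier G2" and \<delta>: "\<delta> > 0"
  shows "finite {n. cmod (coord n y) > \<delta>}"
proof -
  note K = slab_compact[OF y] and S = slab_sets[OF y]
  let ?K = "K1 \<times> ((\<lambda>u. u \<otimes>\<^bsub>G2\<^esub> y) ` K2)"
  define t where "t = \<delta> / (2 * (measure M (slab y) + 1))"
  have m0: "measure M (slab y) + 1 > 0" by (simp add: add_nonneg_pos)
  have t: "t > 0" using \<delta> m0 by (simp add: t_def)
  have tm: "t * measure M (slab y) \<le> \<delta> / 2"
  proof -
    have "t * measure M (slab y) \<le> t * (measure M (slab y) + 1)" using t by simp
    also have "\<dots> = \<delta> / 2"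
    proof -
      have "\<delta> / (2 * m) * m = \<delta> / 2" if "m > 0" for m using that by simp
      from this[OF m0] show ?thesis unfolding t_def .
    qed
    finally show ?thesis .
  qed
  have "mass ?K \<longlonglongrightarrow> 0" by (rule summable_LIMSEQ_zero[OF mass_summable[OF K(1)]])
  then have "\<forall>\<^sub>F n in sequentially. mass ?K n < t * \<delta> / 2"
    using t \<delta> by (intro order_tendstoD(2)) auto
  then obtain N0 where N0: "\<And>n. n \<ge> N0 \<Longrightarrow> mass ?K n < t * \<delta> / 2" by (auto simp: eventually_sequentially)
  have "cmod (coord n y) \<le> \<delta>" if "n \<ge> N0" for n
  proof -
    have "mass ?K n / t < \<delta> / 2" using N0[OF that] t by (simp add: field_simps)
    then show ?thesis using I_bound[OF K S t, of n] tm unfolding coord_def by linarith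
  qed
  then have "{n. cmod (coord n y) > \<delta>} \<subseteq> {..<N0}" by (force simp: not_le)
  then show ?thesis by (rule finite_subset) simp
qed

lemma coord_continuous: "continuous_map T2 euclidean (coord n)"
proof (rule continuous_map_sequentialI[OF S2.second_countable_T])
  fix y and s :: "nat \<Rightarrow> 'b"
  assume y: "y \<in> topspace T2" and s: "\<And>k. s k \<in> topspace T2" "limitin T2 s y sequentially"
  have yc: "y \<in> carrier G2" and sc: "s k \<in> carrier G2" for k using y s(1)[of k] by auto
  obtain P C where PC: "openin T2 P" "compactin T2 C" "y \<in> P" "P \<subseteq> C"
    using bspec[OF S2.locally_compact_T[unfolded locally_compact_space_def] y] by blast
  \<comment> \<open>A product of compact sets is compact. It contains the moved copies of
    \<open>U2\<close> for all points of \<open>P\<close>, so a single mass term serves for all slabs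
    near \<open>y\<close>.\<close>
  define K2' where "K2' = (\<lambda>(u, v). u \<otimes>\<^bsub>G2\<^esub> v) ` (K2 \<times> C)"
  have K2': "compactin T2 K2'"
    unfolding K2'_def by (rule image_compactin[OF _ S2.mult_continuous]) (use U2 PC in \<open>simp add: compactin_Times\<close>)
  define K where "K = K1 \<times> K2'"
  have K: "compactin T K" using U1 K2' by (simp add: K_def compactin_Times)
  have sub: "slab z \<subseteq> K" if "z \<in> P" for z
    using that PC U1 U2 by (force simp: slab_def K_def K2'_def)
  have evP: "\<forall>\<^sub>F k in sequentially. s k \<in> P" using s(2) PC by (auto simp: limitin_def)
  have fm: "emeasure M (slab z) \<noteq> \<infinity>" if "z \<in> carrier G2" for z
    using compact_finite[OF slab_compact[OF that]] by simp
  \<comment> \<open>All slabs have the same measure by \<open>right_snd\<close>, so the two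
    differences are equally large. It remains to treat the one inside \<open>slab y\<close>, where
    dominated convergence applies.\<close>
  have mD: "measure M (slab (s k) - slab y) = measure M (slab y - slab (s k))" for k
  proof -
    have "measure M (slab (s k) - slab (s k) \<inter> slab y) = measure M (slab (s k)) - measure M (slab (s k) \<inter> slab y)"
      by (rule measure_Diff[OF fm[OF sc]]) (use slab_sets[OF sc] slab_sets[OF yc] in \<open>auto simp: sets_M\<close>)
    moreover have "measure M (slab y - slab (s k) \<inter> slab y) = measure M (slab y) - measure M (slab (s k) \<inter> slab y)"
      by (rule measure_Diff[OF fm[OF yc]]) (use slab_sets[OF sc] slab_sets[OF yc] in \<open>auto simp: sets_M\<close>)
    moreover have "slab (s k) - slab (s k) \<inter> slab y = slab (s k) - slab y" "slab y - slab (s k) \<inter> slab y = slab y - slab (s k)" by auto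
    ultimately show ?thesis using slab_emeasure[OF sc] slab_emeasure[OF yc] by (simp add: measure_def)
  qed
  have lim: "(\<lambda>k. measure M (slab y - slab (s k))) \<longlonglongrightarrow> 0"
  proof -
    have E: "slab y - slab (s k) \<in> sets M" for k using slab_sets[OF sc[of k]] slab_sets[OF yc] by (simp add: sets_M)
    have "(\<lambda>k. \<integral>x. indicator (slab y - slab (s k)) x \<partial>M) \<longlonglongrightarrow> (\<integral>x. (0::real) \<partial>M)"
    proof (rule integral_dominated_convergence[where w = "indicator (slab y)"])
      show "integrable M (indicator (slab y) :: _ \<Rightarrow> real)"
        using slab_sets[OF yc] fm[OF yc] by (simp add: sets_M less_top)
      show "AE x in M. (\<lambda>k. indicator (slab y - slab (s k)) x) \<longlonglongrightarrow> (0::real)"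
      proof (rule AE_I2)
        fix x assume "x \<in> space M"
        show "(\<lambda>k. indicator (slab y - slab (s k)) x) \<longlonglongrightarrow> (0::real)"
        proof (cases "x \<in> slab y")
          case True
          have U2c: "U2 \<subseteq> carrier G2" using openin_subset[OF U2(1)] by simp
          obtain x1 x2 where x: "x = (x1, x2)" by (cases x)
          have x12: "x1 \<in> U1" "x2 \<in> (\<lambda>u. u \<otimes>\<^bsub>G2\<^esub> y) ` U2" using True by (auto simp: slab_def x)
          then have x2: "x2 \<in> carrier G2" "x2 \<otimes>\<^bsub>G2\<^esub> inv\<^bsub>G2\<^esub> y \<in> U2" unfolding S2.right_image[OF yc U2c] by auto
          have "limitin T2 (\<lambda>k. x2 \<otimes>\<^bsub>G2\<^esub> inv\<^bsub>G2\<^esub> (s k)) (x2 \<otimes>\<^bsub>G2\<^esub> inv\<^bsub>G2\<^esub> y) sequentially"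
            by (rule S2.mult_limitin[OF S2.const_limitin[OF x2(1)] S2.inv_limitin[OF s(2)]])
          then have "\<forall>\<^sub>F k in sequentially. x2 \<otimes>\<^bsub>G2\<^esub> inv\<^bsub>G2\<^esub> (s k) \<in> U2" using U2(1) x2(2) by (auto simp: limitin_def)
          then have "\<forall>\<^sub>F k in sequentially. indicator (slab y - slab (s k)) x = (0::real)"
          proof eventually_elim
            case (elim k)
            then have "x \<in> slab (s k)" unfolding slab_def x S2.right_image[OF sc U2c] using x12(1) x2(1) by simp
            then show ?case by simp
          qed
          then show ?thesis by (rule tendsto_eventually)
        qed simp
      qed
      show "AE x in M. norm (indicator (slab y - slab (s k)) x :: real) \<le> indicator (slab y) x" for k
        by (auto simp: indicator_def)
      show "(indicator (slab y - slab (s k)) :: _ \<Rightarrow> real) \<in> borel_measurable M" for k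
        using E by (intro borel_measurable_indicator)
    qed simp
    then show ?thesis using E by simp
  qed
  show "(\<lambda>k. coord n (s k)) \<longlonglongrightarrow> coord n y"
  proof (rule tendstoI)
    fix \<epsilon> :: real assume e: "\<epsilon> > 0"
    \<comment> \<open>Large enough to push the mass term below \<open>\<epsilon> / 4\<close>; the
      measure of the difference is afterwards made small relative to this \<open>t\<close>.\<close>
    define t where "t = 4 * mass K n / \<epsilon> + 1"
    have t: "t > 0" using mass_nonneg[of K n] e by (simp add: t_def add_nonneg_pos)
    have mt: "mass K n / t < \<epsilon> / 4"
    proof -
      have "4 * mass K n < \<epsilon> * t" using e by (simp add: t_def field_simps)
      then show ?thesis using t by (simp add: field_simps)
    qed
    have "\<forall>\<^sub>F k in sequentially. measure M (slab y - slab (s k)) < \<epsilon> / (4 * t)"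
      using lim e t by (intro order_tendstoD(2)) auto
    with evP show "\<forall>\<^sub>F k in sequentially. dist (coord n (s k)) (coord n y) < \<epsilon>"
    proof eventually_elim
      case (elim k)
      note ss = slab_sets[OF sc[of k]] slab_sets[OF yc]
      have sb: "slab (s k) \<subseteq> K" "slab y \<subseteq> K" using sub elim(1) PC(3) by auto
      have "dist (coord n (s k)) (coord n y) = cmod (I n (slab (s k) - slab y) - I n (slab y - slab (s k)))"
        unfolding dist_norm coord_def I_diff[OF K sb ss, of n] ..
      also have "\<dots> \<le> cmod (I n (slab (s k) - slab y)) + cmod (I n (slab y - slab (s k)))" by (rule norm_triangle_ineq4)
      also have "\<dots> \<le> (t * measure M (slab (s k) - slab y) + mass K n / t) + (t * measure M (slab y - slab (s k)) + mass K n / t)"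
        by (intro add_mono I_bound[OF K _ _ t]) (use sb ss in auto)
      also have "\<dots> = 2 * (t * measure M (slab y - slab (s k))) + 2 * (mass K n / t)" by (simp add: mD)
      also have "t * measure M (slab y - slab (s k)) < \<epsilon> / 4" using elim(2) t by (simp add: field_simps)
      finally have "dist (coord n (s k)) (coord n y) < 2 * (\<epsilon> / 4) + 2 * (mass K n / t)" by simp
      then show ?case using mt by linarith
    qed
  qed
qed

context
  assumes inv: "\<And>g. g \<in> carrier G1 \<Longrightarrow> AE x in M. sec f (emb g \<otimes>\<^bsub>G\<^esub> x) = sec f x"
begin

lemma I_right_inv:
  assumes A: "A \<in> sets (borel_of T1)" "compactin T1 K" "A \<subseteq> K"
    and B: "B \<in> sets (borel_of T2)" "compactin T2 L" "B \<subseteq> L" and g: "g \<in> carrier G1"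
  shows "I n (((\<lambda>x. x \<otimes>\<^bsub>G1\<^esub> g) ` A) \<times> B) = I n (A \<times> B)"
proof -
  have s1: "compactin T (((\<lambda>x. x \<otimes>\<^bsub>G1\<^esub> g) ` K) \<times> L)" "((\<lambda>x. x \<otimes>\<^bsub>G1\<^esub> g) ` A) \<times> B \<subseteq> ((\<lambda>x. x \<otimes>\<^bsub>G1\<^esub> g) ` K) \<times> L"
    "((\<lambda>x. x \<otimes>\<^bsub>G1\<^esub> g) ` A) \<times> B \<in> sets (borel_of T)"
    using A B S1.right_image_compact[OF g A(2)] Times_sets[OF S1.right_image_sets[OF g A(1)] B(1)] by (auto simp: compactin_Times)
  have s2: "compactin T (K \<times> L)" "A \<times> B \<subseteq> K \<times> L" "A \<times> B \<in> sets (borel_of T)"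
    using A B Times_sets[OF A(1) B(1)] by (auto simp: compactin_Times)
  have ae: "AE z in M. f (n, (h, \<one>\<^bsub>G2\<^esub>) \<otimes>\<^bsub>G\<^esub> z) = f (n, z)" if "h \<in> carrier G1" for h
    using inv[OF that] unfolding emb_def by eventually_elim (rule fun_cong)
  have r: "AE z in M. Re (f (n, (h, \<one>\<^bsub>G2\<^esub>) \<otimes>\<^bsub>G\<^esub> z)) = Re (f (n, z))" "AE z in M. Im (f (n, (h, \<one>\<^bsub>G2\<^esub>) \<otimes>\<^bsub>G\<^esub> z)) = Im (f (n, z))"
    if "h \<in> carrier G1" for h
    using ae[OF that] by (eventually_elim, simp only:)+
  show ?thesis
    unfolding complex_eq_iff Re_Im_I[OF s1] Re_Im_I[OF s2]
    by (intro conjI slab_integral_right_inv[OF Re_Im_measurable(1) Re_Im_locally_integrable(1) r(1) A B g]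
      slab_integral_right_inv[OF Re_Im_measurable(2) Re_Im_locally_integrable(2) r(2) A B g])
qed

text \<open>Right translation of the integration variable by \<gamma> turns the slab at
  \<open>y \<otimes> snd \<gamma>\<close> into the slab at \<open>y\<close> with its first side
  moved by the inverse of \<open>fst \<gamma>\<close>. Invariance of \<open>f\<close> under
  \<open>G1\<close>, in the form \<open>I_right_inv\<close>, undoes this move.\<close>

lemma coord_equivariant:
  assumes y: "y \<in> carrier G2" and \<gamma>: "\<gamma> \<in> \<Gamma>"
  shows "coord n (y \<otimes>\<^bsub>G2\<^esub> snd \<gamma>) = c (inv\<^bsub>G\<^esub> \<gamma>) n * coord (s (inv\<^bsub>G\<^esub> \<gamma>) n) y"
proof -
  obtain g1 g2 where gg: "\<gamma> = (g1, g2)" by (cases \<gamma>)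
  have g: "g1 \<in> carrier G1" "g2 \<in> carrier G2" using \<Gamma>_carrier[OF \<gamma>] by (auto simp: gg)
  have U1c: "U1 \<subseteq> carrier G1" and U2c: "U2 \<subseteq> carrier G2" using openin_subset[OF U1(1)] openin_subset[OF U2(1)] by auto
  have yg: "y \<otimes>\<^bsub>G2\<^esub> g2 \<in> carrier G2" using y g by simp
  let ?A = "(\<lambda>x. x \<otimes>\<^bsub>G1\<^esub> inv\<^bsub>G1\<^esub> g1) ` U1" and ?B = "(\<lambda>u. u \<otimes>\<^bsub>G2\<^esub> y) ` U2"
  note [measurable] = WD(1)[OF f] slab_sets[OF yg]
  have "coord n (y \<otimes>\<^bsub>G2\<^esub> g2) = (\<integral>x. indicator (slab (y \<otimes>\<^bsub>G2\<^esub> g2)) (x \<otimes>\<^bsub>G\<^esub> \<gamma>) *\<^sub>R f (n, x \<otimes>\<^bsub>G\<^esub> \<gamma>) \<partial>M)"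
    unfolding coord_def I_def by (rule right_integral[OF \<Gamma>_carrier[OF \<gamma>], symmetric]) measurable
  also have "\<dots> = (\<integral>x. c (inv\<^bsub>G\<^esub> \<gamma>) n * (indicator (?A \<times> ?B) x *\<^sub>R f (s (inv\<^bsub>G\<^esub> \<gamma>) n, x)) \<partial>M)"
  proof (rule Bochner_Integration.integral_cong[OF refl])
    fix x assume "x \<in> space M"
    then have xc: "x \<in> carrier G" by (simp only: space_M)
    obtain x1 x2 where x: "x = (x1, x2)" by (cases x)
    have x12: "x1 \<in> carrier G1" "x2 \<in> carrier G2" using xc by (auto simp: x)
    have e1: "x1 \<in> ?A \<longleftrightarrow> x1 \<otimes>\<^bsub>G1\<^esub> g1 \<in> U1"
      unfolding S1.right_image[OF S1.inv_closed[OF g(1)] U1c] using x12 g by simp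
    have "(x2 \<otimes>\<^bsub>G2\<^esub> g2) \<otimes>\<^bsub>G2\<^esub> inv\<^bsub>G2\<^esub> (y \<otimes>\<^bsub>G2\<^esub> g2) = x2 \<otimes>\<^bsub>G2\<^esub> inv\<^bsub>G2\<^esub> y"
    proof -
      have "(x2 \<otimes>\<^bsub>G2\<^esub> g2) \<otimes>\<^bsub>G2\<^esub> inv\<^bsub>G2\<^esub> (y \<otimes>\<^bsub>G2\<^esub> g2) = x2 \<otimes>\<^bsub>G2\<^esub> (g2 \<otimes>\<^bsub>G2\<^esub> (inv\<^bsub>G2\<^esub> g2 \<otimes>\<^bsub>G2\<^esub> inv\<^bsub>G2\<^esub> y))"
        using x12 y g by (simp add: S2.inv_mult_group S2.m_assoc)
      also have "g2 \<otimes>\<^bsub>G2\<^esub> (inv\<^bsub>G2\<^esub> g2 \<otimes>\<^bsub>G2\<^esub> inv\<^bsub>G2\<^esub> y) = inv\<^bsub>G2\<^esub> y"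
        using y g by (simp add: S2.m_assoc[symmetric])
      finally show ?thesis .
    qed
    then have e2: "x2 \<otimes>\<^bsub>G2\<^esub> g2 \<in> (\<lambda>u. u \<otimes>\<^bsub>G2\<^esub> (y \<otimes>\<^bsub>G2\<^esub> g2)) ` U2 \<longleftrightarrow> x2 \<in> ?B"
      unfolding S2.right_image[OF yg U2c] S2.right_image[OF y U2c] using x12 g by simp
    have "x \<otimes>\<^bsub>G\<^esub> \<gamma> \<in> slab (y \<otimes>\<^bsub>G2\<^esub> g2) \<longleftrightarrow> x \<in> ?A \<times> ?B"
      unfolding x gg mult_prod slab_def mem_Times_iff fst_conv snd_conv using e1 e2 by blast
    then have "indicator (slab (y \<otimes>\<^bsub>G2\<^esub> g2)) (x \<otimes>\<^bsub>G\<^esub> \<gamma>) = (indicator (?A \<times> ?B) x :: real)" by (simp add: indicator_def)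
    moreover have "f (n, x \<otimes>\<^bsub>G\<^esub> \<gamma>) = c (inv\<^bsub>G\<^esub> \<gamma>) n * f (s (inv\<^bsub>G\<^esub> \<gamma>) n, x)"
      using fun_cong[OF WD(3)[OF f xc \<gamma>], of n] by (simp only: op_def)
    ultimately show "indicator (slab (y \<otimes>\<^bsub>G2\<^esub> g2)) (x \<otimes>\<^bsub>G\<^esub> \<gamma>) *\<^sub>R f (n, x \<otimes>\<^bsub>G\<^esub> \<gamma>)
        = c (inv\<^bsub>G\<^esub> \<gamma>) n * (indicator (?A \<times> ?B) x *\<^sub>R f (s (inv\<^bsub>G\<^esub> \<gamma>) n, x))" by (simp only: mult_scaleR_right)
  qed
  also have "\<dots> = c (inv\<^bsub>G\<^esub> \<gamma>) n * I (s (inv\<^bsub>G\<^esub> \<gamma>) n) (?A \<times> ?B)"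
    unfolding I_def by (rule integral_mult_right_zero)
  also have "I (s (inv\<^bsub>G\<^esub> \<gamma>) n) (?A \<times> ?B) = I (s (inv\<^bsub>G\<^esub> \<gamma>) n) (U1 \<times> ?B)"
    by (rule I_right_inv[OF openin_sets_borel_of[OF U1(1)] U1(2,3) openin_sets_borel_of[OF S2.right_image_open[OF y U2(1)]]
        S2.right_image_compact[OF y U2(2)] image_mono[OF U2(3)] S1.inv_closed[OF g(1)]])
  finally show ?thesis by (simp add: gg coord_def slab_def)
qed

text \<open>The sums in \<open>perp\<close> are finite and commute with the integral, and the
  sections of \<open>f\<close> satisfy \<open>perp\<close> at every point.\<close>

lemma coord_perp: "y \<in> carrier G2 \<Longrightarrow> perp (\<lambda>n. coord n y)"
  unfolding perp_def
proof
  fix n assume y: "y \<in> carrier G2"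
  note i = I_integrable[OF slab_compact[OF y] slab_sets[OF y]]
  have "(\<Sum>m | inv_vec n m \<noteq> 0. coord m y * cnj (inv_vec n m))
     = (\<Sum>m | inv_vec n m \<noteq> 0. \<integral>x. (indicator (slab y) x *\<^sub>R f (m, x)) * cnj (inv_vec n m) \<partial>M)"
    unfolding coord_def I_def by (intro sum.cong refl integral_mult_left_zero[symmetric])
  also have "\<dots> = (\<integral>x. (\<Sum>m | inv_vec n m \<noteq> 0. (indicator (slab y) x *\<^sub>R f (m, x)) * cnj (inv_vec n m)) \<partial>M)"
    by (rule Bochner_Integration.integral_sum[symmetric]) (intro integrable_mult_left i)
  also have "\<dots> = (\<integral>x. 0 \<partial>M)"
  proof (rule Bochner_Integration.integral_cong[OF refl])
    fix x assume "x \<in> space M"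
    then have x: "x \<in> carrier G" by (simp only: space_M)
    have "(\<Sum>m | inv_vec n m \<noteq> 0. (indicator (slab y) x *\<^sub>R f (m, x)) * cnj (inv_vec n m))
      = indicator (slab y) x *\<^sub>R (\<Sum>m | inv_vec n m \<noteq> 0. f (m, x) * cnj (inv_vec n m))"
      by (simp add: scaleR_sum_right)
    then show "(\<Sum>m | inv_vec n m \<noteq> 0. (indicator (slab y) x *\<^sub>R f (m, x)) * cnj (inv_vec n m)) = 0"
      using WD(4)[OF f x] by (simp add: perp_def)
  qed
  finally show "(\<Sum>m | inv_vec n m \<noteq> 0. coord m y * cnj (inv_vec n m)) = 0" by simp
qed

end

end

end

section \<open>Orbits, and periods of equivariant coordinates\<close>

lemma s_mul: "\<gamma> \<in> \<Gamma> \<Longrightarrow> \<delta> \<in> \<Gamma> \<Longrightarrow> s (\<gamma> \<otimes>\<^bsub>G\<^esub> \<delta>) m = s \<delta> (s \<gamma> m)"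
  using s_mult[of \<gamma> \<delta> m] by simp

lemma c_mul: "\<gamma> \<in> \<Gamma> \<Longrightarrow> \<delta> \<in> \<Gamma> \<Longrightarrow> c (\<gamma> \<otimes>\<^bsub>G\<^esub> \<delta>) m = c \<gamma> m * c \<delta> (s \<gamma> m)"
  using c_mult[of \<gamma> \<delta> m] by simp

lemma s_1: "s \<one>\<^bsub>G\<^esub> m = m"
  using s_one[of m] by simp

lemma s_inverse:
  assumes "\<gamma> \<in> \<Gamma>"
  shows "s \<gamma> (s (inv\<^bsub>G\<^esub> \<gamma>) m) = m" "s (inv\<^bsub>G\<^esub> \<gamma>) (s \<gamma> m) = m"
  using s_mul[OF \<Gamma>_closed(3)[OF assms] assms, of m] s_mul[OF assms \<Gamma>_closed(3)[OF assms], of m] s_1[of m]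
  unfolding r_inv[OF \<Gamma>_carrier[OF assms]] l_inv[OF \<Gamma>_carrier[OF assms]] by simp_all

lemma orbit_\<Gamma>: "orbit n = (\<lambda>\<gamma>. s \<gamma> n) ` \<Gamma>"
  by (simp add: orbit_def)

lemma orbit_step:
  assumes "\<gamma> \<in> \<Gamma>"
  shows "s \<gamma> m \<in> orbit n \<longleftrightarrow> m \<in> orbit n"
proof
  assume "s \<gamma> m \<in> orbit n"
  then obtain \<delta> where d: "\<delta> \<in> \<Gamma>" "s \<gamma> m = s \<delta> n" unfolding orbit_\<Gamma> by (rule imageE)
  have "m = s (\<delta> \<otimes>\<^bsub>G\<^esub> inv\<^bsub>G\<^esub> \<gamma>) n"
    using s_mul[OF d(1) \<Gamma>_closed(3)[OF assms], of n] s_inverse(2)[OF assms, of m] by (simp only: d(2))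
  then show "m \<in> orbit n" unfolding orbit_\<Gamma> using \<Gamma>_closed(1)[OF d(1) \<Gamma>_closed(3)[OF assms]] by (rule image_eqI)
next
  assume "m \<in> orbit n"
  then obtain \<delta> where d: "\<delta> \<in> \<Gamma>" "m = s \<delta> n" unfolding orbit_\<Gamma> by (rule imageE)
  have "s \<gamma> m = s (\<delta> \<otimes>\<^bsub>G\<^esub> \<gamma>) n" using s_mul[OF d(1) assms, of n] by (simp only: d(2))
  then show "s \<gamma> m \<in> orbit n" unfolding orbit_\<Gamma> using \<Gamma>_closed(1)[OF d(1) assms] by (rule image_eqI)
qed

context
  fixes \<phi> :: "nat \<Rightarrow> 'b \<Rightarrow> complex"
  assumes cont: "\<And>n. continuous_map T2 euclidean (\<phi> n)"
    and equiv: "\<And>n y \<gamma>. y \<in> carrier G2 \<Longrightarrow> \<gamma> \<in> \<Gamma> \<Longrightarrow>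
      \<phi> n (y \<otimes>\<^bsub>G2\<^esub> snd \<gamma>) = c (inv\<^bsub>G\<^esub> \<gamma>) n * \<phi> (s (inv\<^bsub>G\<^esub> \<gamma>) n) y"
begin

lemma equiv_one:
  assumes "\<gamma> \<in> \<Gamma>"
  shows "\<phi> n (snd \<gamma>) = c (inv\<^bsub>G\<^esub> \<gamma>) n * \<phi> (s (inv\<^bsub>G\<^esub> \<gamma>) n) \<one>\<^bsub>G2\<^esub>"
proof -
  have "snd \<gamma> \<in> carrier G2" using \<Gamma>_carrier[OF assms] by (auto simp: carrier_G)
  then show ?thesis using equiv[OF S2.one_closed assms, of n] by simp
qed

text \<open>If \<open>\<phi> n\<close> is nonzero at the identity, these are the elements whose
  right translation multiplies \<open>\<phi> n\<close> by a unimodular constant, and they form a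
  group. The relation is written without division, as a system of closed conditions.\<close>

definition period :: "nat \<Rightarrow> 'b set" where
  "period n = {h \<in> carrier G2. cmod (\<phi> n h) = cmod (\<phi> n \<one>\<^bsub>G2\<^esub>)
     \<and> (\<forall>y\<in>carrier G2. \<phi> n (y \<otimes>\<^bsub>G2\<^esub> h) * \<phi> n \<one>\<^bsub>G2\<^esub> = \<phi> n h * \<phi> n y)}"

text \<open>Equivariance under an element that fixes the index \<open>n\<close> relates
  \<open>\<phi> n\<close> to itself, with a unimodular scalar as factor.\<close>

lemma period_stabilizer:
  assumes \<gamma>: "\<gamma> \<in> \<Gamma>" and st: "s \<gamma> n = n"
  shows "snd \<gamma> \<in> period n"
proof -
  have st': "s (inv\<^bsub>G\<^esub> \<gamma>) n = n" using s_inverse(2)[OF \<gamma>, of n] by (simp only: st)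
  have 1: "\<phi> n (snd \<gamma>) = c (inv\<^bsub>G\<^esub> \<gamma>) n * \<phi> n \<one>\<^bsub>G2\<^esub>" using equiv_one[OF \<gamma>, of n] by (simp only: st')
  have 2: "\<phi> n (y \<otimes>\<^bsub>G2\<^esub> snd \<gamma>) = c (inv\<^bsub>G\<^esub> \<gamma>) n * \<phi> n y" if "y \<in> carrier G2" for y
    using equiv[OF that \<gamma>, of n] by (simp only: st')
  have "snd \<gamma> \<in> carrier G2" using \<Gamma>_carrier[OF \<gamma>] by (auto simp: carrier_G)
  then show ?thesis unfolding period_def by (simp add: 1 2 norm_mult c_norm \<Gamma>_closed(3)[OF \<gamma>])
qed

lemma period_closed: "closedin T2 (period n)"
proof -
  have m: "continuous_map euclidean euclidean (\<lambda>z :: complex. b * z)" for b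
    by (simp add: continuous_map_iff_continuous2)
  have A: "closedin T2 {h \<in> topspace T2. cmod (\<phi> n h) = cmod (\<phi> n \<one>\<^bsub>G2\<^esub>)}"
  proof (rule closedin_continuous_maps_eq[OF Hausdorff_space_euclidean])
    show "continuous_map T2 euclideanreal (\<lambda>h. cmod (\<phi> n h))"
      using continuous_map_norm[OF cont] .
  qed simp
  have B: "closedin T2 {h \<in> topspace T2. \<phi> n \<one>\<^bsub>G2\<^esub> * \<phi> n (y \<otimes>\<^bsub>G2\<^esub> h) = \<phi> n y * \<phi> n h}" if "y \<in> carrier G2" for y
    by (rule closedin_continuous_maps_eq[OF Hausdorff_space_euclidean
          continuous_map_compose[OF continuous_map_compose[OF S2.left_continuous[OF that] cont] m, unfolded o_def]
          continuous_map_compose[OF cont m, unfolded o_def]])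
  have "period n = {h \<in> topspace T2. cmod (\<phi> n h) = cmod (\<phi> n \<one>\<^bsub>G2\<^esub>)}
    \<inter> (\<Inter>y\<in>carrier G2. {h \<in> topspace T2. \<phi> n \<one>\<^bsub>G2\<^esub> * \<phi> n (y \<otimes>\<^bsub>G2\<^esub> h) = \<phi> n y * \<phi> n h})"
    by (auto simp: period_def mult.commute)
  also have "closedin T2 \<dots>"
    using S2.one_closed by (intro closedin_Int A closedin_INT B) auto
  finally show ?thesis .
qed

context
  fixes n :: nat
  assumes nz: "\<phi> n \<one>\<^bsub>G2\<^esub> \<noteq> 0"
begin

lemma period_mult:
  assumes h: "h \<in> period n" and k: "k \<in> period n"
  shows "h \<otimes>\<^bsub>G2\<^esub> k \<in> period n"
proof -
  let ?a = "\<phi> n \<one>\<^bsub>G2\<^esub>"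
  have hk: "h \<in> carrier G2" "k \<in> carrier G2" "cmod (\<phi> n h) = cmod ?a" "cmod (\<phi> n k) = cmod ?a"
    using h k by (auto simp: period_def)
  have e: "\<phi> n (y \<otimes>\<^bsub>G2\<^esub> h) * ?a = \<phi> n h * \<phi> n y" "\<phi> n (y \<otimes>\<^bsub>G2\<^esub> k) * ?a = \<phi> n k * \<phi> n y" if "y \<in> carrier G2" for y
    using h k that by (auto simp: period_def)
  have p: "\<phi> n (h \<otimes>\<^bsub>G2\<^esub> k) = \<phi> n k * \<phi> n h / ?a" using e(2)[OF hk(1)] nz by (simp add: field_simps)
  have "\<phi> n (y \<otimes>\<^bsub>G2\<^esub> (h \<otimes>\<^bsub>G2\<^esub> k)) * ?a = \<phi> n (h \<otimes>\<^bsub>G2\<^esub> k) * \<phi> n y" if y: "y \<in> carrier G2" for y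
  proof -
    have "\<phi> n (y \<otimes>\<^bsub>G2\<^esub> (h \<otimes>\<^bsub>G2\<^esub> k)) * ?a = \<phi> n k * \<phi> n (y \<otimes>\<^bsub>G2\<^esub> h)"
      using e(2)[of "y \<otimes>\<^bsub>G2\<^esub> h"] y hk by (simp add: S2.m_assoc)
    also have "\<phi> n (y \<otimes>\<^bsub>G2\<^esub> h) = \<phi> n h * \<phi> n y / ?a" using e(1)[OF y] nz by (simp add: field_simps)
    finally show ?thesis unfolding p by simp
  qed
  then show ?thesis using hk nz by (simp add: period_def p norm_mult norm_divide)
qed

lemma period_inv:
  assumes h: "h \<in> period n"
  shows "inv\<^bsub>G2\<^esub> h \<in> period n"
proof -
  let ?a = "\<phi> n \<one>\<^bsub>G2\<^esub>"
  have hc: "h \<in> carrier G2" "cmod (\<phi> n h) = cmod ?a" using h by (auto simp: period_def)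
  have e: "\<phi> n (y \<otimes>\<^bsub>G2\<^esub> h) * ?a = \<phi> n h * \<phi> n y" if "y \<in> carrier G2" for y
    using h that by (auto simp: period_def)
  have hz: "\<phi> n h \<noteq> 0" using hc(2) nz by auto
  have p: "\<phi> n (y \<otimes>\<^bsub>G2\<^esub> inv\<^bsub>G2\<^esub> h) = \<phi> n y * ?a / \<phi> n h" if y: "y \<in> carrier G2" for y
    using e[of "y \<otimes>\<^bsub>G2\<^esub> inv\<^bsub>G2\<^esub> h"] y hc hz by (simp add: S2.m_assoc field_simps)
  have q: "\<phi> n (inv\<^bsub>G2\<^esub> h) = ?a * ?a / \<phi> n h" using p[OF S2.one_closed] hc by simp
  show ?thesis using hc nz by (simp add: period_def p q norm_mult norm_divide)
qed

text \<open>Only finitely many coordinates exceed half of \<open>\<bar>\<phi> n 1\<bar>\<close> at the identity, so finitely many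
closed cosets of the period group cover the dense projection of \<open>\<Gamma>\<close> near the identity, and one of
them has interior by Baire's argument. Hence the period group is open and closed.\<close>

lemma period_all:
  assumes fin: "\<And>\<delta>. \<delta> > 0 \<Longrightarrow> finite {m. cmod (\<phi> m \<one>\<^bsub>G2\<^esub>) > \<delta>}"
    and dense: "T2 closure_of (snd ` \<Gamma>) = topspace T2" and conn: "connected_space T2"
  shows "period n = carrier G2"
proof -
  let ?a = "\<phi> n \<one>\<^bsub>G2\<^esub>"
  define \<delta> where "\<delta> = cmod ?a / 2"
  have d: "\<delta> > 0" "\<delta> < cmod ?a" using nz by (auto simp: \<delta>_def)
  define V where "V = {y \<in> topspace T2. \<phi> n y \<in> {z. cmod z > \<delta>}}"
  have V: "openin T2 V" unfolding V_def
    by (rule openin_continuous_map_preimage[OF cont]) (simp add: open_Collect_less continuous_intros)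
  have V1: "\<one>\<^bsub>G2\<^esub> \<in> V" using d by (simp add: V_def)
  \<comment> \<open>The modulus of \<open>\<phi> n\<close> at \<open>snd \<gamma>\<close> equals the
    modulus at the identity of the coordinate \<open>s (inv \<gamma>) n\<close>; so every index in
    \<open>S\<close> exceeds \<open>\<delta>\<close> there, and \<open>S\<close> is finite.\<close>
  define S where "S = (\<lambda>\<gamma>. s (inv\<^bsub>G\<^esub> \<gamma>) n) ` {\<gamma> \<in> \<Gamma>. snd \<gamma> \<in> V}"
  have "S \<subseteq> {m. cmod (\<phi> m \<one>\<^bsub>G2\<^esub>) > \<delta>}"
    using equiv_one by (auto simp: S_def V_def norm_mult c_norm \<Gamma>_closed(3))
  then have finS: "finite S" using fin[OF d(1)] by (rule finite_subset)
  have "\<forall>m\<in>S. \<exists>\<gamma>. \<gamma> \<in> \<Gamma> \<and> s (inv\<^bsub>G\<^esub> \<gamma>) n = m" unfolding S_def by blast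
  from bchoice[OF this] obtain r where r: "\<And>m. m \<in> S \<Longrightarrow> r m \<in> \<Gamma>" "\<And>m. m \<in> S \<Longrightarrow> s (inv\<^bsub>G\<^esub> (r m)) n = m" by auto
  have car: "snd \<gamma> \<in> carrier G2" if "\<gamma> \<in> \<Gamma>" for \<gamma> using \<Gamma>_carrier[OF that] by (auto simp: carrier_G)
  have pc: "period n \<subseteq> carrier G2" by (auto simp: period_def)
  define \<C> where "\<C> = (\<lambda>m. (\<lambda>x. snd (r m) \<otimes>\<^bsub>G2\<^esub> x) ` period n) ` S"
  have finC: "finite \<C>" using finS by (simp add: \<C>_def)
  have clC: "closedin T2 C" if "C \<in> \<C>" for C
  proof -
    from that obtain m where m: "m \<in> S" "C = (\<lambda>x. snd (r m) \<otimes>\<^bsub>G2\<^esub> x) ` period n" unfolding \<C>_def by (rule imageE)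
    have g: "snd (r m) \<in> carrier G2" by (rule car[OF r(1)[OF m(1)]])
    have "closedin T2 {x \<in> topspace T2. inv\<^bsub>G2\<^esub> (snd (r m)) \<otimes>\<^bsub>G2\<^esub> x \<in> period n}"
      by (rule closedin_continuous_map_preimage[OF S2.left_continuous[OF S2.inv_closed[OF g]] period_closed])
    then show ?thesis unfolding m(2) S2.left_image[OF g pc] by simp
  qed
  have inC: "snd \<gamma> \<in> \<Union>\<C>" if \<gamma>: "\<gamma> \<in> \<Gamma>" "snd \<gamma> \<in> V" for \<gamma>
  proof -
    define m where "m = s (inv\<^bsub>G\<^esub> \<gamma>) n"
    have m: "m \<in> S" unfolding m_def S_def using \<gamma> by blast
    \<comment> \<open>Two elements of \<Gamma> that produce the same index differ by an element of
      the stabiliser of \<open>n\<close>, whose projection is a period.\<close>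
    define \<delta>' where "\<delta>' = inv\<^bsub>G\<^esub> (r m) \<otimes>\<^bsub>G\<^esub> \<gamma>"
    have dG: "\<delta>' \<in> \<Gamma>" unfolding \<delta>'_def by (rule \<Gamma>_closed(1)[OF \<Gamma>_closed(3)[OF r(1)[OF m]] \<gamma>(1)])
    have "s \<delta>' n = s \<gamma> m"
      unfolding \<delta>'_def s_mul[OF \<Gamma>_closed(3)[OF r(1)[OF m]] \<gamma>(1)] r(2)[OF m] ..
    also have "\<dots> = n" unfolding m_def by (rule s_inverse(1)[OF \<gamma>(1)])
    finally have p: "snd \<delta>' \<in> period n" by (rule period_stabilizer[OF dG])
    have "r m \<otimes>\<^bsub>G\<^esub> \<delta>' = \<gamma>"
      unfolding \<delta>'_def m_assoc[OF \<Gamma>_carrier[OF r(1)[OF m]] inv_closed[OF \<Gamma>_carrier[OF r(1)[OF m]]] \<Gamma>_carrier[OF \<gamma>(1)], symmetric]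
        r_inv[OF \<Gamma>_carrier[OF r(1)[OF m]]] by (rule l_one[OF \<Gamma>_carrier[OF \<gamma>(1)]])
    then have "snd \<gamma> = snd (r m) \<otimes>\<^bsub>G2\<^esub> snd \<delta>'" unfolding mult_prod_alt by auto
    then show ?thesis using p m unfolding \<C>_def by blast
  qed
  have "V \<subseteq> \<Union>\<C>"
  proof (rule ccontr)
    assume "\<not> V \<subseteq> \<Union>\<C>"
    then obtain y where y: "y \<in> V - \<Union>\<C>" by blast
    have op: "openin T2 (V - \<Union>\<C>)" by (intro openin_diff V closedin_Union finC clC)
    have "y \<in> T2 closure_of (snd ` \<Gamma>)" unfolding dense using y openin_subset[OF V] by auto
    then obtain z where "z \<in> snd ` \<Gamma>" "z \<in> V - \<Union>\<C>" using y op unfolding in_closure_of by blast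
    then show False using inC by blast
  qed
  from finite_closed_cover_interior[OF finC clC V _ this] V1
  obtain C U where C: "C \<in> \<C>" and U: "openin T2 U" "U \<noteq> {}" "U \<subseteq> C" by blast
  obtain m where m: "m \<in> S" "C = (\<lambda>x. snd (r m) \<otimes>\<^bsub>G2\<^esub> x) ` period n" using C unfolding \<C>_def by (rule imageE)
  define g where "g = snd (r m)"
  have g: "g \<in> carrier G2" unfolding g_def by (rule car[OF r(1)[OF m(1)]])
  obtain u where u: "u \<in> U" using U(2) by blast
  obtain h0 where h0: "h0 \<in> period n" "u = g \<otimes>\<^bsub>G2\<^esub> h0" using u U(3) unfolding m(2) g_def by blast
  have h0c: "h0 \<in> carrier G2" using h0 pc by blast
  have "openin T2 (period n)"
    unfolding openin_subopen[of T2 "period n"]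
  proof
    fix h assume h: "h \<in> period n"
    have hc: "h \<in> carrier G2" using h pc by blast
    \<comment> \<open>Left translation by \<open>k\<close> takes \<open>h\<close> to the interior
      point \<open>u\<close> of the coset, so the preimage of \<open>U\<close> is a neighbourhood of
      \<open>h\<close>.\<close>
    define k where "k = g \<otimes>\<^bsub>G2\<^esub> h0 \<otimes>\<^bsub>G2\<^esub> inv\<^bsub>G2\<^esub> h"
    have kc: "k \<in> carrier G2" using g h0c hc by (simp add: k_def)
    define X where "X = {x \<in> topspace T2. k \<otimes>\<^bsub>G2\<^esub> x \<in> U}"
    have "openin T2 X" unfolding X_def by (rule openin_continuous_map_preimage[OF S2.left_continuous[OF kc] U(1)])
    moreover have "h \<in> X" using u g h0c hc by (simp add: X_def k_def h0(2) S2.m_assoc)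
    moreover have "X \<subseteq> period n"
    proof
      fix x assume x: "x \<in> X"
      then have xc: "x \<in> carrier G2" by (simp add: X_def)
      obtain h1 where h1: "h1 \<in> period n" "k \<otimes>\<^bsub>G2\<^esub> x = g \<otimes>\<^bsub>G2\<^esub> h1" using x U(3) unfolding X_def m(2) g_def by blast
      have h1c: "h1 \<in> carrier G2" using h1 pc by blast
      have "g \<otimes>\<^bsub>G2\<^esub> (h0 \<otimes>\<^bsub>G2\<^esub> (inv\<^bsub>G2\<^esub> h \<otimes>\<^bsub>G2\<^esub> x)) = g \<otimes>\<^bsub>G2\<^esub> h1"
        using h1(2) g h0c hc xc by (simp add: k_def S2.m_assoc)
      then have "h0 \<otimes>\<^bsub>G2\<^esub> (inv\<^bsub>G2\<^esub> h \<otimes>\<^bsub>G2\<^esub> x) = h1" using g h0c hc xc h1c by simp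
      then have "h \<otimes>\<^bsub>G2\<^esub> (inv\<^bsub>G2\<^esub> h0 \<otimes>\<^bsub>G2\<^esub> h1) = h \<otimes>\<^bsub>G2\<^esub> (inv\<^bsub>G2\<^esub> h0 \<otimes>\<^bsub>G2\<^esub> (h0 \<otimes>\<^bsub>G2\<^esub> (inv\<^bsub>G2\<^esub> h \<otimes>\<^bsub>G2\<^esub> x)))" by simp
      also have "\<dots> = x" using h0c hc xc by (simp add: S2.m_assoc[symmetric])
      finally show "x \<in> period n" using period_mult[OF h period_mult[OF period_inv[OF h0(1)] h1(1)]] by simp
    qed
    ultimately show "\<exists>X. openin T2 X \<and> h \<in> X \<and> X \<subseteq> period n" by blast
  qed
  moreover have "period n \<noteq> {}" using h0(1) by blast
  ultimately show ?thesis using conn period_closed[of n] unfolding connected_space_clopen_in by auto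
qed

lemma no_equivariant_coordinates:
  assumes fin: "\<And>\<delta>. \<delta> > 0 \<Longrightarrow> finite {m. cmod (\<phi> m \<one>\<^bsub>G2\<^esub>) > \<delta>}"
    and dense: "T2 closure_of (snd ` \<Gamma>) = topspace T2" and conn: "connected_space T2"
    and map: "minimally_almost_periodic G2 T2" and perp: "perp (\<lambda>m. \<phi> m \<one>\<^bsub>G2\<^esub>)"
  shows False
proof -
  let ?a = "\<phi> n \<one>\<^bsub>G2\<^esub>"
  have all: "period n = carrier G2" by (rule period_all[OF fin dense conn])
  have e: "\<phi> n (y \<otimes>\<^bsub>G2\<^esub> h) * ?a = \<phi> n h * \<phi> n y" "cmod (\<phi> n h) = cmod ?a"
    if "y \<in> carrier G2" "h \<in> carrier G2" for y h
  proof -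
    have "h \<in> period n" unfolding all by (rule that(2))
    then show "\<phi> n (y \<otimes>\<^bsub>G2\<^esub> h) * ?a = \<phi> n h * \<phi> n y" "cmod (\<phi> n h) = cmod ?a"
      using that(1) by (auto simp: period_def)
  qed
  \<comment> \<open>When every element is a period, the defining relation says that
    \<open>\<phi> n\<close>, divided by its value at the identity, is multiplicative and
    unimodular.\<close>
  have const: "\<phi> n h = ?a" if h: "h \<in> carrier G2" for h
  proof -
    have "\<phi> n h / ?a = 1"
    proof (rule map_trivial_character[OF _ map _ _ _ h])
      show "topological_group G2 T2"
        using S2.sc_group by (simp add: second_countable_lc_group_def lc_group_def)
      have "continuous_map euclidean euclidean (\<lambda>z :: complex. z / ?a)"
        using nz by (simp add: continuous_map_iff_continuous2) (intro continuous_intros, simp)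
      from continuous_map_compose[OF cont this] show "continuous_map T2 euclidean (\<lambda>h. \<phi> n h / ?a)" by (simp add: o_def)
      show "\<phi> n (x \<otimes>\<^bsub>G2\<^esub> y) / ?a = \<phi> n x / ?a * (\<phi> n y / ?a)" if "x \<in> carrier G2" "y \<in> carrier G2" for x y
        using e(1)[OF that] nz by (simp add: field_simps)
      show "cmod (\<phi> n x / ?a) = 1" if "x \<in> carrier G2" for x
        using e(2)[OF that that] nz by (simp add: norm_divide)
    qed
    then show ?thesis using nz by simp
  qed
  have val: "?a = c \<gamma> n * \<phi> (s \<gamma> n) \<one>\<^bsub>G2\<^esub>" if \<gamma>: "\<gamma> \<in> \<Gamma>" for \<gamma>
  proof -
    have "snd (inv\<^bsub>G\<^esub> \<gamma>) \<in> carrier G2" using \<Gamma>_carrier[OF \<Gamma>_closed(3)[OF \<gamma>]] by (auto simp: carrier_G)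
    from const[OF this] equiv_one[OF \<Gamma>_closed(3)[OF \<gamma>], of n] show ?thesis
      unfolding inv_inv[OF \<Gamma>_carrier[OF \<gamma>]] by (simp only:)
  qed
  have norm: "cmod (\<phi> m \<one>\<^bsub>G2\<^esub>) = cmod ?a" if "m \<in> orbit n" for m
  proof -
    obtain \<gamma> where \<gamma>: "\<gamma> \<in> \<Gamma>" "m = s \<gamma> n" using \<open>m \<in> orbit n\<close> unfolding orbit_\<Gamma> by (rule imageE)
    show ?thesis unfolding val[OF \<gamma>(1)] \<gamma>(2) by (simp add: norm_mult c_norm[OF \<gamma>(1)])
  qed
  \<comment> \<open>All indices of the orbit have the same modulus at the identity, and only
    finitely many exceed half of it.\<close>
  have fo: "finite (orbit n)"
    by (rule finite_subset[OF _ fin[of "cmod ?a / 2"]]) (use norm nz in auto)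
  have no: "n \<in> orbit n" unfolding orbit_\<Gamma> by (rule image_eqI[where x = "\<one>\<^bsub>G\<^esub>", OF _ \<Gamma>_closed(2)]) (simp only: s_1)
  \<comment> \<open>The values at the identity, cut off to the finite orbit, form an invariant
    vector; its existence ensures that \<open>inv_vec n\<close> is not the default zero.\<close>
  define h where "h m = (if m \<in> orbit n then \<phi> m \<one>\<^bsub>G2\<^esub> else 0)" for m
  have "c \<gamma> m * h (s \<gamma> m) = h m" if \<gamma>: "\<gamma> \<in> \<Gamma>" for \<gamma> m
  proof (cases "m \<in> orbit n")
    case True
    then obtain \<delta> where d: "\<delta> \<in> \<Gamma>" "m = s \<delta> n" unfolding orbit_\<Gamma> by (rule imageE)
    have "c \<delta> n * (c \<gamma> m * \<phi> (s \<gamma> m) \<one>\<^bsub>G2\<^esub>) = c \<delta> n * \<phi> m \<one>\<^bsub>G2\<^esub>"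
      using val[OF \<Gamma>_closed(1)[OF d(1) \<gamma>]] val[OF d(1)] unfolding s_mul[OF d(1) \<gamma>] c_mul[OF d(1) \<gamma>] d(2) by (metis mult.assoc)
    then show ?thesis using True c_nz[OF d(1)] by (simp add: h_def orbit_step[OF \<gamma>])
  qed (simp add: h_def orbit_step[OF \<gamma>])
  then have "is_inv_vec n h"
    unfolding is_inv_vec_def op_def using fo no nz by (auto simp: h_def)
  then have u: "is_inv_vec n (inv_vec n)"
    using someI[of "is_inv_vec n" h] by (auto simp: inv_vec_def)
  let ?u = "inv_vec n"
  have un: "?u n \<noteq> 0" and sub: "{m. ?u m \<noteq> 0} \<subseteq> orbit n" and uf: "finite {m. ?u m \<noteq> 0}"
    using u by (auto simp: is_inv_vec_def)
  \<comment> \<open>\<Gamma> acts transitively on the orbit, so an invariant vector is determined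
    there by its value at \<open>n\<close>, and the two vectors are proportional.\<close>
  have scaled: "\<phi> m \<one>\<^bsub>G2\<^esub> = (?a / ?u n) * ?u m" if "m \<in> orbit n" for m
  proof -
    obtain \<gamma> where \<gamma>: "\<gamma> \<in> \<Gamma>" "m = s \<gamma> n" using \<open>m \<in> orbit n\<close> unfolding orbit_\<Gamma> by (rule imageE)
    have "op \<gamma> ?u = ?u" using inv_vec_op[of \<gamma> n] \<gamma> by simp
    from fun_cong[OF this, of n] have "c \<gamma> n * ?u m = ?u n" by (simp add: op_def \<gamma>(2))
    then show ?thesis using val[OF \<gamma>(1)] un c_nz[OF \<gamma>(1), of n] unfolding \<gamma>(2)[symmetric] by (simp add: field_simps)
  qed
  \<comment> \<open>By proportionality the orthogonality relation at \<open>n\<close> is a nonzero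
    multiple of the squared norm of \<open>inv_vec n\<close>.\<close>
  have "0 = (\<Sum>m | ?u m \<noteq> 0. \<phi> m \<one>\<^bsub>G2\<^esub> * cnj (?u m))" using perp by (simp add: perp_def)
  also have "\<dots> = (\<Sum>m | ?u m \<noteq> 0. (?a / ?u n) * of_real ((cmod (?u m))\<^sup>2))"
    using scaled sub by (intro sum.cong refl) (auto simp: complex_norm_square mult.assoc simp del: of_real_power)
  also have "\<dots> = (?a / ?u n) * of_real (\<Sum>m | ?u m \<noteq> 0. (cmod (?u m))\<^sup>2)" by (simp only: sum_distrib_left of_real_sum)
  finally have "(\<Sum>m | ?u m \<noteq> 0. (cmod (?u m))\<^sup>2) = 0" using nz un by (simp del: of_real_sum of_real_power)
  moreover have "(\<Sum>m | ?u m \<noteq> 0. (cmod (?u m))\<^sup>2) > 0" using uf un by (intro sum_pos) auto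
  ultimately show False by simp
qed

end

end

end

theorem theorem1p12:
  fixes G1 :: "('a, 'm) monoid_scheme" and T1 :: "'a topology"
    and G2 :: "('b, 'n) monoid_scheme" and T2 :: "'b topology"
    and \<Gamma> :: "('a \<times> 'b) set" and p :: real
  assumes "second_countable_lc_group G1 T1"
    and "second_countable_lc_group G2 T2"
    and "irreducible_lattice G1 T1 G2 T2 \<Gamma>"
    and "kazhdan_T G1 T1"
    and "connected_space T2"
    and "minimally_almost_periodic G2 T2"
    and "1 < p" and "p \<noteq> 2"
  shows "property_T_lp ((G1 \<times>\<times> G2)\<lparr>carrier := \<Gamma>\<rparr>) p"
  unfolding property_T_lp_def
proof (rule notI, elim exE conjE)
  let ?H = "(G1 \<times>\<times> G2)\<lparr>carrier := \<Gamma>\<rparr>"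
  fix \<pi> X
  assume \<pi>: "orth_rep ?H p \<pi>" and X: "\<forall>k. X k \<in> lp_prime ?H p \<pi> \<and> lp_norm p (X k) = 1"
    and ai: "\<forall>g\<in>carrier ?H. (\<lambda>k. lp_norm p (\<lambda>n. \<pi> g (X k) n - X k n)) \<longlonglongrightarrow> 0"
  have tg: "topological_group G1 T1" "topological_group G2 T2"
    using assms(1,2) by (auto simp: second_countable_lc_group_def lc_group_def)
  have S: "sc_group G1 T1" "sc_group G2 T2" using assms(1,2) by (auto simp: sc_group_def)
  have lat: "subgroup \<Gamma> (G1 \<times>\<times> G2)" "subtopology (prod_topology T1 T2) \<Gamma> = discrete_topology \<Gamma>"
    and dense: "T2 closure_of (snd ` \<Gamma>) = topspace T2"
    using assms(3) by (auto simp: irreducible_lattice_def lattice_def)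
  obtain M F where MF: "left_haar_measure (G1 \<times>\<times> G2) (prod_topology T1 T2) M"
    "fundamental_domain (G1 \<times>\<times> G2) (prod_topology T1 T2) \<Gamma> F" "emeasure M F < \<infinity>"
    using assms(3) by (auto simp: irreducible_lattice_def lattice_def)
  have grp: "group (G1 \<times>\<times> G2)" using tg by (intro DirProd_group) (simp_all add: topological_group_def)
  have H: "group ?H" by (rule subgroup.subgroup_is_group[OF lat(1) grp])
  obtain c s where cs: "monomial_action ?H c s"
    and op: "\<And>g f. g \<in> carrier ?H \<Longrightarrow> f \<in> lp_space p \<Longrightarrow> \<pi> g f = (\<lambda>m. c g m * f (s g m))"
  proof (rule orth_rep_monomial[OF H assms(7,8) \<pi>])
    fix c s
    assume "monomial_action ?H c s"
      "\<And>g f. g \<in> carrier ?H \<Longrightarrow> f \<in> lp_space p \<Longrightarrow> \<pi> g f = (\<lambda>m. c g m * f (s g m))"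
    then show thesis by (rule that)
  qed
  have PL: "product_lattice G1 T1 G2 T2 \<Gamma> M F"
    by (intro product_lattice.intro S kazhdan_no_real_chars[OF tg(1) assms(4)] map_no_real_chars[OF tg(2) assms(6)] MF lat)
  interpret lattice_action G1 T1 G2 T2 \<Gamma> M F c s
    by (intro lattice_action.intro PL cs)
  have op': "\<pi> g f = op g f" if "g \<in> carrier ?H" "f \<in> lp_space p" for g f
    unfolding op_def by (rule op[OF that])
  have X': "X k \<in> lp_prime ?H p \<pi>" "lp_norm p (X k) = 1" for k using X by auto
  obtain v where v: "\<And>k. v k \<in> l2_space UNIV" "\<And>k. l2_norm (v k) = 1" "\<And>k. perp (v k)"
    and vi: "\<And>g. g \<in> carrier ?H \<Longrightarrow> (\<lambda>k. l2_norm (\<lambda>n. op g (v k) n - v k n)) \<longlonglongrightarrow> 0"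
  proof (rule reduction_to_l2[where \<pi> = \<pi> and F = X, OF assms(7) _ X'], rule op', assumption+, rule bspec[OF ai], assumption)
    fix v
    assume "\<And>k. v k \<in> l2_space UNIV" "\<And>k. l2_norm (v k) = 1" "\<And>k. perp (v k)"
      "\<And>g. g \<in> carrier ?H \<Longrightarrow> (\<lambda>k. l2_norm (\<lambda>n. op g (v k) n - v k n)) \<longlonglongrightarrow> 0"
    then show thesis by (rule that)
  qed
  have vi': "(\<lambda>k. l2_norm (\<lambda>n. op g (v k) n - v k n)) \<longlonglongrightarrow> 0" if "g \<in> \<Gamma>" for g
    by (rule vi) (simp add: that)
  obtain f where f: "f \<in> W" "(\<integral>\<^sup>+x. indicator F x * wt f x \<partial>M) < \<infinity>" "(\<integral>\<^sup>+x. indicator F x * wt f x \<partial>M) \<noteq> 0"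
    and inv: "\<And>g. g \<in> carrier G1 \<Longrightarrow> AE x in M. sec f (emb g \<otimes>\<^bsub>G\<^esub> x) = sec f x"
  proof (rule invariant_function[OF assms(4) v vi'], assumption)
    fix f
    assume "f \<in> W" "(\<integral>\<^sup>+x. indicator F x * wt f x \<partial>M) < \<infinity>" "(\<integral>\<^sup>+x. indicator F x * wt f x \<partial>M) \<noteq> 0"
      "\<And>g. g \<in> carrier G1 \<Longrightarrow> AE x in M. sec f (emb g \<otimes>\<^bsub>G\<^esub> x) = sec f x"
    then show thesis by (rule that)
  qed
  obtain n U V K L where UV: "openin T1 U" "openin T2 V" "compactin T1 K" "compactin T2 L" "U \<subseteq> K" "V \<subseteq> L"
    and nz: "I f n (U \<times> V) \<noteq> 0"
    by (rule I_nonzero[OF f])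
  note cmp = UV(1,3,5) UV(2,4,6)
  \<comment> \<open>At the identity the slab is the rectangle \<open>U \<times> V\<close> itself, so
    the nonzero average is a coordinate that does not vanish at the identity.\<close>
  have "(\<lambda>u. u \<otimes>\<^bsub>G2\<^esub> \<one>\<^bsub>G2\<^esub>) ` V = V" using openin_subset[OF UV(2)] by (force simp: subset_iff)
  then have "coord f U V n \<one>\<^bsub>G2\<^esub> \<noteq> 0" using nz unfolding coord_def[OF f(1,2) cmp] slab_def[OF f(1,2) cmp] by (simp only: not_False_eq_True)
  from no_equivariant_coordinates[OF coord_continuous[OF f(1,2) cmp] coord_equivariant[OF f(1,2) cmp inv] this
      coord_small_finite[OF f(1,2) cmp S2.one_closed] dense assms(5,6) coord_perp[OF f(1,2) cmp inv S2.one_closed]]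
  show False .
qed

end
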